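(* Let $a>1$, let $\lambda_a\in(0,\frac14)$ be the second eigenvalue of the problem $(N)$, and let $u_a\in H^1(\Omega)$ be a corresponding second eigenfunction of $(N)$. Then there exist $\delta>0$ and $C>0$ such that $$|u_a(x)|\le C\left(\log\frac{a}{|x|}\right)^{\frac12-\frac{\sqrt{1-4\lambda_a}}{2}}$$ for all $x\in B_\delta\setminus\{0\}$ if $0\in\Omega$, and for all $x\in B_\delta\cap\Omega$ if $0\in\partial\Omega$.
   Context: $\Omega\subset\mathbb{R}^2$ is a smooth bounded domain with $0\in\overline{\Omega}$ and $\sup_{x\in\Omega}|x|=1$. $B_\delta$ is the ball of radius $\delta$ centered at the origin (in the case $0\in\Omega$, $\delta$ is such that $B_\delta\subset\Omega$). The eigenvalue problem $(N)$ is $$-\Delta u=\lambda\frac{u}{|x|^2\left(\log\frac{a}{|x|}\right)^2}\ \text{in }\Omega,\qquad \frac{\partial u}{\partial\nu}=0\ \text{on }\partial\Omega,$$ understood weakly: $\int_\Omega\nabla u\cdot\nabla\phi\,dx=\lambda\int_\Omega\frac{u\phi}{|x|^2(\log\frac{a}{|x|})^2}\,dx$ for all $\phi\in H^1(\Omega)$; $\nu$ is the unit outer normal. Its first eigenvalue is $0$, with constant eigenfunctions. The second eigenvalue is $$\lambda_a=\inf\left\{\frac{\int_{\Omega}|\nabla u|^2\,dx}{\int_{\Omega}\frac{|u|^2}{|x|^2\left(\log\frac{a}{|x|}\right)^2}\,dx}\ \middle|\ u\in H^1(\Omega)\setminus\{0\},\ \int_{\Omega}\frac{u}{|x|^2\left(\log\frac{a}{|x|}\right)^2}\,dx=0\right\},$$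 and a corresponding second eigenfunction is a minimizer of this problem (equivalently a nonzero weak solution in $H^1(\Omega)$ of $(N)$ with $\lambda=\lambda_a$). $u_a$ is identified with its continuous representative in $\Omega\setminus\{0\}$. *)

theory Defs
  imports "HOL-Analysis.Analysis"
begin

definition partial_deriv ::
    "'a::euclidean_space \<Rightarrow> ('a \<Rightarrow> real) \<Rightarrow> 'a \<Rightarrow> real" where
  "partial_deriv i f x = frechet_derivative f (at x) i"

fun C_k :: "nat \<Rightarrow> ('a::euclidean_space \<Rightarrow> real) \<Rightarrow> bool" where
  "C_k 0 f \<longleftrightarrow> continuous_on UNIV f"
| "C_k (Suc k) f \<longleftrightarrow> f differentiable_on UNIV \<and> (\<forall>i\<in>Basis. C_k k (partial_deriv i f))"

definition smooth :: "('a::euclidean_space \<Rightarrow> real) \<Rightarrow> bool" where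
  "smooth f \<longleftrightarrow> (\<forall>k. C_k k f)"

text \<open>Near each boundary point, in suitable Cartesian coordinates given by an orthogonal map,
  the domain is the strict epigraph of a \<open>C\<^sup>\<infinity>\<close> function.\<close>

definition smooth_boundary :: "(real^2) set \<Rightarrow> bool" where
  "smooth_boundary \<Omega> \<longleftrightarrow>
     (\<forall>p\<in>frontier \<Omega>. \<exists>r>0. \<exists>(T :: real^2 \<Rightarrow> real^2) (\<gamma> :: real \<Rightarrow> real).
        orthogonal_transformation T \<and> smooth \<gamma> \<and>
        \<Omega> \<inter> ball p r = {x \<in> ball p r. T x $ 2 > \<gamma> (T x $ 1)})"

definition smooth_bounded_domain :: "(real^2) set \<Rightarrow> bool" where
  "smooth_bounded_domain \<Omega> \<longleftrightarrow>
     \<Omega> \<noteq> {} \<and> open \<Omega> \<and> connected \<Omega> \<and> bounded \<Omega> \<and> smooth_boundary \<Omega>"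

definition test_functions :: "'a::euclidean_space set \<Rightarrow> ('a \<Rightarrow> real) set" where
  "test_functions \<Omega> =
     {\<phi>. smooth \<phi> \<and> compact (closure {x. \<phi> x \<noteq> 0}) \<and> closure {x. \<phi> x \<noteq> 0} \<subseteq> \<Omega>}"

text \<open>Elements of \<open>L\<^sup>2(\<Omega>)\<close> and \<open>H\<^sup>1(\<Omega>)\<close> are represented by functions on the whole
  space, of which only the values on \<open>\<Omega>\<close> matter, up to null sets.\<close>

definition L2_on :: "'a::euclidean_space set \<Rightarrow> ('a \<Rightarrow> 'b::euclidean_space) \<Rightarrow> bool" where
  "L2_on \<Omega> f \<longleftrightarrow>
     f \<in> borel_measurable (lebesgue_on \<Omega>) \<and> integrable (lebesgue_on \<Omega>) (\<lambda>x. (norm (f x))\<^sup>2)"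

definition is_weak_gradient ::
    "'a::euclidean_space set \<Rightarrow> ('a \<Rightarrow> real) \<Rightarrow> ('a \<Rightarrow> 'a) \<Rightarrow> bool" where
  "is_weak_gradient \<Omega> u g \<longleftrightarrow>
     (\<forall>\<phi>\<in>test_functions \<Omega>. \<forall>i\<in>Basis.
        (\<integral>x. u x * partial_deriv i \<phi> x \<partial>lebesgue_on \<Omega>)
          = - (\<integral>x. (g x \<bullet> i) * \<phi> x \<partial>lebesgue_on \<Omega>))"

definition H1 :: "'a::euclidean_space set \<Rightarrow> ('a \<Rightarrow> real) set" where
  "H1 \<Omega> = {u. L2_on \<Omega> u \<and> (\<exists>g. L2_on \<Omega> g \<and> is_weak_gradient \<Omega> u g)}"

text \<open>The weak gradient of an element of \<open>H\<^sup>1(\<Omega>)\<close> (\<open>\<Omega>\<close> open) is unique up to null sets; it is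
  used only under integrals, so the choice of representative is immaterial.\<close>

definition weak_gradient :: "'a::euclidean_space set \<Rightarrow> ('a \<Rightarrow> real) \<Rightarrow> 'a \<Rightarrow> 'a" where
  "weak_gradient \<Omega> u = (SOME g. L2_on \<Omega> g \<and> is_weak_gradient \<Omega> u g)"

definition log_weight :: "real \<Rightarrow> real^2 \<Rightarrow> real" where
  "log_weight a x = 1 / ((norm x)\<^sup>2 * (ln (a / norm x))\<^sup>2)"

definition rayleigh_quotient :: "(real^2) set \<Rightarrow> real \<Rightarrow> (real^2 \<Rightarrow> real) \<Rightarrow> real" where
  "rayleigh_quotient \<Omega> a u =
     (\<integral>x. (norm (weak_gradient \<Omega> u x))\<^sup>2 \<partial>lebesgue_on \<Omega>) /
     (\<integral>x. \<bar>u x\<bar>\<^sup>2 * log_weight a x \<partial>lebesgue_on \<Omega>)"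

text \<open>The elements of \<open>H\<^sup>1(\<Omega>)\<close>, nonzero as classes modulo null sets, with zero weighted mean.
  For a smooth bounded domain in the unit disc and \<open>a > 1\<close>, the weighted integrals here and in the
  quotient converge for every \<open>u\<close> in \<open>H\<^sup>1(\<Omega>)\<close>, by the critical Hardy inequality, so the
  convention that the integral of a non-integrable function is 0 does not come into play.\<close>

definition admissible :: "(real^2) set \<Rightarrow> real \<Rightarrow> (real^2 \<Rightarrow> real) set" where
  "admissible \<Omega> a =
     {u \<in> H1 \<Omega>. \<not> (AE x in lebesgue_on \<Omega>. u x = 0) \<and>
        (\<integral>x. u x * log_weight a x \<partial>lebesgue_on \<Omega>) = 0}"

definition second_eigenvalue :: "(real^2) set \<Rightarrow> real \<Rightarrow> real" where
  "second_eigenvalue \<Omega> a = (INF u\<in>admissible \<Omega> a. rayleigh_quotient \<Omega> a u)"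

definition second_eigenfunction :: "(real^2) set \<Rightarrow> real \<Rightarrow> (real^2 \<Rightarrow> real) \<Rightarrow> bool" where
  "second_eigenfunction \<Omega> a u \<longleftrightarrow>
     u \<in> admissible \<Omega> a \<and> rayleigh_quotient \<Omega> a u = second_eigenvalue \<Omega> a"

end

theory Submission
  imports Defs
begin

text \<open>
  Testing the minimality of \<open>u\<close> gives the Euler--Lagrange equation
  \<open>\<integral> \<nabla>u \<bullet> \<nabla>\<phi> = \<lambda> \<integral> u \<phi> / (|x| ln (a/|x|))\<^sup>2\<close> for all \<open>\<phi>\<close> in \<open>H\<^sup>1\<close>; the constraint on the mean
  disappears because \<open>u\<close> is orthogonal to the constants. As \<open>\<alpha> (1 - \<alpha>) = \<lambda>\<close>, the function
  \<open>ln (a/|x|) powr \<alpha>\<close> solves the equation away from the origin, and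
  \<open>\<Psi> = ln (a/|x|) powr \<alpha> - b \<bullet> x - c |x|\<^sup>2\<close> is a positive strict supersolution near the origin. If the
  origin is a boundary point, \<open>b\<close> is a large multiple of the inner normal there, which gives \<open>\<Psi>\<close> a
  normal derivative of the right sign on the nearby boundary. If \<open>|u| \<le> C \<Psi>\<close> on the part of the frontier of
  a neighbourhood \<open>U\<close> of the origin that lies in the domain, then the test function
  \<open>\<Psi> G(u / (C \<Psi>))\<close>, with \<open>G\<close> increasing and vanishing on \<open>[-1, 1]\<close>, shows that \<open>|u| \<le> C \<Psi>\<close> in \<open>U\<close>.

  No regularity of \<open>u\<close> up to the boundary is needed to find \<open>U\<close>: a function in \<open>H\<^sup>1\<close> is bounded on almost
  every line, so \<open>U\<close> can be a rectangle with \<open>u\<close> bounded on the two sides that cross the boundary; of the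
  other two, one lies inside and one outside the domain.
\<close>

section \<open>Smooth functions on open sets\<close>

text \<open>With z = u / \<Psi>, \<phi> = \<Psi> G(z) and \<Phi> = \<Psi> z G(z) \<ge> 0 one has
  \<nabla>u . \<nabla>\<phi> = \<Psi>^2 G'(z) |\<nabla>z|^2 + \<nabla>\<Psi> . \<nabla>\<Phi> and u
  \<phi> = \<Psi> \<Phi>. The equation for u thus bounds the integral of \<nabla>\<Psi> .
  \<nabla>\<Phi> from above; the strict supersolution \<Psi>, tested with \<Phi>, bounds it from
  below by more, unless \<Phi> = 0. The obstacle: this must run without traces or a divergence
  theorem, for a u that is merely continuous with a weak gradient. The boundary term is replaced by
  cutoffs whose gradients have a sign against \<nabla>\<Psi>. The frontier of U is harmless because
  \<Phi> vanishes near it, and the origin is removable in the plane. Boundedness of z^2 G'(z) keeps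
  the gradients of \<phi> and \<Phi> square-integrable for unbounded z. The gradient of
  \<open>ln (a/|x|) powr \<alpha>\<close> is square-integrable because \<alpha> < 1/2, which singles
  out the smaller root of \<alpha> (1 - \<alpha>) = \<lambda>. The term - c |x|^2 supplies the
  strictness.\<close>

fun Ck_on :: "nat \<Rightarrow> 'a::euclidean_space set \<Rightarrow> ('a \<Rightarrow> real) \<Rightarrow> bool" where
  "Ck_on 0 S f \<longleftrightarrow> continuous_on S f"
| "Ck_on (Suc k) S f \<longleftrightarrow> f differentiable_on S \<and> (\<forall>i\<in>Basis. Ck_on k S (partial_deriv i f))"

text \<open>A local version of \<open>smooth\<close> is needed because the barrier and the
  reciprocals in the argument are smooth only away from the origin. Derivatives are those of the
  whole space, so the notion is meant for open \<open>S\<close>, where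
  \<open>differentiable_on\<close> amounts to differentiability at each point.\<close>

definition smooth_on :: "'a::euclidean_space set \<Rightarrow> ('a \<Rightarrow> real) \<Rightarrow> bool" where
  "smooth_on S f \<longleftrightarrow> (\<forall>k. Ck_on k S f)"

lemma C_k_iff_Ck_on: "C_k k f \<longleftrightarrow> Ck_on k UNIV f"
  by (induction k arbitrary: f) auto

lemma smooth_iff_smooth_on: "smooth f \<longleftrightarrow> smooth_on UNIV f"
  by (simp add: smooth_def smooth_on_def C_k_iff_Ck_on)

lemma partial_deriv_eqI: "(f has_derivative D) (at x) \<Longrightarrow> partial_deriv i f x = D i"
  unfolding partial_deriv_def using frechet_derivative_at by fastforce

lemma partial_deriv_cong:
  assumes "open S" "x \<in> S" "\<And>y. y \<in> S \<Longrightarrow> f y = g y"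
  shows "partial_deriv i f x = partial_deriv i g x"
proof -
  have "(f has_derivative D) (at x) \<longleftrightarrow> (g has_derivative D) (at x)" for D
    using assms has_derivative_transform_within_open by metis
  then show ?thesis
    unfolding partial_deriv_def frechet_derivative_def by simp
qed

text \<open>The tool behind the calculus rules: a formula for a derivative holds only at points of
  \<open>S\<close>, and openness lets it replace \<open>partial_deriv\<close> there at every
  order.\<close>

lemma Ck_on_cong:
  assumes "open S" "\<And>y. y \<in> S \<Longrightarrow> f y = g y" "Ck_on k S f"
  shows "Ck_on k S g"
  using assms(2,3)
proof (induction k arbitrary: f g)
  case 0
  then show ?case by (metis Ck_on.simps(1) continuous_on_cong)
next
  case (Suc k)
  have "g differentiable_on S"
    using Suc.prems by (metis (no_types, lifting) Ck_on.simps(2) differentiable_on_def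
        differentiable_transform_within zero_less_one)
  moreover have "Ck_on k S (partial_deriv i g)" if "i \<in> Basis" for i
  proof (rule Suc.IH)
    show "Ck_on k S (partial_deriv i f)" using Suc.prems that by simp
    show "partial_deriv i f y = partial_deriv i g y" if "y \<in> S" for y
      using partial_deriv_cong[OF assms(1) that] Suc.prems(1) by blast
  qed
  ultimately show ?case by simp
qed

lemma Ck_on_subset: "Ck_on k T f \<Longrightarrow> S \<subseteq> T \<Longrightarrow> Ck_on k S f"
  by (induction k arbitrary: f) (auto intro: continuous_on_subset differentiable_on_subset)

lemma Ck_on_SucD: "Ck_on (Suc k) S f \<Longrightarrow> Ck_on k S f"
  by (induction k arbitrary: f) (auto intro: differentiable_imp_continuous_on)

lemma Ck_on_Un:
  assumes "open S" "open T" "Ck_on k S f" "Ck_on k T f"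
  shows "Ck_on k (S \<union> T) f"
  using assms(3,4)
proof (induction k arbitrary: f)
  case 0
  then show ?case using assms by (auto intro: continuous_on_open_Un)
next
  case (Suc k)
  have "f differentiable_on (S \<union> T)"
    using Suc.prems assms(1,2)
    by (simp add: differentiable_on_eq_differentiable_at open_Un) blast
  then show ?case using Suc by simp
qed

lemma Ck_on_const: "Ck_on k S (\<lambda>x. c)"
proof (induction k arbitrary: c)
  case (Suc k)
  have "partial_deriv i (\<lambda>x. c) = (\<lambda>x. 0)" for i :: 'a
    by (rule ext, subst partial_deriv_eqI[of _ "\<lambda>_. 0"]) auto
  then show ?case using Suc by simp
qed simp

lemma Ck_on_bounded_linear:
  assumes "bounded_linear f" shows "Ck_on k S f"
proof (cases k)
  case 0
  then show ?thesis using assms by (simp add: linear_continuous_on)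
next
  case (Suc n)
  have "(f has_derivative f) (at x)" for x
    using assms by (rule bounded_linear_imp_has_derivative)
  then have "partial_deriv i f = (\<lambda>x. f i)" for i
    by (intro ext partial_deriv_eqI)
  then show ?thesis
    using Suc assms by (simp add: Ck_on_const bounded_linear_imp_differentiable_on)
qed

lemma partial_deriv_add:
  assumes "f differentiable (at x)" "g differentiable (at x)"
  shows "partial_deriv i (\<lambda>x. f x + g x) x = partial_deriv i f x + partial_deriv i g x"
  using assms unfolding frechet_derivative_works partial_deriv_def[symmetric]
  by (subst partial_deriv_eqI[OF has_derivative_add]) (auto simp: partial_deriv_def)

lemma partial_deriv_mult:
  assumes "f differentiable (at x)" "g differentiable (at x)"
  shows "partial_deriv i (\<lambda>x. f x * g x) x = f x * partial_deriv i g x + partial_deriv i f x * g x"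
  using assms unfolding frechet_derivative_works
  by (subst partial_deriv_eqI[OF has_derivative_mult]) (auto simp: partial_deriv_def)

lemma partial_deriv_compose:
  assumes "f differentiable (at x)" "(h has_real_derivative d) (at (f x))"
  shows "partial_deriv i (\<lambda>x. h (f x)) x = d * partial_deriv i f x"
proof -
  have "((\<lambda>x. h (f x)) has_derivative (\<lambda>y. frechet_derivative f (at x) y * d)) (at x)"
    by (rule DERIV_compose_FDERIV[where f=h and g=f, OF assms(2)]) (use assms(1) in \<open>simp add: frechet_derivative_works\<close>)
  then show ?thesis
    by (subst partial_deriv_eqI[of _ "\<lambda>y. frechet_derivative f (at x) y * d"]) (auto simp: partial_deriv_def)
qed

lemma partial_deriv_real: "(h has_real_derivative d) (at x) \<Longrightarrow> partial_deriv 1 h x = d"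
  by (subst partial_deriv_eqI[of h "\<lambda>y. d * y"]) (auto simp: has_field_derivative_def)

lemma Ck_on_differentiable: "open S \<Longrightarrow> Ck_on (Suc k) S f \<Longrightarrow> x \<in> S \<Longrightarrow> f differentiable (at x)"
  by (simp add: differentiable_on_eq_differentiable_at)

lemma Ck_on_add:
  assumes "open S" "Ck_on k S f" "Ck_on k S g"
  shows "Ck_on k S (\<lambda>x. f x + g x)"
  using assms(2,3)
proof (induction k arbitrary: f g)
  case 0
  then show ?case by (auto intro: continuous_intros)
next
  case (Suc k)
  have "Ck_on k S (partial_deriv i (\<lambda>x. f x + g x))" if i: "i \<in> Basis" for i
  proof (rule Ck_on_cong[OF assms(1)])
    show "Ck_on k S (\<lambda>x. partial_deriv i f x + partial_deriv i g x)"
      using Suc i by simp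
    show "partial_deriv i f y + partial_deriv i g y = partial_deriv i (\<lambda>x. f x + g x) y" if "y \<in> S" for y
      using partial_deriv_add[OF Ck_on_differentiable[OF assms(1) Suc.prems(1) that]
          Ck_on_differentiable[OF assms(1) Suc.prems(2) that]] by simp
  qed
  then show ?case using Suc.prems by (auto intro: derivative_intros)
qed

lemma Ck_on_mult:
  assumes "open S" "Ck_on k S f" "Ck_on k S g"
  shows "Ck_on k S (\<lambda>x. f x * g x)"
  using assms(2,3)
proof (induction k arbitrary: f g)
  case 0
  then show ?case by (auto intro: continuous_intros)
next
  case (Suc k)
  have "Ck_on k S (partial_deriv i (\<lambda>x. f x * g x))" if i: "i \<in> Basis" for i
  proof (rule Ck_on_cong[OF assms(1)])
    show "Ck_on k S (\<lambda>x. f x * partial_deriv i g x + partial_deriv i f x * g x)"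
      using Suc.prems i Ck_on_SucD[OF Suc.prems(1)] Ck_on_SucD[OF Suc.prems(2)]
      by (intro Ck_on_add[OF assms(1)] Suc.IH) auto
    show "f y * partial_deriv i g y + partial_deriv i f y * g y = partial_deriv i (\<lambda>x. f x * g x) y"
      if "y \<in> S" for y
      using partial_deriv_mult[OF Ck_on_differentiable[OF assms(1) Suc.prems(1) that]
          Ck_on_differentiable[OF assms(1) Suc.prems(2) that]] by simp
  qed
  then show ?case using Suc.prems by (auto intro: derivative_intros)
qed

lemma has_real_derivative_partial_deriv:
  assumes "h differentiable (at (x::real))"
  shows "(h has_real_derivative partial_deriv 1 h x) (at x)"
  using assms partial_deriv_real real_differentiable_def by metis

lemma Ck_on_compose:
  assumes "open S" "open T" "f ` S \<subseteq> T" "Ck_on k T h" "Ck_on k S f"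
  shows "Ck_on k S (\<lambda>x. h (f x))"
  using assms(4,5)
proof (induction k arbitrary: h)
  case 0
  then show ?case using assms by (auto intro: continuous_on_compose2)
next
  case (Suc k)
  have dh: "(h has_real_derivative partial_deriv 1 h (f y)) (at (f y))" if "y \<in> S" for y
    using Ck_on_differentiable[OF assms(2) Suc.prems(1)] assms(3) that
    by (blast intro: has_real_derivative_partial_deriv)
  have df: "f differentiable (at y)" if "y \<in> S" for y
    using Ck_on_differentiable[OF assms(1) Suc.prems(2)] that by blast
  have "Ck_on k S (partial_deriv i (\<lambda>x. h (f x)))" if i: "i \<in> Basis" for i
  proof (rule Ck_on_cong[OF assms(1)])
    show "Ck_on k S (\<lambda>x. partial_deriv 1 h (f x) * partial_deriv i f x)"
      using Suc.prems(2) i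
      by (intro Ck_on_mult[OF assms(1) Suc.IH[OF _ Ck_on_SucD[OF Suc.prems(2)]]])
        (use Suc.prems(1) in auto)
    show "partial_deriv 1 h (f y) * partial_deriv i f y = partial_deriv i (\<lambda>x. h (f x)) y"
      if "y \<in> S" for y
      using partial_deriv_compose[OF df dh] that by simp
  qed
  moreover have "(\<lambda>x. h (f x)) differentiable (at y)" if "y \<in> S" for y
    using DERIV_compose_FDERIV[where f=h and g=f, OF dh[OF that]] df[OF that]
    unfolding differentiable_def by blast
  ultimately show ?case
    using assms(1) by (simp add: differentiable_on_eq_differentiable_at)
qed

lemma smooth_on_const: "smooth_on S (\<lambda>x. c)"
  by (simp add: smooth_on_def Ck_on_const)

lemma smooth_on_bounded_linear: "bounded_linear f \<Longrightarrow> smooth_on S f"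
  by (simp add: smooth_on_def Ck_on_bounded_linear)

lemma smooth_on_add: "open S \<Longrightarrow> smooth_on S f \<Longrightarrow> smooth_on S g \<Longrightarrow> smooth_on S (\<lambda>x. f x + g x)"
  by (simp add: smooth_on_def Ck_on_add)

lemma smooth_on_mult: "open S \<Longrightarrow> smooth_on S f \<Longrightarrow> smooth_on S g \<Longrightarrow> smooth_on S (\<lambda>x. f x * g x)"
  by (simp add: smooth_on_def Ck_on_mult)

lemma smooth_on_uminus: "open S \<Longrightarrow> smooth_on S f \<Longrightarrow> smooth_on S (\<lambda>x. - f x)"
  using smooth_on_mult[OF _ smooth_on_const[of S "-1"]] by auto

lemma smooth_on_diff: "open S \<Longrightarrow> smooth_on S f \<Longrightarrow> smooth_on S g \<Longrightarrow> smooth_on S (\<lambda>x. f x - g x)"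
  using smooth_on_add[OF _ _ smooth_on_uminus] by fastforce

lemma smooth_on_compose:
  "open S \<Longrightarrow> open T \<Longrightarrow> f ` S \<subseteq> T \<Longrightarrow> smooth_on T h \<Longrightarrow> smooth_on S f \<Longrightarrow> smooth_on S (\<lambda>x. h (f x))"
  by (simp add: smooth_on_def Ck_on_compose)

lemma smooth_on_compose_UNIV:
  "open S \<Longrightarrow> smooth h \<Longrightarrow> smooth_on S f \<Longrightarrow> smooth_on S (\<lambda>x. h (f x))"
  by (simp add: smooth_on_compose[of S UNIV] smooth_iff_smooth_on)

lemma smooth_on_cong: "open S \<Longrightarrow> (\<And>y. y \<in> S \<Longrightarrow> f y = g y) \<Longrightarrow> smooth_on S f \<Longrightarrow> smooth_on S g"
  unfolding smooth_on_def using Ck_on_cong by blast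

lemma smooth_on_subset: "smooth_on T f \<Longrightarrow> S \<subseteq> T \<Longrightarrow> smooth_on S f"
  unfolding smooth_on_def using Ck_on_subset by blast

lemma smooth_imp_smooth_on: "smooth f \<Longrightarrow> smooth_on S f"
  using smooth_on_subset smooth_iff_smooth_on by blast

lemma smooth_on_Un: "open S \<Longrightarrow> open T \<Longrightarrow> smooth_on S f \<Longrightarrow> smooth_on T f \<Longrightarrow> smooth_on (S \<union> T) f"
  unfolding smooth_on_def using Ck_on_Un by blast

lemma smooth_on_sum:
  assumes "open S" "\<And>i. i \<in> I \<Longrightarrow> smooth_on S (f i)"
  shows "smooth_on S (\<lambda>x. \<Sum>i\<in>I. f i x)"
  using assms(2)
  by (induction I rule: infinite_finite_induct) (auto intro: smooth_on_const smooth_on_add assms(1))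

lemma smooth_on_partial_deriv: "smooth_on S f \<Longrightarrow> i \<in> Basis \<Longrightarrow> smooth_on S (partial_deriv i f)"
  unfolding smooth_on_def by (metis Ck_on.simps(2))

lemma smooth_on_continuous: "smooth_on S f \<Longrightarrow> continuous_on S f"
  unfolding smooth_on_def by (metis Ck_on.simps(1))

lemma smooth_on_differentiable: "open S \<Longrightarrow> smooth_on S f \<Longrightarrow> x \<in> S \<Longrightarrow> f differentiable (at x)"
  unfolding smooth_on_def using Ck_on_differentiable by blast

lemma smooth_differentiable: "smooth f \<Longrightarrow> f differentiable (at x)"
  using smooth_iff_smooth_on smooth_on_differentiable by blast

lemma smooth_polynomial: "real_polynomial_function f \<Longrightarrow> smooth (f :: 'a::euclidean_space \<Rightarrow> real)"
  unfolding smooth_iff_smooth_on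
  by (induction rule: real_polynomial_function.induct)
    (auto intro: smooth_on_const smooth_on_add smooth_on_mult smooth_on_bounded_linear)

section \<open>Powers, the logarithm and a smooth step\<close>

lemma Ck_on_powr: "Ck_on k {0<..} (\<lambda>x::real. x powr b)"
proof (induction k arbitrary: b)
  case 0
  then show ?case by (auto intro!: continuous_intros)
next
  case (Suc k)
  have d: "((\<lambda>x. x powr b) has_real_derivative b * x powr (b - 1)) (at x)" if "x > 0" for x :: real
    using that by (rule has_real_derivative_powr)
  have "Ck_on k {0<..} (partial_deriv i (\<lambda>x. x powr b))" if "i \<in> Basis" for i :: real
  proof (rule Ck_on_cong)
    show "Ck_on k {0<..} (\<lambda>x::real. b * x powr (b - 1))"
      by (intro Ck_on_mult Ck_on_const Suc open_greaterThan)
  qed (use that partial_deriv_real[OF d] in auto)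
  moreover have "(\<lambda>x::real. x powr b) differentiable_on {0<..}"
    using d by (auto simp: differentiable_on_eq_differentiable_at simp: real_differentiable_def)
  ultimately show ?case by simp
qed

lemma smooth_on_powr: "smooth_on {0<..} (\<lambda>x::real. x powr b)"
  by (simp add: smooth_on_def Ck_on_powr)

lemma smooth_on_inverse: "smooth_on {0<..} (\<lambda>x::real. inverse x)"
  by (rule smooth_on_cong[OF _ _ smooth_on_powr[of "-1"]]) (auto simp: powr_minus)

text \<open>Spares an induction over the order for functions whose derivative is already known to be
  smooth, such as the logarithm.\<close>

lemma smooth_on_SucI:
  fixes f :: "real \<Rightarrow> real"
  assumes "open S" "\<And>x. x \<in> S \<Longrightarrow> (f has_real_derivative f' x) (at x)" "smooth_on S f'"
  shows "smooth_on S f"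
  unfolding smooth_on_def
proof
  fix k
  show "Ck_on k S f"
  proof (cases k)
    case 0
    have "continuous_on S f"
      using assms(2) by (intro continuous_at_imp_continuous_on ballI) (rule DERIV_isCont)
    then show ?thesis using 0 by simp
  next
    case (Suc n)
    have "Ck_on n S (partial_deriv 1 f)"
      by (rule Ck_on_cong[OF assms(1), of f'])
        (use partial_deriv_real[OF assms(2)] assms(3) in \<open>auto simp: smooth_on_def\<close>)
    moreover have "f differentiable_on S"
      using assms by (auto simp: differentiable_on_eq_differentiable_at simp: real_differentiable_def)
    ultimately show ?thesis using Suc by simp
  qed
qed

lemma smooth_on_ln: "smooth_on {0<..} (ln :: real \<Rightarrow> real)"
  by (rule smooth_on_SucI[OF _ _ smooth_on_inverse]) (auto intro: DERIV_ln)

lemma power_div_fact_le_exp: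
  assumes "(x::real) \<ge> 0" shows "x ^ n / fact n \<le> exp x"
proof -
  have "(\<Sum>k\<in>{n}. inverse (fact k) *\<^sub>R x ^ k) \<le> (\<Sum>k. inverse (fact k) *\<^sub>R x ^ k)"
    using assms by (intro sum_le_suminf summable_exp_generic) auto
  then show ?thesis by (simp add: exp_def field_simps)
qed

text \<open>The index is there because differentiation leads from \<open>flat n\<close> to
  \<open>flat (n + 1)\<close> and \<open>flat (n + 2)\<close>: one induction over the order, for all
  n at once, gives smoothness of the whole family.\<close>

definition flat :: "nat \<Rightarrow> real \<Rightarrow> real" where
  "flat n x = (if x > 0 then exp (- (1 / x)) / x ^ n else 0)"

text \<open>Quadratic decay at 0 makes the difference quotient there tend to 0. It comes from the
  term of order n + 2 of the exponential series at 1/x.\<close>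

lemma flat_bound: "\<bar>flat n x\<bar> \<le> fact (n + 2) * x\<^sup>2"
proof (cases "x > 0")
  case True
  have "(1 / x) ^ (n + 2) / fact (n + 2) \<le> exp (1 / x)"
    using True by (intro power_div_fact_le_exp) simp
  then have "1 \<le> exp (1 / x) * (fact (n + 2) * x ^ (n + 2))"
    using True by (simp only: power_divide power_one divide_divide_eq_left)
      (simp add: pos_divide_le_eq mult_ac)
  then have "exp (- (1 / x)) \<le> fact (n + 2) * x ^ (n + 2)"
    using True by (simp only: exp_minus inverse_eq_divide) (simp add: pos_divide_le_eq mult_ac)
  also have "\<dots> = fact (n + 2) * x\<^sup>2 * x ^ n"
    by (simp only: power_add mult_ac)
  finally have "exp (- (1 / x)) / x ^ n \<le> fact (n + 2) * x\<^sup>2"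
    using True by (simp only: pos_divide_le_eq zero_less_power)
  then show ?thesis using True by (simp add: flat_def)
qed (simp add: flat_def)

lemma flat_deriv: "(flat n has_real_derivative flat (n + 2) x - n * flat (n + 1) x) (at x)"
proof -
  consider "x > 0" | "x < 0" | "x = 0" by linarith
  then show ?thesis
  proof cases
    case 1
    have "((\<lambda>x. exp (- (1 / x)) * (1 / x) ^ n) has_real_derivative
        exp (- (1 / x)) * (1 / x\<^sup>2) * (1 / x) ^ n
          + exp (- (1 / x)) * (n * (1 / x) ^ (n - 1) * (- 1 / x\<^sup>2))) (at x)"
      using 1 by (auto intro!: derivative_eq_intros simp: power2_eq_square)
    also have "exp (- (1 / x)) * (1 / x\<^sup>2) * (1 / x) ^ n = flat (n + 2) x"
      using 1 by (simp add: flat_def power_divide power_add power2_eq_square)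
    also have "exp (- (1 / x)) * (n * (1 / x) ^ (n - 1) * (- 1 / x\<^sup>2)) = - (n * flat (n + 1) x)"
      using 1 by (cases n) (simp_all add: flat_def power_divide power2_eq_square mult_ac)
    finally have "((\<lambda>x. exp (- (1 / x)) * (1 / x) ^ n) has_real_derivative
        flat (n + 2) x - n * flat (n + 1) x) (at x)" by simp
    then show ?thesis
      by (rule has_field_derivative_transform_within_open[of _ _ _ "{0<..}"]) (use 1 in \<open>auto simp: flat_def power_divide\<close>)
  next
    case 2
    have "((\<lambda>x. 0) has_real_derivative flat (n + 2) x - n * flat (n + 1) x) (at x)"
      using 2 by (simp add: flat_def)
    then show ?thesis
      by (rule has_field_derivative_transform_within_open[of _ _ _ "{..<0}"]) (use 2 in \<open>auto simp: flat_def\<close>)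
  next
    case 3
    have "((\<lambda>h. flat n h / h) \<longlongrightarrow> 0) (at 0)"
    proof (rule Lim_null_comparison)
      show "\<forall>\<^sub>F h in at 0. norm (flat n h / h) \<le> fact (n + 2) * \<bar>h\<bar>"
      proof (intro always_eventually allI)
        fix h :: real
        have "\<bar>flat n h\<bar> \<le> (fact (n + 2) * \<bar>h\<bar>) * \<bar>h\<bar>"
          using flat_bound[of n h] by (simp add: power2_eq_square mult.assoc)
        then show "norm (flat n h / h) \<le> fact (n + 2) * \<bar>h\<bar>"
          by (cases "h = 0") (simp_all add: pos_divide_le_eq del: fact_Suc)
      qed
      show "((\<lambda>h. fact (n + 2) * \<bar>h\<bar>) \<longlongrightarrow> 0) (at (0::real))"
        by (auto intro!: tendsto_eq_intros)
    qed
    then show ?thesis using 3 by (simp add: DERIV_def flat_def)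
  qed
qed

lemma Ck_on_flat: "Ck_on k UNIV (flat n)"
proof (induction k arbitrary: n)
  case 0
  then show ?case
    using DERIV_isCont[OF flat_deriv] by (simp add: continuous_at_imp_continuous_on)
next
  case (Suc k)
  have "partial_deriv 1 (flat n) = (\<lambda>x. flat (n + 2) x + (- real n) * flat (n + 1) x)"
    using partial_deriv_real[OF flat_deriv] by fastforce
  then have "Ck_on k UNIV (partial_deriv 1 (flat n))"
    by (simp only:) (intro Ck_on_add[OF _ Suc Ck_on_mult[OF _ Ck_on_const Suc]] open_UNIV)
  moreover have "flat n differentiable_on UNIV"
    using flat_deriv by (auto simp: differentiable_on_eq_differentiable_at real_differentiable_def)
  ultimately show ?case by simp
qed

text \<open>Rises from 0 on the negative axis to 1 beyond 1; all cutoffs below are compositions with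
  this function. The denominator never vanishes since x or 1 - x is positive.\<close>

definition smooth_step :: "real \<Rightarrow> real" where
  "smooth_step x = flat 0 x / (flat 0 x + flat 0 (1 - x))"

lemma flat_nonneg: "flat n x \<ge> 0"
  by (simp add: flat_def)

lemma flat_sum_pos: "flat 0 x + flat 0 (1 - x) > 0"
  by (auto simp: flat_def intro: add_pos_nonneg add_nonneg_pos)

lemma smooth_smooth_step: "smooth smooth_step"
proof -
  have 0: "smooth_on UNIV (flat 0)" by (simp add: smooth_on_def Ck_on_flat)
  have 1: "smooth_on UNIV (\<lambda>x. flat 0 (1 - x))"
    by (intro smooth_on_compose[of UNIV UNIV, OF _ _ _ 0] smooth_on_diff smooth_on_const
        smooth_on_bounded_linear) auto
  have "smooth_on UNIV (\<lambda>x. flat 0 x * inverse (flat 0 x + flat 0 (1 - x)))"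
    using flat_sum_pos
    by (intro smooth_on_mult 0 smooth_on_compose[of UNIV "{0<..}", OF _ _ _ smooth_on_inverse]
        smooth_on_add 1) auto
  then show ?thesis
    by (simp add: smooth_iff_smooth_on smooth_step_def[abs_def] divide_inverse)
qed

lemma smooth_step_0: "x \<le> 0 \<Longrightarrow> smooth_step x = 0"
  and smooth_step_1: "x \<ge> 1 \<Longrightarrow> smooth_step x = 1"
  using flat_sum_pos[of x] by (auto simp: smooth_step_def flat_def split: if_splits)

lemma smooth_step_nonneg: "0 \<le> smooth_step x"
  and smooth_step_le_1: "smooth_step x \<le> 1"
  using flat_sum_pos[of x] flat_nonneg[of 0] by (auto simp: smooth_step_def)

lemma smooth_step_DERIV: "(smooth_step has_real_derivative deriv smooth_step x) (at x)"
  using smooth_differentiable[OF smooth_smooth_step]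
  by (simp add: DERIV_deriv_iff_real_differentiable)

text \<open>The sign matters because the cutoffs in the comparison argument must increase in
  prescribed directions. The quotient rule leaves a sum of two products of nonnegative members of
  the family \<open>flat\<close>.\<close>

lemma smooth_step_deriv_nonneg: "deriv smooth_step x \<ge> 0"
proof -
  let ?d = "\<lambda>x. flat 0 x + flat 0 (1 - x)"
  have d: "(flat 0 has_real_derivative flat 2 x) (at x)" for x
    using flat_deriv[of 0 x] by (simp add: numeral_2_eq_2)
  have d': "((\<lambda>x. flat 0 (1 - x)) has_real_derivative flat 2 (1 - x) * (- 1)) (at x)"
    by (rule DERIV_chain'[where f="\<lambda>x. 1 - x", OF _ d]) (auto intro!: derivative_eq_intros)
  have "(smooth_step has_real_derivative
      (flat 2 x * ?d x - flat 0 x * (flat 2 x + flat 2 (1 - x) * (- 1))) / (?d x * ?d x)) (at x)"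
    unfolding smooth_step_def[abs_def]
    using flat_sum_pos[of x] by (intro DERIV_divide DERIV_add d d') auto
  then have "deriv smooth_step x
      = (flat 2 x * ?d x - flat 0 x * (flat 2 x + flat 2 (1 - x) * (- 1))) / (?d x * ?d x)"
    by (rule DERIV_imp_deriv)
  also have "\<dots> = (flat 2 x * flat 0 (1 - x) + flat 0 x * flat 2 (1 - x)) / (?d x * ?d x)"
    by (simp add: algebra_simps)
  finally show ?thesis using flat_nonneg by simp
qed

lemma smooth_compose_const: "smooth f \<Longrightarrow> bounded_linear l \<Longrightarrow> smooth (\<lambda>x. f (l x + c))"
  for f :: "real \<Rightarrow> real" and l :: "'a::euclidean_space \<Rightarrow> real"
  unfolding smooth_iff_smooth_on
  by (rule smooth_on_compose[of UNIV UNIV])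
    (auto intro: smooth_on_add smooth_on_bounded_linear smooth_on_const)

lemma smooth_norm_square: "smooth (\<lambda>x::'a::euclidean_space. (norm (x - p))\<^sup>2)"
proof -
  have "smooth_on UNIV (\<lambda>x::'a. \<Sum>i\<in>Basis. (x \<bullet> i - p \<bullet> i) * (x \<bullet> i - p \<bullet> i))"
    by (intro smooth_on_sum smooth_on_mult smooth_on_diff smooth_on_const smooth_on_bounded_linear)
      (auto intro: bounded_linear_inner_left)
  then show ?thesis
    unfolding smooth_iff_smooth_on power2_norm_eq_inner
    by (subst euclidean_inner) (simp add: inner_diff_left)
qed

section \<open>Test functions and cutoffs\<close>

lemma test_functionsD:
  assumes "\<phi> \<in> test_functions V"
  shows "smooth \<phi>" "compact (closure {x. \<phi> x \<noteq> 0})" "closure {x. \<phi> x \<noteq> 0} \<subseteq> V"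
  using assms by (auto simp: test_functions_def)

lemma test_functions_outside: "\<phi> \<in> test_functions V \<Longrightarrow> x \<notin> V \<Longrightarrow> \<phi> x = 0"
  using closure_subset[of "{x. \<phi> x \<noteq> 0}"] by (auto simp: test_functions_def)

lemma test_functionsI:
  assumes "smooth \<phi>" "compact K" "K \<subseteq> V" "\<And>x. x \<notin> K \<Longrightarrow> \<phi> x = 0"
  shows "\<phi> \<in> test_functions V"
proof -
  have "closure {x. \<phi> x \<noteq> 0} \<subseteq> K"
    using assms by (intro closure_minimal) (auto intro: compact_imp_closed)
  then show ?thesis
    using assms closed_Int_compact[OF closed_closure, of K "{x. \<phi> x \<noteq> 0}"]
    by (auto simp: test_functions_def inf.absorb1)
qed

text \<open>\<open>V\<close> and the complement of \<open>K\<close> are open and cover the space; on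
  the second set the function is identically zero.\<close>

lemma smooth_extend_zero:
  assumes "open V" "closed K" "K \<subseteq> V" "smooth_on V f" "\<And>x. x \<notin> K \<Longrightarrow> f x = 0"
  shows "smooth f"
proof -
  have "smooth_on (- K) f"
    by (rule smooth_on_cong[OF _ _ smooth_on_const[of _ 0]]) (use assms in auto)
  then have "smooth_on (V \<union> - K) f"
    using assms by (intro smooth_on_Un) auto
  moreover have "V \<union> - K = UNIV" using assms by auto
  ultimately show ?thesis by (simp add: smooth_iff_smooth_on)
qed

lemma test_functions_mult:
  assumes "open V" "\<phi> \<in> test_functions V" "smooth_on V m"
  shows "(\<lambda>x. m x * \<phi> x) \<in> test_functions V"
proof -
  let ?K = "closure {x. \<phi> x \<noteq> 0}"
  have z: "m x * \<phi> x = 0" if "x \<notin> ?K" for x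
    using that closure_subset[of "{x. \<phi> x \<noteq> 0}"] by auto
  have "smooth (\<lambda>x. m x * \<phi> x)"
    using test_functionsD[OF assms(2)] z assms smooth_on_mult[OF assms(1,3) smooth_imp_smooth_on]
    by (intro smooth_extend_zero[of V ?K]) auto
  then show ?thesis
    using test_functionsD[OF assms(2)] z by (intro test_functionsI[of _ ?K]) auto
qed

lemma test_functions_mono: "\<phi> \<in> test_functions V \<Longrightarrow> V \<subseteq> W \<Longrightarrow> \<phi> \<in> test_functions W"
  by (auto simp: test_functions_def)

lemma partial_deriv_zero_open: "open S \<Longrightarrow> x \<in> S \<Longrightarrow> (\<And>y. y \<in> S \<Longrightarrow> f y = 0) \<Longrightarrow> partial_deriv i f x = 0"
  using partial_deriv_cong[of S x f "\<lambda>_. 0"] partial_deriv_eqI[of "\<lambda>_. 0" "\<lambda>_. 0"] by simp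

lemma partial_deriv_outside_support:
  "x \<notin> closure {x. \<phi> x \<noteq> 0} \<Longrightarrow> partial_deriv i \<phi> x = 0"
  using closure_subset[of "{x. \<phi> x \<noteq> 0}"]
  by (intro partial_deriv_zero_open[of "- closure {x. \<phi> x \<noteq> 0}"]) auto

lemma test_functions_partial_deriv:
  assumes "\<phi> \<in> test_functions V" "i \<in> Basis"
  shows "partial_deriv i \<phi> \<in> test_functions V"
  using test_functionsD[OF assms(1)] assms(2) partial_deriv_outside_support
  by (intro test_functionsI[of _ "closure {x. \<phi> x \<noteq> 0}"])
    (auto simp: smooth_iff_smooth_on smooth_on_partial_deriv)

lemma test_functions_continuous: "\<phi> \<in> test_functions V \<Longrightarrow> continuous_on S \<phi>"
  using smooth_on_continuous smooth_imp_smooth_on test_functionsD(1) by blast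

text \<open>Finitely many balls cover \<open>A\<close>; the sum of the corresponding bumps is at
  least 1 on their union, and one more \<open>smooth_step\<close> turns this into the value 1. That
  the value 1 is taken on an open \<open>N\<close>, not just on \<open>A\<close>, makes the
  derivatives of the cutoff vanish there.\<close>

lemma cutoff_exists:
  fixes V :: "'a::euclidean_space set"
  assumes "open V" "compact A" "A \<subseteq> V"
  obtains \<theta> N where "\<theta> \<in> test_functions V" "\<And>x. 0 \<le> \<theta> x" "\<And>x. \<theta> x \<le> 1"
    "open N" "A \<subseteq> N" "N \<subseteq> V" "\<And>x. x \<in> N \<Longrightarrow> \<theta> x = 1"
proof -
  have "\<exists>r>0. cball p (2 * r) \<subseteq> V" if "p \<in> A" for p
  proof -
    obtain e where "e > 0" "cball p e \<subseteq> V"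
      using assms \<open>p \<in> A\<close> open_contains_cball by blast
    then show ?thesis by (intro exI[of _ "e / 2"]) auto
  qed
  then obtain r where r: "\<And>p. p \<in> A \<Longrightarrow> r p > 0" "\<And>p. p \<in> A \<Longrightarrow> cball p (2 * r p) \<subseteq> V"
    by metis
  have "A \<subseteq> (\<Union>p\<in>A. ball p (r p))" using r by force
  then obtain F where F: "F \<subseteq> A" "finite F" "A \<subseteq> (\<Union>p\<in>F. ball p (r p))"
    using assms(2) by (metis (no_types, lifting) compactE_image open_ball)
  \<comment> \<open>Equal to 1 for |x - p| \<le> r and to 0 once |x - p|^2 \<ge> 2 r^2; the square
    keeps it smooth at the centre.\<close>
  define b where "b p x = smooth_step (2 - (norm (x - p))\<^sup>2 * inverse ((r p)\<^sup>2))" for p x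
  define \<theta> where "\<theta> x = smooth_step (\<Sum>p\<in>F. b p x)" for x
  have sb: "smooth_on UNIV (b p)" for p
    unfolding b_def
    by (intro smooth_on_compose_UNIV[OF _ smooth_smooth_step] smooth_on_diff smooth_on_mult
        smooth_on_const smooth_norm_square[unfolded smooth_iff_smooth_on] open_UNIV)
  have bnn: "b p x \<ge> 0" for p x by (simp add: b_def smooth_step_nonneg)
  have b1: "b p x = 1" if "x \<in> ball p (r p)" "p \<in> F" for p x
  proof -
    have "(norm (x - p))\<^sup>2 \<le> (r p)\<^sup>2" "r p > 0"
      using that r F by (auto intro!: power_mono simp: dist_norm norm_minus_commute)
    then show ?thesis by (auto simp: b_def field_simps intro!: smooth_step_1)
  qed
  have b0: "b p x = 0" if "x \<notin> cball p (2 * r p)" "p \<in> F" for p x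
  proof -
    have "r p > 0" "2 * r p \<le> norm (x - p)"
      using that r F by (auto simp: dist_norm norm_minus_commute)
    then have "(2 * r p)\<^sup>2 \<le> (norm (x - p))\<^sup>2" by (intro power_mono) auto
    then have "4 * (r p)\<^sup>2 \<le> (norm (x - p))\<^sup>2"
      by (simp add: power_mult_distrib)
    moreover have "2 * (r p)\<^sup>2 \<le> 4 * (r p)\<^sup>2" by simp
    ultimately have "2 * (r p)\<^sup>2 \<le> (norm (x - p))\<^sup>2" by (rule order_trans[rotated])
    then show ?thesis using \<open>r p > 0\<close> by (auto simp: b_def field_simps intro!: smooth_step_0)
  qed
  have "\<theta> \<in> test_functions V"
  proof (rule test_functionsI)
    show "smooth \<theta>"
      unfolding smooth_iff_smooth_on \<theta>_def
      by (intro smooth_on_compose_UNIV[OF _ smooth_smooth_step] smooth_on_sum sb open_UNIV)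
    show "compact (\<Union>p\<in>F. cball p (2 * r p))" using F by auto
    show "(\<Union>p\<in>F. cball p (2 * r p)) \<subseteq> V" using F r by blast
    show "\<theta> x = 0" if "x \<notin> (\<Union>p\<in>F. cball p (2 * r p))" for x
      using b0 that by (simp add: \<theta>_def smooth_step_0)
  qed
  moreover have "\<theta> x = 1" if x: "x \<in> (\<Union>p\<in>F. ball p (r p))" for x
  proof -
    obtain p where p: "p \<in> F" "x \<in> ball p (r p)" using x by auto
    have "b p x \<le> (\<Sum>p\<in>F. b p x)"
      using bnn F p by (intro member_le_sum) auto
    then show ?thesis using b1[OF p(2,1)] by (simp add: \<theta>_def smooth_step_1)
  qed
  moreover have "(\<Union>p\<in>F. ball p (r p)) \<subseteq> V"
  proof -
    have "ball p (r p) \<subseteq> cball p (2 * r p)" if "p \<in> F" for p using r F that by (force simp: less_imp_le)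
    then show ?thesis using r F by fast
  qed
  ultimately show ?thesis
    using F by (intro that[of \<theta> "\<Union>p\<in>F. ball p (r p)"]) (auto simp: \<theta>_def smooth_step_nonneg smooth_step_le_1)
qed

section \<open>Weak gradients of continuous functions\<close>

lemma continuous_imp_lebesgue_measurable:
  fixes f :: "'a::euclidean_space \<Rightarrow> 'b::{euclidean_space}"
  shows "continuous_on UNIV f \<Longrightarrow> f \<in> borel_measurable lebesgue"
  by (intro measurable_completion) (simp add: borel_measurable_continuous_onI)

lemma continuous_on_extend_zero:
  fixes f :: "'a::euclidean_space \<Rightarrow> real"
  assumes "open V" "closed K" "K \<subseteq> V" "continuous_on V f" "\<And>x. x \<notin> K \<Longrightarrow> f x = 0"
  shows "continuous_on UNIV f"
proof -
  have "continuous_on (- K) f"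
    using assms(5) by (subst continuous_on_cong[where g="\<lambda>_. 0"]) auto
  then have "continuous_on (V \<union> - K) f"
    using assms by (intro continuous_on_open_Un) auto
  moreover have "V \<union> - K = UNIV" using assms by auto
  ultimately show ?thesis by simp
qed

lemma compact_support_integrable:
  fixes f :: "'a::euclidean_space \<Rightarrow> real"
  assumes "continuous_on UNIV f" "compact K" "\<And>x. x \<notin> K \<Longrightarrow> f x = 0"
  shows "integrable lebesgue f"
proof -
  have "integrable lborel (\<lambda>x. indicator K x *\<^sub>R f x)"
    using assms(1,2) by (intro borel_integrable_compact continuous_on_subset[OF assms(1)]) auto
  moreover have "(\<lambda>x. indicator K x *\<^sub>R f x) = f"
    using assms(3) by (fastforce simp: indicator_def)
  ultimately show ?thesis
    using assms(1) by (simp add: integrable_completion borel_measurable_continuous_onI)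
qed

lemma compact_support_bounded:
  fixes f :: "'a::euclidean_space \<Rightarrow> real"
  assumes "continuous_on UNIV f" "compact K" "\<And>x. x \<notin> K \<Longrightarrow> f x = 0"
  obtains B where "B > 0" "\<And>x. \<bar>f x\<bar> \<le> B"
proof -
  have "bounded (f ` K)"
    using assms by (intro compact_imp_bounded compact_continuous_image) (auto intro: continuous_on_subset)
  then obtain B where "B > 0" "\<And>y. y \<in> f ` K \<Longrightarrow> norm y \<le> B"
    unfolding bounded_pos by blast
  then show ?thesis using assms(3) by (intro that[of B]) (auto, metis abs_zero image_eqI less_imp_le)
qed

section \<open>Translations and difference quotients\<close>

lemma integral_translate:
  fixes f :: "'a::euclidean_space \<Rightarrow> real"
  assumes "f \<in> borel_measurable borel"
  shows "(\<integral>x. f (x + c) \<partial>lebesgue) = (\<integral>x. f x \<partial>lebesgue)"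
proof -
  have "(\<integral>x. f x \<partial>lebesgue) = (\<integral>x. f x \<partial>distr lborel borel ((+) c))"
    using assms by (simp add: integral_completion lborel_distr_plus)
  also have "\<dots> = (\<integral>x. f (c + x) \<partial>lborel)"
    using assms by (intro integral_distr) auto
  also have "\<dots> = (\<integral>x. f (c + x) \<partial>lebesgue)"
    using measurable_compose[of "(+) c", OF borel_measurable_continuous_onI assms]
    by (intro integral_completion[symmetric]) (simp add: continuous_on_add)
  finally show ?thesis by (simp add: add.commute)
qed

lemma integrable_mult_bounded:
  fixes f k :: "'a \<Rightarrow> real"
  assumes "integrable M f" "k \<in> borel_measurable M" "\<And>x. \<bar>k x\<bar> \<le> B"
  shows "integrable M (\<lambda>x. f x * k x)"
proof (rule Bochner_Integration.integrable_bound)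
  show "integrable M (\<lambda>x. B * f x)" using assms by simp
  have "\<bar>f x\<bar> * \<bar>k x\<bar> \<le> \<bar>f x\<bar> * \<bar>B\<bar>" for x
    using assms(3)[of x] by (intro mult_left_mono) auto
  then show "AE x in M. norm (f x * k x) \<le> norm (B * f x)"
    by (simp add: abs_mult mult.commute)
qed (use assms in measurable)

lemma has_real_derivative_translate:
  assumes "smooth \<phi>"
  shows "((\<lambda>t. \<phi> (x - t *\<^sub>R e)) has_real_derivative - partial_deriv e \<phi> (x - t *\<^sub>R e)) (at t)"
proof -
  have "(\<phi> has_derivative frechet_derivative \<phi> (at (x - t *\<^sub>R e))) (at (x - t *\<^sub>R e))"
    using smooth_differentiable[OF assms] by (simp add: frechet_derivative_works[symmetric])
  moreover have "((\<lambda>t. x - t *\<^sub>R e) has_derivative (\<lambda>t. - (t *\<^sub>R e))) (at t)"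
    by (auto intro!: derivative_eq_intros)
  ultimately have "((\<lambda>t. \<phi> (x - t *\<^sub>R e)) has_derivative
      (\<lambda>t'. frechet_derivative \<phi> (at (x - t *\<^sub>R e)) (- (t' *\<^sub>R e)))) (at t)"
    by (rule has_derivative_compose[rotated])
  moreover have "(\<lambda>t'. frechet_derivative \<phi> (at (x - t *\<^sub>R e)) (- (t' *\<^sub>R e)))
      = (*) (- frechet_derivative \<phi> (at (x - t *\<^sub>R e)) e)"
  proof -
    have l: "linear (frechet_derivative \<phi> (at (x - t *\<^sub>R e)))"
      using smooth_differentiable[OF assms] by (rule linear_frechet_derivative)
    show ?thesis
      by (rule ext) (simp add: linear_neg[OF l] linear_scale[OF l] mult.commute)
  qed
  ultimately show ?thesis
    unfolding has_field_derivative_def partial_deriv_def by simp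
qed

text \<open>The derivative falls on the smooth factor, so integrability of \<open>U\<close> is
  enough: the difference quotients of \<phi> are bounded by the supremum of its derivative, and
  dominated convergence applies along every sequence tending to 0.\<close>

lemma DERIV_integral_translate:
  fixes U :: "'a::euclidean_space \<Rightarrow> real"
  assumes U: "integrable lebesgue U"
    and phi: "smooth \<phi>" "compact K" "\<And>x. x \<notin> K \<Longrightarrow> \<phi> x = 0" and e: "e \<in> Basis"
  shows "((\<lambda>t. \<integral>x. U x * \<phi> (x - t *\<^sub>R e) \<partial>lebesgue) has_real_derivative
          - (\<integral>x. U x * partial_deriv e \<phi> (x - t *\<^sub>R e) \<partial>lebesgue)) (at t)"
proof -
  have test: "\<phi> \<in> test_functions UNIV"
    using phi by (intro test_functionsI[of _ K]) auto
  have pc: "continuous_on UNIV (partial_deriv e \<phi>)"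
    using test_functions_continuous[OF test_functions_partial_deriv[OF test e]] .
  have pc': "continuous_on UNIV \<phi>" using test_functions_continuous[OF test] .
  have "partial_deriv e \<phi> x = 0" if "x \<notin> K" for x
    using phi that compact_imp_closed by (intro partial_deriv_zero_open[of "- K"]) auto
  then obtain B where B: "B > 0" "\<And>x. \<bar>partial_deriv e \<phi> x\<bar> \<le> B"
    using compact_support_bounded[OF pc phi(2)] by metis
  obtain B' where B': "B' > 0" "\<And>x. \<bar>\<phi> x\<bar> \<le> B'"
    using compact_support_bounded[OF pc' phi(2,3)] by metis
  have meas: "(\<lambda>x. \<phi> (x - t *\<^sub>R e)) \<in> borel_measurable lebesgue" for t
    by (intro continuous_imp_lebesgue_measurable continuous_on_compose2[OF pc'] continuous_intros) auto
  have meas': "(\<lambda>x. partial_deriv e \<phi> (x - t *\<^sub>R e)) \<in> borel_measurable lebesgue" for t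
    by (intro continuous_imp_lebesgue_measurable continuous_on_compose2[OF pc] continuous_intros) auto
  have int: "integrable lebesgue (\<lambda>x. U x * \<phi> (x - t *\<^sub>R e))" for t
    using U meas B' by (intro integrable_mult_bounded)
  have lip: "\<bar>\<phi> (x - s *\<^sub>R e) - \<phi> (x - t *\<^sub>R e)\<bar> \<le> B * \<bar>s - t\<bar>" for x s t
    using field_differentiable_bound[of UNIV "\<lambda>t. \<phi> (x - t *\<^sub>R e)" "\<lambda>t. - partial_deriv e \<phi> (x - t *\<^sub>R e)" B s t]
      has_real_derivative_translate[OF phi(1)] B by auto
  let ?A = "\<lambda>t. \<integral>x. U x * \<phi> (x - t *\<^sub>R e) \<partial>lebesgue"
  have "(\<lambda>h. (?A (t + h) - ?A t) / h) \<midarrow>0\<rightarrow> (\<integral>x. - (U x * partial_deriv e \<phi> (x - t *\<^sub>R e)) \<partial>lebesgue)"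
  proof (rule LIMSEQ_SEQ_conv[THEN iffD1], intro allI impI, elim conjE)
    fix S :: "nat \<Rightarrow> real" assume S: "\<forall>n. S n \<noteq> 0" "S \<longlonglongrightarrow> 0"
    let ?s = "\<lambda>n x. U x * ((\<phi> (x - (t + S n) *\<^sub>R e) - \<phi> (x - t *\<^sub>R e)) / S n)"
    have "(\<lambda>n. \<integral>x. ?s n x \<partial>lebesgue) \<longlonglongrightarrow> (\<integral>x. - (U x * partial_deriv e \<phi> (x - t *\<^sub>R e)) \<partial>lebesgue)"
    proof (rule integral_dominated_convergence[where w="\<lambda>x. \<bar>U x\<bar> * B"])
      show "(\<lambda>x. - (U x * partial_deriv e \<phi> (x - t *\<^sub>R e))) \<in> borel_measurable lebesgue"
        using U meas' by measurable
      show "?s n \<in> borel_measurable lebesgue" for n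
        using U meas by measurable
      show "integrable lebesgue (\<lambda>x. \<bar>U x\<bar> * B)" using U by simp
      show "AE x in lebesgue. (\<lambda>n. ?s n x) \<longlonglongrightarrow> - (U x * partial_deriv e \<phi> (x - t *\<^sub>R e))"
      proof (intro AE_I2)
        fix x
        have "(\<lambda>h. (\<phi> (x - (t + h) *\<^sub>R e) - \<phi> (x - t *\<^sub>R e)) / h) \<midarrow>0\<rightarrow> - partial_deriv e \<phi> (x - t *\<^sub>R e)"
          using has_real_derivative_translate[OF phi(1)] unfolding DERIV_def by blast
        then have "(\<lambda>n. (\<phi> (x - (t + S n) *\<^sub>R e) - \<phi> (x - t *\<^sub>R e)) / S n) \<longlonglongrightarrow> - partial_deriv e \<phi> (x - t *\<^sub>R e)"
          by (rule filterlim_compose) (use S in \<open>auto intro: filterlim_atI\<close>)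
        then show "(\<lambda>n. ?s n x) \<longlonglongrightarrow> - (U x * partial_deriv e \<phi> (x - t *\<^sub>R e))"
          using tendsto_mult_left[of _ "- partial_deriv e \<phi> (x - t *\<^sub>R e)" _ "U x"]
          by (simp only: mult_minus_right)
      qed
      show "AE x in lebesgue. norm (?s n x) \<le> \<bar>U x\<bar> * B" for n
      proof (intro AE_I2)
        fix x
        have "\<bar>(\<phi> (x - (t + S n) *\<^sub>R e) - \<phi> (x - t *\<^sub>R e)) / S n\<bar>
            = \<bar>\<phi> (x - (t + S n) *\<^sub>R e) - \<phi> (x - t *\<^sub>R e)\<bar> / \<bar>S n\<bar>"
          by (rule abs_divide)
        also have "\<dots> \<le> (B * \<bar>S n\<bar>) / \<bar>S n\<bar>"
          using lip[of x "t + S n" t] by (intro divide_right_mono) auto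
        also have "\<dots> = B" using S by simp
        finally have "\<bar>(\<phi> (x - (t + S n) *\<^sub>R e) - \<phi> (x - t *\<^sub>R e)) / S n\<bar> \<le> B" .
        then show "norm (?s n x) \<le> \<bar>U x\<bar> * B"
          unfolding real_norm_def abs_mult[of "U x"] by (rule mult_left_mono) simp
      qed
    qed
    moreover have "(\<integral>x. ?s n x \<partial>lebesgue) = (?A (t + S n) - ?A t) / S n" for n
    proof -
      have "(\<integral>x. ?s n x \<partial>lebesgue)
          = (\<integral>x. (U x * \<phi> (x - (t + S n) *\<^sub>R e) - U x * \<phi> (x - t *\<^sub>R e)) / S n \<partial>lebesgue)"
        by (intro Bochner_Integration.integral_cong) (auto simp: right_diff_distrib)
      also have "\<dots> = (?A (t + S n) - ?A t) / S n"
        using int by (simp only: Bochner_Integration.integral_diff integral_divide_zero)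
      finally show ?thesis .
    qed
    ultimately show "(\<lambda>n. (?A (t + S n) - ?A t) / S n)
        \<longlonglongrightarrow> (\<integral>x. - (U x * partial_deriv e \<phi> (x - t *\<^sub>R e)) \<partial>lebesgue)" by (simp only:)
  qed
  then show ?thesis by (simp add: DERIV_def)
qed

definition locally_integrable :: "'a::euclidean_space set \<Rightarrow> ('a \<Rightarrow> 'b::euclidean_space) \<Rightarrow> bool" where
  "locally_integrable V g \<longleftrightarrow> (\<forall>K. compact K \<longrightarrow> K \<subseteq> V \<longrightarrow> set_integrable lebesgue K g)"

text \<open>Continuous functions with a locally integrable weak gradient. Unlike H^1, this class is
  closed under composition with C^1 functions and under multiplication by smooth ones without growth
  conditions at the frontier of \<open>V\<close>. The integrals run over the whole space since test
  functions vanish off \<open>V\<close>.\<close>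

definition wgrad :: "'a::euclidean_space set \<Rightarrow> ('a \<Rightarrow> real) \<Rightarrow> ('a \<Rightarrow> 'a) \<Rightarrow> bool" where
  "wgrad V u g \<longleftrightarrow> open V \<and> continuous_on V u \<and> locally_integrable V g \<and>
     (\<forall>\<phi>\<in>test_functions V. \<forall>i\<in>Basis.
        (\<integral>x. u x * partial_deriv i \<phi> x \<partial>lebesgue) = - (\<integral>x. (g x \<bullet> i) * \<phi> x \<partial>lebesgue))"

lemma locally_integrable_mult:
  fixes k :: "'a::euclidean_space \<Rightarrow> real"
  assumes "locally_integrable V g" "compact K" "K \<subseteq> V" "continuous_on UNIV k" "\<And>x. x \<notin> K \<Longrightarrow> k x = 0"
  shows "integrable lebesgue (\<lambda>x. (g x \<bullet> i) * k x)"
proof -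
  have "integrable lebesgue (\<lambda>x. (indicator K x *\<^sub>R g x) \<bullet> i)"
    using assms unfolding locally_integrable_def set_integrable_def by (intro integrable_inner_left) auto
  moreover obtain B where "\<And>x. \<bar>k x\<bar> \<le> B"
    using compact_support_bounded[OF assms(4,2,5)] by metis
  ultimately have "integrable lebesgue (\<lambda>x. ((indicator K x *\<^sub>R g x) \<bullet> i) * k x)"
    using assms(4) by (intro integrable_mult_bounded continuous_imp_lebesgue_measurable)
  moreover have "(\<lambda>x. ((indicator K x *\<^sub>R g x) \<bullet> i) * k x) = (\<lambda>x. (g x \<bullet> i) * k x)"
    using assms(5) by (fastforce simp: indicator_def)
  ultimately show ?thesis by simp
qed

lemma locally_integrable_integral_bound:
  fixes k :: "'a::euclidean_space \<Rightarrow> real"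
  assumes "locally_integrable V g" "compact K" "K \<subseteq> V" "continuous_on UNIV k" "\<And>x. x \<notin> K \<Longrightarrow> k x = 0"
    "\<And>x. \<bar>k x\<bar> \<le> M" "i \<in> Basis"
  shows "\<bar>\<integral>x. (g x \<bullet> i) * k x \<partial>lebesgue\<bar> \<le> M * (\<integral>x. norm (indicator K x *\<^sub>R g x) \<partial>lebesgue)"
proof -
  have int: "integrable lebesgue (\<lambda>x. indicator K x *\<^sub>R g x)"
    using assms unfolding locally_integrable_def set_integrable_def by auto
  have "\<bar>\<integral>x. (g x \<bullet> i) * k x \<partial>lebesgue\<bar> \<le> (\<integral>x. \<bar>(g x \<bullet> i) * k x\<bar> \<partial>lebesgue)"
    using integral_abs_bound by blast
  also have "\<dots> \<le> (\<integral>x. M * norm (indicator K x *\<^sub>R g x) \<partial>lebesgue)"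
  proof (rule integral_mono)
    show "integrable lebesgue (\<lambda>x. \<bar>(g x \<bullet> i) * k x\<bar>)"
      using locally_integrable_mult[OF assms(1-5)] by simp
    show "\<bar>(g x \<bullet> i) * k x\<bar> \<le> M * norm (indicator K x *\<^sub>R g x)" for x
    proof (cases "x \<in> K")
      case True
      have "\<bar>g x \<bullet> i\<bar> * \<bar>k x\<bar> \<le> norm (g x) * M"
        using assms(6)[of x] Basis_le_norm[OF assms(7), of "g x"] by (intro mult_mono) (assumption | simp)+
      then show ?thesis using True by (simp add: abs_mult mult.commute)
    qed (use assms(5) in auto)
    show "integrable lebesgue (\<lambda>x. M * norm (indicator K x *\<^sub>R g x))"
      by (intro integrable_mult_right integrable_norm int)
  qed
  finally show ?thesis by (simp only: integral_mult_right_zero)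
qed

lemma compact_neighborhood:
  fixes K :: "'a::euclidean_space set"
  assumes "compact K" "K \<subseteq> V" "open V"
  obtains W where "open W" "K \<subseteq> W" "compact (closure W)" "closure W \<subseteq> V"
proof -
  obtain \<theta> N where t: "\<theta> \<in> test_functions V" "open N" "K \<subseteq> N" "\<And>x. x \<in> N \<Longrightarrow> \<theta> x = (1::real)"
    using cutoff_exists[OF assms(3,1,2)] by metis
  have "closure N \<subseteq> closure {x. \<theta> x \<noteq> 0}"
    using t(4) by (intro closure_mono) auto
  moreover have "compact (closure N)"
    using closed_Int_compact[OF closed_closure test_functionsD(2)[OF t(1)], of N] calculation
    by (simp add: inf.absorb1)
  ultimately show ?thesis
    using t test_functionsD(3)[OF t(1)] by (intro that[of N]) auto
qed

lemma partial_deriv_translate: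
  assumes "\<phi> differentiable (at (x - c))"
  shows "partial_deriv i (\<lambda>x. \<phi> (x - c)) x = partial_deriv i \<phi> (x - c)"
proof -
  have "((\<lambda>x. x - c) has_derivative (\<lambda>x. x)) (at x)" by (auto intro!: derivative_eq_intros)
  then have "((\<lambda>x. \<phi> (x - c)) has_derivative (\<lambda>h. frechet_derivative \<phi> (at (x - c)) h)) (at x)"
    using assms has_derivative_compose unfolding frechet_derivative_works by blast
  then show ?thesis by (subst partial_deriv_eqI) (auto simp: partial_deriv_def)
qed

lemma smooth_translate:
  fixes \<phi> :: "'a::euclidean_space \<Rightarrow> real"
  assumes "smooth \<phi>" shows "smooth (\<lambda>x. \<phi> (x - c))"
proof -
  have "Ck_on k UNIV (\<lambda>x. \<phi> (x - c))" if "Ck_on k UNIV \<phi>" for k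
    using that
  proof (induction k arbitrary: \<phi>)
    case 0
    then show ?case by (auto intro!: continuous_on_compose2[of UNIV \<phi>] continuous_intros)
  next
    case (Suc k)
    have d: "\<phi> differentiable (at x)" for x
      using Ck_on_differentiable[OF _ Suc.prems] by simp
    have "partial_deriv i (\<lambda>x. \<phi> (x - c)) = (\<lambda>x. partial_deriv i \<phi> (x - c))" for i
      using partial_deriv_translate[OF d] by blast
    moreover have "(\<lambda>x. \<phi> (x - c)) differentiable (at x)" for x
      by (rule differentiable_compose[of \<phi> "\<lambda>x. x - c", OF d]) (auto intro!: derivative_intros)
    ultimately show ?case
      using Suc by (simp add: differentiable_on_eq_differentiable_at)
  qed
  then show ?thesis
    using assms by (simp add: smooth_iff_smooth_on smooth_on_def)
qed

text \<open>Plays the part of mollification: a polynomial close to \<open>k\<close> on the support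
  of a cutoff \<theta>, multiplied by \<theta>, is a test function, and k = \<theta> k carries the
  error bound over.\<close>

lemma uniform_approximation_test:
  fixes k :: "'a::euclidean_space \<Rightarrow> real"
  assumes "compact K" "K \<subseteq> V" "open V" "continuous_on UNIV k" "\<And>x. x \<notin> K \<Longrightarrow> k x = 0" "\<epsilon> > 0"
  obtains \<phi> where "\<phi> \<in> test_functions V" "\<And>x. \<bar>\<phi> x - k x\<bar> \<le> \<epsilon>"
proof -
  obtain \<theta> N where t: "\<theta> \<in> test_functions V" "\<And>x. 0 \<le> \<theta> x" "\<And>x. \<theta> x \<le> 1" "K \<subseteq> N" "\<And>x. x \<in> N \<Longrightarrow> \<theta> x = (1::real)"
    using cutoff_exists[OF assms(3,1,2)] by metis
  let ?L = "closure {x. \<theta> x \<noteq> 0}"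
  obtain p where p: "polynomial_function p" "\<And>x. x \<in> ?L \<Longrightarrow> norm (k x - p x) < \<epsilon>"
    using Stone_Weierstrass_polynomial_function[OF test_functionsD(2)[OF t(1)]
        continuous_on_subset[OF assms(4) subset_UNIV] assms(6)] by blast
  have "(\<lambda>x. p x * \<theta> x) \<in> test_functions V"
    using p(1) by (intro test_functions_mult assms t smooth_imp_smooth_on smooth_polynomial)
      (simp add: real_polynomial_function_eq)
  moreover have "\<bar>p x * \<theta> x - k x\<bar> \<le> \<epsilon>" for x
  proof (cases "x \<in> ?L")
    case True
    have "k x = 0 \<or> \<theta> x = 1"
      using t(4,5) assms(5)[of x] by (cases "x \<in> K") auto
    then have "p x * \<theta> x - k x = \<theta> x * (p x - k x)" by (auto simp: algebra_simps)
    then have "\<bar>p x * \<theta> x - k x\<bar> = \<theta> x * \<bar>p x - k x\<bar>"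
      using t(2)[of x] by (simp add: abs_mult)
    also have "\<dots> \<le> 1 * \<epsilon>"
      using t(2,3) p(2)[OF True] assms(6) by (intro mult_mono) auto
    finally show ?thesis by simp
  next
    case False
    then have "\<theta> x = 0" using closure_subset[of "{x. \<theta> x \<noteq> 0}"] by auto
    then have "k x = 0" using t(4,5) assms(5) by (metis subsetD zero_neq_one)
    then show ?thesis using \<open>\<theta> x = 0\<close> assms(6) by simp
  qed
  ultimately show ?thesis using that by blast
qed

text \<open>\<open>U\<close> is \<open>u\<close> times a cutoff, so that it is continuous with
  compact support and its translates make sense everywhere. For small t the translate of \<phi> is
  still a test function on \<open>V\<close>; hence \<integral> U(x) \<phi>(x - t e) dx has
  derivative \<integral> (g . e) \<phi>(x - t e) dx in t. The mean value inequality gives the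
  Lipschitz bound, and t = 0 the limit.\<close>

lemma smooth_difference_quotient:
  fixes u :: "'a::euclidean_space \<Rightarrow> real"
  assumes wg: "wgrad V u g" and K: "compact K" "K \<subseteq> V" and e: "e \<in> Basis"
  obtains \<delta> C U L N where "\<delta> > 0" "C \<ge> 0" "continuous_on UNIV U" "compact L" "L \<subseteq> V"
    "\<And>x. x \<notin> L \<Longrightarrow> U x = 0" "open N" "K \<subseteq> N" "\<And>x. x \<in> N \<Longrightarrow> U x = u x"
    "\<And>\<phi> M t. \<phi> \<in> test_functions V \<Longrightarrow> (\<And>x. x \<notin> K \<Longrightarrow> \<phi> x = 0) \<Longrightarrow> (\<And>x. \<bar>\<phi> x\<bar> \<le> M) \<Longrightarrow> \<bar>t\<bar> < \<delta> \<Longrightarrow>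
       \<bar>\<integral>x. U x * (\<phi> (x - t *\<^sub>R e) - \<phi> x) \<partial>lebesgue\<bar> \<le> \<bar>t\<bar> * M * C"
    "\<And>\<phi>. \<phi> \<in> test_functions V \<Longrightarrow> (\<And>x. x \<notin> K \<Longrightarrow> \<phi> x = 0) \<Longrightarrow>
       (\<lambda>t. (\<integral>x. U x * (\<phi> (x - t *\<^sub>R e) - \<phi> x) \<partial>lebesgue) / t) \<midarrow>0\<rightarrow> (\<integral>x. (g x \<bullet> e) * \<phi> x \<partial>lebesgue)"
proof -
  have V: "open V" and cu: "continuous_on V u" and li: "locally_integrable V g"
    and id: "\<And>\<phi>. \<phi> \<in> test_functions V \<Longrightarrow>
        (\<integral>x. u x * partial_deriv e \<phi> x \<partial>lebesgue) = - (\<integral>x. (g x \<bullet> e) * \<phi> x \<partial>lebesgue)"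
    using wg e unfolding wgrad_def by auto
  obtain W where W: "open W" "K \<subseteq> W" "compact (closure W)" "closure W \<subseteq> V"
    using compact_neighborhood[OF K V] .
  obtain \<delta> where d: "\<delta> > 0" "(\<Union>x\<in>K. ball x \<delta>) \<subseteq> W"
    using compact_subset_open_imp_ball_epsilon_subset[OF K(1) W(1,2)] by blast
  obtain \<theta> N where t: "\<theta> \<in> test_functions V" "open N" "closure W \<subseteq> N" "\<And>x. x \<in> N \<Longrightarrow> \<theta> x = (1::real)"
    using cutoff_exists[OF V W(3,4)] by metis
  define L where "L = closure {x. \<theta> x \<noteq> 0}"
  define U where "U x = u x * \<theta> x" for x
  define C where "C = (\<integral>x. norm (indicator (closure W) x *\<^sub>R g x) \<partial>lebesgue)"
  have L: "compact L" "L \<subseteq> V" using test_functionsD[OF t(1)] by (auto simp: L_def)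
  have U0: "U x = 0" if "x \<notin> L" for x
    using that closure_subset[of "{x. \<theta> x \<noteq> 0}"] by (auto simp: L_def U_def)
  have U1: "U x = u x" if "x \<in> N" for x using t(4)[OF that] by (simp add: U_def)
  have Uc: "continuous_on UNIV U"
  proof (rule continuous_on_extend_zero[OF V compact_imp_closed[OF L(1)] L(2) _ U0])
    show "continuous_on V U"
      unfolding U_def using cu test_functions_continuous[OF t(1)] by (intro continuous_intros)
  qed
  have Ui: "integrable lebesgue U" by (rule compact_support_integrable[OF Uc L(1) U0])
  have der: "((\<lambda>t. \<integral>x. U x * \<phi> (x - t *\<^sub>R e) \<partial>lebesgue) has_real_derivative
      (\<integral>x. (g x \<bullet> e) * \<phi> (x - t *\<^sub>R e) \<partial>lebesgue)) (at t)"
    and bnd: "(\<And>x. \<bar>\<phi> x\<bar> \<le> M) \<Longrightarrow> \<bar>\<integral>x. (g x \<bullet> e) * \<phi> (x - t *\<^sub>R e) \<partial>lebesgue\<bar> \<le> M * C"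
    if phi: "\<phi> \<in> test_functions V" "\<And>x. x \<notin> K \<Longrightarrow> \<phi> x = 0" and t: "\<bar>t\<bar> < \<delta>" for \<phi> t M
  proof -
    let ?\<phi> = "\<lambda>x. \<phi> (x - t *\<^sub>R e)"
    have "?\<phi> x = 0" if "x \<notin> W" for x
    proof (rule ccontr)
      assume "?\<phi> x \<noteq> 0"
      then have "x - t *\<^sub>R e \<in> K" using phi(2) by blast
      moreover have "x \<in> ball (x - t *\<^sub>R e) \<delta>" using t e by (simp add: dist_norm)
      ultimately show False using d(2) that by blast
    qed
    then have out': "?\<phi> x = 0" if "x \<notin> closure W" for x
      using that closure_subset by blast
    have tp: "?\<phi> \<in> test_functions V"
      using out' W by (intro test_functionsI[OF smooth_translate[OF test_functionsD(1)[OF phi(1)]] W(3,4)])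
    have pt: "partial_deriv e ?\<phi> x = partial_deriv e \<phi> (x - t *\<^sub>R e)" for x
      by (rule partial_deriv_translate[OF smooth_differentiable[OF test_functionsD(1)[OF phi(1)]]])
    have "partial_deriv e ?\<phi> x = 0" if "x \<notin> closure W" for x
      using that out' by (intro partial_deriv_zero_open[of "- closure W"]) auto
    then have "U x * partial_deriv e \<phi> (x - t *\<^sub>R e) = u x * partial_deriv e ?\<phi> x" for x
      using U1 \<open>closure W \<subseteq> N\<close> pt by (cases "x \<in> closure W") auto
    then have "- (\<integral>x. U x * partial_deriv e \<phi> (x - t *\<^sub>R e) \<partial>lebesgue) = (\<integral>x. (g x \<bullet> e) * ?\<phi> x \<partial>lebesgue)"
      using id[OF tp] by simp
    then show "((\<lambda>t. \<integral>x. U x * \<phi> (x - t *\<^sub>R e) \<partial>lebesgue) has_real_derivative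
      (\<integral>x. (g x \<bullet> e) * \<phi> (x - t *\<^sub>R e) \<partial>lebesgue)) (at t)"
      using DERIV_integral_translate[OF Ui test_functionsD(1)[OF phi(1)] K(1) phi(2) e, of t] by simp
    show "\<bar>\<integral>x. (g x \<bullet> e) * \<phi> (x - t *\<^sub>R e) \<partial>lebesgue\<bar> \<le> M * C" if "\<And>x. \<bar>\<phi> x\<bar> \<le> M"
      unfolding C_def
      by (rule locally_integrable_integral_bound[OF li W(3,4) test_functions_continuous[OF tp] out' that e])
  qed
  have diff: "(\<integral>x. U x * (\<phi> (x - t *\<^sub>R e) - \<phi> x) \<partial>lebesgue)
      = (\<integral>x. U x * \<phi> (x - t *\<^sub>R e) \<partial>lebesgue) - (\<integral>x. U x * \<phi> (x - 0 *\<^sub>R e) \<partial>lebesgue)"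
    if phi: "\<phi> \<in> test_functions V" "\<And>x. x \<notin> K \<Longrightarrow> \<phi> x = 0" for \<phi> t
  proof -
    obtain B where B: "\<And>x. \<bar>\<phi> x\<bar> \<le> B"
      using compact_support_bounded[OF test_functions_continuous[OF phi(1)] K(1) phi(2)] by metis
    have "integrable lebesgue (\<lambda>x. U x * \<phi> (x - t *\<^sub>R e))" for t
      using B by (intro integrable_mult_bounded[OF Ui] continuous_imp_lebesgue_measurable
          continuous_on_compose2[OF test_functions_continuous[OF phi(1), of UNIV]] continuous_intros) auto
    from this[of t] this[of 0] show ?thesis
      by (simp add: right_diff_distrib)
  qed
  show ?thesis
  proof (rule that[OF d(1) _ Uc L U0 t(2) _ U1])
    show "C \<ge> 0" by (simp add: C_def)
    show "K \<subseteq> N" using W t closure_subset by blast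
    fix \<phi> M t assume phi: "\<phi> \<in> test_functions V" "\<And>x. x \<notin> K \<Longrightarrow> \<phi> x = 0"
      and M: "\<And>x. \<bar>\<phi> x\<bar> \<le> M" and t: "\<bar>t\<bar> < \<delta>"
    have "norm ((\<integral>x. U x * \<phi> (x - t *\<^sub>R e) \<partial>lebesgue) - (\<integral>x. U x * \<phi> (x - 0 *\<^sub>R e) \<partial>lebesgue)) \<le> M * C * norm (t - 0)"
    proof (rule field_differentiable_bound[of "ball 0 \<delta>"])
      show "((\<lambda>t. \<integral>x. U x * \<phi> (x - t *\<^sub>R e) \<partial>lebesgue) has_real_derivative
          (\<integral>x. (g x \<bullet> e) * \<phi> (x - s *\<^sub>R e) \<partial>lebesgue)) (at s within ball 0 \<delta>)" if "s \<in> ball 0 \<delta>" for s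
        using der[OF phi, of s] that by (simp add: has_field_derivative_at_within)
      show "norm (\<integral>x. (g x \<bullet> e) * \<phi> (x - s *\<^sub>R e) \<partial>lebesgue) \<le> M * C" if "s \<in> ball 0 \<delta>" for s
        using bnd[OF phi, of s M] that M by simp
    qed (use t d in auto)
    then show "\<bar>\<integral>x. U x * (\<phi> (x - t *\<^sub>R e) - \<phi> x) \<partial>lebesgue\<bar> \<le> \<bar>t\<bar> * M * C"
      using diff[OF phi, of t] by (simp add: mult_ac)
  next
    fix \<phi> assume phi: "\<phi> \<in> test_functions V" "\<And>x. x \<notin> K \<Longrightarrow> \<phi> x = 0"
    show "(\<lambda>t. (\<integral>x. U x * (\<phi> (x - t *\<^sub>R e) - \<phi> x) \<partial>lebesgue) / t) \<midarrow>0\<rightarrow> (\<integral>x. (g x \<bullet> e) * \<phi> x \<partial>lebesgue)"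
      using der[OF phi, of 0] d(1) by (simp add: DERIV_def diff[OF phi])
  qed
qed

text \<open>Both conclusions are controlled by the supremum of the test function, so they pass to
  continuous functions by uniform approximation. The chain rule needs this: it tests with
  \<open>F' (u x) * \<phi> x\<close>, which is only continuous.\<close>

lemma difference_quotient:
  fixes u :: "'a::euclidean_space \<Rightarrow> real"
  assumes wg: "wgrad V u g" and K: "compact K" "K \<subseteq> V" and e: "e \<in> Basis"
  obtains \<delta> C U L N where "\<delta> > 0" "C \<ge> 0" "continuous_on UNIV U" "compact L" "L \<subseteq> V"
    "\<And>x. x \<notin> L \<Longrightarrow> U x = 0" "open N" "K \<subseteq> N" "\<And>x. x \<in> N \<Longrightarrow> U x = u x"
    "\<And>k M t. continuous_on UNIV k \<Longrightarrow> (\<And>x. x \<notin> K \<Longrightarrow> k x = 0) \<Longrightarrow> (\<And>x. \<bar>k x\<bar> \<le> M) \<Longrightarrow> \<bar>t\<bar> < \<delta> \<Longrightarrow>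
       \<bar>\<integral>x. U x * (k (x - t *\<^sub>R e) - k x) \<partial>lebesgue\<bar> \<le> \<bar>t\<bar> * M * C"
    "\<And>k. continuous_on UNIV k \<Longrightarrow> (\<And>x. x \<notin> K \<Longrightarrow> k x = 0) \<Longrightarrow>
       (\<lambda>t. (\<integral>x. U x * (k (x - t *\<^sub>R e) - k x) \<partial>lebesgue) / t) \<midarrow>0\<rightarrow> (\<integral>x. (g x \<bullet> e) * k x \<partial>lebesgue)"
proof -
  have V: "open V" and li: "locally_integrable V g" using wg by (auto simp: wgrad_def)
  obtain W where W: "open W" "K \<subseteq> W" "compact (closure W)" "closure W \<subseteq> V"
    using compact_neighborhood[OF K V] .
  \<comment> \<open>Two nested neighbourhoods of \<open>K\<close>: functions supported in the
    closure of the inner one are approximated by test functions living in the outer one.\<close>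
  obtain W' where W': "open W'" "closure W \<subseteq> W'" "compact (closure W')" "closure W' \<subseteq> V"
    using compact_neighborhood[OF W(3,4) V] .
  have WW: "W \<subseteq> closure W" "W' \<subseteq> closure W'" by (rule closure_subset)+
  obtain \<delta> C U L N where U: "\<delta> > 0" "C \<ge> 0" "continuous_on UNIV U" "compact L" "L \<subseteq> V"
    "\<And>x. x \<notin> L \<Longrightarrow> U x = 0" "open N" "closure W' \<subseteq> N" "\<And>x. x \<in> N \<Longrightarrow> U x = u x"
    and bnd: "\<And>\<phi> M t. \<phi> \<in> test_functions V \<Longrightarrow> (\<And>x. x \<notin> closure W' \<Longrightarrow> \<phi> x = 0) \<Longrightarrow> (\<And>x. \<bar>\<phi> x\<bar> \<le> M) \<Longrightarrow> \<bar>t\<bar> < \<delta> \<Longrightarrow>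
       \<bar>\<integral>x. U x * (\<phi> (x - t *\<^sub>R e) - \<phi> x) \<partial>lebesgue\<bar> \<le> \<bar>t\<bar> * M * C"
    and lim: "\<And>\<phi>. \<phi> \<in> test_functions V \<Longrightarrow> (\<And>x. x \<notin> closure W' \<Longrightarrow> \<phi> x = 0) \<Longrightarrow>
       (\<lambda>t. (\<integral>x. U x * (\<phi> (x - t *\<^sub>R e) - \<phi> x) \<partial>lebesgue) / t) \<midarrow>0\<rightarrow> (\<integral>x. (g x \<bullet> e) * \<phi> x \<partial>lebesgue)"
    apply (rule smooth_difference_quotient[OF wg W'(3,4) e])
    subgoal premises p for \<delta> C U L N by (rule that[of \<delta> C U L N]) (fact p)+
    done
  have Ui: "integrable lebesgue U" by (rule compact_support_integrable[OF U(3,4,6)])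
  let ?I = "\<lambda>k t. \<integral>x. U x * (k (x - t *\<^sub>R e) - k x) \<partial>lebesgue"
  have int: "integrable lebesgue (\<lambda>x. U x * (k (x - t *\<^sub>R e) - k x))"
    if k: "continuous_on UNIV k" "compact K'" "\<And>x. x \<notin> K' \<Longrightarrow> k x = 0" for k :: "'a \<Rightarrow> real" and t K'
  proof -
    obtain B where B: "\<And>x. \<bar>k x\<bar> \<le> B"
      using compact_support_bounded[OF k] by metis
    have "\<bar>k (x - t *\<^sub>R e) - k x\<bar> \<le> 2 * B" for x using B[of "x - t *\<^sub>R e"] B[of x] by linarith
    then show ?thesis
      by (intro integrable_mult_bounded[OF Ui] continuous_imp_lebesgue_measurable continuous_intros
          continuous_on_compose2[OF k(1)] k(1)) auto
  qed
  have bnd2: "\<bar>?I k t\<bar> \<le> \<bar>t\<bar> * M * C"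
    if k: "continuous_on UNIV k" "\<And>x. x \<notin> closure W \<Longrightarrow> k x = 0" and M: "\<And>x. \<bar>k x\<bar> \<le> M" and t: "\<bar>t\<bar> < \<delta>" for k M t
  proof (rule field_le_epsilon)
    fix \<epsilon> :: real assume "\<epsilon> > 0"
    define S where "S = (\<integral>x. \<bar>U x\<bar> \<partial>lebesgue)"
    have S: "S \<ge> 0" by (simp add: S_def)
    define \<eta> where "\<eta> = \<epsilon> / (\<bar>t\<bar> * C + 2 * S + 1)"
    have pos: "\<bar>t\<bar> * C + 2 * S + 1 > 0" using S U(2) by (simp add: add_nonneg_pos)
    have \<eta>: "\<eta> > 0" using \<open>\<epsilon> > 0\<close> pos by (simp add: \<eta>_def)
    obtain \<phi> where phi: "\<phi> \<in> test_functions W'" "\<And>x. \<bar>\<phi> x - k x\<bar> \<le> \<eta>"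
      using uniform_approximation_test[OF W(3) W'(2,1) k \<eta>] by blast
    have phi': "\<phi> \<in> test_functions V" "\<And>x. x \<notin> closure W' \<Longrightarrow> \<phi> x = 0"
      using test_functions_mono[OF phi(1)] W' WW test_functions_outside[OF phi(1)] by blast+
    have b: "\<bar>\<phi> x\<bar> \<le> M + \<eta>" for x using phi(2)[of x] M[of x] by linarith
    have 1: "\<bar>?I \<phi> t\<bar> \<le> \<bar>t\<bar> * (M + \<eta>) * C" by (rule bnd[OF phi' b t])
    have i1: "integrable lebesgue (\<lambda>x. U x * (\<phi> (x - t *\<^sub>R e) - \<phi> x))"
      by (rule int[OF test_functions_continuous[OF phi'(1)] W'(3) phi'(2)])
    have i2: "integrable lebesgue (\<lambda>x. U x * (k (x - t *\<^sub>R e) - k x))"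
      by (rule int[OF k(1) W(3) k(2)])
    have "\<bar>?I k t - ?I \<phi> t\<bar> = \<bar>\<integral>x. U x * (k (x - t *\<^sub>R e) - k x) - U x * (\<phi> (x - t *\<^sub>R e) - \<phi> x) \<partial>lebesgue\<bar>"
      using i1 i2 by (simp only: Bochner_Integration.integral_diff)
    also have "\<dots> \<le> (\<integral>x. \<bar>U x * (k (x - t *\<^sub>R e) - k x) - U x * (\<phi> (x - t *\<^sub>R e) - \<phi> x)\<bar> \<partial>lebesgue)"
      by (rule integral_abs_bound)
    also have "\<dots> \<le> (\<integral>x. \<bar>U x\<bar> * (2 * \<eta>) \<partial>lebesgue)"
    proof (rule integral_mono)
      fix x
      have "\<bar>(k (x - t *\<^sub>R e) - k x) - (\<phi> (x - t *\<^sub>R e) - \<phi> x)\<bar> \<le> 2 * \<eta>"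
        using phi(2)[of x] phi(2)[of "x - t *\<^sub>R e"] by linarith
      then show "\<bar>U x * (k (x - t *\<^sub>R e) - k x) - U x * (\<phi> (x - t *\<^sub>R e) - \<phi> x)\<bar> \<le> \<bar>U x\<bar> * (2 * \<eta>)"
        unfolding right_diff_distrib[symmetric] abs_mult by (rule mult_left_mono) simp
    qed (use i1 i2 Ui in \<open>auto intro!: Bochner_Integration.integrable_diff integrable_abs\<close>)
    also have "\<dots> = 2 * \<eta> * S" by (simp add: S_def mult.commute)
    finally have "\<bar>?I k t\<bar> \<le> \<bar>t\<bar> * (M + \<eta>) * C + 2 * \<eta> * S" using 1 by linarith
    also have "\<dots> = \<bar>t\<bar> * M * C + \<eta> * (\<bar>t\<bar> * C + 2 * S)" by (simp add: algebra_simps)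
    also have "\<dots> \<le> \<bar>t\<bar> * M * C + \<eta> * (\<bar>t\<bar> * C + 2 * S + 1)"
      using \<eta> by (intro add_left_mono mult_left_mono) auto
    also have "\<dots> = \<bar>t\<bar> * M * C + \<epsilon>" using pos by (simp add: \<eta>_def)
    finally show "\<bar>?I k t\<bar> \<le> \<bar>t\<bar> * M * C + \<epsilon>" .
  qed
  show ?thesis
  proof (rule that[OF U(1-7) _ U(9)])
    show "K \<subseteq> N" using W W' WW U(8) by blast
    fix k :: "'a \<Rightarrow> real" and M t :: real assume "continuous_on UNIV k" "\<And>x. x \<notin> K \<Longrightarrow> k x = 0" "\<And>x. \<bar>k x\<bar> \<le> M" "\<bar>t\<bar> < \<delta>"
    then show "\<bar>?I k t\<bar> \<le> \<bar>t\<bar> * M * C"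
      using W(2) WW by (intro bnd2) auto
  next
    fix k :: "'a \<Rightarrow> real" assume k: "continuous_on UNIV k" "\<And>x. x \<notin> K \<Longrightarrow> k x = 0"
    define S where "S = (\<integral>x. norm (indicator (closure W) x *\<^sub>R g x) \<partial>lebesgue)"
    have S: "S \<ge> 0" by (simp add: S_def)
    show "(\<lambda>t. ?I k t / t) \<midarrow>0\<rightarrow> (\<integral>x. (g x \<bullet> e) * k x \<partial>lebesgue)"
    proof (rule tendstoI)
      fix \<epsilon> :: real assume "\<epsilon> > 0"
      \<comment> \<open>The approximation error enters twice, through the bound for the quotients,
        uniformly in t, and through the limit integral. \<open>C + S\<close> collects both, and the
        1 keeps the denominator positive.\<close>
      define \<eta> where "\<eta> = \<epsilon> / (2 * (C + S + 1))"
      have \<eta>: "\<eta> > 0" "\<eta> * (C + S) < \<epsilon> / 2"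
        using \<open>\<epsilon> > 0\<close> U(2) S by (auto simp: \<eta>_def field_simps add_nonneg_pos)
      obtain \<phi> where phi: "\<phi> \<in> test_functions W" "\<And>x. \<bar>\<phi> x - k x\<bar> \<le> \<eta>"
        using uniform_approximation_test[OF K(1) W(2,1) k \<eta>(1)] by blast
      have out: "\<phi> x = 0" if "x \<notin> closure W" for x
        using test_functions_outside[OF phi(1)] that WW by blast
      have phi': "\<phi> \<in> test_functions V" "\<And>x. x \<notin> closure W' \<Longrightarrow> \<phi> x = 0"
        using test_functions_mono[OF phi(1)] W W' WW test_functions_outside[OF phi(1)] by blast+
      have cphi: "continuous_on UNIV \<phi>" by (rule test_functions_continuous[OF phi(1)])
      have c: "continuous_on UNIV (\<lambda>x. k x - \<phi> x)" using cphi k(1) by (intro continuous_intros)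
      have o: "k x - \<phi> x = 0" if "x \<notin> closure W" for x using out[OF that] k(2)[of x] that W(2) WW by auto
      have b: "\<bar>k x - \<phi> x\<bar> \<le> \<eta>" for x using phi(2)[of x] by linarith
      have I: "?I (\<lambda>x. k x - \<phi> x) t = ?I k t - ?I \<phi> t" for t
      proof -
        have "?I k t - ?I \<phi> t = (\<integral>x. U x * (k (x - t *\<^sub>R e) - k x) - U x * (\<phi> (x - t *\<^sub>R e) - \<phi> x) \<partial>lebesgue)"
          by (rule Bochner_Integration.integral_diff[symmetric])
            (rule int[OF k(1) K(1) k(2)] int[OF cphi W(3) out], assumption)+
        then show ?thesis by (simp add: algebra_simps)
      qed
      have J: "\<bar>(\<integral>x. (g x \<bullet> e) * k x \<partial>lebesgue) - (\<integral>x. (g x \<bullet> e) * \<phi> x \<partial>lebesgue)\<bar> \<le> \<eta> * S"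
      proof -
        have "(\<integral>x. (g x \<bullet> e) * k x \<partial>lebesgue) - (\<integral>x. (g x \<bullet> e) * \<phi> x \<partial>lebesgue)
          = (\<integral>x. (g x \<bullet> e) * (k x - \<phi> x) \<partial>lebesgue)"
          using locally_integrable_mult[OF li K k, of e] locally_integrable_mult[OF li W(3,4) cphi out, of e]
          by (simp add: right_diff_distrib)
        then show ?thesis
          using locally_integrable_integral_bound[OF li W(3,4) c o b e] by (simp add: S_def)
      qed
      have "\<forall>\<^sub>F t in at 0. dist (?I \<phi> t / t) (\<integral>x. (g x \<bullet> e) * \<phi> x \<partial>lebesgue) < \<epsilon> / 2"
        by (rule tendstoD[OF lim[OF phi'] half_gt_zero[OF \<open>\<epsilon> > 0\<close>]])
      moreover have "\<forall>\<^sub>F t in at (0::real). \<bar>t\<bar> < \<delta> \<and> t \<noteq> 0"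
        using U(1) by (auto simp: eventually_at intro!: exI[of _ \<delta>])
      ultimately show "\<forall>\<^sub>F t in at 0. dist (?I k t / t) (\<integral>x. (g x \<bullet> e) * k x \<partial>lebesgue) < \<epsilon>"
      proof eventually_elim
        case (elim t)
        have "\<bar>?I k t - ?I \<phi> t\<bar> \<le> \<bar>t\<bar> * \<eta> * C"
          using bnd2[OF c o b, of t] elim I by simp
        then have "\<bar>?I k t - ?I \<phi> t\<bar> / \<bar>t\<bar> \<le> \<eta> * C"
          using elim by (simp add: pos_divide_le_eq mult_ac)
        then have "\<bar>?I k t / t - ?I \<phi> t / t\<bar> \<le> \<eta> * C"
          by (simp only: abs_divide diff_divide_distrib[symmetric])
        then show ?case
          using elim J \<eta>(2) unfolding dist_real_def distrib_left by linarith
      qed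
    qed
  qed
qed

text \<open>Translation does not change the integral of \<phi>, so its derivative in t is zero. The
  cutoff \<theta>, equal to 1 around the support, supplies the integrable factor that
  differentiation under the integral asks for.\<close>

lemma integral_partial_deriv_eq_0:
  fixes \<phi> :: "'a::euclidean_space \<Rightarrow> real"
  assumes phi: "\<phi> \<in> test_functions UNIV" and e: "e \<in> Basis"
  shows "(\<integral>x. partial_deriv e \<phi> x \<partial>lebesgue) = 0"
proof -
  let ?K = "closure {x. \<phi> x \<noteq> 0}"
  have K: "compact ?K" and out: "\<And>x. x \<notin> ?K \<Longrightarrow> \<phi> x = 0"
    using test_functionsD(2)[OF phi] closure_subset[of "{x. \<phi> x \<noteq> 0}"] by auto
  obtain \<theta> N where t: "\<theta> \<in> test_functions UNIV" "open N" "?K \<subseteq> N" "\<And>x. x \<in> N \<Longrightarrow> \<theta> x = (1::real)"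
    using cutoff_exists[OF open_UNIV K] by (metis subset_UNIV)
  obtain \<delta> where d: "\<delta> > 0" "(\<Union>x\<in>?K. ball x \<delta>) \<subseteq> N"
    using compact_subset_open_imp_ball_epsilon_subset[OF K t(2,3)] by blast
  have "integrable lebesgue \<theta>"
    using closure_subset[of "{x. \<theta> x \<noteq> 0}"]
    by (intro compact_support_integrable[OF test_functions_continuous[OF t(1)] test_functionsD(2)[OF t(1)]]) auto
  then have D: "((\<lambda>t. \<integral>x. \<theta> x * \<phi> (x - t *\<^sub>R e) \<partial>lebesgue) has_real_derivative
          - (\<integral>x. \<theta> x * partial_deriv e \<phi> (x - 0 *\<^sub>R e) \<partial>lebesgue)) (at 0)"
    by (rule DERIV_integral_translate[OF _ test_functionsD(1)[OF phi] K out e])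
  have "(\<integral>x. \<theta> x * \<phi> (x - t *\<^sub>R e) \<partial>lebesgue) = (\<integral>x. \<phi> x \<partial>lebesgue)" if "t \<in> ball 0 \<delta>" for t
  proof -
    have "\<theta> x * \<phi> (x - t *\<^sub>R e) = \<phi> (x - t *\<^sub>R e)" for x
    proof (cases "\<phi> (x - t *\<^sub>R e) = 0")
      case False
      then have "x - t *\<^sub>R e \<in> ?K" using out by blast
      moreover have "x \<in> ball (x - t *\<^sub>R e) \<delta>" using that e by (simp add: dist_norm)
      ultimately have "x \<in> N" using d(2) by blast
      then show ?thesis using t(4)[of x] by simp
    qed simp
    then have "(\<integral>x. \<theta> x * \<phi> (x - t *\<^sub>R e) \<partial>lebesgue) = (\<integral>x. \<phi> (x + - t *\<^sub>R e) \<partial>lebesgue)"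
      by (simp only: scaleR_minus_left diff_conv_add_uminus[symmetric])
    also have "\<dots> = (\<integral>x. \<phi> x \<partial>lebesgue)"
      by (rule integral_translate) (rule borel_measurable_continuous_onI[OF test_functions_continuous[OF phi]])
    finally show ?thesis .
  qed
  then have "((\<lambda>t. \<integral>x. \<phi> x \<partial>lebesgue) has_real_derivative
          - (\<integral>x. \<theta> x * partial_deriv e \<phi> (x - 0 *\<^sub>R e) \<partial>lebesgue)) (at 0)"
    using d(1) by (intro has_field_derivative_transform_within_open[OF D open_ball[of 0 \<delta>]]) auto
  then have "(\<integral>x. \<theta> x * partial_deriv e \<phi> x \<partial>lebesgue) = 0"
    using DERIV_unique[OF _ DERIV_const] by fastforce
  moreover have "\<theta> x * partial_deriv e \<phi> x = partial_deriv e \<phi> x" for x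
    using partial_deriv_outside_support[of x \<phi> e] t(3,4) by (cases "x \<in> ?K") auto
  ultimately show ?thesis by simp
qed

section \<open>The chain rule for weak gradients\<close>

lemma difference_quotient_remainder:
  fixes F F' :: "real \<Rightarrow> real"
  assumes F: "\<And>y. (F has_real_derivative F' y) (at y)"
    and e: "\<And>y. y \<in> {-B..B} \<Longrightarrow> z \<in> {-B..B} \<Longrightarrow> \<bar>y - a\<bar> \<le> \<bar>z - a\<bar> \<Longrightarrow> \<bar>F' y - F' a\<bar> \<le> \<epsilon>"
    and B: "a \<in> {-B..B}" "z \<in> {-B..B}"
  shows "\<bar>F z - F a - F' a * (z - a)\<bar> \<le> \<epsilon> * \<bar>z - a\<bar>"
proof -
  have "norm ((F z - F' a * z) - (F a - F' a * a)) \<le> \<epsilon> * norm (z - a)"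
  proof (rule field_differentiable_bound[of "closed_segment a z"])
    fix y assume y: "y \<in> closed_segment a z"
    then have "y \<in> {-B..B}" "\<bar>y - a\<bar> \<le> \<bar>z - a\<bar>"
      using B by (auto simp: closed_segment_eq_real_ivl split: if_splits)
    then show "norm (F' y - F' a) \<le> \<epsilon>" using e B by simp
    show "((\<lambda>y. F y - F' a * y) has_real_derivative F' y - F' a) (at y within closed_segment a z)"
      using F[of y, THEN DERIV_subset[where t = "closed_segment a z"]]
      by (auto intro!: derivative_eq_intros)
  qed auto
  then show ?thesis by (simp add: algebra_simps)
qed

text \<open>Discrete integration by parts: it moves a difference from the test function to
  \<open>U\<close>.\<close>

lemma integral_translate_product:
  fixes U k :: "'a::euclidean_space \<Rightarrow> real"
  assumes "continuous_on UNIV U" "continuous_on UNIV k" "compact K" "\<And>x. x \<notin> K \<Longrightarrow> k x = 0"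
  shows "(\<integral>x. U x * (k (x - c) - k x) \<partial>lebesgue) = (\<integral>x. (U (x + c) - U x) * k x \<partial>lebesgue)"
proof -
  have 1: "integrable lebesgue (\<lambda>x. U x * k (x - c))"
  proof (rule compact_support_integrable)
    show "compact ((\<lambda>x. x + c) ` K)" using assms(3) by (intro compact_continuous_image continuous_intros)
    show "U x * k (x - c) = 0" if "x \<notin> (\<lambda>x. x + c) ` K" for x
      using that assms(4)[of "x - c"] by (auto simp: image_iff) (metis diff_add_cancel)
  qed (auto intro!: continuous_intros continuous_on_compose2[OF assms(2)] assms(1))
  have 2: "integrable lebesgue (\<lambda>x. U x * k x)" "integrable lebesgue (\<lambda>x. U (x + c) * k x)"
    by (rule compact_support_integrable[OF _ assms(3)];
        auto intro!: continuous_intros continuous_on_compose2[OF assms(1)] assms simp: assms(4))+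
  have "(\<integral>x. U x * k (x - c) \<partial>lebesgue) = (\<integral>x. U (x + c) * k (x + c - c) \<partial>lebesgue)"
    by (rule integral_translate[symmetric])
      (intro borel_measurable_continuous_onI continuous_intros continuous_on_compose2[OF assms(2)] assms(1), auto)
  then show ?thesis
    using 1 2 by (simp add: left_diff_distrib right_diff_distrib)
qed

lemma locally_integrable_continuous:
  fixes f :: "'a::euclidean_space \<Rightarrow> 'b::euclidean_space"
  assumes "continuous_on V f" shows "locally_integrable V f"
  unfolding locally_integrable_def set_integrable_def
proof (intro allI impI)
  fix K assume K: "compact K" "K \<subseteq> V"
  have "integrable lborel (\<lambda>x. indicator K x *\<^sub>R f x)"
    using K assms continuous_on_subset by (intro borel_integrable_compact) auto
  then show "integrable lebesgue (\<lambda>x. indicator K x *\<^sub>R f x)"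
    by (subst integrable_completion) (auto dest: borel_measurable_integrable)
qed

lemma locally_integrable_add:
  "locally_integrable V f \<Longrightarrow> locally_integrable V g \<Longrightarrow> locally_integrable V (\<lambda>x. f x + g x)"
  unfolding locally_integrable_def by (auto intro: set_integral_add)

lemma locally_integrable_scaleR:
  fixes f :: "'a::euclidean_space \<Rightarrow> 'b::euclidean_space"
  assumes "continuous_on V m" "locally_integrable V f" shows "locally_integrable V (\<lambda>x. m x *\<^sub>R f x)"
  unfolding locally_integrable_def set_integrable_def
proof (intro allI impI)
  fix K assume K: "compact K" "K \<subseteq> V"
  have cK: "continuous_on K m" using assms(1) K continuous_on_subset by blast
  have "bounded (m ` K)"
    using K by (intro compact_imp_bounded compact_continuous_image cK) auto
  then obtain B where B: "\<And>x. x \<in> K \<Longrightarrow> \<bar>m x\<bar> \<le> B" unfolding bounded_iff by auto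
  have fi: "integrable lebesgue (\<lambda>x. indicator K x *\<^sub>R f x)"
    using assms(2) K by (auto simp: locally_integrable_def set_integrable_def)
  have "(\<lambda>x. indicator K x *\<^sub>R m x) \<in> borel_measurable borel"
    using K cK by (intro borel_measurable_continuous_on_indicator) (auto intro: borel_compact)
  then have mm: "(\<lambda>x. indicator K x *\<^sub>R m x) \<in> borel_measurable lebesgue"
    by (intro measurable_completion) simp
  have "integrable lebesgue (\<lambda>x. (indicator K x *\<^sub>R m x) *\<^sub>R (indicator K x *\<^sub>R f x))"
  proof (rule Bochner_Integration.integrable_bound)
    show "integrable lebesgue (\<lambda>x. B *\<^sub>R (indicator K x *\<^sub>R f x))"
      using fi by (intro integrable_scaleR_right)
    show "AE x in lebesgue. norm ((indicator K x *\<^sub>R m x) *\<^sub>R (indicator K x *\<^sub>R f x))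
        \<le> norm (B *\<^sub>R (indicator K x *\<^sub>R f x))"
      using B by (intro AE_I2) (auto simp: indicator_def intro!: mult_right_mono intro: order_trans[OF _ abs_ge_self])
  qed (use mm fi in measurable)
  moreover have "(\<lambda>x. (indicator K x *\<^sub>R m x) *\<^sub>R (indicator K x *\<^sub>R f x)) = (\<lambda>x. indicator K x *\<^sub>R m x *\<^sub>R f x)"
    by (auto simp: indicator_def)
  ultimately show "integrable lebesgue (\<lambda>x. indicator K x *\<^sub>R m x *\<^sub>R f x)" by simp
qed

text \<open>F(u(x + t e)) - F(u x) equals F'(u x) (u(x + t e) - u x) up to a small multiple of the
  increment of \<open>u\<close>. After division by t the main term converges by
  \<open>difference_quotient\<close>; for the error the increment must be O(t) in L^1 against
  \<phi>, which is the bound \<open>L1\<close> below.\<close>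

lemma wgrad_compose:
  fixes u :: "'a::euclidean_space \<Rightarrow> real" and F F' :: "real \<Rightarrow> real"
  assumes wg: "wgrad V u g"
    and F: "\<And>y. (F has_real_derivative F' y) (at y)" and F'c: "continuous_on UNIV F'"
  shows "wgrad V (\<lambda>x. F (u x)) (\<lambda>x. F' (u x) *\<^sub>R g x)"
proof -
  have V: "open V" and cu: "continuous_on V u" and li: "locally_integrable V g"
    using wg unfolding wgrad_def by auto
  have Fc: "continuous_on UNIV F"
    using F by (intro continuous_at_imp_continuous_on ballI) (rule DERIV_isCont)
  have "(\<integral>x. F (u x) * partial_deriv e \<phi> x \<partial>lebesgue) = - (\<integral>x. (F' (u x) *\<^sub>R g x \<bullet> e) * \<phi> x \<partial>lebesgue)"
    if phi: "\<phi> \<in> test_functions V" and e: "e \<in> Basis" for \<phi> e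
  proof -
    define K where "K = closure {x. \<phi> x \<noteq> 0}"
    have K: "compact K" "K \<subseteq> V" and out: "\<And>x. x \<notin> K \<Longrightarrow> \<phi> x = 0"
      using test_functionsD(2,3)[OF phi] closure_subset[of "{x. \<phi> x \<noteq> 0}"] by (auto simp: K_def)
    have pc: "continuous_on UNIV \<phi>" by (rule test_functions_continuous[OF phi])
    have ppc: "continuous_on UNIV (partial_deriv e \<phi>)"
      by (rule test_functions_continuous[OF test_functions_partial_deriv[OF phi e]])
    have pout: "\<And>x. x \<notin> K \<Longrightarrow> partial_deriv e \<phi> x = 0"
      using partial_deriv_outside_support[of _ \<phi> e] by (simp add: K_def)
    obtain \<delta> C U L N where U: "\<delta> > 0" "C \<ge> 0" "continuous_on UNIV U" "compact L" "L \<subseteq> V"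
      "\<And>x. x \<notin> L \<Longrightarrow> U x = 0" "open N" "K \<subseteq> N" "\<And>x. x \<in> N \<Longrightarrow> U x = u x"
      and bnd: "\<And>k M t. continuous_on UNIV k \<Longrightarrow> (\<And>x. x \<notin> K \<Longrightarrow> k x = 0) \<Longrightarrow> (\<And>x. \<bar>k x\<bar> \<le> M) \<Longrightarrow> \<bar>t\<bar> < \<delta> \<Longrightarrow>
         \<bar>\<integral>x. U x * (k (x - t *\<^sub>R e) - k x) \<partial>lebesgue\<bar> \<le> \<bar>t\<bar> * M * C"
      and lim: "\<And>k. continuous_on UNIV k \<Longrightarrow> (\<And>x. x \<notin> K \<Longrightarrow> k x = 0) \<Longrightarrow>
         (\<lambda>t. (\<integral>x. U x * (k (x - t *\<^sub>R e) - k x) \<partial>lebesgue) / t) \<midarrow>0\<rightarrow> (\<integral>x. (g x \<bullet> e) * k x \<partial>lebesgue)"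
      apply (rule difference_quotient[OF wg K e])
      subgoal premises p for \<delta> C U L N by (rule that[of \<delta> C U L N]) (fact p)+
      done
    obtain B where B: "\<And>x. \<bar>U x\<bar> \<le> B" using compact_support_bounded[OF U(3,4,6)] by metis
    obtain M where M: "M > 0" "\<And>x. \<bar>\<phi> x\<bar> \<le> M" using compact_support_bounded[OF pc K(1) out] by metis
    have Bm: "U x \<in> {-B..B}" for x using B[of x] by auto
    define v where "v t x = U (x + t *\<^sub>R e) - U x" for t x
    have vc: "continuous_on UNIV (v t)" for t
      unfolding v_def by (intro continuous_intros continuous_on_compose2[OF U(3)] U(3)) auto
    \<comment> \<open>Subtracting \<open>F 0\<close> restores compact support, as \<open>U\<close>
      vanishes off \<open>L\<close>; the constant disappears at the end because derivatives of test
      functions have integral zero.\<close>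
    have FUc: "continuous_on UNIV (\<lambda>x. F (U x) - F 0)"
      by (intro continuous_intros continuous_on_compose2[OF Fc] U(3)) auto
    have F'Uc: "continuous_on UNIV (\<lambda>x. F' (U x) * \<phi> x)"
      by (intro continuous_intros continuous_on_compose2[OF F'c] U(3) pc) auto
    have FUi: "integrable lebesgue (\<lambda>x. F (U x) - F 0)"
      by (rule compact_support_integrable[OF FUc U(4)]) (simp add: U(6))
    have pint: "integrable lebesgue (\<lambda>x. \<bar>\<phi> x\<bar>)"
      by (rule compact_support_integrable[OF _ K(1)]) (auto intro!: continuous_intros pc simp: out)
    have vint: "integrable lebesgue (\<lambda>x. \<bar>\<phi> x\<bar> * \<bar>v t x\<bar>)" for t
      by (rule compact_support_integrable[OF _ K(1)]) (auto intro!: continuous_intros pc vc simp: out)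
    have L1: "(\<integral>x. \<bar>\<phi> x\<bar> * \<bar>v t x\<bar> \<partial>lebesgue) \<le> \<bar>t\<bar> * M * C" if t: "\<bar>t\<bar> < \<delta>" for t
    proof (rule field_le_epsilon)
      fix \<epsilon> :: real assume "\<epsilon> > 0"
      define P where "P = (\<integral>x. \<bar>\<phi> x\<bar> \<partial>lebesgue)"
      have P: "P \<ge> 0" by (simp add: P_def)
      define \<eta> where "\<eta> = \<epsilon> / (P + 1)"
      have \<eta>: "\<eta> > 0" "\<eta> * P \<le> \<epsilon>" using \<open>\<epsilon> > 0\<close> P by (auto simp: \<eta>_def field_simps add_nonneg_pos)
      have pos: "\<bar>v t x\<bar> + \<eta> > 0" for x using \<eta> by (simp add: add_nonneg_pos)
      \<comment> \<open>A continuous substitute for |\<phi>| sgn v: tested against it, the increment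
        v integrates to nearly \<integral> |\<phi>| |v|, while its supremum is at most
        \<open>M\<close> however v oscillates.\<close>
      define k where "k x = \<bar>\<phi> x\<bar> * (v t x / (\<bar>v t x\<bar> + \<eta>))" for x
      have kc: "continuous_on UNIV k"
        unfolding k_def using pos by (intro continuous_intros pc vc) (auto simp: less_imp_neq[symmetric])
      have ko: "k x = 0" if "x \<notin> K" for x using out[OF that] by (simp add: k_def)
      have kb: "\<bar>k x\<bar> \<le> M" for x
      proof -
        have "\<bar>v t x / (\<bar>v t x\<bar> + \<eta>)\<bar> \<le> 1" using pos[of x] \<eta> by (simp add: abs_divide)
        then have "\<bar>\<phi> x\<bar> * \<bar>v t x / (\<bar>v t x\<bar> + \<eta>)\<bar> \<le> M * 1" using M by (intro mult_mono) auto
        then show ?thesis by (simp add: k_def abs_mult)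
      qed
      have kint: "integrable lebesgue (\<lambda>x. v t x * k x)"
        by (rule compact_support_integrable[OF _ K(1)]) (auto intro!: continuous_intros kc vc simp: ko)
      have 1: "(\<integral>x. v t x * k x \<partial>lebesgue) \<le> \<bar>t\<bar> * M * C"
        using bnd[OF kc ko kb t] integral_translate_product[OF U(3) kc K(1) ko, of "t *\<^sub>R e"]
        by (simp add: v_def)
      have "(\<integral>x. \<bar>\<phi> x\<bar> * \<bar>v t x\<bar> \<partial>lebesgue) \<le> (\<integral>x. v t x * k x + \<eta> * \<bar>\<phi> x\<bar> \<partial>lebesgue)"
      proof (rule integral_mono)
        fix x
        have "\<bar>v t x\<bar> = (\<bar>v t x\<bar> * \<bar>v t x\<bar> + \<eta> * \<bar>v t x\<bar>) / (\<bar>v t x\<bar> + \<eta>)"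
          using pos[of x] by (simp add: field_simps)
        also have "\<dots> \<le> (\<bar>v t x\<bar> * \<bar>v t x\<bar> + \<eta> * (\<bar>v t x\<bar> + \<eta>)) / (\<bar>v t x\<bar> + \<eta>)"
          using pos[of x] \<eta> by (intro divide_right_mono add_left_mono mult_left_mono) auto
        also have "\<dots> = v t x * (v t x / (\<bar>v t x\<bar> + \<eta>)) + \<eta>"
          using pos[of x] by (simp add: add_divide_distrib)
        finally have "\<bar>\<phi> x\<bar> * \<bar>v t x\<bar> \<le> \<bar>\<phi> x\<bar> * (v t x * (v t x / (\<bar>v t x\<bar> + \<eta>)) + \<eta>)"
          by (rule mult_left_mono) simp
        then show "\<bar>\<phi> x\<bar> * \<bar>v t x\<bar> \<le> v t x * k x + \<eta> * \<bar>\<phi> x\<bar>"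
          by (simp add: k_def algebra_simps)
      qed (use vint kint pint in auto)
      also have "\<dots> = (\<integral>x. v t x * k x \<partial>lebesgue) + \<eta> * P"
        using kint pint by (simp add: P_def)
      finally show "(\<integral>x. \<bar>\<phi> x\<bar> * \<bar>v t x\<bar> \<partial>lebesgue) \<le> \<bar>t\<bar> * M * C + \<epsilon>" using 1 \<eta>(2) by linarith
    qed
    let ?A = "\<lambda>t. \<integral>x. (F (U x) - F 0) * \<phi> (x - t *\<^sub>R e) \<partial>lebesgue"
    let ?J = "\<lambda>t. \<integral>x. U x * (F' (U (x - t *\<^sub>R e)) * \<phi> (x - t *\<^sub>R e) - F' (U x) * \<phi> x) \<partial>lebesgue"
    have Adiff: "?A t - ?A 0 = (\<integral>x. (F (U (x + t *\<^sub>R e)) - F (U x)) * \<phi> x \<partial>lebesgue)" for t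
    proof -
      have i: "integrable lebesgue (\<lambda>x. (F (U x) - F 0) * \<phi> (x - t *\<^sub>R e))" for t
        using M by (intro integrable_mult_bounded[OF FUi] continuous_imp_lebesgue_measurable
            continuous_on_compose2[OF pc] continuous_intros) auto
      have "?A t - ?A 0 = (\<integral>x. (F (U x) - F 0) * (\<phi> (x - t *\<^sub>R e) - \<phi> x) \<partial>lebesgue)"
        using i[of t] i[of 0] by (simp add: right_diff_distrib)
      also have "\<dots> = (\<integral>x. ((F (U (x + t *\<^sub>R e)) - F 0) - (F (U x) - F 0)) * \<phi> x \<partial>lebesgue)"
        by (rule integral_translate_product[OF FUc pc K(1) out])
      finally show ?thesis by simp
    qed
    have J: "?J t = (\<integral>x. v t x * (F' (U x) * \<phi> x) \<partial>lebesgue)" for t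
      using integral_translate_product[OF U(3) F'Uc K(1), of "t *\<^sub>R e"] out by (simp add: v_def)
    \<comment> \<open>\<open>F'\<close> is uniformly continuous on an interval containing the range
      of \<open>U\<close>, and \<open>U\<close> is uniformly continuous near \<open>K\<close>; so
      for small t the remainder in the expansion of \<open>F\<close> is at most \<epsilon> times the
      increment.\<close>
    have err: "\<forall>\<^sub>F t in at 0. \<bar>(?A t - ?A 0) / t - ?J t / t\<bar> \<le> \<epsilon> * (M * C)" if "\<epsilon> > 0" for \<epsilon>
    proof -
      have "uniformly_continuous_on {-B..B} F'"
        using F'c continuous_on_subset by (intro compact_uniformly_continuous) auto
      then obtain \<eta> where \<eta>: "\<eta> > 0" "\<And>y z. y \<in> {-B..B} \<Longrightarrow> z \<in> {-B..B} \<Longrightarrow> dist z y < \<eta> \<Longrightarrow> dist (F' z) (F' y) < \<epsilon>"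
        using \<open>\<epsilon> > 0\<close> by (rule uniformly_continuous_onE) (rule that; assumption)
      have "compact {x + y |x y. x \<in> K \<and> y \<in> cball 0 1}"
        using K(1) by (intro compact_sums) auto
      then have "uniformly_continuous_on {x + y |x y. x \<in> K \<and> y \<in> cball 0 1} U"
        using U(3) continuous_on_subset by (intro compact_uniformly_continuous) auto
      then obtain \<rho> where \<rho>: "\<rho> > 0" "\<And>y z. y \<in> {x + y |x y. x \<in> K \<and> y \<in> cball 0 1} \<Longrightarrow>
          z \<in> {x + y |x y. x \<in> K \<and> y \<in> cball 0 1} \<Longrightarrow> dist z y < \<rho> \<Longrightarrow> dist (U z) (U y) < \<eta>"
        using \<eta>(1) by (rule uniformly_continuous_onE) (rule that; assumption)
      have "\<forall>\<^sub>F t in at (0::real). \<bar>t\<bar> < min \<delta> (min \<rho> 1) \<and> t \<noteq> 0"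
        using U(1) \<rho>(1) by (auto simp: eventually_at intro!: exI[of _ "min \<delta> (min \<rho> 1)"])
      then show ?thesis
      proof eventually_elim
        case (elim t)
        then have t: "\<bar>t\<bar> < \<delta>" "\<bar>t\<bar> < \<rho>" "\<bar>t\<bar> < 1" "t \<noteq> 0" by auto
        have small: "\<bar>v t x\<bar> < \<eta>" if "x \<in> K" for x
        proof -
          have a: "x + 0 \<in> {x + y |x y. x \<in> K \<and> y \<in> cball 0 1}" using that by fastforce
          have b: "x + t *\<^sub>R e \<in> {x + y |x y. x \<in> K \<and> y \<in> cball 0 1}" using that t(3) e by fastforce
          have c: "dist (x + t *\<^sub>R e) (x + 0) < \<rho>" using t e by (simp add: dist_norm)
          from \<rho>(2)[OF a b c] show ?thesis by (simp add: v_def dist_real_def)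
        qed
        have R: "\<bar>(F (U (x + t *\<^sub>R e)) - F (U x)) * \<phi> x - v t x * (F' (U x) * \<phi> x)\<bar> \<le> \<epsilon> * (\<bar>\<phi> x\<bar> * \<bar>v t x\<bar>)" for x
        proof (cases "x \<in> K")
          case True
          have "\<bar>F (U (x + t *\<^sub>R e)) - F (U x) - F' (U x) * (U (x + t *\<^sub>R e) - U x)\<bar> \<le> \<epsilon> * \<bar>U (x + t *\<^sub>R e) - U x\<bar>"
          proof (rule difference_quotient_remainder[OF F _ Bm Bm])
            fix y assume "y \<in> {-B..B}" "\<bar>y - U x\<bar> \<le> \<bar>U (x + t *\<^sub>R e) - U x\<bar>"
            then show "\<bar>F' y - F' (U x)\<bar> \<le> \<epsilon>"
              using \<eta>(2)[of "U x" y] Bm[of x] small[OF True] by (simp add: v_def dist_real_def)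
          qed
          then have "\<bar>F (U (x + t *\<^sub>R e)) - F (U x) - F' (U x) * v t x\<bar> * \<bar>\<phi> x\<bar> \<le> (\<epsilon> * \<bar>v t x\<bar>) * \<bar>\<phi> x\<bar>"
            unfolding v_def by (rule mult_right_mono) simp
          then show ?thesis
            by (simp add: abs_mult[symmetric] algebra_simps)
        qed (simp add: out)
        have i1: "integrable lebesgue (\<lambda>x. (F (U (x + t *\<^sub>R e)) - F (U x)) * \<phi> x)"
          by (rule compact_support_integrable[OF _ K(1)])
            (auto intro!: continuous_intros continuous_on_compose2[OF Fc] continuous_on_compose2[OF U(3)] U(3) pc simp: out)
        have i2: "integrable lebesgue (\<lambda>x. v t x * (F' (U x) * \<phi> x))"
          by (rule compact_support_integrable[OF _ K(1)]) (auto intro!: continuous_intros vc F'Uc simp: out)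
        have "\<bar>(?A t - ?A 0) - ?J t\<bar> = \<bar>\<integral>x. (F (U (x + t *\<^sub>R e)) - F (U x)) * \<phi> x - v t x * (F' (U x) * \<phi> x) \<partial>lebesgue\<bar>"
          unfolding Adiff J using i1 i2 by (simp only: Bochner_Integration.integral_diff)
        also have "\<dots> \<le> (\<integral>x. \<bar>(F (U (x + t *\<^sub>R e)) - F (U x)) * \<phi> x - v t x * (F' (U x) * \<phi> x)\<bar> \<partial>lebesgue)"
          by (rule integral_abs_bound)
        also have "\<dots> \<le> (\<integral>x. \<epsilon> * (\<bar>\<phi> x\<bar> * \<bar>v t x\<bar>) \<partial>lebesgue)"
        proof (rule integral_mono)
          show "integrable lebesgue (\<lambda>x. \<bar>(F (U (x + t *\<^sub>R e)) - F (U x)) * \<phi> x - v t x * (F' (U x) * \<phi> x)\<bar>)"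
            by (intro integrable_abs Bochner_Integration.integrable_diff i1 i2)
          show "integrable lebesgue (\<lambda>x. \<epsilon> * (\<bar>\<phi> x\<bar> * \<bar>v t x\<bar>))" by (intro integrable_mult_right vint)
        qed (rule R)
        also have "\<dots> \<le> \<epsilon> * (\<bar>t\<bar> * M * C)"
          using L1[OF t(1)] \<open>\<epsilon> > 0\<close> by simp
        finally have "\<bar>(?A t - ?A 0) - ?J t\<bar> / \<bar>t\<bar> \<le> \<epsilon> * (M * C)"
          using t(4) by (simp add: pos_divide_le_eq mult_ac)
        then show ?case by (simp only: abs_divide diff_divide_distrib[symmetric])
      qed
    qed
    have "(\<lambda>t. (?A t - ?A 0) / t - ?J t / t) \<midarrow>0\<rightarrow> 0"
    proof (rule tendstoI)
      fix \<epsilon> :: real assume "\<epsilon> > 0"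
      have "\<epsilon> / (2 * (M * C + 1)) > 0" using \<open>\<epsilon> > 0\<close> M U(2) by (simp add: add_nonneg_pos)
      from err[OF this] show "\<forall>\<^sub>F t in at 0. dist ((?A t - ?A 0) / t - ?J t / t) 0 < \<epsilon>"
      proof eventually_elim
        case (elim t)
        have "\<epsilon> / (2 * (M * C + 1)) * (M * C) < \<epsilon>"
          using \<open>\<epsilon> > 0\<close> M U(2) by (simp add: field_simps add_nonneg_pos add_pos_nonneg)
        then show ?case using elim by (simp add: dist_real_def)
      qed
    qed
    moreover have "(\<lambda>t. ?J t / t) \<midarrow>0\<rightarrow> (\<integral>x. (g x \<bullet> e) * (F' (U x) * \<phi> x) \<partial>lebesgue)"
      using lim[OF F'Uc] out by simp
    ultimately have "(\<lambda>t. (?A t - ?A 0) / t) \<midarrow>0\<rightarrow> (\<integral>x. (g x \<bullet> e) * (F' (U x) * \<phi> x) \<partial>lebesgue)"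
      by (rule Lim_transform[rotated])
    moreover have "(\<lambda>t. (?A t - ?A 0) / t) \<midarrow>0\<rightarrow> - (\<integral>x. (F (U x) - F 0) * partial_deriv e \<phi> x \<partial>lebesgue)"
      using DERIV_integral_translate[OF FUi test_functionsD(1)[OF phi] K(1) out e, of 0] by (simp add: DERIV_def)
    ultimately have eq: "- (\<integral>x. (F (U x) - F 0) * partial_deriv e \<phi> x \<partial>lebesgue) = (\<integral>x. (g x \<bullet> e) * (F' (U x) * \<phi> x) \<partial>lebesgue)"
      using LIM_unique by blast
    have i1: "integrable lebesgue (\<lambda>x. F (U x) * partial_deriv e \<phi> x)"
      by (rule compact_support_integrable[OF _ K(1)])
        (auto intro!: continuous_intros continuous_on_compose2[OF Fc] U(3) ppc simp: pout)
    have i2: "integrable lebesgue (partial_deriv e \<phi>)"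
      by (rule compact_support_integrable[OF ppc K(1) pout])
    have "(\<integral>x. (F (U x) - F 0) * partial_deriv e \<phi> x \<partial>lebesgue)
        = (\<integral>x. F (U x) * partial_deriv e \<phi> x \<partial>lebesgue) - F 0 * (\<integral>x. partial_deriv e \<phi> x \<partial>lebesgue)"
      using i1 i2 by (simp add: left_diff_distrib)
    also have "\<dots> = (\<integral>x. F (U x) * partial_deriv e \<phi> x \<partial>lebesgue)"
      using integral_partial_deriv_eq_0[OF test_functions_mono[OF phi] e] by simp
    also have "\<dots> = (\<integral>x. F (u x) * partial_deriv e \<phi> x \<partial>lebesgue)"
    proof (rule Bochner_Integration.integral_cong)
      show "F (U x) * partial_deriv e \<phi> x = F (u x) * partial_deriv e \<phi> x" for x
        using U(8,9) pout[of x] by (cases "x \<in> K") auto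
    qed simp
    finally have "(\<integral>x. F (u x) * partial_deriv e \<phi> x \<partial>lebesgue) = - (\<integral>x. (g x \<bullet> e) * (F' (U x) * \<phi> x) \<partial>lebesgue)"
      using eq by simp
    also have "(\<integral>x. (g x \<bullet> e) * (F' (U x) * \<phi> x) \<partial>lebesgue) = (\<integral>x. (F' (u x) *\<^sub>R g x \<bullet> e) * \<phi> x \<partial>lebesgue)"
    proof (rule Bochner_Integration.integral_cong)
      show "(g x \<bullet> e) * (F' (U x) * \<phi> x) = (F' (u x) *\<^sub>R g x \<bullet> e) * \<phi> x" for x
        using U(8,9) out[of x] by (cases "x \<in> K") auto
    qed simp
    finally show ?thesis .
  qed
  moreover have "continuous_on V (\<lambda>x. F (u x))"
    by (rule continuous_on_compose2[OF Fc cu]) simp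
  moreover have "locally_integrable V (\<lambda>x. F' (u x) *\<^sub>R g x)"
    by (intro locally_integrable_scaleR li continuous_on_compose2[OF F'c cu]) simp
  ultimately show ?thesis using V unfolding wgrad_def by blast
qed

section \<open>Gradients of smooth functions and the product rule\<close>

definition grad :: "('a::euclidean_space \<Rightarrow> real) \<Rightarrow> 'a \<Rightarrow> 'a" where
  "grad f x = (\<Sum>i\<in>Basis. partial_deriv i f x *\<^sub>R i)"

lemma grad_inner: "i \<in> Basis \<Longrightarrow> grad f x \<bullet> i = partial_deriv i f x"
  by (simp add: grad_def)

lemma continuous_on_grad: "smooth_on S f \<Longrightarrow> continuous_on S (grad f)"
  unfolding grad_def by (intro continuous_intros smooth_on_continuous smooth_on_partial_deriv)

lemma continuous_times_test:
  assumes "open V" "continuous_on V f" "\<phi> \<in> test_functions V"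
  shows "continuous_on UNIV (\<lambda>x. f x * \<phi> x)"
  using closure_subset[of "{x. \<phi> x \<noteq> 0}"] test_functionsD[OF assms(3)]
  by (intro continuous_on_extend_zero[OF assms(1) closed_closure test_functionsD(3)[OF assms(3)]]
      continuous_intros assms test_functions_continuous[OF assms(3)]) auto

lemma integrable_continuous_times_test:
  assumes "open V" "continuous_on V f" "\<phi> \<in> test_functions V"
  shows "integrable lebesgue (\<lambda>x. f x * \<phi> x)"
  using closure_subset[of "{x. \<phi> x \<noteq> 0}"]
  by (intro compact_support_integrable[OF continuous_times_test[OF assms] test_functionsD(2)[OF assms(3)]]) auto

lemma integrable_locally_integrable_times_test:
  assumes "locally_integrable V g" "\<phi> \<in> test_functions V"
  shows "integrable lebesgue (\<lambda>x. (g x \<bullet> i) * \<phi> x)"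
  using closure_subset[of "{x. \<phi> x \<noteq> 0}"]
  by (intro locally_integrable_mult[OF assms(1) test_functionsD(2,3)[OF assms(2)] test_functions_continuous[OF assms(2)]]) auto

text \<open>Holds at every point although \<open>m\<close> is smooth only on \<open>V\<close>: off
  the support of \<phi> both sides are zero.\<close>

lemma partial_deriv_mult_test:
  assumes "open V" "smooth_on V m" "\<phi> \<in> test_functions V"
  shows "partial_deriv i (\<lambda>x. m x * \<phi> x) x = m x * partial_deriv i \<phi> x + partial_deriv i m x * \<phi> x"
proof (cases "x \<in> closure {x. \<phi> x \<noteq> 0}")
  case True
  then have "x \<in> V" using test_functionsD(3)[OF assms(3)] by blast
  then show ?thesis
    by (intro partial_deriv_mult smooth_on_differentiable[OF assms(1,2)]
        smooth_differentiable[OF test_functionsD(1)[OF assms(3)]])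
next
  case False
  define S where "S = closure {x. \<phi> x \<noteq> 0}"
  have z: "\<phi> y = 0" if "y \<notin> S" for y
    using that closure_subset[of "{x. \<phi> x \<noteq> 0}"] by (auto simp: S_def)
  have x: "x \<notin> S" "open (- S)" using False by (auto simp: S_def)
  have "partial_deriv i (\<lambda>x. m x * \<phi> x) x = 0"
    by (rule partial_deriv_zero_open[of "- S"]) (use x z in auto)
  then show ?thesis
    using partial_deriv_outside_support[OF False, of i] z[OF x(1)] by simp
qed

text \<open>The weak gradient of \<open>u\<close> is tested with \<open>m * \<phi>\<close>.\<close>

lemma wgrad_mult_smooth:
  fixes u :: "'a::euclidean_space \<Rightarrow> real"
  assumes wg: "wgrad V u g" and m: "smooth_on V m"
  shows "wgrad V (\<lambda>x. m x * u x) (\<lambda>x. m x *\<^sub>R g x + u x *\<^sub>R grad m x)"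
proof -
  have V: "open V" and cu: "continuous_on V u" and li: "locally_integrable V g"
    and id: "\<And>\<phi> i. \<phi> \<in> test_functions V \<Longrightarrow> i \<in> Basis \<Longrightarrow>
        (\<integral>x. u x * partial_deriv i \<phi> x \<partial>lebesgue) = - (\<integral>x. (g x \<bullet> i) * \<phi> x \<partial>lebesgue)"
    using wg unfolding wgrad_def by auto
  have cm: "continuous_on V m" by (rule smooth_on_continuous[OF m])
  have "(\<integral>x. (m x * u x) * partial_deriv i \<phi> x \<partial>lebesgue)
      = - (\<integral>x. ((m x *\<^sub>R g x + u x *\<^sub>R grad m x) \<bullet> i) * \<phi> x \<partial>lebesgue)"
    if phi: "\<phi> \<in> test_functions V" and i: "i \<in> Basis" for \<phi> i
  proof -
    have t: "(\<lambda>x. m x * \<phi> x) \<in> test_functions V" by (rule test_functions_mult[OF V phi m])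
    have 1: "integrable lebesgue (\<lambda>x. u x * partial_deriv i (\<lambda>x. m x * \<phi> x) x)"
      by (rule integrable_continuous_times_test[OF V cu test_functions_partial_deriv[OF t i]])
    have 2: "integrable lebesgue (\<lambda>x. (u x * partial_deriv i m x) * \<phi> x)"
      by (intro integrable_continuous_times_test[OF V _ phi] continuous_intros cu
          smooth_on_continuous smooth_on_partial_deriv m i)
    have 3: "integrable lebesgue (\<lambda>x. (g x \<bullet> i) * (m x * \<phi> x))"
      by (rule integrable_locally_integrable_times_test[OF li t])
    have "(\<integral>x. (m x * u x) * partial_deriv i \<phi> x \<partial>lebesgue)
        = (\<integral>x. u x * partial_deriv i (\<lambda>x. m x * \<phi> x) x - (u x * partial_deriv i m x) * \<phi> x \<partial>lebesgue)"
      by (simp only: partial_deriv_mult_test[OF V m phi]) (simp add: algebra_simps)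
    also have "\<dots> = - (\<integral>x. (g x \<bullet> i) * (m x * \<phi> x) \<partial>lebesgue) - (\<integral>x. (u x * partial_deriv i m x) * \<phi> x \<partial>lebesgue)"
      using 1 2 id[OF t i] by simp
    also have "\<dots> = - (\<integral>x. (g x \<bullet> i) * (m x * \<phi> x) + (u x * partial_deriv i m x) * \<phi> x \<partial>lebesgue)"
      using 2 3 by simp
    also have "\<dots> = - (\<integral>x. ((m x *\<^sub>R g x + u x *\<^sub>R grad m x) \<bullet> i) * \<phi> x \<partial>lebesgue)"
      using i by (simp add: inner_add_left grad_inner algebra_simps)
    finally show ?thesis .
  qed
  moreover have "locally_integrable V (\<lambda>x. m x *\<^sub>R g x + u x *\<^sub>R grad m x)"
    by (intro locally_integrable_add locally_integrable_scaleR cm cu li locally_integrable_continuous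
        continuous_on_grad m)
  ultimately show ?thesis
    using V cu cm unfolding wgrad_def by (auto intro: continuous_intros)
qed

text \<open>The indicator of a compact set is the pointwise limit of cutoffs supported in shrinking
  neighbourhoods of it, all of them inside one compact subset of \<open>V\<close>, so dominated
  convergence applies.\<close>

lemma integral_compact_eq_0:
  fixes h :: "'a::euclidean_space \<Rightarrow> real"
  assumes V: "open V" and li: "locally_integrable V h"
    and z: "\<And>\<phi>. \<phi> \<in> test_functions V \<Longrightarrow> (\<integral>x. h x * \<phi> x \<partial>lebesgue) = 0"
    and C: "compact C" "C \<subseteq> V"
  shows "(\<integral>x. h x * indicator C x \<partial>lebesgue) = 0"
proof -
  obtain W where W: "open W" "C \<subseteq> W" "compact (closure W)" "closure W \<subseteq> V"
    using compact_neighborhood[OF C V] .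
  define Vn where "Vn n = W \<inter> (\<Union>x\<in>C. ball x (1 / real (Suc n)))" for n
  have "\<exists>\<phi>. \<phi> \<in> test_functions (Vn n) \<and> (\<forall>x. 0 \<le> \<phi> x \<and> \<phi> x \<le> 1) \<and> (\<forall>x\<in>C. \<phi> x = 1)" for n
  proof -
    have o: "open (Vn n)" using W(1) by (auto simp: Vn_def)
    have s: "C \<subseteq> Vn n" using W(2) by (force simp: Vn_def)
    obtain \<phi> N where "\<phi> \<in> test_functions (Vn n)" "\<And>x. 0 \<le> \<phi> x" "\<And>x. \<phi> x \<le> 1"
      "C \<subseteq> N" "\<And>x. x \<in> N \<Longrightarrow> \<phi> x = (1::real)"
      using cutoff_exists[OF o C(1) s] by metis
    then show ?thesis by blast
  qed
  then obtain \<phi> where phi: "\<And>n. \<phi> n \<in> test_functions (Vn n)" "\<And>n x. 0 \<le> \<phi> n x" "\<And>n x. \<phi> n x \<le> 1" "\<And>n x. x \<in> C \<Longrightarrow> \<phi> n x = 1"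
    by metis
  have WV: "W \<subseteq> closure W" by (rule closure_subset)
  have phiV: "\<phi> n \<in> test_functions V" for n
    using W(4) WV by (intro test_functions_mono[OF phi(1)]) (auto simp: Vn_def)
  have out: "\<phi> n x = 0" if "x \<notin> closure W" for n x
    using test_functions_outside[OF phi(1), of x n] that WV by (auto simp: Vn_def)
  have hW: "integrable lebesgue (\<lambda>x. indicator (closure W) x *\<^sub>R h x)"
    using li W by (auto simp: locally_integrable_def set_integrable_def)
  have "(\<lambda>n. \<integral>x. h x * \<phi> n x \<partial>lebesgue) \<longlonglongrightarrow> (\<integral>x. h x * indicator C x \<partial>lebesgue)"
  proof (rule integral_dominated_convergence[where w="\<lambda>x. \<bar>indicator (closure W) x *\<^sub>R h x\<bar>"])
    have "(\<lambda>x. (indicator (closure W) x *\<^sub>R h x) * indicator C x) \<in> borel_measurable lebesgue"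
      using hW C by (intro borel_measurable_times borel_measurable_indicator) (auto simp: borel_compact)
    moreover have "(\<lambda>x. (indicator (closure W) x *\<^sub>R h x) * indicator C x) = (\<lambda>x. h x * indicator C x)"
      using W WV by (fastforce simp: indicator_def)
    ultimately show "(\<lambda>x. h x * indicator C x) \<in> borel_measurable lebesgue" by simp
    show "(\<lambda>x. h x * \<phi> n x) \<in> borel_measurable lebesgue" for n
      using integrable_locally_integrable_times_test[OF li phiV, of 1 n] by (auto dest: borel_measurable_integrable)
    show "integrable lebesgue (\<lambda>x. \<bar>indicator (closure W) x *\<^sub>R h x\<bar>)" using hW by (rule integrable_abs)
    show "AE x in lebesgue. (\<lambda>n. h x * \<phi> n x) \<longlonglongrightarrow> h x * indicator C x"
    proof (intro AE_I2 tendsto_mult_left)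
      fix x
      show "(\<lambda>n. \<phi> n x) \<longlonglongrightarrow> indicator C x"
      proof (cases "x \<in> C")
        case False
        then obtain \<epsilon> where e: "\<epsilon> > 0" "ball x \<epsilon> \<subseteq> - C"
          using C(1) compact_imp_closed openE[of "- C" x] by (metis ComplI open_Compl)
        obtain N where N: "1 / real (Suc N) < \<epsilon>" using e(1) nat_approx_posE by blast
        have "\<phi> n x = 0" if "n \<ge> N" for n
        proof (rule test_functions_outside[OF phi(1)])
          have "1 / real (Suc n) \<le> 1 / real (Suc N)" using that by (simp add: field_simps)
          then have "x \<notin> ball y (1 / real (Suc n))" if "y \<in> C" for y
            using N e(2) that by (force simp: dist_commute)
          then show "x \<notin> Vn n" by (auto simp: Vn_def)
        qed
        then have "\<forall>\<^sub>F n in sequentially. \<phi> n x = 0" using eventually_sequentially by blast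
        then show ?thesis using False by (simp add: tendsto_eventually)
      qed (simp add: phi)
    qed
    show "AE x in lebesgue. norm (h x * \<phi> n x) \<le> \<bar>indicator (closure W) x *\<^sub>R h x\<bar>" for n
    proof (intro AE_I2)
      fix x
      have "\<bar>h x\<bar> * \<bar>\<phi> n x\<bar> \<le> \<bar>h x\<bar> * 1"
        using phi(2,3)[of n x] by (intro mult_left_mono) auto
      then show "norm (h x * \<phi> n x) \<le> \<bar>indicator (closure W) x *\<^sub>R h x\<bar>"
        using out[of x n] by (cases "x \<in> closure W") (auto simp: abs_mult)
    qed
  qed
  then have "(\<lambda>n. 0) \<longlonglongrightarrow> (\<integral>x. h x * indicator C x \<partial>lebesgue)"
    by (simp only: z[OF phiV])
  then show ?thesis by (simp add: tendsto_const_iff)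
qed

text \<open>By inner regularity a closed \<open>T\<close> exhausts the positivity set up to measure
  \<epsilon>. The integral of \<open>h\<close> over \<open>T\<close> is zero while \<open>h\<close>
  is positive there, so \<open>T\<close> is null.\<close>

lemma positive_set_null:
  fixes h :: "'a::euclidean_space \<Rightarrow> real"
  assumes li: "locally_integrable V h"
    and z: "\<And>C. compact C \<Longrightarrow> C \<subseteq> V \<Longrightarrow> (\<integral>x. h x * indicator C x \<partial>lebesgue) = 0"
    and K: "compact K" "K \<subseteq> V"
  shows "{x \<in> K. h x > 0} \<in> null_sets lebesgue"
proof -
  let ?A = "{x \<in> K. h x > 0}"
  have hK: "(\<lambda>x. indicator K x *\<^sub>R h x) \<in> borel_measurable lebesgue"
    using li K borel_measurable_integrable by (auto simp: locally_integrable_def set_integrable_def)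
  have "{x \<in> space lebesgue. 0 < indicator K x *\<^sub>R h x} \<in> sets lebesgue"
    using borel_measurable_less[OF borel_measurable_const hK] by simp
  moreover have "{x \<in> space lebesgue. 0 < indicator K x *\<^sub>R h x} = ?A"
    by (auto simp: indicator_def split: if_splits)
  ultimately have A: "?A \<in> sets lebesgue" by simp
  have e: "emeasure lebesgue ?A \<le> 0 + ennreal \<epsilon>" if "\<epsilon> > 0" for \<epsilon>
  proof -
    obtain T where T: "closed T" "T \<subseteq> ?A" "?A - T \<in> lmeasurable" "emeasure lebesgue (?A - T) < ennreal \<epsilon>"
      using sets_lebesgue_inner_closed[OF A \<open>\<epsilon> > 0\<close>] .
    have Tc: "compact T"
      using T(1,2) K(1) by (metis (no_types, lifting) closed_Int_compact inf.absorb1 mem_Collect_eq subset_iff)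
    have int: "integrable lebesgue (\<lambda>x. h x * indicator T x)"
      using li Tc T(2) K(2) unfolding locally_integrable_def set_integrable_def
      by (auto simp: mult.commute)
    have "AE x in lebesgue. h x * indicator T x = 0"
      using z[OF Tc] T(2) K(2) integral_nonneg_eq_0_iff_AE[OF int]
      by (fastforce simp: indicator_def)
    then have "AE x in lebesgue. x \<notin> T"
      by eventually_elim (use T(2) in \<open>auto simp: indicator_def split: if_splits\<close>)
    then have "emeasure lebesgue T = 0"
      using T(1) by (subst (asm) AE_iff_measurable[of T]) auto
    moreover have "emeasure lebesgue ?A \<le> emeasure lebesgue T + emeasure lebesgue (?A - T)"
    proof -
      have "emeasure lebesgue (T \<union> (?A - T)) \<le> emeasure lebesgue T + emeasure lebesgue (?A - T)"
        using T A by (intro emeasure_subadditive) auto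
      moreover have "T \<union> (?A - T) = ?A" using T(2) by auto
      ultimately show ?thesis by simp
    qed
    ultimately have "emeasure lebesgue ?A \<le> emeasure lebesgue (?A - T)" by simp
    also have "\<dots> \<le> ennreal \<epsilon>" using T(4) by (rule less_imp_le)
    finally show ?thesis by simp
  qed
  have "emeasure lebesgue ?A \<le> 0"
    by (rule ennreal_le_epsilon) (rule e)
  then show ?thesis using A by auto
qed

text \<open>The fundamental lemma of the calculus of variations, from the two preceding facts for
  \<open>h\<close> and \<open>- h\<close> on countably many compact sets covering
  \<open>V\<close>.\<close>

lemma AE_eq_0_if_test_integrals_0:
  fixes h :: "'a::euclidean_space \<Rightarrow> real"
  assumes V: "open V" and li: "locally_integrable V h"
    and z: "\<And>\<phi>. \<phi> \<in> test_functions V \<Longrightarrow> (\<integral>x. h x * \<phi> x \<partial>lebesgue) = 0"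
  shows "AE x in lebesgue. x \<in> V \<longrightarrow> h x = 0"
proof -
  obtain K :: "nat \<Rightarrow> 'a set" where K: "\<And>n. compact (K n)" "\<And>n. K n \<subseteq> V" "\<Union>(range K) = V"
    using open_Union_compact_subsets[OF V] by metis
  have li': "locally_integrable V (\<lambda>x. - h x)"
    using locally_integrable_scaleR[OF continuous_on_const li, of "-1"] by simp
  have "{x \<in> K n. h x > 0} \<in> null_sets lebesgue" for n
    by (rule positive_set_null[OF li integral_compact_eq_0[OF V li z] K(1,2)])
  moreover have "{x \<in> K n. - h x > 0} \<in> null_sets lebesgue" for n
    by (rule positive_set_null[OF li' integral_compact_eq_0[OF V li'] K(1,2)]) (use z in auto)
  ultimately have "(\<Union>n. {x \<in> K n. h x > 0} \<union> {x \<in> K n. - h x > 0}) \<in> null_sets lebesgue"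
    by (intro null_sets_UN null_sets.Un) auto
  then show ?thesis
    by (rule AE_I') (use K(3) in force)
qed

text \<open>The set \<open>A\<close> where \<open>f\<close> may be nonzero stays off the frontier of
  \<open>U\<close>, so truncation to \<open>U\<close> creates no jump. The part of \<open>A\<close>
  that lies in the closure of \<open>U\<close> and in the support of \<eta> is a compact subset of
  \<open>U\<close>; a cutoff \<theta> equal to 1 near it turns \<eta> into the admissible test
  function \<eta> \<theta> without changing either integrand.\<close>

lemma zero_extension_identity:
  fixes f :: "'a::euclidean_space \<Rightarrow> real"
  assumes wg: "wgrad (D \<inter> W) f p" and U: "open U" "D \<inter> closure U \<subseteq> W" and W: "open W" "open D"
    and A: "closedin (top_of_set (D \<inter> W)) A" "A \<inter> frontier U = {}"
    and zero: "\<And>x. x \<in> D \<inter> W \<Longrightarrow> x \<notin> A \<Longrightarrow> f x = 0" "\<And>x. x \<in> D \<inter> W \<Longrightarrow> x \<notin> A \<Longrightarrow> p x = 0"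
    and eta: "\<eta> \<in> test_functions D" and i: "i \<in> Basis"
  shows "(\<integral>x. (if x \<in> U then f x else 0) * partial_deriv i \<eta> x \<partial>lebesgue)
    = - (\<integral>x. ((if x \<in> U then p x else 0) \<bullet> i) * \<eta> x \<partial>lebesgue)"
proof -
  define S where "S = closure {x. \<eta> x \<noteq> 0}"
  have S: "compact S" "S \<subseteq> D" using test_functionsD(2,3)[OF eta] by (auto simp: S_def)
  have eta0: "\<eta> x = 0" "partial_deriv i \<eta> x = 0" if "x \<notin> S" for x
    using that closure_subset[of "{x. \<eta> x \<noteq> 0}"] partial_deriv_outside_support[of x \<eta> i] by (auto simp: S_def)
  obtain T where T: "closed T" "A = (D \<inter> W) \<inter> T"
    using A(1) by (auto simp: closedin_closed)
  define C where "C = S \<inter> closure U \<inter> T"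
  have C: "compact C" using S(1) T(1) by (auto simp: C_def intro!: compact_Int_closed)
  have CA: "C \<subseteq> A" using S U T by (auto simp: C_def)
  have CU: "C \<subseteq> U \<inter> (D \<inter> W)"
  proof
    fix x assume "x \<in> C"
    then have "x \<in> A" "x \<in> closure U" using CA by (auto simp: C_def)
    then show "x \<in> U \<inter> (D \<inter> W)" using A(2) T(2) U(1) by (auto simp: frontier_def interior_open)
  qed
  obtain \<theta> N where t: "\<theta> \<in> test_functions (U \<inter> (D \<inter> W))" "open N" "C \<subseteq> N" "\<And>x. x \<in> N \<Longrightarrow> \<theta> x = (1::real)"
    using cutoff_exists[of "U \<inter> (D \<inter> W)", OF _ C CU] U(1) W by (metis open_Int)
  have t': "\<theta> \<in> test_functions (D \<inter> W)" using test_functions_mono[OF t(1)] by blast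
  have prod: "(\<lambda>x. \<eta> x * \<theta> x) \<in> test_functions (D \<inter> W)"
    using W by (intro test_functions_mult t' smooth_imp_smooth_on test_functionsD(1)[OF eta]) auto
  have dprod: "partial_deriv i (\<lambda>x. \<eta> x * \<theta> x) x = \<eta> x * partial_deriv i \<theta> x + partial_deriv i \<eta> x * \<theta> x" for x
    by (rule partial_deriv_mult_test[of "D \<inter> W"])
      (use W t' test_functionsD(1)[OF eta] in \<open>auto intro: smooth_imp_smooth_on\<close>)
  have t0: "\<theta> x = 0" "partial_deriv i \<theta> x = 0" if "x \<notin> U" for x
    using that test_functionsD(3)[OF t(1)] partial_deriv_outside_support[of x \<theta> i] test_functions_outside[OF t(1)] by auto
  have t1: "\<theta> x = 1" "partial_deriv i \<theta> x = 0" if "x \<in> C" for x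
  proof -
    have "x \<in> N" using t(3) that by blast
    then show "\<theta> x = 1" "partial_deriv i \<theta> x = 0"
      using t(4) partial_deriv_cong[OF t(2), of x \<theta> "\<lambda>_. 1"] partial_deriv_eqI[of "\<lambda>_. 1" "\<lambda>_. 0"] by auto
  qed
  have split: "x \<in> C \<or> x \<notin> S \<or> (f x = 0 \<and> p x = 0)" if "x \<in> U" for x
  proof -
    have "x \<in> closure U" using that closure_subset by blast
    then have "x \<in> C" if "x \<in> S" "x \<in> A" using that T(2) by (simp add: C_def)
    moreover have "x \<in> D \<inter> W" if "x \<in> S" using that S(2) U(2) \<open>x \<in> closure U\<close> by blast
    ultimately show ?thesis using zero by blast
  qed
  have "(if x \<in> U then f x else 0) * partial_deriv i \<eta> x = f x * partial_deriv i (\<lambda>x. \<eta> x * \<theta> x) x" for x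
    using t0[of x] t1[of x] split[of x] eta0[of x] by (auto simp: dprod)
  moreover have "((if x \<in> U then p x else 0) \<bullet> i) * \<eta> x = (p x \<bullet> i) * (\<eta> x * \<theta> x)" for x
    using t0[of x] t1[of x] split[of x] eta0[of x] by auto
  moreover have "(\<integral>x. f x * partial_deriv i (\<lambda>x. \<eta> x * \<theta> x) x \<partial>lebesgue)
      = - (\<integral>x. (p x \<bullet> i) * (\<eta> x * \<theta> x) \<partial>lebesgue)"
    using wg prod i unfolding wgrad_def by blast
  ultimately show ?thesis by (simp only:)
qed

section \<open>Sobolev functions\<close>

lemma integral_lebesgue_on_eq:
  fixes f :: "'a::euclidean_space \<Rightarrow> real"
  assumes "\<Omega> \<in> sets lebesgue" "\<And>x. x \<notin> \<Omega> \<Longrightarrow> f x = 0"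
  shows "(\<integral>x. f x \<partial>lebesgue_on \<Omega>) = (\<integral>x. f x \<partial>lebesgue)"
proof -
  have "(\<integral>x. f x \<partial>lebesgue_on \<Omega>) = (\<integral>x. indicator \<Omega> x *\<^sub>R f x \<partial>lebesgue)"
    using assms(1) by (subst integral_restrict_space) auto
  also have "(\<lambda>x. indicator \<Omega> x *\<^sub>R f x) = f"
  proof
    show "indicator \<Omega> x *\<^sub>R f x = f x" for x using assms(2)[of x] by (cases "x \<in> \<Omega>") auto
  qed
  finally show ?thesis .
qed

lemma is_weak_gradient_iff:
  fixes \<Omega> :: "'a::euclidean_space set"
  assumes "open \<Omega>"
  shows "is_weak_gradient \<Omega> u g \<longleftrightarrow> (\<forall>\<phi>\<in>test_functions \<Omega>. \<forall>i\<in>Basis.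
        (\<integral>x. u x * partial_deriv i \<phi> x \<partial>lebesgue) = - (\<integral>x. (g x \<bullet> i) * \<phi> x \<partial>lebesgue))"
proof -
  have m: "\<Omega> \<in> sets lebesgue" using assms by auto
  have "(\<integral>x. u x * partial_deriv i \<phi> x \<partial>lebesgue_on \<Omega>) = (\<integral>x. u x * partial_deriv i \<phi> x \<partial>lebesgue)"
    "(\<integral>x. (g x \<bullet> i) * \<phi> x \<partial>lebesgue_on \<Omega>) = (\<integral>x. (g x \<bullet> i) * \<phi> x \<partial>lebesgue)"
    if "\<phi> \<in> test_functions \<Omega>" "i \<in> Basis" for \<phi> i
    using test_functions_outside[OF that(1)] test_functions_outside[OF test_functions_partial_deriv[OF that]]
    by (intro integral_lebesgue_on_eq[OF m]; simp)+
  then show ?thesis unfolding is_weak_gradient_def by simp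
qed

lemma L2_on_measurable:
  assumes "L2_on \<Omega> f" "\<Omega> \<in> sets lebesgue"
  shows "(\<lambda>x. indicator \<Omega> x *\<^sub>R f x) \<in> borel_measurable lebesgue"
proof -
  have "f \<in> borel_measurable (lebesgue_on \<Omega>)" using assms(1) by (simp add: L2_on_def)
  then show ?thesis
    using assms(2) by (simp add: borel_measurable_restrict_space_iff)
qed

lemma L2_on_integrable:
  assumes "L2_on \<Omega> f" "\<Omega> \<in> sets lebesgue"
  shows "integrable lebesgue (\<lambda>x. indicator \<Omega> x *\<^sub>R (norm (f x))\<^sup>2)"
proof -
  have "integrable (lebesgue_on \<Omega>) (\<lambda>x. (norm (f x))\<^sup>2)" using assms(1) by (simp add: L2_on_def)
  then show ?thesis
    using assms(2) by (simp add: integrable_restrict_space)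
qed

text \<open>From t \<le> 1 + t^2 and the finite measure of compact sets.\<close>

lemma L2_on_imp_locally_integrable:
  fixes f :: "'a::euclidean_space \<Rightarrow> 'b::euclidean_space"
  assumes "L2_on \<Omega> f" "open \<Omega>" "V \<subseteq> \<Omega>"
  shows "locally_integrable V f"
  unfolding locally_integrable_def set_integrable_def
proof (intro allI impI)
  fix K assume K: "compact K" "K \<subseteq> V"
  have m: "\<Omega> \<in> sets lebesgue" using assms(2) by auto
  have Km: "K \<in> sets lebesgue" using K(1) by (auto simp: borel_compact)
  have eq: "(\<lambda>x. indicator K x *\<^sub>R f x) = (\<lambda>x. indicator K x *\<^sub>R indicator \<Omega> x *\<^sub>R f x)"
    using K(2) assms(3) by (auto simp: indicator_def fun_eq_iff)
  show "integrable lebesgue (\<lambda>x. indicator K x *\<^sub>R f x)"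
  proof (rule Bochner_Integration.integrable_bound)
    have "integrable lebesgue (indicator K :: 'a \<Rightarrow> real)"
      using lmeasurable_compact[OF K(1)] unfolding fmeasurable_def by (intro integrable_real_indicator) auto
    then show "integrable lebesgue (\<lambda>x. indicator K x + indicator \<Omega> x *\<^sub>R (norm (f x))\<^sup>2 :: real)"
      using L2_on_integrable[OF assms(1) m] by (rule Bochner_Integration.integrable_add)
    show "(\<lambda>x. indicator K x *\<^sub>R f x) \<in> borel_measurable lebesgue"
      unfolding eq using Km L2_on_measurable[OF assms(1) m] by measurable
    have "norm (f x) \<le> 1 + (norm (f x))\<^sup>2" for x
    proof -
      have "0 \<le> (norm (f x))\<^sup>2 + 1 - 2 * norm (f x)"
        using zero_le_power2[of "norm (f x) - 1"] by (simp add: power2_diff)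
      then show ?thesis using zero_le_power2[of "norm (f x)"] by linarith
    qed
    then show "AE x in lebesgue. norm (indicator K x *\<^sub>R f x) \<le> norm (indicator K x + indicator \<Omega> x *\<^sub>R (norm (f x))\<^sup>2 :: real)"
      using K(2) assms(3) by (intro AE_I2) (auto simp: indicator_def)
  qed
qed

lemma wgrad_of_weak_gradient:
  assumes "L2_on \<Omega> g" "is_weak_gradient \<Omega> u g" "open \<Omega>" "open V" "V \<subseteq> \<Omega>" "continuous_on V u"
  shows "wgrad V u g"
proof -
  have "(\<integral>x. u x * partial_deriv i \<phi> x \<partial>lebesgue) = - (\<integral>x. (g x \<bullet> i) * \<phi> x \<partial>lebesgue)"
    if "\<phi> \<in> test_functions V" "i \<in> Basis" for \<phi> i
    using assms(2)[unfolded is_weak_gradient_iff[OF assms(3)]] test_functions_mono[OF that(1) assms(5)] that(2)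
    by simp
  then show ?thesis
    unfolding wgrad_def using assms(4,6) L2_on_imp_locally_integrable[OF assms(1,3,5)] by simp
qed

text \<open>Needed because \<open>weak_gradient\<close> is a choice: any weak gradient at hand may
  then replace the chosen one under an integral.\<close>

lemma weak_gradient_unique:
  fixes \<Omega> :: "'a::euclidean_space set"
  assumes "open \<Omega>" "L2_on \<Omega> g" "is_weak_gradient \<Omega> u g" "L2_on \<Omega> h" "is_weak_gradient \<Omega> u h"
  shows "AE x in lebesgue_on \<Omega>. g x = h x"
proof -
  have li: "locally_integrable \<Omega> g" "locally_integrable \<Omega> h"
    using assms L2_on_imp_locally_integrable by blast+
  have comp: "locally_integrable \<Omega> (\<lambda>x. g x \<bullet> i - h x \<bullet> i)" for i
    using li unfolding locally_integrable_def set_integrable_def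
    by (auto simp flip: inner_diff_left inner_scaleR_left simp: scaleR_right_diff_distrib
        intro!: integrable_inner_left Bochner_Integration.integrable_diff)
  have "AE x in lebesgue. x \<in> \<Omega> \<longrightarrow> g x \<bullet> i - h x \<bullet> i = 0" if i: "i \<in> Basis" for i
  proof (rule AE_eq_0_if_test_integrals_0[OF assms(1) comp])
    fix \<phi> assume phi: "\<phi> \<in> test_functions \<Omega>"
    have "(\<integral>x. (g x \<bullet> i) * \<phi> x \<partial>lebesgue) = (\<integral>x. (h x \<bullet> i) * \<phi> x \<partial>lebesgue)"
      using assms(3,5) phi i unfolding is_weak_gradient_iff[OF assms(1)] by fastforce
    then show "(\<integral>x. (g x \<bullet> i - h x \<bullet> i) * \<phi> x \<partial>lebesgue) = 0"
      using integrable_locally_integrable_times_test[OF li(1) phi, of i]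
        integrable_locally_integrable_times_test[OF li(2) phi, of i]
      by (simp add: left_diff_distrib)
  qed
  then have "AE x in lebesgue. \<forall>i\<in>Basis. x \<in> \<Omega> \<longrightarrow> g x \<bullet> i - h x \<bullet> i = 0"
    by (subst AE_ball_countable) (auto intro: countable_finite)
  then have "AE x in lebesgue. x \<in> \<Omega> \<longrightarrow> g x = h x"
    by eventually_elim (auto intro: euclidean_eqI)
  then show ?thesis
    using assms(1) by (subst AE_restrict_space_iff) auto
qed

section \<open>Removability of the origin in the plane\<close>

lemma smooth_step_deriv_bounded: obtains B where "B > 0" "\<And>x. \<bar>deriv smooth_step x\<bar> \<le> B"
proof -
  have pd: "partial_deriv 1 smooth_step = deriv smooth_step"
    using partial_deriv_real[OF smooth_step_DERIV] by blast
  have c: "continuous_on UNIV (deriv smooth_step)"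
    using smooth_on_continuous[OF smooth_on_partial_deriv[of UNIV smooth_step 1]] smooth_smooth_step
    by (simp add: pd smooth_iff_smooth_on)
  have "deriv smooth_step x = 0" if x: "x \<notin> {0..1}" for x
  proof -
    consider "x < 0" | "x > 1" using x by (cases "x < 0") auto
    then have "(smooth_step has_real_derivative 0) (at x)"
    proof cases
      case 1
      show ?thesis
        by (rule has_field_derivative_transform_within_open[OF DERIV_const[of 0], of "{..<0}"])
          (use 1 smooth_step_0 in auto)
    next
      case 2
      show ?thesis
        by (rule has_field_derivative_transform_within_open[OF DERIV_const[of 1], of "{1<..}"])
          (use 2 smooth_step_1 in auto)
    qed
    then show ?thesis by (rule DERIV_imp_deriv)
  qed
  then show ?thesis using compact_support_bounded[OF c, of "{0..1}"] that by auto
qed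

lemma partial_deriv_norm_square: "partial_deriv i (\<lambda>x::'a::euclidean_space. (norm x)\<^sup>2) x = 2 * (x \<bullet> i)"
proof -
  have "((\<lambda>x::'a. x \<bullet> x) has_derivative (\<lambda>h. x \<bullet> h + h \<bullet> x)) (at x)"
    by (auto intro!: derivative_eq_intros)
  then show ?thesis
    unfolding power2_norm_eq_inner by (subst partial_deriv_eqI) (auto simp: inner_commute)
qed

text \<open>Zero for n |x|^2 \<le> 1 and one for n |x|^2 \<ge> 2. The square keeps the function
  smooth and makes its gradient a nonnegative multiple of x, which later has a sign against the
  gradient of the barrier.\<close>

definition origin_cutoff :: "nat \<Rightarrow> 'a::euclidean_space \<Rightarrow> real" where
  "origin_cutoff n x = smooth_step (real n * (norm x)\<^sup>2 - 1)"

lemma smooth_origin_cutoff: "smooth (origin_cutoff n :: 'a::euclidean_space \<Rightarrow> real)"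
proof -
  have "smooth_on UNIV (\<lambda>x::'a. smooth_step (real n * (norm (x - 0))\<^sup>2 - 1))"
    by (intro smooth_on_compose_UNIV[OF _ smooth_smooth_step] smooth_on_diff smooth_on_mult
        smooth_on_const smooth_norm_square[unfolded smooth_iff_smooth_on] open_UNIV)
  then show ?thesis by (simp add: smooth_iff_smooth_on origin_cutoff_def[abs_def])
qed

lemma origin_cutoff_deriv:
  "partial_deriv i (origin_cutoff n) x = deriv smooth_step (real n * (norm x)\<^sup>2 - 1) * (2 * real n * (x \<bullet> i))"
proof -
  have d': "(\<lambda>x::'a. (norm x)\<^sup>2) differentiable (at x)"
    using smooth_differentiable[OF smooth_norm_square[of 0], of x] by simp
  then have d: "(\<lambda>x::'a. real n * (norm x)\<^sup>2 - 1) differentiable (at x)"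
    by (intro derivative_intros)
  have "partial_deriv i (\<lambda>x::'a. real n * (norm x)\<^sup>2 + - 1) x = real n * partial_deriv i (\<lambda>x. (norm x)\<^sup>2) x"
    using partial_deriv_add[of "\<lambda>x::'a. real n * (norm x)\<^sup>2" x "\<lambda>_. - 1" i]
      partial_deriv_mult[of "\<lambda>_. real n" x "\<lambda>x. (norm x)\<^sup>2" i] d'
      partial_deriv_eqI[of "\<lambda>_::'a. - 1" "\<lambda>_. 0" x i] partial_deriv_eqI[of "\<lambda>_::'a. real n" "\<lambda>_. 0" x i]
    by simp
  then show ?thesis
    using partial_deriv_compose[OF d smooth_step_DERIV, of i]
    by (simp add: origin_cutoff_def[abs_def] partial_deriv_norm_square mult_ac)
qed

lemma origin_cutoff_bounds: "0 \<le> origin_cutoff n x" "origin_cutoff n x \<le> 1"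
  by (simp_all add: origin_cutoff_def smooth_step_nonneg smooth_step_le_1)

lemma origin_cutoff_0: "real n * (norm x)\<^sup>2 \<le> 1 \<Longrightarrow> origin_cutoff n x = 0"
  by (simp add: origin_cutoff_def smooth_step_0)

lemma origin_cutoff_tendsto:
  assumes "x \<noteq> 0" shows "(\<lambda>n. origin_cutoff n x) \<longlonglongrightarrow> 1"
proof -
  obtain N where N: "2 / (norm x)\<^sup>2 \<le> real N" using real_arch_simple by blast
  have "origin_cutoff n x = 1" if "n \<ge> N" for n
  proof -
    have "2 / (norm x)\<^sup>2 \<le> real n" using N that by linarith
    then have "2 \<le> real n * (norm x)\<^sup>2" using assms by (simp add: pos_divide_le_eq)
    then show ?thesis by (simp add: origin_cutoff_def smooth_step_1)
  qed
  then have "\<forall>\<^sub>F n in sequentially. origin_cutoff n x = 1" using eventually_sequentially by blast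
  then show ?thesis by (simp add: tendsto_eventually)
qed

lemma measure_cball_real2: "r \<ge> 0 \<Longrightarrow> measure lebesgue (cball (0::real^2) r) = pi * r\<^sup>2"
  by (simp add: content_cball eval_unit_ball_vol)

lemma AE_lebesgue_neq: "AE x in lebesgue. x \<noteq> (c::'a::euclidean_space)"
  by (rule AE_I'[of "{c}"]) auto

text \<open>The choice s = sqrt (\<alpha> n) + 1 / (n + 1) balances the two terms; the extra summand
  avoids s = 0. This stands in for the Cauchy-Schwarz inequality: a pointwise Young inequality with
  a free weight s is enough.\<close>

lemma tendsto_zero_of_weighted_bounds:
  fixes X \<alpha> :: "nat \<Rightarrow> real"
  assumes "\<alpha> \<longlonglongrightarrow> 0" "\<And>n. \<alpha> n \<ge> 0" "\<And>n s. s > 0 \<Longrightarrow> \<bar>X n\<bar> \<le> c * (\<alpha> n / s + s)" "c \<ge> 0"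
  shows "X \<longlonglongrightarrow> 0"
proof (rule Lim_null_comparison)
  show "\<forall>\<^sub>F n in sequentially. norm (X n) \<le> c * (sqrt (\<alpha> n) + (sqrt (\<alpha> n) + 1 / real (Suc n)))"
  proof (intro always_eventually allI)
    fix n
    let ?s = "sqrt (\<alpha> n) + 1 / real (Suc n)"
    have s: "?s > 0" using assms(2)[of n] by (intro add_nonneg_pos) auto
    have "\<alpha> n = sqrt (\<alpha> n) * sqrt (\<alpha> n)" using assms(2)[of n] by simp
    also have "\<dots> \<le> sqrt (\<alpha> n) * ?s" using assms(2)[of n] by (intro mult_left_mono) auto
    finally have "\<alpha> n / ?s \<le> sqrt (\<alpha> n)" using s by (simp only: pos_divide_le_eq)
    then have "c * (\<alpha> n / ?s + ?s) \<le> c * (sqrt (\<alpha> n) + ?s)" using assms(4) by (intro mult_left_mono) auto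
    then show "norm (X n) \<le> c * (sqrt (\<alpha> n) + ?s)" using assms(3)[OF s, of n] by simp
  qed
  have "(\<lambda>n. c * (sqrt (\<alpha> n) + (sqrt (\<alpha> n) + 1 / real (Suc n)))) \<longlonglongrightarrow> c * (sqrt 0 + (sqrt 0 + 0))"
    by (intro tendsto_intros assms(1) LIMSEQ_Suc[OF lim_1_over_n])
  then show "(\<lambda>n. c * (sqrt (\<alpha> n) + (sqrt (\<alpha> n) + 1 / real (Suc n)))) \<longlonglongrightarrow> 0" by simp
qed

text \<open>In the plane, the gradients of \<open>origin_cutoff\<close> are bounded in \<open>L\<^sup>2\<close>, so a single point
  is removable.\<close>

lemma weak_gradient_remove_origin:
  fixes \<Omega> :: "(real^2) set"
  assumes \<Omega>: "open \<Omega>" and L2: "L2_on \<Omega> \<phi>" "L2_on \<Omega> p"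
    and id: "\<And>\<eta> i. \<eta> \<in> test_functions (\<Omega> - {0}) \<Longrightarrow> i \<in> Basis \<Longrightarrow>
      (\<integral>x. \<phi> x * partial_deriv i \<eta> x \<partial>lebesgue) = - (\<integral>x. (p x \<bullet> i) * \<eta> x \<partial>lebesgue)"
  shows "is_weak_gradient \<Omega> \<phi> p"
  unfolding is_weak_gradient_iff[OF \<Omega>]
proof (intro ballI)
  fix \<eta> and i :: "real^2" assume eta: "\<eta> \<in> test_functions \<Omega>" and i: "i \<in> Basis"
  have li: "locally_integrable \<Omega> \<phi>" "locally_integrable \<Omega> p"
    using L2_on_imp_locally_integrable[OF _ \<Omega> order_refl] L2 by auto
  have \<Omega>m: "\<Omega> \<in> sets lebesgue" using \<Omega> by auto
  have eta': "partial_deriv i \<eta> \<in> test_functions \<Omega>" by (rule test_functions_partial_deriv[OF eta i])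
  let ?S = "\<lambda>n. origin_cutoff n :: real^2 \<Rightarrow> real"
  have S: "(\<lambda>x. ?S n x * \<eta> x) \<in> test_functions (\<Omega> - {0})" if "n > 0" for n
  proof -
    let ?K = "closure {x. \<eta> x \<noteq> 0}"
    define K where "K = ?K - ball 0 (sqrt (1 / n))"
    have "smooth (\<lambda>x. ?S n x * \<eta> x)"
      using smooth_on_mult[OF open_UNIV smooth_imp_smooth_on[OF smooth_origin_cutoff]
          smooth_imp_smooth_on[OF test_functionsD(1)[OF eta]]] by (simp add: smooth_iff_smooth_on)
    moreover have "compact K" using test_functionsD(2)[OF eta] unfolding K_def by (rule compact_diff) simp
    moreover have "K \<subseteq> \<Omega> - {0}" using test_functionsD(3)[OF eta] that by (auto simp: K_def)
    moreover have "?S n x * \<eta> x = 0" if "x \<notin> K" for x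
    proof (cases "x \<in> ?K")
      case True
      then have "norm x < sqrt (1 / n)" using that by (auto simp: K_def)
      then have "(norm x)\<^sup>2 \<le> (sqrt (1 / n))\<^sup>2" by (intro power_mono) auto
      then have "real n * (norm x)\<^sup>2 \<le> 1" using \<open>n > 0\<close> by (simp add: field_simps)
      then show ?thesis by (simp add: origin_cutoff_0)
    next
      case False
      then show ?thesis using closure_subset[of "{x. \<eta> x \<noteq> 0}"] by auto
    qed
    ultimately show ?thesis by (rule test_functionsI)
  qed
  obtain B where B: "B > 0" "\<And>x. \<bar>deriv smooth_step x\<bar> \<le> B" using smooth_step_deriv_bounded by blast
  obtain M where M: "M > 0" "\<And>x. \<bar>\<eta> x\<bar> \<le> M"
    using compact_support_bounded[OF test_functions_continuous[OF eta] test_functionsD(2)[OF eta]]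
      closure_subset[of "{x. \<eta> x \<noteq> 0}"] by (metis (mono_tags, lifting) mem_Collect_eq subsetD)
  have scont: "continuous_on UNIV (?S n)" for n
    by (intro smooth_on_continuous smooth_imp_smooth_on smooth_origin_cutoff)
  have dS: "partial_deriv i (\<lambda>x. ?S n x * \<eta> x) x = ?S n x * partial_deriv i \<eta> x + partial_deriv i (?S n) x * \<eta> x" for n x
    by (rule partial_deriv_mult_test[OF \<Omega> smooth_imp_smooth_on[OF smooth_origin_cutoff] eta])
  have int1: "integrable lebesgue (\<lambda>x. \<phi> x * k x)" if "k \<in> test_functions \<Omega>" for k
    using integrable_locally_integrable_times_test[OF li(1) that, of 1] by simp
  have int2: "integrable lebesgue (\<lambda>x. \<phi> x * (partial_deriv i (?S n) x * \<eta> x))" for n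
    by (intro int1 test_functions_mult[OF \<Omega> eta] smooth_on_partial_deriv smooth_imp_smooth_on smooth_origin_cutoff i)
  have int3: "integrable lebesgue (\<lambda>x. \<phi> x * (?S n x * partial_deriv i \<eta> x))" for n
    by (intro int1 test_functions_mult[OF \<Omega> eta'] smooth_imp_smooth_on smooth_origin_cutoff)
  have int4: "integrable lebesgue (\<lambda>x. (p x \<bullet> i) * \<eta> x)"
    by (rule integrable_locally_integrable_times_test[OF li(2) eta])
  have sm: "(\<lambda>x. ?S n x) \<in> borel_measurable lebesgue" for n
    by (rule continuous_imp_lebesgue_measurable[OF scont])
  have L1: "(\<lambda>n. \<integral>x. (\<phi> x * partial_deriv i \<eta> x) * ?S n x \<partial>lebesgue) \<longlonglongrightarrow> (\<integral>x. \<phi> x * partial_deriv i \<eta> x \<partial>lebesgue)"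
    and L2: "(\<lambda>n. \<integral>x. ((p x \<bullet> i) * \<eta> x) * ?S n x \<partial>lebesgue) \<longlonglongrightarrow> (\<integral>x. (p x \<bullet> i) * \<eta> x \<partial>lebesgue)"
  proof -
    have gen: "(\<lambda>n. \<integral>x. F x * ?S n x \<partial>lebesgue) \<longlonglongrightarrow> (\<integral>x. F x \<partial>lebesgue)" if F: "integrable lebesgue F" for F
    proof (rule integral_dominated_convergence[where w="\<lambda>x. \<bar>F x\<bar>"])
      show "F \<in> borel_measurable lebesgue" "(\<lambda>x. F x * ?S n x) \<in> borel_measurable lebesgue" for n
        using F sm by measurable
      show "integrable lebesgue (\<lambda>x. \<bar>F x\<bar>)" using F by simp
      show "AE x in lebesgue. (\<lambda>n. F x * ?S n x) \<longlonglongrightarrow> F x"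
        using AE_lebesgue_neq[of 0]
      proof eventually_elim
        case (elim x)
        show ?case using tendsto_mult_left[OF origin_cutoff_tendsto[OF elim], of "F x"] by simp
      qed
      show "AE x in lebesgue. norm (F x * ?S n x) \<le> \<bar>F x\<bar>" for n
      proof (intro AE_I2)
        fix x
        show "norm (F x * ?S n x) \<le> \<bar>F x\<bar>"
          using origin_cutoff_bounds[of n x] by (simp add: abs_mult mult_left_le)
      qed
    qed
    show "(\<lambda>n. \<integral>x. (\<phi> x * partial_deriv i \<eta> x) * ?S n x \<partial>lebesgue) \<longlonglongrightarrow> (\<integral>x. \<phi> x * partial_deriv i \<eta> x \<partial>lebesgue)"
      by (rule gen[OF int1[OF eta']])
    show "(\<lambda>n. \<integral>x. ((p x \<bullet> i) * \<eta> x) * ?S n x \<partial>lebesgue) \<longlonglongrightarrow> (\<integral>x. (p x \<bullet> i) * \<eta> x \<partial>lebesgue)"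
      by (rule gen[OF int4])
  qed
  \<comment> \<open>The error term that carries the gradient of the cutoff; its integrand has no
    fixed integrable majorant at hand.\<close>
  define X where "X n = (\<integral>x. \<phi> x * (partial_deriv i (?S n) x * \<eta> x) \<partial>lebesgue)" for n
  define Q where "Q n = cball (0::real^2) (sqrt (2 / Suc n))" for n
  \<comment> \<open>The mass of \<phi>^2 on the ball that contains the transition zone of cutoff
    number n + 1. It tends to 0, while the gradients of the cutoffs are merely bounded in
    L^2.\<close>
  define \<alpha> where "\<alpha> n = (\<integral>x. (indicator \<Omega> x *\<^sub>R (norm (\<phi> x))\<^sup>2) * indicator (Q n) x \<partial>lebesgue)" for n
  have Qm: "Q n \<in> sets lebesgue" for n by (simp add: Q_def)
  have phi2: "integrable lebesgue (\<lambda>x. indicator \<Omega> x *\<^sub>R (norm (\<phi> x))\<^sup>2)" by (rule L2_on_integrable[OF assms(2) \<Omega>m])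
  have phi2Q: "integrable lebesgue (\<lambda>x. (indicator \<Omega> x *\<^sub>R (norm (\<phi> x))\<^sup>2) * indicator (Q n) x)" for n
    by (rule integrable_mult_bounded[OF phi2 borel_measurable_indicator[OF Qm], of _ 1]) (simp add: indicator_def)
  have "\<alpha> \<longlonglongrightarrow> (\<integral>x. 0 \<partial>(lebesgue :: (real^2) measure))"
    unfolding \<alpha>_def
  proof (rule integral_dominated_convergence[where w="\<lambda>x. indicator \<Omega> x *\<^sub>R (norm (\<phi> x))\<^sup>2", OF _ _ phi2])
    show "(\<lambda>x. (indicator \<Omega> x *\<^sub>R (norm (\<phi> x))\<^sup>2) * indicator (Q n) x) \<in> borel_measurable lebesgue" for n
      using phi2Q by (rule borel_measurable_integrable)
    show "AE x in lebesgue. (\<lambda>n. (indicator \<Omega> x *\<^sub>R (norm (\<phi> x))\<^sup>2) * indicator (Q n) x) \<longlonglongrightarrow> 0"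
      using AE_lebesgue_neq[of 0]
    proof eventually_elim
      case (elim x)
      obtain N where N: "2 / (norm x)\<^sup>2 < real N" using reals_Archimedean2 by blast
      have "indicator (Q n) x = (0::real)" if "n \<ge> N" for n
      proof -
        have "2 / (norm x)\<^sup>2 < real (Suc n)" using N that by linarith
        then have "2 / real (Suc n) < (norm x)\<^sup>2" using elim by (simp add: field_simps)
        then have "sqrt (2 / real (Suc n)) < norm x" by (intro real_less_lsqrt) auto
        then show ?thesis by (simp add: Q_def)
      qed
      then have "\<forall>\<^sub>F n in sequentially. (indicator \<Omega> x *\<^sub>R (norm (\<phi> x))\<^sup>2) * indicator (Q n) x = 0"
        by (intro eventually_sequentiallyI[of N]) (simp only: mult_zero_right)
      then show ?case by (rule tendsto_eventually)
    qed
    show "AE x in lebesgue. norm ((indicator \<Omega> x *\<^sub>R (norm (\<phi> x))\<^sup>2) * indicator (Q n) x) \<le> indicator \<Omega> x *\<^sub>R (norm (\<phi> x))\<^sup>2" for n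
      by (intro AE_I2) (auto simp: indicator_def)
  qed simp
  then have \<alpha>0: "\<alpha> \<longlonglongrightarrow> 0" by simp
  have X0: "(\<lambda>n. X (Suc n)) \<longlonglongrightarrow> 0"
  proof (rule tendsto_zero_of_weighted_bounds[OF \<alpha>0])
    show "\<alpha> n \<ge> 0" for n by (simp add: \<alpha>_def)
    define c where "c = M * B * (2 * pi + 1) * 4"
    show "M * B * (2 * pi + 1) * 4 \<ge> 0" using M B by simp
    fix n and s :: real assume s: "s > 0"
    let ?n = "real (Suc n)"
    \<comment> \<open>In the transition zone n |x|^2 \<le> 2, so the gradient of the cutoff is of
      size sqrt n at most; Young's inequality with weight s separates it from \<phi>. The area of
      \<open>Q n\<close> will cancel the factor n.\<close>
    have pt: "\<bar>\<phi> x * (partial_deriv i (?S (Suc n)) x * \<eta> x)\<bar>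
        \<le> M * B * 4 * ((indicator \<Omega> x *\<^sub>R (norm (\<phi> x))\<^sup>2) * indicator (Q n) x / s + s * (?n * indicator (Q n) x))" (is "_ \<le> ?R x") for x
    proof (cases "x \<in> \<Omega> \<and> x \<in> Q n")
      case True
      have nx: "norm x \<le> sqrt (2 / ?n)" using True by (simp add: Q_def)
      have "norm x * ?n \<le> sqrt (2 / ?n) * ?n" using nx by (intro mult_right_mono) auto
      also have "\<dots> = sqrt 2 * (?n / sqrt ?n)" by (simp add: real_sqrt_divide)
      also have "\<dots> = sqrt 2 * sqrt ?n" by (subst real_div_sqrt) simp_all
      also have "\<dots> \<le> 2 * sqrt ?n" using sqrt2_less_2 by (intro mult_right_mono) auto
      finally have nn: "norm x * ?n \<le> 2 * sqrt ?n" .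
      have "\<bar>partial_deriv i (?S (Suc n)) x\<bar> \<le> B * (2 * ?n * norm x)"
        unfolding origin_cutoff_deriv abs_mult using B Basis_le_norm[OF i, of x]
        by (intro mult_mono) auto
      also have "2 * ?n * norm x = 2 * (norm x * ?n)" by (simp only: mult_ac)
      also have "B * (2 * (norm x * ?n)) \<le> B * (4 * sqrt ?n)"
      proof (rule mult_left_mono)
        show "2 * (norm x * ?n) \<le> 4 * sqrt ?n" using nn by linarith
      qed (use B in simp)
      finally have d: "\<bar>partial_deriv i (?S (Suc n)) x\<bar> \<le> B * (4 * sqrt ?n)" .
      have "\<bar>\<phi> x * (partial_deriv i (?S (Suc n)) x * \<eta> x)\<bar> \<le> \<bar>\<phi> x\<bar> * ((B * (4 * sqrt ?n)) * M)"
        unfolding abs_mult using d M B by (intro mult_left_mono mult_mono) auto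
      also have "\<dots> = M * B * 4 * (\<bar>\<phi> x\<bar> * sqrt ?n)" by simp
      also have "\<bar>\<phi> x\<bar> * sqrt ?n \<le> (\<phi> x)\<^sup>2 / s + s * ?n"
      proof -
        have "0 \<le> (\<bar>\<phi> x\<bar> - s * sqrt ?n)\<^sup>2" by simp
        then have "2 * (s * (\<bar>\<phi> x\<bar> * sqrt ?n)) \<le> (\<phi> x)\<^sup>2 + s\<^sup>2 * ?n"
          by (simp add: power2_diff power_mult_distrib mult_ac)
        moreover have "0 \<le> s * (\<bar>\<phi> x\<bar> * sqrt ?n)" using s by simp
        ultimately have "s * (\<bar>\<phi> x\<bar> * sqrt ?n) \<le> (\<phi> x)\<^sup>2 + s\<^sup>2 * ?n" by linarith
        also have "\<dots> = s * ((\<phi> x)\<^sup>2 / s + s * ?n)" using s by (simp add: distrib_left power2_eq_square)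
        finally show ?thesis using s by (simp only: mult_le_cancel_left_pos)
      qed
      finally show ?thesis using True M B by (simp add: mult_left_mono)
    next
      case False
      have "partial_deriv i (?S (Suc n)) x * \<eta> x = 0"
      proof (cases "x \<in> \<Omega>")
        case True
        then have "sqrt (2 / ?n) < norm x" using False by (auto simp: Q_def)
        then have "(sqrt (2 / ?n))\<^sup>2 < (norm x)\<^sup>2" by (intro power_strict_mono) auto
        then have "2 < ?n * (norm x)\<^sup>2" by (simp add: field_simps)
        then have "?n * (norm x)\<^sup>2 - 1 > 1" by simp
        moreover have "deriv smooth_step y = 0" if "y > 1" for y
          by (intro DERIV_imp_deriv has_field_derivative_transform_within_open[OF DERIV_const[of 1], of "{1<..}"])
            (use that smooth_step_1 in auto)
        ultimately show ?thesis unfolding origin_cutoff_deriv by simp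
      next
        case False
        then show ?thesis using test_functions_outside[OF eta] by simp
      qed
      then have "\<bar>\<phi> x * (partial_deriv i (?S (Suc n)) x * \<eta> x)\<bar> = 0" by (simp only: mult_zero_right abs_zero)
      also have "0 \<le> ?R x"
        using M(1) B(1) s by (intro mult_nonneg_nonneg add_nonneg_nonneg divide_nonneg_nonneg) auto
      finally show ?thesis .
    qed
    have Qi: "integrable lebesgue (\<lambda>x. ?n * indicator (Q n) x)"
      using lmeasurable_cball[of "0 :: real^2" "sqrt (2 / ?n)"] unfolding Q_def fmeasurable_def
      by (intro integrable_mult_right integrable_real_indicator) auto
    have Qv: "(\<integral>x. ?n * indicator (Q n) x \<partial>lebesgue) = 2 * pi"
      using measure_cball_real2[of "sqrt (2 / ?n)"] by (simp add: Q_def)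
    have "\<bar>X (Suc n)\<bar> \<le> (\<integral>x. \<bar>\<phi> x * (partial_deriv i (?S (Suc n)) x * \<eta> x)\<bar> \<partial>lebesgue)"
      unfolding X_def by (rule integral_abs_bound)
    also have "\<dots> \<le> (\<integral>x. ?R x \<partial>lebesgue)"
    proof (rule integral_mono[OF _ _ pt])
      show "integrable lebesgue (\<lambda>x. \<bar>\<phi> x * (partial_deriv i (?S (Suc n)) x * \<eta> x)\<bar>)"
        by (rule integrable_abs[OF int2])
      show "integrable lebesgue ?R"
        by (intro integrable_mult_right Bochner_Integration.integrable_add integrable_divide phi2Q Qi)
    qed
    also have "\<dots> = M * B * 4 * (\<alpha> n / s + s * (2 * pi))"
    proof -
      have i1: "integrable lebesgue (\<lambda>x. (indicator \<Omega> x *\<^sub>R (norm (\<phi> x))\<^sup>2) * indicator (Q n) x / s)"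
        by (intro integrable_divide phi2Q)
      have i2: "integrable lebesgue (\<lambda>x. s * (?n * indicator (Q n) x))"
        by (intro integrable_mult_right Qi)
      show ?thesis
        by (simp only: integral_mult_right_zero Bochner_Integration.integral_add[OF i1 i2] integral_divide_zero
            Qv[unfolded integral_mult_right_zero] \<alpha>_def)
    qed
    \<comment> \<open>Enlarging both coefficients to 2 pi + 1 brings the bound into the form c
      (\<alpha> n / s + s).\<close>
    also have "\<dots> \<le> M * B * 4 * ((2 * pi + 1) * (\<alpha> n / s) + s * (2 * pi + 1))"
    proof -
      have "\<alpha> n / s \<ge> 0" using s by (simp add: \<alpha>_def)
      then have "1 * (\<alpha> n / s) \<le> (2 * pi + 1) * (\<alpha> n / s)" by (intro mult_right_mono) auto
      moreover have "s * (2 * pi) \<le> s * (2 * pi + 1)" using s by (intro mult_left_mono) auto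
      ultimately have "\<alpha> n / s + s * (2 * pi) \<le> (2 * pi + 1) * (\<alpha> n / s) + s * (2 * pi + 1)"
        using add_mono by fastforce
      then show ?thesis using M(1) B(1) by (intro mult_left_mono) auto
    qed
    also have "\<dots> = M * B * (2 * pi + 1) * 4 * (\<alpha> n / s + s)" by (simp add: distrib_left mult_ac)
    finally show "\<bar>X (Suc n)\<bar> \<le> M * B * (2 * pi + 1) * 4 * (\<alpha> n / s + s)" .
  qed
  have split: "(\<integral>x. (\<phi> x * partial_deriv i \<eta> x) * ?S (Suc n) x \<partial>lebesgue) + X (Suc n)
      = - (\<integral>x. ((p x \<bullet> i) * \<eta> x) * ?S (Suc n) x \<partial>lebesgue)" for n
  proof -
    have "(\<integral>x. \<phi> x * (?S (Suc n) x * partial_deriv i \<eta> x) \<partial>lebesgue) + X (Suc n)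
      = (\<integral>x. \<phi> x * partial_deriv i (\<lambda>x. ?S (Suc n) x * \<eta> x) x \<partial>lebesgue)"
      unfolding X_def dS distrib_left
      by (rule Bochner_Integration.integral_add[OF int3 int2, symmetric])
    also have "\<dots> = - (\<integral>x. (p x \<bullet> i) * (?S (Suc n) x * \<eta> x) \<partial>lebesgue)"
      by (rule id[OF S i]) simp
    finally show ?thesis by (simp add: mult_ac)
  qed
  from tendsto_add[OF LIMSEQ_Suc[OF L1] X0]
  have "(\<lambda>n. - (\<integral>x. ((p x \<bullet> i) * \<eta> x) * ?S (Suc n) x \<partial>lebesgue)) \<longlonglongrightarrow> (\<integral>x. \<phi> x * partial_deriv i \<eta> x \<partial>lebesgue) + 0"
    by (simp only: split)
  then show "(\<integral>x. \<phi> x * partial_deriv i \<eta> x \<partial>lebesgue) = - (\<integral>x. (p x \<bullet> i) * \<eta> x \<partial>lebesgue)"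
    using LIMSEQ_unique[OF _ tendsto_minus[OF LIMSEQ_Suc[OF L2]]] by simp
qed

text \<open>On the dyadic annulus (1/2)^(k+1) < |x| \<le> (1/2)^k the integrand is at most
  \<open>c k * 4 ^ (k + 1)\<close>, while the disc of radius (1/2)^k has area pi / 4^k. What remains
  is a multiple of the series of (ln a + k ln 2) powr (- b), convergent since b > 1. Exponent 2
  serves the weight of the eigenvalue problem, exponent 2 - 2 \<alpha> the gradient of the
  barrier.\<close>

lemma log_weight_powr_integrable:
  assumes a: "a > 1" and b: "b > 1"
  shows "integrable lebesgue (\<lambda>x::real^2. indicator (cball 0 1) x * (ln (a / norm x) powr (- b) / (norm x)\<^sup>2))"
proof -
  define f where "f x = indicator (cball 0 1) x * (ln (a / norm x) powr (- b) / (norm x)\<^sup>2)" for x :: "real^2"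
  define c where "c k = (ln a + real k * ln 2) powr (- b)" for k :: nat
  have lna: "ln a > 0" using a by simp
  have pos: "ln a + real k * ln 2 > 0" for k using lna by (simp add: add_pos_nonneg)
  have summ: "summable c"
  proof (rule summable_comparison_test)
    show "summable (\<lambda>k. ln 2 powr (- b) * real k powr (- b))"
      using b by (intro summable_mult) (simp add: summable_real_powr_iff)
    have "norm (c k) \<le> ln 2 powr (- b) * real k powr (- b)" if "k \<ge> 1" for k
    proof -
      have "c k \<le> (real k * ln 2) powr (- b)"
        unfolding c_def using that lna b by (intro powr_mono2') auto
      then show ?thesis using that by (simp add: c_def powr_mult mult.commute)
    qed
    then show "\<exists>N. \<forall>n\<ge>N. norm (c n) \<le> ln 2 powr (- b) * real n powr (- b)" by blast
  qed
  let ?A = "\<lambda>k. cball (0::real^2) ((1/2) ^ k)"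
  have fb: "ennreal (f x) \<le> (\<Sum>k. ennreal (c k * 4 ^ (k + 1)) * indicator (?A k) x)" for x
  proof (cases "x = 0 \<or> x \<notin> cball 0 1")
    case True
    then show ?thesis by (auto simp: f_def)
  next
    case False
    then have x: "norm x > 0" "norm x \<le> 1" by auto
    \<comment> \<open>The least such k also satisfies |x| \<le> (1/2)^k: for k > 0 by minimality,
      for k = 0 since |x| \<le> 1.\<close>
    define k where "k = (LEAST k. (1/2) ^ (k + 1) < norm x)"
    obtain k0 where "(1/2) ^ k0 < norm x" using x(1) real_arch_pow_inv[of "norm x" "1/2"] by auto
    moreover have "(1/2) ^ (k0 + 1) \<le> (1/2 :: real) ^ k0" by (rule power_decreasing) auto
    ultimately have "(1/2) ^ (k0 + 1) < norm x" by (rule le_less_trans[rotated])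
    then have k1: "(1/2) ^ (k + 1) < norm x" unfolding k_def by (rule LeastI)
    have k2: "norm x \<le> (1/2) ^ k"
    proof (cases k)
      case (Suc j)
      then show ?thesis using not_less_Least[of j "\<lambda>k. (1/2) ^ (k + 1) < norm x"] by (simp add: k_def)
    qed (use x in simp)
    have "ln a + real k * ln 2 = ln (a * 2 ^ k)" using a by (simp add: ln_mult ln_realpow)
    also have "\<dots> \<le> ln (a / norm x)"
    proof (rule ln_mono)
      have "a * norm x * 2 ^ k \<le> a * (1/2) ^ k * 2 ^ k" using k2 a by (intro mult_right_mono mult_left_mono) auto
      then show "a * 2 ^ k \<le> a / norm x" using x(1) by (simp add: field_simps)
    qed (use a x in auto)
    finally have l: "ln (a / norm x) powr (- b) \<le> c k"
      unfolding c_def using pos b by (intro powr_mono2') auto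
    have "((1/2) ^ (k + 1))\<^sup>2 \<le> (norm x)\<^sup>2" using k1 by (intro power_mono) auto
    then have "1 / (norm x)\<^sup>2 \<le> 1 / ((1/2) ^ (k + 1))\<^sup>2" using x(1) by (intro divide_left_mono) auto
    also have "\<dots> = 4 ^ (k + 1)" by (simp add: power_divide power2_eq_square flip: power_mult_distrib)
    finally have "ln (a / norm x) powr (- b) * (1 / (norm x)\<^sup>2) \<le> c k * 4 ^ (k + 1)"
      using l by (intro mult_mono) (auto simp: c_def)
    then have "ennreal (f x) \<le> ennreal (c k * 4 ^ (k + 1)) * indicator (?A k) x"
      using x k2 by (auto simp: f_def indicator_def intro!: ennreal_leI)
    also have "\<dots> \<le> (\<Sum>k. ennreal (c k * 4 ^ (k + 1)) * indicator (?A k) x)"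
    proof -
      define g where "g j = ennreal (c j * 4 ^ (j + 1)) * indicator (?A j) x" for j
      have "g k \<le> suminf g" using sum_le_suminf[of g "{k}"] by simp
      then show ?thesis unfolding g_def .
    qed
    finally show ?thesis .
  qed
  have "(\<integral>\<^sup>+x. ennreal (f x) \<partial>lebesgue) \<le> (\<integral>\<^sup>+x. (\<Sum>k. ennreal (c k * 4 ^ (k + 1)) * indicator (?A k) x) \<partial>lebesgue)"
    by (intro nn_integral_mono fb)
  also have "\<dots> = (\<Sum>k. \<integral>\<^sup>+x. ennreal (c k * 4 ^ (k + 1)) * indicator (?A k) x \<partial>lebesgue)"
    by (intro nn_integral_suminf borel_measurable_times_ennreal borel_measurable_const borel_measurable_indicator) simp
  also have "\<dots> = (\<Sum>k. ennreal (4 * pi * c k))"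
  proof (rule suminf_cong)
    fix k
    have "emeasure lebesgue (?A k) = ennreal (pi * ((1/2) ^ k)\<^sup>2)"
      using measure_cball_real2[of "(1/2) ^ k"] lmeasurable_cball[of "0::real^2" "(1/2) ^ k"]
      by (metis emeasure_eq_measure2 zero_le_divide_1_iff zero_le_numeral zero_le_power)
    then have "(\<integral>\<^sup>+x. ennreal (c k * 4 ^ (k + 1)) * indicator (?A k) x \<partial>lebesgue) = ennreal (c k * 4 ^ (k + 1)) * ennreal (pi * ((1/2) ^ k)\<^sup>2)"
      by (subst nn_integral_cmult_indicator) auto
    also have "\<dots> = ennreal (c k * 4 ^ (k + 1) * (pi * ((1/2) ^ k)\<^sup>2))"
      by (rule ennreal_mult[symmetric]) (auto simp: c_def)
    also have "c k * 4 ^ (k + 1) * (pi * ((1/2) ^ k)\<^sup>2) = 4 * pi * c k"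
      by (simp add: power_divide power2_eq_square flip: power_mult_distrib)
    finally show "(\<integral>\<^sup>+x. ennreal (c k * 4 ^ (k + 1)) * indicator (?A k) x \<partial>lebesgue) = ennreal (4 * pi * c k)" .
  qed
  also have "\<dots> = ennreal (\<Sum>k. 4 * pi * c k)"
    by (intro suminf_ennreal2 summable_mult summ) (simp add: c_def)
  also have "\<dots> < \<infinity>" by simp
  finally have fin: "(\<integral>\<^sup>+x. ennreal (f x) \<partial>lebesgue) < \<infinity>" .
  have "f \<in> borel_measurable borel"
    unfolding f_def[abs_def]
    by (intro borel_measurable_times borel_measurable_indicator borel_measurable_divide powr_real_measurable
        borel_measurable_ln borel_measurable_power borel_measurable_norm borel_measurable_const) auto
  then have "f \<in> borel_measurable lebesgue" by (intro measurable_completion) simp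
  then have "integrable lebesgue f"
    using fin by (intro integrableI_nonneg) (auto simp: f_def)
  then show ?thesis by (simp add: f_def[abs_def])
qed

section \<open>The Euler--Lagrange equation\<close>

lemma integrable_product_of_squares:
  fixes f g :: "'a \<Rightarrow> 'b::euclidean_space"
  assumes "f \<in> borel_measurable M" "g \<in> borel_measurable M"
    "integrable M (\<lambda>x. (norm (f x))\<^sup>2)" "integrable M (\<lambda>x. (norm (g x))\<^sup>2)"
  shows "integrable M (\<lambda>x. f x \<bullet> g x)"
proof (rule Bochner_Integration.integrable_bound)
  show "integrable M (\<lambda>x. (norm (f x))\<^sup>2 + (norm (g x))\<^sup>2)" using assms by simp
  have "\<bar>f x \<bullet> g x\<bar> \<le> (norm (f x))\<^sup>2 + (norm (g x))\<^sup>2" for x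
  proof -
    have "0 \<le> (norm (f x))\<^sup>2 + (norm (g x))\<^sup>2 - 2 * (norm (f x) * norm (g x))"
      using zero_le_power2[of "norm (f x) - norm (g x)"] by (simp add: power2_diff)
    moreover have "0 \<le> norm (f x) * norm (g x)" by simp
    ultimately show ?thesis using Cauchy_Schwarz_ineq2[of "f x" "g x"] by linarith
  qed
  then show "AE x in M. norm (f x \<bullet> g x) \<le> norm ((norm (f x))\<^sup>2 + (norm (g x))\<^sup>2)" by simp
qed (use assms in measurable)

lemma norm_square_add_scaleR:
  fixes x y :: "'a::real_inner"
  shows "(norm (x + c *\<^sub>R y))\<^sup>2 = (norm x)\<^sup>2 + 2 * c * (x \<bullet> y) + c\<^sup>2 * (norm y)\<^sup>2"
  unfolding power2_norm_eq_inner
  by (simp only: inner_add_left inner_add_right inner_scaleR_left inner_scaleR_right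
      inner_commute[of y x] power2_eq_square) (simp only: algebra_simps)

lemma L2_on_add_scaleR:
  fixes f g :: "'a::euclidean_space \<Rightarrow> 'b::euclidean_space"
  assumes "L2_on \<Omega> f" "L2_on \<Omega> g"
  shows "L2_on \<Omega> (\<lambda>x. f x + c *\<^sub>R g x)"
proof -
  have m: "f \<in> borel_measurable (lebesgue_on \<Omega>)" "g \<in> borel_measurable (lebesgue_on \<Omega>)"
    and i: "integrable (lebesgue_on \<Omega>) (\<lambda>x. (norm (f x))\<^sup>2)" "integrable (lebesgue_on \<Omega>) (\<lambda>x. (norm (g x))\<^sup>2)"
    using assms by (auto simp: L2_on_def)
  have "(norm (f x + c *\<^sub>R g x))\<^sup>2 = (norm (f x))\<^sup>2 + 2 * c * (f x \<bullet> g x) + c\<^sup>2 * (norm (g x))\<^sup>2" for x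
    by (rule norm_square_add_scaleR)
  then have "integrable (lebesgue_on \<Omega>) (\<lambda>x. (norm (f x + c *\<^sub>R g x))\<^sup>2)"
    using i integrable_product_of_squares[OF m i] by simp
  then show ?thesis using m by (simp add: L2_on_def)
qed

lemma L2_on_const:
  assumes "open \<Omega>" "bounded \<Omega>" shows "L2_on \<Omega> (\<lambda>x. c)"
  using finite_measure_lebesgue_on[of \<Omega>] lmeasurable_open[OF assms(2,1)]
  by (auto simp: L2_on_def intro: finite_measure.integrable_const)

text \<open>The constant \<open>c\<close> will restore the zero weighted mean of a variation. It
  leaves the gradient unchanged because derivatives of test functions have integral zero.\<close>

lemma is_weak_gradient_add_scaleR:
  fixes \<Omega> :: "'a::euclidean_space set"
  assumes \<Omega>: "open \<Omega>" and L2: "L2_on \<Omega> u" "L2_on \<Omega> g" "L2_on \<Omega> \<phi>" "L2_on \<Omega> p"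
    and w: "is_weak_gradient \<Omega> u g" "is_weak_gradient \<Omega> \<phi> p"
  shows "is_weak_gradient \<Omega> (\<lambda>x. u x + s * (\<phi> x - c)) (\<lambda>x. g x + s *\<^sub>R p x)"
  unfolding is_weak_gradient_iff[OF \<Omega>]
proof (intro ballI)
  fix \<eta> and i :: 'a assume eta: "\<eta> \<in> test_functions \<Omega>" and i: "i \<in> Basis"
  have li: "locally_integrable \<Omega> u" "locally_integrable \<Omega> g" "locally_integrable \<Omega> \<phi>" "locally_integrable \<Omega> p"
    using L2_on_imp_locally_integrable[OF _ \<Omega> order_refl] L2 by auto
  have eta': "partial_deriv i \<eta> \<in> test_functions \<Omega>" by (rule test_functions_partial_deriv[OF eta i])
  have iu: "integrable lebesgue (\<lambda>x. u x * partial_deriv i \<eta> x)" "integrable lebesgue (\<lambda>x. \<phi> x * partial_deriv i \<eta> x)"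
    using integrable_locally_integrable_times_test[OF li(1) eta', of 1] integrable_locally_integrable_times_test[OF li(3) eta', of 1] by auto
  have ig: "integrable lebesgue (\<lambda>x. (g x \<bullet> i) * \<eta> x)" "integrable lebesgue (\<lambda>x. (p x \<bullet> i) * \<eta> x)"
    using integrable_locally_integrable_times_test[OF li(2) eta] integrable_locally_integrable_times_test[OF li(4) eta] by auto
  have ic: "integrable lebesgue (partial_deriv i \<eta>)"
    using integrable_continuous_times_test[OF \<Omega> continuous_on_const eta', of 1] by simp
  have "(\<integral>x. (u x + s * (\<phi> x - c)) * partial_deriv i \<eta> x \<partial>lebesgue)
      = (\<integral>x. u x * partial_deriv i \<eta> x + s * (\<phi> x * partial_deriv i \<eta> x) - s * c * partial_deriv i \<eta> x \<partial>lebesgue)"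
    by (simp add: algebra_simps)
  also have "\<dots> = (\<integral>x. u x * partial_deriv i \<eta> x \<partial>lebesgue) + s * (\<integral>x. \<phi> x * partial_deriv i \<eta> x \<partial>lebesgue)
      - s * c * (\<integral>x. partial_deriv i \<eta> x \<partial>lebesgue)"
    using iu ic by simp
  also have "\<dots> = - (\<integral>x. (g x \<bullet> i) * \<eta> x \<partial>lebesgue) - s * (\<integral>x. (p x \<bullet> i) * \<eta> x \<partial>lebesgue)"
    using w eta i integral_partial_deriv_eq_0[OF test_functions_mono[OF eta subset_UNIV] i]
    unfolding is_weak_gradient_iff[OF \<Omega>] by simp
  also have "\<dots> = - (\<integral>x. ((g x + s *\<^sub>R p x) \<bullet> i) * \<eta> x \<partial>lebesgue)"
    using ig by (simp add: inner_add_left distrib_right mult.assoc)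
  finally show "(\<integral>x. (u x + s * (\<phi> x - c)) * partial_deriv i \<eta> x \<partial>lebesgue) = - (\<integral>x. ((g x + s *\<^sub>R p x) \<bullet> i) * \<eta> x \<partial>lebesgue)" .
qed

text \<open>The choice s = - b / (|r| + 1) lets the linear part win over the quadratic one, whatever
  the sign of \<open>r\<close>.\<close>

lemma linear_coefficient_zero:
  fixes b r :: real
  assumes "\<And>s. 0 \<le> 2 * s * b + s\<^sup>2 * r"
  shows "b = 0"
proof (rule ccontr)
  assume b: "b \<noteq> 0"
  define s where "s = - b / (\<bar>r\<bar> + 1)"
  have r1: "\<bar>r\<bar> + 1 > 0" by simp
  have "s\<^sup>2 * r \<le> s\<^sup>2 * (\<bar>r\<bar> + 1)" by (intro mult_left_mono) auto
  also have "\<dots> = b\<^sup>2 / (\<bar>r\<bar> + 1)" using r1 by (simp add: s_def power_divide power2_eq_square)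
  finally have "2 * s * b + s\<^sup>2 * r \<le> - (b\<^sup>2 / (\<bar>r\<bar> + 1))"
    using r1 by (simp add: s_def power2_eq_square)
  moreover have "b\<^sup>2 / (\<bar>r\<bar> + 1) > 0" using b r1 by simp
  ultimately show False using assms[of s] by linarith
qed

text \<open>The case of exponent 2 in \<open>log_weight_powr_integrable\<close>. Positivity is
  claimed only almost everywhere since \<open>log_weight a 0 = 0\<close> by division by
  zero.\<close>

lemma log_weight_integrable:
  assumes "a > 1" "open \<Omega>" "\<Omega> \<subseteq> cball 0 1"
  shows "integrable (lebesgue_on \<Omega>) (log_weight a)" "AE x in lebesgue_on \<Omega>. log_weight a x > 0"
    "log_weight a \<in> borel_measurable (lebesgue_on \<Omega>)"
proof -
  have \<Omega>m: "\<Omega> \<in> sets lebesgue" using assms by auto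
  have pos: "ln (a / norm x) > 0" if "x \<in> \<Omega>" "x \<noteq> 0" for x
  proof -
    have "norm x \<le> 1" using that assms by auto
    then have "1 < a / norm x" using that assms(1) by (simp add: less_divide_eq)
    then show ?thesis by simp
  qed
  have "integrable lebesgue (\<lambda>x::real^2. (indicator (cball 0 1) x * (ln (a / norm x) powr (- 2) / (norm x)\<^sup>2)) * indicator \<Omega> x)"
    by (rule integrable_mult_bounded[OF log_weight_powr_integrable[OF assms(1)] borel_measurable_indicator[OF \<Omega>m], of _ 1])
      (auto simp: indicator_def)
  moreover have "(indicator (cball 0 1) x * (ln (a / norm x) powr (- 2) / (norm x)\<^sup>2)) * indicator \<Omega> x
      = indicator \<Omega> x *\<^sub>R log_weight a x" for x :: "real^2"
  proof (cases "x \<in> \<Omega> \<and> x \<noteq> 0")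
    case True
    then have "ln (a / norm x) powr (- 2) = 1 / (ln (a / norm x))\<^sup>2"
      using pos[of x] by (simp add: powr_minus_divide powr_numeral)
    then show ?thesis using True assms(3) by (auto simp: log_weight_def indicator_def)
  qed (auto simp: log_weight_def indicator_def)
  ultimately show i: "integrable (lebesgue_on \<Omega>) (log_weight a)"
    using \<Omega>m by (simp add: integrable_restrict_space)
  then show "log_weight a \<in> borel_measurable (lebesgue_on \<Omega>)" by (rule borel_measurable_integrable)
  have "AE x in lebesgue. x \<in> \<Omega> \<longrightarrow> log_weight a x > 0"
    using AE_lebesgue_neq[of 0]
  proof eventually_elim
    case (elim x)
    then show ?case using pos[of x] by (auto simp: log_weight_def zero_less_mult_iff)
  qed
  then show "AE x in lebesgue_on \<Omega>. log_weight a x > 0"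
    using \<Omega>m by (subst AE_restrict_space_iff) auto
qed

lemma log_weight_nonneg: "log_weight a x \<ge> 0"
  by (simp add: log_weight_def)

lemma integrable_weighted_product:
  fixes f h :: "'a \<Rightarrow> real"
  assumes "f \<in> borel_measurable M" "h \<in> borel_measurable M" "w \<in> borel_measurable M" "\<And>x. w x \<ge> 0"
    "integrable M (\<lambda>x. (f x)\<^sup>2 * w x)" "integrable M (\<lambda>x. (h x)\<^sup>2 * w x)"
  shows "integrable M (\<lambda>x. f x * h x * w x)"
proof (rule Bochner_Integration.integrable_bound)
  show "integrable M (\<lambda>x. (f x)\<^sup>2 * w x + (h x)\<^sup>2 * w x)" using assms by simp
  have "\<bar>f x * h x\<bar> * w x \<le> ((f x)\<^sup>2 + (h x)\<^sup>2) * w x" for x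
  proof (rule mult_right_mono[OF _ assms(4)])
    have "0 \<le> (f x)\<^sup>2 + (h x)\<^sup>2 - 2 * \<bar>f x * h x\<bar>"
      using zero_le_power2[of "\<bar>f x\<bar> - \<bar>h x\<bar>"] by (simp add: power2_diff abs_mult)
    then show "\<bar>f x * h x\<bar> \<le> (f x)\<^sup>2 + (h x)\<^sup>2" using abs_ge_zero[of "f x * h x"] by linarith
  qed
  then show "AE x in M. norm (f x * h x * w x) \<le> norm ((f x)\<^sup>2 * w x + (h x)\<^sup>2 * w x)"
    using assms(4) by (intro AE_I2) (simp add: abs_mult distrib_right)
qed (use assms in measurable)

lemma H1_I: "L2_on \<Omega> v \<Longrightarrow> L2_on \<Omega> q \<Longrightarrow> is_weak_gradient \<Omega> v q \<Longrightarrow> v \<in> H1 \<Omega>"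
  by (auto simp: H1_def)

lemma weak_gradient_properties:
  assumes "v \<in> H1 \<Omega>"
  shows "L2_on \<Omega> (weak_gradient \<Omega> v)" "is_weak_gradient \<Omega> v (weak_gradient \<Omega> v)"
proof -
  have "\<exists>g. L2_on \<Omega> g \<and> is_weak_gradient \<Omega> v g" using assms by (auto simp: H1_def)
  from someI_ex[OF this] show "L2_on \<Omega> (weak_gradient \<Omega> v)" "is_weak_gradient \<Omega> v (weak_gradient \<Omega> v)"
    by (auto simp: weak_gradient_def)
qed

text \<open>Frees the quotient from the choice made in \<open>weak_gradient\<close>.\<close>

lemma rayleigh_quotient_eq:
  fixes \<Omega> :: "(real^2) set"
  assumes "open \<Omega>" "L2_on \<Omega> v" "L2_on \<Omega> q" "is_weak_gradient \<Omega> v q"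
  shows "rayleigh_quotient \<Omega> a v =
    (\<integral>x. (norm (q x))\<^sup>2 \<partial>lebesgue_on \<Omega>) / (\<integral>x. (v x)\<^sup>2 * log_weight a x \<partial>lebesgue_on \<Omega>)"
proof -
  note w = weak_gradient_properties[OF H1_I[OF assms(2-4)]]
  have "(\<integral>x. (norm (weak_gradient \<Omega> v x))\<^sup>2 \<partial>lebesgue_on \<Omega>) = (\<integral>x. (norm (q x))\<^sup>2 \<partial>lebesgue_on \<Omega>)"
  proof (rule integral_cong_AE)
    show "AE x in lebesgue_on \<Omega>. (norm (weak_gradient \<Omega> v x))\<^sup>2 = (norm (q x))\<^sup>2"
      using weak_gradient_unique[OF assms(1) w assms(3,4)] by eventually_elim simp
  qed (use w(1) assms(3) in \<open>auto simp: L2_on_def\<close>)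
  then show ?thesis by (simp add: rayleigh_quotient_def)
qed

text \<open>\<open>u\<close> is varied in the direction \<phi> - c with c the weighted mean of
  \<phi>, which keeps the constraint. Minimality makes a quadratic polynomial in s nonnegative; its
  constant term vanishes since \<open>u\<close> attains the infimum, so its linear coefficient is
  zero.\<close>

lemma euler_lagrange:
  fixes \<Omega> :: "(real^2) set"
  assumes \<Omega>: "open \<Omega>" "bounded \<Omega>" "\<Omega> \<subseteq> cball 0 1" and a: "a > 1"
    and ev: "0 < second_eigenvalue \<Omega> a" and ef: "second_eigenfunction \<Omega> a u"
  defines "g \<equiv> weak_gradient \<Omega> u"
  shows "L2_on \<Omega> u" "L2_on \<Omega> g" "is_weak_gradient \<Omega> u g"
    "integrable (lebesgue_on \<Omega>) (\<lambda>x. (u x)\<^sup>2 * log_weight a x)"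
    "\<lbrakk>L2_on \<Omega> \<phi>; L2_on \<Omega> p; is_weak_gradient \<Omega> \<phi> p; integrable (lebesgue_on \<Omega>) (\<lambda>x. (\<phi> x)\<^sup>2 * log_weight a x)\<rbrakk>
     \<Longrightarrow> (\<integral>x. g x \<bullet> p x \<partial>lebesgue_on \<Omega>) = second_eigenvalue \<Omega> a * (\<integral>x. u x * \<phi> x * log_weight a x \<partial>lebesgue_on \<Omega>)"
proof -
  let ?M = "lebesgue_on \<Omega>" and ?w = "log_weight a" and ?l = "second_eigenvalue \<Omega> a"
  have adm: "u \<in> admissible \<Omega> a" and rq: "rayleigh_quotient \<Omega> a u = ?l"
    using ef by (auto simp: second_eigenfunction_def)
  have uH1: "u \<in> H1 \<Omega>" and un0: "\<not> (AE x in ?M. u x = 0)" and u0: "(\<integral>x. u x * ?w x \<partial>?M) = 0"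
    using adm by (auto simp: admissible_def)
  show u2: "L2_on \<Omega> u" using uH1 by (simp add: H1_def)
  show g2: "L2_on \<Omega> g" and gw: "is_weak_gradient \<Omega> u g"
    using weak_gradient_properties[OF uH1] by (auto simp: g_def)
  have rqu: "?l = (\<integral>x. (norm (g x))\<^sup>2 \<partial>?M) / (\<integral>x. (u x)\<^sup>2 * ?w x \<partial>?M)"
    using rq rayleigh_quotient_eq[OF \<Omega>(1) u2 g2 gw] by simp
  \<comment> \<open>A non-integrable \<open>u^2 w\<close> would have integral 0 and, by x / 0 = 0,
    Rayleigh quotient 0; positivity of the eigenvalue excludes this. Finiteness of the weighted norm
    of \<open>u\<close> is obtained here in place of an appeal to the Hardy inequality.\<close>
  then have den: "(\<integral>x. (u x)\<^sup>2 * ?w x \<partial>?M) \<noteq> 0" using ev by auto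
  then show u2w: "integrable ?M (\<lambda>x. (u x)\<^sup>2 * ?w x)"
    using not_integrable_integral_eq by blast
  have num: "(\<integral>x. (norm (g x))\<^sup>2 \<partial>?M) = ?l * (\<integral>x. (u x)\<^sup>2 * ?w x \<partial>?M)"
    using rqu den by (simp add: field_simps)
  note w = log_weight_integrable[OF a \<Omega>(1,3)]
  have um: "u \<in> borel_measurable ?M" using u2 by (simp add: L2_on_def)
  assume phi2: "L2_on \<Omega> \<phi>" and p2: "L2_on \<Omega> p" and pw: "is_weak_gradient \<Omega> \<phi> p"
    and phi2w: "integrable ?M (\<lambda>x. (\<phi> x)\<^sup>2 * ?w x)"
  have phim: "\<phi> \<in> borel_measurable ?M" using phi2 by (simp add: L2_on_def)
  note prod = integrable_weighted_product[OF _ _ w(3) log_weight_nonneg]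
  have c2w: "integrable ?M (\<lambda>x. c\<^sup>2 * ?w x)" for c using w(1) by simp
  have uw: "integrable ?M (\<lambda>x. u x * ?w x)" using prod[OF um borel_measurable_const[of 1] u2w] w(1) by simp
  have phiw: "integrable ?M (\<lambda>x. \<phi> x * ?w x)" using prod[OF phim borel_measurable_const[of 1] phi2w] w(1) by simp
  have uphiw: "integrable ?M (\<lambda>x. u x * \<phi> x * ?w x)" by (rule prod[OF um phim u2w phi2w])
  define m where "m = (\<integral>x. ?w x \<partial>?M)"
  \<comment> \<open>The weight is positive almost everywhere; total weight 0 would make the domain a
    null set and hence \<open>u\<close> zero almost everywhere.\<close>
  have m: "m \<noteq> 0"
  proof
    assume "m = 0"
    then have "AE x in ?M. ?w x = 0"
      using integral_nonneg_eq_0_iff_AE[OF w(1)] log_weight_nonneg by (simp add: m_def)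
    then have "AE x in ?M. u x = 0" using w(2) by eventually_elim simp
    then show False using un0 by simp
  qed
  define c where "c = (\<integral>x. \<phi> x * ?w x \<partial>?M) / m"
  have psi2w: "integrable ?M (\<lambda>x. (\<phi> x - c)\<^sup>2 * ?w x)"
    and upsiw: "integrable ?M (\<lambda>x. u x * (\<phi> x - c) * ?w x)"
    and psiw: "integrable ?M (\<lambda>x. (\<phi> x - c) * ?w x)"
  proof -
    have "integrable ?M (\<lambda>x. (\<phi> x)\<^sup>2 * ?w x - 2 * c * (\<phi> x * ?w x) + c\<^sup>2 * ?w x)"
      using phi2w phiw c2w by simp
    then show "integrable ?M (\<lambda>x. (\<phi> x - c)\<^sup>2 * ?w x)"
      by (simp add: power2_diff algebra_simps)
    have "integrable ?M (\<lambda>x. u x * \<phi> x * ?w x - c * (u x * ?w x))"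
      using uphiw uw by simp
    then show "integrable ?M (\<lambda>x. u x * (\<phi> x - c) * ?w x)" by (simp add: algebra_simps)
    have "integrable ?M (\<lambda>x. \<phi> x * ?w x - c * ?w x)" using phiw w(1) by simp
    then show "integrable ?M (\<lambda>x. (\<phi> x - c) * ?w x)" by (simp add: algebra_simps)
  qed
  have psi0: "(\<integral>x. (\<phi> x - c) * ?w x \<partial>?M) = 0"
  proof -
    have "(\<integral>x. (\<phi> x - c) * ?w x \<partial>?M) = (\<integral>x. \<phi> x * ?w x \<partial>?M) - c * m"
      using phiw w(1) by (simp add: left_diff_distrib m_def)
    then show ?thesis using m by (simp add: c_def)
  qed
  have ineq: "0 \<le> 2 * s * ((\<integral>x. g x \<bullet> p x \<partial>?M) - ?l * (\<integral>x. u x * (\<phi> x - c) * ?w x \<partial>?M))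
     + s\<^sup>2 * ((\<integral>x. (norm (p x))\<^sup>2 \<partial>?M) - ?l * (\<integral>x. (\<phi> x - c)\<^sup>2 * ?w x \<partial>?M))" for s
  proof -
    define v where "v x = u x + s * (\<phi> x - c)" for x
    define q where "q x = g x + s *\<^sub>R p x" for x
    have q2: "L2_on \<Omega> q" unfolding q_def by (rule L2_on_add_scaleR[OF g2 p2])
    have v2: "L2_on \<Omega> v"
      using L2_on_add_scaleR[OF L2_on_add_scaleR[OF u2 phi2, of s] L2_on_const[OF \<Omega>(1,2), of 1], of "- (s * c)"]
      by (simp add: v_def[abs_def] algebra_simps)
    have vw: "is_weak_gradient \<Omega> v q"
      unfolding v_def q_def by (rule is_weak_gradient_add_scaleR[OF \<Omega>(1) u2 g2 phi2 p2 gw pw])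
    have exp_v: "(v x)\<^sup>2 * ?w x = (u x)\<^sup>2 * ?w x + 2 * s * (u x * (\<phi> x - c) * ?w x) + s\<^sup>2 * ((\<phi> x - c)\<^sup>2 * ?w x)" for x
      by (simp add: v_def power2_eq_square algebra_simps)
    have v2w: "integrable ?M (\<lambda>x. (v x)\<^sup>2 * ?w x)"
      unfolding exp_v using u2w upsiw psi2w by simp
    have iv: "(\<integral>x. (v x)\<^sup>2 * ?w x \<partial>?M) = (\<integral>x. (u x)\<^sup>2 * ?w x \<partial>?M) + 2 * s * (\<integral>x. u x * (\<phi> x - c) * ?w x \<partial>?M)
        + s\<^sup>2 * (\<integral>x. (\<phi> x - c)\<^sup>2 * ?w x \<partial>?M)"
      unfolding exp_v using u2w upsiw psi2w by simp
    have exp_q: "(norm (q x))\<^sup>2 = (norm (g x))\<^sup>2 + 2 * s * (g x \<bullet> p x) + s\<^sup>2 * (norm (p x))\<^sup>2" for x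
      unfolding q_def by (rule norm_square_add_scaleR)
    have gp: "integrable ?M (\<lambda>x. g x \<bullet> p x)"
      using g2 p2 by (intro integrable_product_of_squares) (auto simp: L2_on_def)
    have iq: "(\<integral>x. (norm (q x))\<^sup>2 \<partial>?M) = (\<integral>x. (norm (g x))\<^sup>2 \<partial>?M) + 2 * s * (\<integral>x. g x \<bullet> p x \<partial>?M)
        + s\<^sup>2 * (\<integral>x. (norm (p x))\<^sup>2 \<partial>?M)"
      unfolding exp_q using g2 p2 gp by (simp add: L2_on_def)
    \<comment> \<open>A variation that vanishes almost everywhere is not admissible, but its
      weighted norm is 0 and the inequality is trivial.\<close>
    have "?l * (\<integral>x. (v x)\<^sup>2 * ?w x \<partial>?M) \<le> (\<integral>x. (norm (q x))\<^sup>2 \<partial>?M)"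
    proof (cases "AE x in ?M. v x = 0")
      case True
      then have "AE x in ?M. (v x)\<^sup>2 * ?w x = 0" by eventually_elim simp
      then have "(\<integral>x. (v x)\<^sup>2 * ?w x \<partial>?M) = 0" by (rule integral_eq_zero_AE)
      then show ?thesis by simp
    next
      case False
      have "(\<integral>x. v x * ?w x \<partial>?M) = (\<integral>x. u x * ?w x + s * ((\<phi> x - c) * ?w x) \<partial>?M)"
        by (simp add: v_def algebra_simps)
      also have "\<dots> = 0" using uw psiw u0 psi0 by simp
      finally have "v \<in> admissible \<Omega> a"
        using H1_I[OF v2 q2 vw] False by (simp add: admissible_def)
      then have "?l \<le> rayleigh_quotient \<Omega> a v"
        unfolding second_eigenvalue_def
        by (intro cINF_lower bdd_belowI2[of _ 0])
          (auto simp: rayleigh_quotient_def log_weight_nonneg intro!: divide_nonneg_nonneg integral_nonneg_AE)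
      moreover have "(\<integral>x. (v x)\<^sup>2 * ?w x \<partial>?M) > 0"
      proof -
        have "(\<integral>x. (v x)\<^sup>2 * ?w x \<partial>?M) \<noteq> 0"
        proof
          assume "(\<integral>x. (v x)\<^sup>2 * ?w x \<partial>?M) = 0"
          then have "AE x in ?M. (v x)\<^sup>2 * ?w x = 0"
            using integral_nonneg_eq_0_iff_AE[OF v2w] log_weight_nonneg by simp
          then have "AE x in ?M. v x = 0" using w(2) by eventually_elim auto
          then show False using False by simp
        qed
        moreover have "(\<integral>x. (v x)\<^sup>2 * ?w x \<partial>?M) \<ge> 0"
          by (intro integral_nonneg_AE AE_I2) (simp add: log_weight_nonneg)
        ultimately show ?thesis by simp
      qed
      ultimately show ?thesis
        unfolding rayleigh_quotient_eq[OF \<Omega>(1) v2 q2 vw] by (simp add: pos_le_divide_eq)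
    qed
    then show ?thesis unfolding iv iq num by (simp add: algebra_simps)
  qed
  have "(\<integral>x. g x \<bullet> p x \<partial>?M) = ?l * (\<integral>x. u x * (\<phi> x - c) * ?w x \<partial>?M)"
    using linear_coefficient_zero[OF ineq] by simp
  also have "(\<integral>x. u x * (\<phi> x - c) * ?w x \<partial>?M) = (\<integral>x. u x * \<phi> x * ?w x - c * (u x * ?w x) \<partial>?M)"
    by (simp add: algebra_simps)
  also have "\<dots> = (\<integral>x. u x * \<phi> x * ?w x \<partial>?M)" using uphiw uw u0 by simp
  finally show "(\<integral>x. g x \<bullet> p x \<partial>?M) = ?l * (\<integral>x. u x * \<phi> x * ?w x \<partial>?M)" .
qed

section \<open>The comparison principle\<close>

text \<open>Chosen rational in the square of the positive part, so that it is C^1, bounded by 1, and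
  its derivative decays like the inverse cube; \<open>trunc'_decay\<close> rests on this
  decay.\<close>

definition soft_pos :: "real \<Rightarrow> real" where
  "soft_pos y = (max 0 y)\<^sup>2 / (1 + (max 0 y)\<^sup>2)"

definition soft_pos' :: "real \<Rightarrow> real" where
  "soft_pos' y = 2 * max 0 y / (1 + (max 0 y)\<^sup>2)\<^sup>2"

text \<open>A smooth bounded substitute for the truncation \<open>sgn z * (|z| - 1)\<^sub>+\<close>.\<close>

definition trunc :: "real \<Rightarrow> real" where
  "trunc z = soft_pos (z - 1) - soft_pos (- z - 1)"

definition trunc' :: "real \<Rightarrow> real" where
  "trunc' z = soft_pos' (z - 1) + soft_pos' (- z - 1)"

lemma one_plus_square_pos: "1 + (x::real)\<^sup>2 > 0"
  by (simp add: add_pos_nonneg)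

lemma soft_pos_DERIV: "(soft_pos has_real_derivative soft_pos' y) (at y)"
proof -
  have sq: "((\<lambda>y. (max 0 y)\<^sup>2) has_real_derivative 2 * max 0 y) (at y)" for y :: real
  proof -
    consider "y > 0" | "y < 0" | "y = 0" by linarith
    then show ?thesis
    proof cases
      case 1
      have "((\<lambda>y. y\<^sup>2) has_real_derivative 2 * max 0 y) (at y)"
        using 1 by (auto intro!: derivative_eq_intros)
      then show ?thesis
        by (rule has_field_derivative_transform_within_open[of _ _ _ "{0<..}"]) (use 1 in auto)
    next
      case 2
      have "((\<lambda>y. 0) has_real_derivative 2 * max 0 y) (at y)"
        using 2 by (auto intro!: derivative_eq_intros)
      then show ?thesis
        by (rule has_field_derivative_transform_within_open[of _ _ _ "{..<0}"]) (use 2 in auto)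
    next
      case 3
      have "((\<lambda>h. (max 0 h)\<^sup>2 / h) \<longlongrightarrow> 0) (at (0::real))"
      proof (rule Lim_null_comparison)
        show "\<forall>\<^sub>F h in at 0. norm ((max 0 h)\<^sup>2 / h) \<le> \<bar>h\<bar>"
          by (intro always_eventually allI) (auto simp: max_def power2_eq_square)
        show "((\<lambda>h. \<bar>h\<bar>) \<longlongrightarrow> 0) (at (0::real))" by (auto intro!: tendsto_eq_intros)
      qed
      then show ?thesis using 3 by (simp add: DERIV_def)
    qed
  qed
  have "((\<lambda>y. (max 0 y)\<^sup>2 / (1 + (max 0 y)\<^sup>2)) has_real_derivative
      (2 * max 0 y * (1 + (max 0 y)\<^sup>2) - (max 0 y)\<^sup>2 * (0 + 2 * max 0 y)) / ((1 + (max 0 y)\<^sup>2) * (1 + (max 0 y)\<^sup>2))) (at y)"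
    using one_plus_square_pos[of "max 0 y"] by (intro DERIV_divide sq DERIV_add DERIV_const) simp
  also have "2 * max 0 y * (1 + (max 0 y)\<^sup>2) - (max 0 y)\<^sup>2 * (0 + 2 * max 0 y) = 2 * max 0 y"
    by (simp add: algebra_simps)
  finally show ?thesis
    unfolding soft_pos_def[abs_def] soft_pos'_def by (simp only: power2_eq_square[symmetric])
qed

lemma soft_pos_bounds: "0 \<le> soft_pos y" "soft_pos y \<le> 1" "0 \<le> soft_pos' y"
  by (simp_all add: soft_pos_def soft_pos'_def add_nonneg_nonneg divide_le_eq_1 one_plus_square_pos)

lemma soft_pos_eq_0: "y \<le> 0 \<Longrightarrow> soft_pos y = 0" "y \<le> 0 \<Longrightarrow> soft_pos' y = 0"
  by (simp_all add: soft_pos_def soft_pos'_def max_def)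

lemma soft_pos_pos: "y > 0 \<Longrightarrow> soft_pos y > 0"
  by (simp add: soft_pos_def add_pos_nonneg)

lemma soft_pos'_decay: "y \<ge> 0 \<Longrightarrow> (1 + y)\<^sup>2 * soft_pos' y \<le> 2"
proof -
  assume y: "y \<ge> 0"
  define q where "q = 1 + y\<^sup>2"
  have q: "q > 0" using one_plus_square_pos by (simp add: q_def)
  have y2: "2 * y \<le> q" using zero_le_power2[of "y - 1"] by (simp add: q_def power2_diff)
  have "(1 + y)\<^sup>2 \<le> 2 * q" using y2 by (simp add: q_def power2_sum)
  then have "(1 + y)\<^sup>2 * (2 * y) \<le> (2 * q) * q" using y y2 q by (intro mult_mono) auto
  then have "(1 + y)\<^sup>2 * (2 * y) / q\<^sup>2 \<le> 2" using q by (simp add: divide_le_eq power2_eq_square)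
  then show ?thesis using y by (simp add: soft_pos'_def q_def max_def)
qed

lemma trunc_DERIV: "(trunc has_real_derivative trunc' z) (at z)"
proof -
  have "((\<lambda>z. soft_pos (z - 1)) has_real_derivative soft_pos' (z - 1) * 1) (at z)"
    by (rule DERIV_chain'[where f="\<lambda>z. z - 1", OF _ soft_pos_DERIV]) (auto intro!: derivative_eq_intros)
  moreover have "((\<lambda>z. soft_pos (- z - 1)) has_real_derivative soft_pos' (- z - 1) * (- 1)) (at z)"
    by (rule DERIV_chain'[where f="\<lambda>z. - z - 1", OF _ soft_pos_DERIV]) (auto intro!: derivative_eq_intros)
  ultimately have "((\<lambda>z. soft_pos (z - 1) - soft_pos (- z - 1)) has_real_derivative
      soft_pos' (z - 1) * 1 - soft_pos' (- z - 1) * (- 1)) (at z)" by (rule DERIV_diff)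
  then show ?thesis by (simp add: trunc_def[abs_def] trunc'_def)
qed

lemma continuous_soft_pos': "continuous_on UNIV soft_pos'"
  unfolding soft_pos'_def[abs_def]
  by (intro continuous_intros) (use one_plus_square_pos in \<open>auto simp: less_imp_neq[symmetric]\<close>)

lemma continuous_trunc: "continuous_on UNIV trunc" and continuous_trunc': "continuous_on UNIV trunc'"
proof -
  show "continuous_on UNIV trunc"
    by (intro continuous_at_imp_continuous_on ballI) (rule DERIV_isCont[OF trunc_DERIV])
  show "continuous_on UNIV trunc'"
    unfolding trunc'_def[abs_def]
    by (intro continuous_intros continuous_on_compose2[OF continuous_soft_pos']) auto
qed

lemma trunc_eq_0: "\<bar>z\<bar> \<le> 1 \<Longrightarrow> trunc z = 0" "\<bar>z\<bar> \<le> 1 \<Longrightarrow> trunc' z = 0"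
  by (auto simp: trunc_def trunc'_def soft_pos_eq_0)

lemma trunc_le_1: "\<bar>trunc z\<bar> \<le> 1"
  using soft_pos_bounds(1,2)[of "z - 1"] soft_pos_bounds(1,2)[of "- z - 1"] by (simp add: trunc_def)

lemma trunc_le: "\<bar>trunc z\<bar> \<le> \<bar>z\<bar>"
  using trunc_eq_0[of z] trunc_le_1[of z] by (cases "\<bar>z\<bar> \<le> 1") auto

lemma trunc'_nonneg: "0 \<le> trunc' z"
  by (simp add: trunc'_def soft_pos_bounds)

text \<open>With G = \<open>trunc\<close> and z = u / \<Psi>, the gradients of \<Psi> G(z) and
  \<Psi> z G(z) are combinations of \<nabla>u and \<nabla>\<Psi> with coefficients G', G - z G', G +
  z G' and - z^2 G'. This bound keeps all of them bounded, even where \<open>u\<close> is large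
  compared with \<Psi>.\<close>

lemma trunc'_decay: "z\<^sup>2 * trunc' z \<le> 2"
proof -
  consider "\<bar>z\<bar> \<le> 1" | "z > 1" | "z < - 1" by linarith
  then show ?thesis
  proof cases
    case 2
    then show ?thesis using soft_pos'_decay[of "z - 1"] by (simp add: trunc'_def soft_pos_eq_0)
  next
    case 3
    then show ?thesis using soft_pos'_decay[of "- z - 1"] by (simp add: trunc'_def soft_pos_eq_0)
  qed (simp add: trunc_eq_0)
qed

lemma trunc'_bounds: "trunc' z \<le> 2" "\<bar>z * trunc' z\<bar> \<le> 2"
proof -
  have "trunc' z \<le> z\<^sup>2 * trunc' z \<and> \<bar>z * trunc' z\<bar> \<le> z\<^sup>2 * trunc' z"
  proof (cases "\<bar>z\<bar> \<le> 1")
    case False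
    have le: "\<bar>z\<bar> \<le> z\<^sup>2"
      using mult_left_mono[of 1 "\<bar>z\<bar>" "\<bar>z\<bar>"] False by (simp add: power2_eq_square)
    moreover have "1 \<le> z\<^sup>2" using le False by linarith
    ultimately have "1 * trunc' z \<le> z\<^sup>2 * trunc' z" "\<bar>z\<bar> * trunc' z \<le> z\<^sup>2 * trunc' z"
      using trunc'_nonneg[of z] by (simp_all only: mult_right_mono)
    then show ?thesis using trunc'_nonneg[of z] by (simp add: abs_mult)
  qed (simp add: trunc_eq_0)
  then show "trunc' z \<le> 2" "\<bar>z * trunc' z\<bar> \<le> 2" using trunc'_decay[of z] by linarith+
qed

lemma trunc_sign: "0 \<le> z * trunc z" "\<bar>z\<bar> > 1 \<Longrightarrow> 0 < z * trunc z"
proof -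
  have pos: "0 < z * trunc z" if "\<bar>z\<bar> > 1" for z
  proof (cases "z > 1")
    case True
    then show ?thesis using soft_pos_pos[of "z - 1"] by (simp add: trunc_def soft_pos_eq_0)
  next
    case False
    then have "z < - 1" using that by linarith
    then show ?thesis using soft_pos_pos[of "- z - 1"] by (simp add: trunc_def soft_pos_eq_0 mult_neg_pos)
  qed
  show "\<bar>z\<bar> > 1 \<Longrightarrow> 0 < z * trunc z" by (rule pos)
  show "0 \<le> z * trunc z" using pos[of z] trunc_eq_0[of z] by (cases "\<bar>z\<bar> \<le> 1") auto
qed

definition laplacian :: "('a::euclidean_space \<Rightarrow> real) \<Rightarrow> 'a \<Rightarrow> real" where
  "laplacian f x = (\<Sum>i\<in>Basis. partial_deriv i (partial_deriv i f) x)"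

lemma L2_on_cong: "(\<And>x. x \<in> \<Omega> \<Longrightarrow> f x = g x) \<Longrightarrow> L2_on \<Omega> f \<longleftrightarrow> L2_on \<Omega> g"
  unfolding L2_on_def
  by (intro arg_cong2[where f="(\<and>)"] measurable_cong Bochner_Integration.integrable_cong refl) auto

lemma indicator_continuous_measurable:
  fixes f :: "'a::euclidean_space \<Rightarrow> 'b::euclidean_space"
  assumes "open S" "continuous_on S f"
  shows "(\<lambda>x. indicator S x *\<^sub>R f x) \<in> borel_measurable (lebesgue_on \<Omega>)"
proof -
  have "(\<lambda>x. indicator S x *\<^sub>R f x) \<in> borel_measurable borel"
    using assms by (intro borel_measurable_continuous_on_indicator) auto
  then have "(\<lambda>x. indicator S x *\<^sub>R f x) \<in> borel_measurable lebesgue"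
    by (intro measurable_completion) simp
  then show ?thesis by (rule measurable_restrict_space1)
qed

lemma L2_on_bounded_multiplier:
  fixes f :: "'a::euclidean_space \<Rightarrow> 'b::euclidean_space"
  assumes "L2_on \<Omega> f" "open S" "continuous_on S m" "\<And>x. x \<in> S \<Longrightarrow> \<bar>m x\<bar> \<le> B"
  shows "L2_on \<Omega> (\<lambda>x. (indicator S x *\<^sub>R m x) *\<^sub>R f x)"
  unfolding L2_on_def
proof
  have f: "f \<in> borel_measurable (lebesgue_on \<Omega>)" "integrable (lebesgue_on \<Omega>) (\<lambda>x. (norm (f x))\<^sup>2)"
    using assms(1) by (auto simp: L2_on_def)
  show m: "(\<lambda>x. (indicator S x *\<^sub>R m x) *\<^sub>R f x) \<in> borel_measurable (lebesgue_on \<Omega>)"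
    using f(1) indicator_continuous_measurable[OF assms(2,3), of \<Omega>] by measurable
  show "integrable (lebesgue_on \<Omega>) (\<lambda>x. (norm ((indicator S x *\<^sub>R m x) *\<^sub>R f x))\<^sup>2)"
  proof (rule Bochner_Integration.integrable_bound)
    show "integrable (lebesgue_on \<Omega>) (\<lambda>x. B\<^sup>2 * (norm (f x))\<^sup>2)" using f by simp
    have "(norm ((indicator S x *\<^sub>R m x) *\<^sub>R f x))\<^sup>2 \<le> B\<^sup>2 * (norm (f x))\<^sup>2" for x
    proof (cases "x \<in> S")
      case True
      have "\<bar>m x\<bar>\<^sup>2 \<le> B\<^sup>2" using assms(4)[OF True] by (intro power_mono) auto
      then show ?thesis using True by (simp add: power_mult_distrib mult_right_mono)
    qed simp
    then show "AE x in lebesgue_on \<Omega>. norm ((norm ((indicator S x *\<^sub>R m x) *\<^sub>R f x))\<^sup>2) \<le> norm (B\<^sup>2 * (norm (f x))\<^sup>2)"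
      by (intro AE_I2) simp
  qed (use m in measurable)
qed

lemma integral_mult_cutoffs_tendsto:
  fixes f :: "'a \<Rightarrow> real"
  assumes "integrable M f" "\<And>n. \<kappa> n \<in> borel_measurable M" "\<And>n x. 0 \<le> \<kappa> n x" "\<And>n x. \<kappa> n x \<le> 1"
    "\<And>x. x \<in> space M \<Longrightarrow> f x \<noteq> 0 \<Longrightarrow> (\<lambda>n. \<kappa> n x) \<longlonglongrightarrow> 1"
  shows "(\<lambda>n. \<integral>x. f x * \<kappa> n x \<partial>M) \<longlonglongrightarrow> (\<integral>x. f x \<partial>M)"
proof (rule integral_dominated_convergence[where w="\<lambda>x. \<bar>f x\<bar>"])
  show "f \<in> borel_measurable M" "(\<lambda>x. f x * \<kappa> n x) \<in> borel_measurable M" for n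
    using assms(1,2) by measurable
  show "integrable M (\<lambda>x. \<bar>f x\<bar>)" using assms(1) by simp
  show "AE x in M. (\<lambda>n. f x * \<kappa> n x) \<longlonglongrightarrow> f x"
  proof (intro AE_I2)
    fix x assume "x \<in> space M"
    then show "(\<lambda>n. f x * \<kappa> n x) \<longlonglongrightarrow> f x"
      using tendsto_mult_left[OF assms(5), of x "f x"] by (cases "f x = 0") auto
  qed
  show "AE x in M. norm (f x * \<kappa> n x) \<le> \<bar>f x\<bar>" for n
    using assms(3)[of n] assms(4)[of n] by (intro AE_I2) (simp add: abs_mult mult_left_le)
qed

lemma grad_inverse:
  assumes "open W" "smooth_on W \<Psi>" "x \<in> W" "\<Psi> x > 0"
  shows "grad (\<lambda>x. inverse (\<Psi> x)) x = (- (inverse (\<Psi> x))\<^sup>2) *\<^sub>R grad \<Psi> x"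
proof -
  have d: "\<Psi> differentiable (at x)" by (rule smooth_on_differentiable[OF assms(1-3)])
  have "((\<lambda>y. inverse y) has_real_derivative - (inverse (\<Psi> x))\<^sup>2) (at (\<Psi> x))"
    using DERIV_inverse[of "\<Psi> x" UNIV] assms(4) by (simp add: power2_eq_square numeral_2_eq_2)
  from partial_deriv_compose[OF d this] show ?thesis
    unfolding grad_def by (simp only: scaleR_sum_right scaleR_scaleR)
qed

text \<open>The cutoffs \<kappa> have compact support in the domain off the origin, so \<Psi> can be
  tested against \<Phi> with no boundary term. Their gradient condition is the weak form of a
  nonnegative outward normal derivative of \<Psi>: \<kappa> falls to 0 towards the boundary. The
  positive \<open>c\<close> is what forces the integral of \<Phi> to vanish.\<close>

lemma comparison_principle:
  fixes \<Omega> U W :: "(real^2) set" and \<kappa> :: "nat \<Rightarrow> real^2 \<Rightarrow> real"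
  assumes \<Omega>: "open \<Omega>" "bounded \<Omega>" "\<Omega> \<subseteq> cball 0 1" and a: "a > 1"
    and ev: "0 < second_eigenvalue \<Omega> a" and ef: "second_eigenfunction \<Omega> a u"
    and cont: "continuous_on (\<Omega> - {0}) u"
    and U: "open U" "0 \<notin> U" and W: "open W" "0 \<notin> W" "(\<Omega> - {0}) \<inter> closure U \<subseteq> W"
    and \<Psi>: "smooth_on W \<Psi>" "\<And>x. x \<in> W \<Longrightarrow> \<Psi> x > 0"
    and bdry: "\<And>x. x \<in> \<Omega> - {0} \<Longrightarrow> x \<in> frontier U \<Longrightarrow> \<bar>u x\<bar> < \<Psi> x"
    and grad2: "integrable (lebesgue_on \<Omega>) (\<lambda>x. indicator (\<Omega> \<inter> U) x * (norm (grad \<Psi> x))\<^sup>2)"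
    and \<kappa>: "\<And>n. \<kappa> n \<in> test_functions (\<Omega> \<inter> W)" "\<And>n x. 0 \<le> \<kappa> n x" "\<And>n x. \<kappa> n x \<le> 1"
      "\<And>x. x \<in> \<Omega> \<inter> U \<Longrightarrow> (\<lambda>n. \<kappa> n x) \<longlonglongrightarrow> 1"
      "\<And>n x. x \<in> \<Omega> \<inter> U \<Longrightarrow> grad (\<kappa> n) x \<bullet> grad \<Psi> x \<le> 0"
    and c: "c > 0" and super: "\<And>x. x \<in> \<Omega> \<inter> U \<Longrightarrow>
      second_eigenvalue \<Omega> a * log_weight a x * \<Psi> x + c \<le> - laplacian \<Psi> x"
    and x0: "x0 \<in> \<Omega> \<inter> U"
  shows "\<bar>u x0\<bar> \<le> \<Psi> x0"
proof -
  let ?M = "lebesgue_on \<Omega>" and ?l = "second_eigenvalue \<Omega> a"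
  define V where "V = \<Omega> \<inter> W"
  define S where "S = \<Omega> \<inter> U"
  define g where "g = weak_gradient \<Omega> u"
  note EL = euler_lagrange[OF \<Omega> a ev ef, folded g_def]
  have V: "open V" "V \<subseteq> \<Omega>" "V = (\<Omega> - {0}) \<inter> W" using \<Omega> W by (auto simp: V_def)
  have S: "open S" "S \<subseteq> V" "S \<subseteq> \<Omega>" using \<Omega> U W closure_subset[of U] by (auto simp: S_def V_def)
  have \<Omega>m: "\<Omega> \<in> sets lebesgue" using \<Omega> by auto
  have cu: "continuous_on V u" by (rule continuous_on_subset[OF cont]) (use V(3) in blast)
  have um: "u \<in> borel_measurable ?M" and uint: "integrable ?M (\<lambda>x. (u x)\<^sup>2)"
    using EL(1) by (auto simp: L2_on_def)
  have wu: "wgrad V u g" by (rule wgrad_of_weak_gradient[OF EL(2,3) \<Omega>(1) V(1,2) cu])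
  have \<Psi>V: "smooth_on V \<Psi>" by (rule smooth_on_subset[OF \<Psi>(1)]) (simp add: V_def)
  have \<Psi>pos: "\<Psi> x > 0" if "x \<in> V" for x using \<Psi>(2) that by (simp add: V_def)
  have inv: "smooth_on V (\<lambda>x. inverse (\<Psi> x))"
    by (rule smooth_on_compose[OF V(1) _ _ smooth_on_inverse \<Psi>V]) (use \<Psi>pos in auto)
  define z where "z x = inverse (\<Psi> x) * u x" for x
  define gz where "gz x = inverse (\<Psi> x) *\<^sub>R g x + u x *\<^sub>R grad (\<lambda>x. inverse (\<Psi> x)) x" for x
  have wz: "wgrad V z gz" unfolding z_def gz_def by (rule wgrad_mult_smooth[OF wu inv])
  then have cz: "continuous_on V z" by (simp add: wgrad_def)
  have uz: "u x = \<Psi> x * z x" if "x \<in> V" for x using \<Psi>pos[OF that] by (simp add: z_def)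
  have gz_eq: "g x = \<Psi> x *\<^sub>R gz x + z x *\<^sub>R grad \<Psi> x" if "x \<in> V" for x
  proof -
    have "gz x = inverse (\<Psi> x) *\<^sub>R g x - (inverse (\<Psi> x) * z x) *\<^sub>R grad \<Psi> x"
      unfolding gz_def grad_inverse[OF V(1) \<Psi>V that \<Psi>pos[OF that]] by (simp add: z_def power2_eq_square mult_ac)
    then show ?thesis using \<Psi>pos[OF that] by (simp add: scaleR_diff_right)
  qed
  \<comment> \<open>\<Psi> H(z) is the nonnegative function \<Phi> against which the supersolution
    inequality is tested; it satisfies u \<phi> = \<Psi> \<Phi>.\<close>
  define H where "H y = y * trunc y" for y
  define H' where "H' y = trunc y + y * trunc' y" for y
  have HD: "(H has_real_derivative H' y) (at y)" for y
    unfolding H_def[abs_def] H'_def by (auto intro!: derivative_eq_intros trunc_DERIV)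
  have H'c: "continuous_on UNIV H'"
    unfolding H'_def[abs_def] by (intro continuous_intros continuous_trunc continuous_trunc')
  define \<phi>0 where "\<phi>0 x = \<Psi> x * trunc (z x)" for x
  define p0 where "p0 x = \<Psi> x *\<^sub>R trunc' (z x) *\<^sub>R gz x + trunc (z x) *\<^sub>R grad \<Psi> x" for x
  define \<Phi>0 where "\<Phi>0 x = \<Psi> x * H (z x)" for x
  define P0 where "P0 x = \<Psi> x *\<^sub>R H' (z x) *\<^sub>R gz x + H (z x) *\<^sub>R grad \<Psi> x" for x
  have w\<phi>: "wgrad V \<phi>0 p0"
    unfolding \<phi>0_def p0_def
    by (rule wgrad_mult_smooth[OF wgrad_compose[OF wz trunc_DERIV continuous_trunc'] \<Psi>V])
  have w\<Phi>: "wgrad V \<Phi>0 P0"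
    unfolding \<Phi>0_def P0_def
    by (rule wgrad_mult_smooth[OF wgrad_compose[OF wz HD H'c] \<Psi>V])
  \<comment> \<open>The strict inequality |u| < \<Psi> on the frontier of \<open>U\<close> keeps
    this relatively closed set off the frontier, and \<open>trunc\<close> and its derivative vanish
    at z outside it, as the extension by zero requires.\<close>
  define A where "A = {x \<in> V. 1 \<le> \<bar>z x\<bar>}"
  have Acl: "closedin (top_of_set V) A"
  proof -
    have "A = V \<inter> (\<lambda>x. \<bar>z x\<bar>) -` {1..}" by (auto simp: A_def)
    then show ?thesis using cz by (auto intro!: continuous_closedin_preimage continuous_intros)
  qed
  have Afr: "A \<inter> frontier U = {}"
  proof -
    have "\<bar>z x\<bar> < 1" if "x \<in> V" "x \<in> frontier U" for x
    proof -
      have "\<bar>u x\<bar> < \<Psi> x" using bdry[of x] that V(3) by blast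
      then show ?thesis using \<Psi>pos[OF that(1)] by (simp add: z_def abs_mult divide_less_eq field_simps)
    qed
    then show ?thesis by (force simp: A_def)
  qed
  have zero: "\<phi>0 x = 0" "p0 x = 0" "\<Phi>0 x = 0" "P0 x = 0" if "x \<in> V" "x \<notin> A" for x
    using that by (auto simp: A_def \<phi>0_def p0_def \<Phi>0_def P0_def H_def H'_def trunc_eq_0)
  define \<phi> where "\<phi> x = (if x \<in> U then \<phi>0 x else 0)" for x
  define p where "p x = (if x \<in> U then p0 x else 0)" for x
  define \<Phi> where "\<Phi> x = (if x \<in> U then \<Phi>0 x else 0)" for x
  define P where "P x = (if x \<in> U then P0 x else 0)" for x
  have op: "open (\<Omega> - {0})" using \<Omega>(1) by auto
  note ext = zero_extension_identity[OF _ U(1) W(3,1) op, folded V(3)]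
  have id\<phi>: "(\<integral>x. \<phi> x * partial_deriv i \<eta> x \<partial>lebesgue) = - (\<integral>x. (p x \<bullet> i) * \<eta> x \<partial>lebesgue)"
    and id\<Phi>: "(\<integral>x. \<Phi> x * partial_deriv i \<eta> x \<partial>lebesgue) = - (\<integral>x. (P x \<bullet> i) * \<eta> x \<partial>lebesgue)"
    if "\<eta> \<in> test_functions (\<Omega> - {0})" "i \<in> Basis" for \<eta> i
    unfolding \<phi>_def p_def \<Phi>_def P_def
    by (rule ext[OF w\<phi> Acl Afr zero(1,2) that] ext[OF w\<Phi> Acl Afr zero(3,4) that]; assumption)+
  have cS: "continuous_on S (\<lambda>x. f (z x))" if "continuous_on UNIV f" for f :: "real \<Rightarrow> real"
    using continuous_on_compose2[OF that continuous_on_subset[OF cz S(2)]] by auto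
  have \<Psi>S: "continuous_on S (grad \<Psi>)"
    by (rule continuous_on_subset[OF continuous_on_grad[OF \<Psi>V] S(2)])
  define D where "D x = indicator S x *\<^sub>R grad \<Psi> x" for x
  have D2: "L2_on \<Omega> D"
    unfolding L2_on_def D_def
  proof
    show "(\<lambda>x. indicator S x *\<^sub>R grad \<Psi> x) \<in> borel_measurable ?M"
      by (rule indicator_continuous_measurable[OF S(1) \<Psi>S])
    have "(norm (indicator S x *\<^sub>R grad \<Psi> x))\<^sup>2 = indicator S x * (norm (grad \<Psi> x))\<^sup>2" for x
      by (auto simp: indicator_def)
    then show "integrable ?M (\<lambda>x. (norm (indicator S x *\<^sub>R grad \<Psi> x))\<^sup>2)"
      using grad2 by (simp add: S_def)
  qed
  have comb: "L2_on \<Omega> (\<lambda>x. (indicator S x *\<^sub>R m x) *\<^sub>R g x + (indicator S x *\<^sub>R k x) *\<^sub>R D x)"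
    if "continuous_on S m" "continuous_on S k" "\<And>x. x \<in> S \<Longrightarrow> \<bar>m x\<bar> \<le> 3" "\<And>x. x \<in> S \<Longrightarrow> \<bar>k x\<bar> \<le> 3" for m k
    using L2_on_add_scaleR[OF L2_on_bounded_multiplier[OF EL(2) S(1) that(1,3)] L2_on_bounded_multiplier[OF D2 S(1) that(2,4)], of 1]
    by simp
  \<comment> \<open>The gradient of z is eliminated, since only \<nabla>u and \<nabla>\<Psi> are
    known to be square-integrable; the coefficients are bounded by 3.\<close>
  have p_eq: "p x = (indicator S x *\<^sub>R trunc' (z x)) *\<^sub>R g x + (indicator S x *\<^sub>R (trunc (z x) - z x * trunc' (z x))) *\<^sub>R D x"
    and P_eq: "P x = (indicator S x *\<^sub>R H' (z x)) *\<^sub>R g x + (indicator S x *\<^sub>R (H (z x) - z x * H' (z x))) *\<^sub>R D x"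
    if "x \<in> \<Omega>" for x
  proof -
    have "p x = (indicator S x *\<^sub>R trunc' (z x)) *\<^sub>R g x + (indicator S x *\<^sub>R (trunc (z x) - z x * trunc' (z x))) *\<^sub>R D x \<and>
      P x = (indicator S x *\<^sub>R H' (z x)) *\<^sub>R g x + (indicator S x *\<^sub>R (H (z x) - z x * H' (z x))) *\<^sub>R D x"
    proof (cases "x \<in> U")
      case True
      then have xS: "x \<in> S" using that by (simp add: S_def)
      then have xV: "x \<in> V" using S(2) by blast
      show ?thesis using True xS
        by (simp add: p_def P_def p0_def P0_def D_def gz_eq[OF xV] algebra_simps)
    next
      case False
      then show ?thesis by (simp add: p_def P_def S_def)
    qed
    then show "p x = (indicator S x *\<^sub>R trunc' (z x)) *\<^sub>R g x + (indicator S x *\<^sub>R (trunc (z x) - z x * trunc' (z x))) *\<^sub>R D x"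
      "P x = (indicator S x *\<^sub>R H' (z x)) *\<^sub>R g x + (indicator S x *\<^sub>R (H (z x) - z x * H' (z x))) *\<^sub>R D x" by auto
  qed
  have p2: "L2_on \<Omega> p"
  proof (subst L2_on_cong[OF p_eq], assumption, rule comb)
    show "continuous_on S (\<lambda>x. trunc' (z x))" "continuous_on S (\<lambda>x. trunc (z x) - z x * trunc' (z x))"
      by (intro cS[of trunc'] cS[of "\<lambda>y. trunc y - y * trunc' y"] continuous_intros continuous_trunc continuous_trunc')+
    show "\<bar>trunc' (z x)\<bar> \<le> 3" "\<bar>trunc (z x) - z x * trunc' (z x)\<bar> \<le> 3" for x
      using trunc'_bounds[of "z x"] trunc'_nonneg[of "z x"] trunc_le_1[of "z x"] by linarith+
  qed
  have P2: "L2_on \<Omega> P"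
  proof (subst L2_on_cong[OF P_eq], assumption, rule comb)
    show "continuous_on S (\<lambda>x. H' (z x))" "continuous_on S (\<lambda>x. H (z x) - z x * H' (z x))"
      unfolding H_def
      by (intro cS[of H'] cS[of "\<lambda>y. y * trunc y - y * H' y"] continuous_intros continuous_trunc H'c)+
    show "\<bar>H' (z x)\<bar> \<le> 3" for x
      using trunc'_bounds[of "z x"] trunc_le_1[of "z x"] unfolding H'_def by linarith
    show "\<bar>H (z x) - z x * H' (z x)\<bar> \<le> 3" for x
    proof -
      have "H (z x) - z x * H' (z x) = - ((z x)\<^sup>2 * trunc' (z x))"
        by (simp add: H_def H'_def power2_eq_square algebra_simps)
      moreover have "0 \<le> (z x)\<^sup>2 * trunc' (z x)" using trunc'_nonneg by simp
      ultimately show ?thesis using trunc'_decay[of "z x"] by linarith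
    qed
  qed
  have \<phi>le: "\<bar>\<phi> x\<bar> \<le> \<bar>u x\<bar>" and \<Phi>le: "\<bar>\<Phi> x\<bar> \<le> \<bar>u x\<bar>" and u\<phi>: "u x * \<phi> x = \<Psi> x * \<Phi> x" and \<Phi>nn: "0 \<le> \<Phi> x" if "x \<in> \<Omega>" for x
  proof -
    have "\<bar>\<phi> x\<bar> \<le> \<bar>u x\<bar> \<and> \<bar>\<Phi> x\<bar> \<le> \<bar>u x\<bar> \<and> u x * \<phi> x = \<Psi> x * \<Phi> x \<and> 0 \<le> \<Phi> x"
    proof (cases "x \<in> U")
      case True
      then have xV: "x \<in> V" using that S by (auto simp: S_def)
      have ps: "\<Psi> x > 0" by (rule \<Psi>pos[OF xV])
      have "\<Psi> x * \<bar>trunc (z x)\<bar> \<le> \<Psi> x * \<bar>z x\<bar>" using ps trunc_le by (intro mult_left_mono) auto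
      moreover have "\<bar>u x\<bar> * \<bar>trunc (z x)\<bar> \<le> \<bar>u x\<bar> * 1" using trunc_le_1 by (intro mult_left_mono) auto
      ultimately show ?thesis
        using True ps trunc_sign(1)[of "z x"] uz[OF xV]
        by (simp add: \<phi>_def \<phi>0_def \<Phi>_def \<Phi>0_def H_def abs_mult mult_ac)
    qed (simp add: \<phi>_def \<Phi>_def)
    then show "\<bar>\<phi> x\<bar> \<le> \<bar>u x\<bar>" "\<bar>\<Phi> x\<bar> \<le> \<bar>u x\<bar>" "u x * \<phi> x = \<Psi> x * \<Phi> x" "0 \<le> \<Phi> x" by auto
  qed
  have dom: "L2_on \<Omega> f" if "\<And>x. x \<in> \<Omega> \<Longrightarrow> f x = indicator S x *\<^sub>R k x" "continuous_on S k" "\<And>x. x \<in> \<Omega> \<Longrightarrow> \<bar>f x\<bar> \<le> \<bar>u x\<bar>" for f k :: "real^2 \<Rightarrow> real"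
    unfolding L2_on_def
  proof
    have "f \<in> borel_measurable ?M \<longleftrightarrow> (\<lambda>x. indicator S x *\<^sub>R k x) \<in> borel_measurable ?M"
      by (rule measurable_cong) (simp add: that(1))
    then show fm: "f \<in> borel_measurable ?M" using indicator_continuous_measurable[OF S(1) that(2)] by simp
    show "integrable ?M (\<lambda>x. (norm (f x))\<^sup>2)"
      by (rule Bochner_Integration.integrable_bound[OF uint])
        (use fm that(3) in \<open>auto intro!: AE_I2 power_mono simp: abs_le_square_iff[symmetric]\<close>)
  qed
  have \<phi>0c: "continuous_on S \<phi>0" and \<Phi>0c: "continuous_on S \<Phi>0"
    using w\<phi> w\<Phi> by (auto simp: wgrad_def intro: continuous_on_subset[OF _ S(2)])
  have \<phi>2: "L2_on \<Omega> \<phi>"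
    by (rule dom[OF _ \<phi>0c \<phi>le]) (auto simp: \<phi>_def S_def)
  have \<Phi>2: "L2_on \<Omega> \<Phi>"
    by (rule dom[OF _ \<Phi>0c \<Phi>le]) (auto simp: \<Phi>_def S_def)
  \<comment> \<open>The identities so far concern test functions supported off the origin; as \<phi>
    and \<open>p\<close> are square-integrable, the origin can be filled in.\<close>
  have \<phi>w: "is_weak_gradient \<Omega> \<phi> p"
    by (rule weak_gradient_remove_origin[OF \<Omega>(1) \<phi>2 p2 id\<phi>])
  note w = log_weight_integrable[OF a \<Omega>(1,3)]
  have \<phi>m: "\<phi> \<in> borel_measurable ?M"
    using \<phi>2 by (auto simp: L2_on_def)
  have \<phi>2w: "integrable ?M (\<lambda>x. (\<phi> x)\<^sup>2 * log_weight a x)"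
  proof (rule Bochner_Integration.integrable_bound[OF EL(4)])
    show "(\<lambda>x. (\<phi> x)\<^sup>2 * log_weight a x) \<in> borel_measurable ?M" using \<phi>m w(3) by measurable
    show "AE x in ?M. norm ((\<phi> x)\<^sup>2 * log_weight a x) \<le> norm ((u x)\<^sup>2 * log_weight a x)"
    proof (intro AE_I2)
      fix x assume "x \<in> space ?M"
      then have "(\<phi> x)\<^sup>2 \<le> (u x)\<^sup>2" using \<phi>le[of x] by (simp add: abs_le_square_iff)
      then show "norm ((\<phi> x)\<^sup>2 * log_weight a x) \<le> norm ((u x)\<^sup>2 * log_weight a x)"
        using log_weight_nonneg[of a x] by (simp add: mult_right_mono)
    qed
  qed
  have u\<phi>w: "integrable ?M (\<lambda>x. u x * \<phi> x * log_weight a x)"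
    by (rule integrable_weighted_product[OF um \<phi>m w(3) log_weight_nonneg EL(4) \<phi>2w])
  have \<Phi>i: "integrable ?M \<Phi>"
  proof -
    have one: "L2_on \<Omega> (\<lambda>x. 1::real)" by (rule L2_on_const[OF \<Omega>(1,2)])
    have "integrable ?M (\<lambda>x. \<Phi> x \<bullet> (1::real))"
      by (rule integrable_product_of_squares) (use \<Phi>2 one in \<open>simp_all only: L2_on_def\<close>)
    then show ?thesis by (simp only: inner_real_def mult_1_right)
  qed
  have DP: "integrable ?M (\<lambda>x. D x \<bullet> P x)"
    using D2 P2 by (intro integrable_product_of_squares) (auto simp: L2_on_def)
  have gp: "integrable ?M (\<lambda>x. g x \<bullet> p x)"
    using EL(2) p2 by (intro integrable_product_of_squares) (auto simp: L2_on_def)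
  \<comment> \<open>On \<open>U\<close> the integrands differ by \<Psi>^2 G'(z) |\<nabla>z|^2,
    nonnegative since G is increasing.\<close>
  have "(\<integral>x. D x \<bullet> P x \<partial>?M) \<le> (\<integral>x. g x \<bullet> p x \<partial>?M)"
  proof (rule integral_mono[OF DP gp])
    fix x assume "x \<in> space ?M"
    then have x\<Omega>: "x \<in> \<Omega>" by simp
    show "D x \<bullet> P x \<le> g x \<bullet> p x"
    proof (cases "x \<in> U")
      case True
      then have xS: "x \<in> S" using x\<Omega> by (simp add: S_def)
      then have xV: "x \<in> V" using S(2) by blast
      have "g x \<bullet> p x = (\<Psi> x)\<^sup>2 * trunc' (z x) * (gz x \<bullet> gz x) + D x \<bullet> P x"
        using True xS
        by (simp add: p_def P_def p0_def P0_def D_def gz_eq[OF xV] H_def H'_def inner_add_left inner_add_right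
            inner_commute[of "gz x" "grad \<Psi> x"] power2_eq_square algebra_simps)
      then show ?thesis using trunc'_nonneg[of "z x"] by simp
    next
      case False
      then show ?thesis by (simp add: p_def P_def)
    qed
  qed
  also have "\<dots> = ?l * (\<integral>x. u x * \<phi> x * log_weight a x \<partial>?M)"
    by (rule EL(5)[OF \<phi>2 p2 \<phi>w \<phi>2w])
  finally have upper: "(\<integral>x. D x \<bullet> P x \<partial>?M) \<le> ?l * (\<integral>x. u x * \<phi> x * log_weight a x \<partial>?M)" .
  define E where "E x = ?l * (u x * \<phi> x * log_weight a x) + c * \<Phi> x" for x
  have Ei: "integrable ?M E" unfolding E_def using u\<phi>w \<Phi>i by simp
  have \<kappa>m: "\<kappa> n \<in> borel_measurable ?M" for n
    by (rule measurable_restrict_space1[OF continuous_imp_lebesgue_measurable[OF test_functions_continuous[OF \<kappa>(1)]]])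
  have \<kappa>b: "\<bar>\<kappa> n x\<bar> \<le> 1" for n x using \<kappa>(2,3)[of n x] by simp
  \<comment> \<open>The products of \<kappa> with the partial derivatives of \<Psi> are test
    functions. Inserted in the weak gradient identity of \<Phi> and summed, they give \<integral>
    \<kappa> \<nabla>\<Psi> . \<nabla>\<Phi> = - \<integral> \<Phi> (\<nabla>\<kappa> .
    \<nabla>\<Psi> + \<kappa> \<Delta>\<Psi>). The sign condition on \<nabla>\<kappa> and the
    supersolution inequality bound this from below.\<close>
  have step: "(\<integral>x. E x * \<kappa> n x \<partial>?M) \<le> (\<integral>x. (D x \<bullet> P x) * \<kappa> n x \<partial>?M)" for n
  proof -
    let ?\<eta> = "\<lambda>i x. partial_deriv i \<Psi> x * \<kappa> n x"
    have \<kappa>V: "\<kappa> n \<in> test_functions V" using \<kappa>(1) by (simp add: V_def)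
    have \<eta>V: "?\<eta> i \<in> test_functions V" if "i \<in> Basis" for i
      by (rule test_functions_mult[OF V(1) \<kappa>V smooth_on_partial_deriv[OF \<Psi>V that]])
    have \<eta>\<Omega>: "?\<eta> i \<in> test_functions (\<Omega> - {0})" "?\<eta> i \<in> test_functions \<Omega>" if "i \<in> Basis" for i
      using test_functions_mono[OF \<eta>V[OF that]] V by blast+
    have li: "locally_integrable \<Omega> \<Phi>" "locally_integrable \<Omega> P"
      using L2_on_imp_locally_integrable[OF _ \<Omega>(1) order_refl] \<Phi>2 P2 by auto
    have i1: "integrable lebesgue (\<lambda>x. \<Phi> x * partial_deriv i (?\<eta> i) x)" if "i \<in> Basis" for i
      using integrable_locally_integrable_times_test[OF li(1) test_functions_partial_deriv[OF \<eta>\<Omega>(2)[OF that] that], of 1] by simp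
    have i2: "integrable lebesgue (\<lambda>x. (P x \<bullet> i) * ?\<eta> i x)" if "i \<in> Basis" for i
      by (rule integrable_locally_integrable_times_test[OF li(2) \<eta>\<Omega>(2)[OF that]])
    have on\<Omega>: "(\<integral>x. f x \<partial>lebesgue) = (\<integral>x. f x \<partial>?M)" "integrable lebesgue f \<Longrightarrow> integrable ?M f"
      if "\<And>x. x \<notin> \<Omega> \<Longrightarrow> f x = 0" for f :: "real^2 \<Rightarrow> real"
    proof -
      show "(\<integral>x. f x \<partial>lebesgue) = (\<integral>x. f x \<partial>?M)" by (rule integral_lebesgue_on_eq[OF \<Omega>m that, symmetric])
      have fe: "(\<lambda>x. indicator \<Omega> x *\<^sub>R f x) = f"
      proof
        show "indicator \<Omega> x *\<^sub>R f x = f x" for x using that[of x] by (cases "x \<in> \<Omega>") auto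
      qed
      then show "integrable lebesgue f \<Longrightarrow> integrable ?M f" using \<Omega>m by (subst integrable_restrict_space) (simp_all only: fe Int_UNIV_right space_completion space_lborel space_borel)
    qed
    have \<eta>0: "?\<eta> i x = 0" "partial_deriv i (?\<eta> i) x = 0" if "x \<notin> \<Omega>" "i \<in> Basis" for i x
      using test_functions_outside[OF \<eta>\<Omega>(2)[OF that(2)] that(1)]
        test_functions_outside[OF test_functions_partial_deriv[OF \<eta>\<Omega>(2)[OF that(2)] that(2)] that(1)] by auto
    define L where "L x = (\<Sum>i\<in>Basis. \<Phi> x * partial_deriv i (?\<eta> i) x)" for x
    define R where "R x = (\<Sum>i\<in>Basis. (P x \<bullet> i) * ?\<eta> i x)" for x
    have LR: "(\<integral>x. L x \<partial>lebesgue) = - (\<integral>x. R x \<partial>lebesgue)"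
      unfolding L_def R_def using i1 i2 id\<Phi>[OF \<eta>\<Omega>(1)]
      by (simp add: Bochner_Integration.integral_sum sum_negf)
    have Li: "integrable ?M L" unfolding L_def by (intro on\<Omega>(2) Bochner_Integration.integrable_sum i1) (simp_all add: \<eta>0)
    have "(\<integral>x. L x \<partial>lebesgue) = (\<integral>x. L x \<partial>?M)" by (rule on\<Omega>(1)) (simp add: L_def \<eta>0)
    moreover have "(\<integral>x. R x \<partial>lebesgue) = (\<integral>x. R x \<partial>?M)" by (rule on\<Omega>(1)) (simp add: R_def \<eta>0)
    moreover have "R x = (D x \<bullet> P x) * \<kappa> n x" if "x \<in> \<Omega>" for x
    proof (cases "x \<in> U")
      case True
      then have "D x \<bullet> P x = (\<Sum>i\<in>Basis. partial_deriv i \<Psi> x * (P x \<bullet> i))"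
        using that by (simp add: D_def S_def grad_def inner_sum_left inner_sum_right inner_commute[of _ "P x"])
      then show ?thesis by (simp add: R_def sum_distrib_left mult_ac)
    next
      case False
      then show ?thesis by (simp add: R_def P_def)
    qed
    then have "(\<integral>x. R x \<partial>?M) = (\<integral>x. (D x \<bullet> P x) * \<kappa> n x \<partial>?M)"
      by (intro Bochner_Integration.integral_cong) auto
    ultimately have eq: "(\<integral>x. (D x \<bullet> P x) * \<kappa> n x \<partial>?M) = (\<integral>x. - L x \<partial>?M)" using LR by simp
    have "(\<integral>x. E x * \<kappa> n x \<partial>?M) \<le> (\<integral>x. - L x \<partial>?M)"
    proof (rule integral_mono)
      show "integrable ?M (\<lambda>x. E x * \<kappa> n x)" by (rule integrable_mult_bounded[OF Ei \<kappa>m \<kappa>b])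
      show "integrable ?M (\<lambda>x. - L x)" using Li by simp
      fix x assume "x \<in> space ?M"
      then have x\<Omega>: "x \<in> \<Omega>" by simp
      show "E x * \<kappa> n x \<le> - L x"
      proof (cases "x \<in> U")
        case True
        have xS: "x \<in> \<Omega> \<inter> U" using True x\<Omega> by simp
        have pd: "partial_deriv i (?\<eta> i) x = partial_deriv i \<Psi> x * partial_deriv i (\<kappa> n) x + partial_deriv i (partial_deriv i \<Psi>) x * \<kappa> n x"
          if "i \<in> Basis" for i
          by (rule partial_deriv_mult_test[OF V(1) smooth_on_partial_deriv[OF \<Psi>V that] \<kappa>V])
        have "grad (\<kappa> n) x \<bullet> grad \<Psi> x = (\<Sum>i\<in>Basis. partial_deriv i \<Psi> x * partial_deriv i (\<kappa> n) x)"
          by (subst euclidean_inner) (simp add: grad_inner mult.commute)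
        then have "(\<Sum>i\<in>Basis. partial_deriv i (?\<eta> i) x) = grad (\<kappa> n) x \<bullet> grad \<Psi> x + laplacian \<Psi> x * \<kappa> n x"
          by (simp add: pd sum.distrib laplacian_def sum_distrib_right)
        then have L: "L x = \<Phi> x * (grad (\<kappa> n) x \<bullet> grad \<Psi> x + laplacian \<Psi> x * \<kappa> n x)"
          by (simp add: L_def sum_distrib_left[symmetric])
        have "E x = \<Phi> x * (?l * log_weight a x * \<Psi> x + c)"
          using u\<phi>[OF x\<Omega>] by (simp add: E_def algebra_simps)
        then have "E x * \<kappa> n x = \<Phi> x * ((?l * log_weight a x * \<Psi> x + c) * \<kappa> n x)" by simp
        also have "\<dots> \<le> \<Phi> x * (- (grad (\<kappa> n) x \<bullet> grad \<Psi> x) + (- laplacian \<Psi> x) * \<kappa> n x)"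
        proof (rule mult_left_mono[OF _ \<Phi>nn[OF x\<Omega>]])
          have "(?l * log_weight a x * \<Psi> x + c) * \<kappa> n x \<le> (- laplacian \<Psi> x) * \<kappa> n x"
            by (rule mult_right_mono[OF super[OF xS] \<kappa>(2)])
          then show "(?l * log_weight a x * \<Psi> x + c) * \<kappa> n x \<le> - (grad (\<kappa> n) x \<bullet> grad \<Psi> x) + (- laplacian \<Psi> x) * \<kappa> n x"
            using \<kappa>(5)[OF xS, of n] by linarith
        qed
        also have "\<dots> = - L x" by (simp add: L algebra_simps)
        finally show ?thesis .
      next
        case False
        then show ?thesis by (simp add: L_def E_def \<Phi>_def \<phi>_def)
      qed
    qed
    then show ?thesis using eq by simp
  qed
  have "(\<lambda>n. \<integral>x. E x * \<kappa> n x \<partial>?M) \<longlonglongrightarrow> (\<integral>x. E x \<partial>?M)"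
    by (rule integral_mult_cutoffs_tendsto[OF Ei \<kappa>m \<kappa>(2,3)])
      (use \<kappa>(4) in \<open>auto simp: E_def \<Phi>_def \<phi>_def split: if_splits\<close>)
  moreover have "(\<lambda>n. \<integral>x. (D x \<bullet> P x) * \<kappa> n x \<partial>?M) \<longlonglongrightarrow> (\<integral>x. D x \<bullet> P x \<partial>?M)"
    by (rule integral_mult_cutoffs_tendsto[OF DP \<kappa>m \<kappa>(2,3)])
      (use \<kappa>(4) in \<open>auto simp: P_def split: if_splits\<close>)
  ultimately have "(\<integral>x. E x \<partial>?M) \<le> (\<integral>x. D x \<bullet> P x \<partial>?M)"
    using step by (intro LIMSEQ_le) auto
  moreover have "(\<integral>x. E x \<partial>?M) = ?l * (\<integral>x. u x * \<phi> x * log_weight a x \<partial>?M) + c * (\<integral>x. \<Phi> x \<partial>?M)"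
    unfolding E_def using u\<phi>w \<Phi>i by simp
  ultimately have "c * (\<integral>x. \<Phi> x \<partial>?M) \<le> 0" using upper by linarith
  then have "(\<integral>x. \<Phi> x \<partial>?M) \<le> 0" using c by (simp add: mult_le_0_iff)
  moreover have nn: "AE x in ?M. 0 \<le> \<Phi> x" using \<Phi>nn by (intro AE_I2) simp
  ultimately have "(\<integral>x. \<Phi> x \<partial>?M) = 0" using integral_nonneg_AE[OF nn] by linarith
  then have "AE x in ?M. \<Phi> x = 0" using integral_nonneg_eq_0_iff_AE[OF \<Phi>i nn] by simp
  then have ae: "AE x in lebesgue. x \<in> \<Omega> \<longrightarrow> \<Phi> x = 0"
    using \<Omega>m by (subst (asm) AE_restrict_space_iff) auto
  show ?thesis
  proof (rule ccontr)
    assume neg: "\<not> \<bar>u x0\<bar> \<le> \<Psi> x0"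
    have x0S: "x0 \<in> S" using x0 by (simp add: S_def)
    then have x0V: "x0 \<in> V" using S(2) by blast
    have "\<bar>z x0\<bar> > 1" using neg \<Psi>pos[OF x0V] by (simp add: z_def abs_mult field_simps)
    then have "\<Phi>0 x0 > 0" using trunc_sign(2)[of "z x0"] \<Psi>pos[OF x0V] by (simp add: \<Phi>0_def H_def)
    \<comment> \<open>From almost everywhere to everywhere: \<Phi> is continuous on
      \<open>S\<close>, so its positivity set is open, and a nonempty open set is not
      negligible.\<close>
    moreover define T where "T = S \<inter> \<Phi>0 -` {0<..}"
    ultimately have "x0 \<in> T" using x0S by simp
    have "open T" unfolding T_def by (rule continuous_open_preimage[OF \<Phi>0c S(1) open_greaterThan])
    moreover have "negligible T"
      unfolding negligible_iff_null_sets
    proof (subst AE_iff_null_sets)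
      show "T \<in> sets lebesgue" using \<open>open T\<close> by auto
      show "AE x in lebesgue. x \<notin> T"
        using ae by eventually_elim (auto simp: T_def S_def \<Phi>_def)
    qed
    ultimately show False using open_not_negligible \<open>x0 \<in> T\<close> by blast
  qed
qed

section \<open>Lines on which the eigenfunction is bounded\<close>

lemma Basis_real2:
  fixes b f :: "real^2"
  assumes "b \<in> Basis" "f \<in> Basis" "b \<noteq> f"
  shows "Basis = {b, f}"
proof (rule card_subset_eq[symmetric])
  show "card {b, f} = card (Basis :: (real^2) set)" using assms(3) by simp
qed (use assms in auto)

lemma real2_decompose:
  fixes b f :: "real^2"
  assumes "b \<in> Basis" "f \<in> Basis" "b \<noteq> f"
  shows "x = (x \<bullet> f) *\<^sub>R f + (x \<bullet> b) *\<^sub>R b"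
  using euclidean_representation[of x] assms(3) unfolding Basis_real2[OF assms] by (simp add: add.commute)

lemma measure_real2_box:
  fixes b f :: "real^2"
  assumes B: "b \<in> Basis" "f \<in> Basis" "b \<noteq> f" and \<epsilon>: "\<epsilon> = 1 \<or> \<epsilon> = - 1" and le: "l1 \<le> u1" "l2 \<le> u2"
  shows "{x. l1 \<le> x \<bullet> f \<and> x \<bullet> f \<le> u1 \<and> l2 \<le> \<epsilon> * (x \<bullet> b) \<and> \<epsilon> * (x \<bullet> b) \<le> u2} \<in> lmeasurable"
    "measure lebesgue {x. l1 \<le> x \<bullet> f \<and> x \<bullet> f \<le> u1 \<and> l2 \<le> \<epsilon> * (x \<bullet> b) \<and> \<epsilon> * (x \<bullet> b) \<le> u2} = (u1 - l1) * (u2 - l2)"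
proof -
  let ?S = "{x. l1 \<le> x \<bullet> f \<and> x \<bullet> f \<le> u1 \<and> l2 \<le> \<epsilon> * (x \<bullet> b) \<and> \<epsilon> * (x \<bullet> b) \<le> u2}"
  define l u where "l = l1 *\<^sub>R f + (if \<epsilon> = 1 then l2 else - u2) *\<^sub>R b"
    and "u = u1 *\<^sub>R f + (if \<epsilon> = 1 then u2 else - l2) *\<^sub>R b"
  have bf: "b \<bullet> f = 0" "f \<bullet> b = 0" "b \<bullet> b = 1" "f \<bullet> f = 1" using B by (auto simp: inner_Basis)
  have S: "?S = cbox l u"
    using \<epsilon> unfolding cbox_def Basis_real2[OF B] by (auto simp: l_def u_def inner_add_left bf)
  show "?S \<in> lmeasurable" unfolding S by simp
  have "measure lborel (cbox l u) = (\<Prod>i\<in>{b, f}. u \<bullet> i - l \<bullet> i)"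
    using \<epsilon> le unfolding Basis_real2[OF B, symmetric]
    by (intro content_cbox) (auto simp: Basis_real2[OF B] l_def u_def inner_add_left bf)
  also have "\<dots> = (u1 - l1) * (u2 - l2)"
    using \<epsilon> B(3) by (auto simp: l_def u_def inner_add_left bf)
  finally show "measure lebesgue ?S = (u1 - l1) * (u2 - l2)" unfolding S by simp
qed

text \<open>The mean value theorem on [0, 1] yields a point with derivative 1, and continuity an
  interval around it with derivative at least 1/2.\<close>

lemma smooth_step_steep:
  obtains b0 \<alpha> \<beta> where "b0 > 0" "0 \<le> \<alpha>" "\<alpha> < \<beta>" "\<beta> \<le> 1" "\<And>y. y \<in> {\<alpha>..\<beta>} \<Longrightarrow> b0 \<le> deriv smooth_step y"
proof -
  obtain y where y: "0 < y" "y < 1" "smooth_step 1 - smooth_step 0 = (1 - 0) * deriv smooth_step y"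
    using MVT2[of 0 1 smooth_step "deriv smooth_step"] smooth_step_DERIV by auto
  then have dy: "deriv smooth_step y = 1" by (simp add: smooth_step_0 smooth_step_1)
  have pd: "partial_deriv 1 smooth_step = deriv smooth_step"
    using partial_deriv_real[OF smooth_step_DERIV] by blast
  have c: "continuous_on UNIV (deriv smooth_step)"
    using smooth_on_continuous[OF smooth_on_partial_deriv[of UNIV smooth_step 1]] smooth_smooth_step
    by (simp add: pd smooth_iff_smooth_on)
  have "open (deriv smooth_step -` {1/2<..} \<inter> {0<..<1})"
    using c by (intro open_Int open_vimage) auto
  moreover have "y \<in> deriv smooth_step -` {1/2<..} \<inter> {0<..<1}" using y dy by simp
  ultimately obtain e where e: "e > 0" "cball y e \<subseteq> deriv smooth_step -` {1/2<..} \<inter> {0<..<1}"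
    using open_contains_cball by blast
  have sub: "{y - e..y + e} \<subseteq> deriv smooth_step -` {1/2<..} \<inter> {0<..<1}"
    using e(2) by (simp add: cball_eq_atLeastAtMost)
  then have "y - e \<in> {0<..<1}" "y + e \<in> {0<..<1}" using e(1) by force+
  then show ?thesis
    using e(1) sub by (intro that[of "1/2" "y - e" "y + e"]) force+
qed

lemma partial_deriv_comp_inner:
  fixes h :: "real \<Rightarrow> real" and e :: "'a::euclidean_space"
  assumes "(h has_real_derivative d) (at (c * (x \<bullet> e) + c'))"
  shows "partial_deriv i (\<lambda>x. h (c * (x \<bullet> e) + c')) x = d * (c * (i \<bullet> e))"
proof -
  have l: "((\<lambda>x::'a. c * (x \<bullet> e) + c') has_derivative (\<lambda>y. c * (y \<bullet> e))) (at x)"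
    by (auto intro!: derivative_eq_intros)
  then have "(\<lambda>x::'a. c * (x \<bullet> e) + c') differentiable (at x)" by (rule differentiableI)
  from partial_deriv_compose[OF this assms, of i] show ?thesis
    using partial_deriv_eqI[OF l, of i] by simp
qed

lemma smooth_comp_inner:
  fixes e :: "'a::euclidean_space"
  shows "smooth_on S (\<lambda>x. smooth_step (c * (x \<bullet> e) + c'))"
  by (rule smooth_imp_smooth_on[OF smooth_compose_const[OF smooth_smooth_step]])
    (intro bounded_linear_intros)

text \<open>The test function is a plateau in the direction \<open>f\<close> times the difference of two steps, at
  heights \<open>q\<close> and \<open>h\<close>, in the direction \<open>\<epsilon> b\<close>: testing with it compares weighted averages of
  \<open>u\<close> at these two heights.\<close>

lemma average_difference_bound:
  fixes u :: "real^2 \<Rightarrow> real" and b f :: "real^2"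
  assumes wg: "wgrad V u g" and B: "b \<in> Basis" "f \<in> Basis" "b \<noteq> f" and \<epsilon>: "\<epsilon> = 1 \<or> \<epsilon> = - 1"
    and gint: "integrable lebesgue (\<lambda>x. indicator V x *\<^sub>R norm (g x))"
    and st: "b0 > 0" "0 \<le> \<alpha>" "\<alpha> < \<beta>" "\<beta> \<le> 1" "\<And>y. y \<in> {\<alpha>..\<beta>} \<Longrightarrow> b0 \<le> deriv smooth_step y"
    and ord: "t1 < t2" "q \<le> h" "\<delta> > 0" and s: "s = 1 \<or> s = - (1::real)"
    and sub: "\<And>x. t1 \<le> x \<bullet> f \<Longrightarrow> x \<bullet> f \<le> t2 \<Longrightarrow> q \<le> \<epsilon> * (x \<bullet> b) \<Longrightarrow> \<epsilon> * (x \<bullet> b) \<le> h + \<delta> \<Longrightarrow> x \<in> V"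
    and low: "\<And>x. t1 \<le> x \<bullet> f \<Longrightarrow> x \<bullet> f \<le> t2 \<Longrightarrow> q \<le> \<epsilon> * (x \<bullet> b) \<Longrightarrow> \<epsilon> * (x \<bullet> b) \<le> q + \<delta> \<Longrightarrow> N \<le> s * u x"
    and high: "\<And>x. t1 \<le> x \<bullet> f \<Longrightarrow> x \<bullet> f \<le> t2 \<Longrightarrow> h \<le> \<epsilon> * (x \<bullet> b) \<Longrightarrow> \<epsilon> * (x \<bullet> b) \<le> h + \<delta> \<Longrightarrow> s * u x \<le> M"
    and NM: "M \<le> N"
  shows "b0 * (\<beta> - \<alpha>) / 3 * (N - M) * (t2 - t1)
    \<le> (\<integral>x. indicator {x \<in> V. t1 \<le> x \<bullet> f \<and> x \<bullet> f < t2} x * norm (g x) \<partial>lebesgue)"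
proof -
  \<comment> \<open>With this slope the plateau \<open>P\<close> equals 1 on the middle third of
    [t1, t2].\<close>
  define m where "m = 3 / (t2 - t1)"
  have m: "m > 0" using ord(1) by (simp add: m_def)
  define P where "P x = smooth_step (m * (x \<bullet> f) + - m * t1) * smooth_step (- m * (x \<bullet> f) + m * t2)" for x
  define St where "St r x = smooth_step ((\<epsilon> / \<delta>) * (x \<bullet> b) + - r / \<delta>)" for r x
  define dS where "dS r x = deriv smooth_step ((\<epsilon> / \<delta>) * (x \<bullet> b) + - r / \<delta>)" for r x
  define \<phi> where "\<phi> x = P x * (St q x - St h x)" for x
  define k where "k r x = P x * dS r x / \<delta>" for r x
  have arg: "(\<epsilon> / \<delta>) * (x \<bullet> b) + - r / \<delta> = (\<epsilon> * (x \<bullet> b) - r) / \<delta>" for x r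
    by (simp add: diff_divide_distrib)
  have Pb: "0 \<le> P x" "P x \<le> 1" for x
    by (simp_all add: P_def smooth_step_nonneg smooth_step_le_1 mult_le_one)
  have P0: "P x = 0" if "\<not> (t1 < x \<bullet> f \<and> x \<bullet> f < t2)" for x
  proof -
    have "m * (x \<bullet> f) + - m * t1 \<le> 0 \<or> - m * (x \<bullet> f) + m * t2 \<le> 0"
      using that m by (auto simp: not_less)
    then show ?thesis using smooth_step_0 unfolding P_def by auto
  qed
  have P1: "P x = 1" if "t1 + (t2 - t1) / 3 \<le> x \<bullet> f" "x \<bullet> f \<le> t2 - (t2 - t1) / 3" for x
  proof -
    have "1 \<le> m * (x \<bullet> f - t1)" "1 \<le> m * (t2 - x \<bullet> f)"
      using that ord(1) by (auto simp: m_def field_simps)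
    then show ?thesis by (simp add: P_def smooth_step_1 algebra_simps)
  qed
  have dS0: "dS r x = 0" if "\<not> (r \<le> \<epsilon> * (x \<bullet> b) \<and> \<epsilon> * (x \<bullet> b) \<le> r + \<delta>)" for r x
  proof -
    have "(\<epsilon> * (x \<bullet> b) - r) / \<delta> < 0 \<or> (\<epsilon> * (x \<bullet> b) - r) / \<delta> > 1"
      using that ord(3) by (auto simp: field_simps not_le)
    then show ?thesis
    proof
      assume n: "(\<epsilon> * (x \<bullet> b) - r) / \<delta> < 0"
      show ?thesis unfolding dS_def arg
        by (intro DERIV_imp_deriv has_field_derivative_transform_within_open[OF DERIV_const[of 0], of "{..<0}"])
          (use n smooth_step_0 in auto)
    next
      assume n: "(\<epsilon> * (x \<bullet> b) - r) / \<delta> > 1"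
      show ?thesis unfolding dS_def arg
        by (intro DERIV_imp_deriv has_field_derivative_transform_within_open[OF DERIV_const[of 1], of "{1<..}"])
          (use n smooth_step_1 in auto)
    qed
  qed
  have St0: "St r x = 0" if "\<epsilon> * (x \<bullet> b) \<le> r" for r x
    unfolding St_def arg using that ord(3) by (intro smooth_step_0) (simp add: divide_le_0_iff)
  have St1: "St r x = 1" if "\<epsilon> * (x \<bullet> b) \<ge> r + \<delta>" for r x
    unfolding St_def arg using that ord(3) by (intro smooth_step_1) (simp add: le_divide_eq)
  define K where "K = {x. t1 \<le> x \<bullet> f \<and> x \<bullet> f \<le> t2 \<and> q \<le> \<epsilon> * (x \<bullet> b) \<and> \<epsilon> * (x \<bullet> b) \<le> h + \<delta>}"
  have bf: "b \<bullet> f = 0" "f \<bullet> b = 0" "b \<bullet> b = 1" "f \<bullet> f = 1" using B by (auto simp: inner_Basis)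
  have Kc: "compact K"
  proof -
    have "K = cbox (t1 *\<^sub>R f + (if \<epsilon> = 1 then q else - (h + \<delta>)) *\<^sub>R b) (t2 *\<^sub>R f + (if \<epsilon> = 1 then h + \<delta> else - q) *\<^sub>R b)"
      using \<epsilon> unfolding K_def cbox_def Basis_real2[OF B] by (auto simp: inner_add_left bf)
    then show ?thesis by simp
  qed
  have KV: "K \<subseteq> V" using sub by (auto simp: K_def)
  have \<phi>0: "\<phi> x = 0" if "x \<notin> K" for x
  proof (cases "t1 < x \<bullet> f \<and> x \<bullet> f < t2")
    case True
    then have "\<epsilon> * (x \<bullet> b) < q \<or> h + \<delta> < \<epsilon> * (x \<bullet> b)" using that by (auto simp: K_def)
    then show ?thesis using St0[of x q] St0[of x h] St1[of q x] St1[of h x] ord(2) by (auto simp: \<phi>_def)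
  qed (simp add: \<phi>_def P0)
  have smP: "smooth_on UNIV P" unfolding P_def by (intro smooth_on_mult smooth_comp_inner open_UNIV)
  have smS: "smooth_on UNIV (St r)" for r unfolding St_def by (rule smooth_comp_inner)
  have test: "\<phi> \<in> test_functions V"
  proof (rule test_functionsI[OF _ Kc KV \<phi>0])
    show "smooth \<phi>" unfolding smooth_iff_smooth_on \<phi>_def by (intro smooth_on_mult smooth_on_diff smP smS open_UNIV)
  qed
  have dP: "partial_deriv b P x = 0" for x
  proof -
    have "partial_deriv b P x = smooth_step (m * (x \<bullet> f) + - m * t1) * partial_deriv b (\<lambda>x. smooth_step (- m * (x \<bullet> f) + m * t2)) x
       + partial_deriv b (\<lambda>x. smooth_step (m * (x \<bullet> f) + - m * t1)) x * smooth_step (- m * (x \<bullet> f) + m * t2)"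
      unfolding P_def by (intro partial_deriv_mult smooth_on_differentiable[OF open_UNIV smooth_comp_inner] UNIV_I)
    then show ?thesis
      by (simp only: partial_deriv_comp_inner[OF smooth_step_DERIV] bf mult_zero_right mult_zero_left add_0_left)
  qed
  have dSt: "partial_deriv b (St r) x = \<epsilon> * dS r x / \<delta>" for r x
    unfolding St_def partial_deriv_comp_inner[OF smooth_step_DERIV] by (simp add: dS_def bf)
  have d\<phi>: "partial_deriv b \<phi> x = \<epsilon> * (k q x - k h x)" for x
  proof -
    have dif: "P differentiable (at x)" "St r differentiable (at x)" for r
      using smooth_on_differentiable[OF open_UNIV] smP smS by blast+
    have "partial_deriv b (\<lambda>x. St q x + - 1 * St h x) x = \<epsilon> * dS q x / \<delta> - \<epsilon> * dS h x / \<delta>"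
      using partial_deriv_add[of "St q" x "\<lambda>x. - 1 * St h x" b] partial_deriv_mult[of "\<lambda>_. - 1" x "St h" b]
        partial_deriv_eqI[of "\<lambda>_::real^2. - 1" "\<lambda>_. 0" x b] dif dSt by simp
    then have "partial_deriv b (\<lambda>x. St q x - St h x) x = \<epsilon> * dS q x / \<delta> - \<epsilon> * dS h x / \<delta>" by simp
    then have "partial_deriv b \<phi> x = P x * (\<epsilon> * dS q x / \<delta> - \<epsilon> * dS h x / \<delta>)"
      unfolding \<phi>_def using partial_deriv_mult[of P x "\<lambda>x. St q x - St h x" b] dif dP by simp
    then show ?thesis by (simp add: k_def algebra_simps)
  qed
  have k0: "k r x = 0" if "\<not> (t1 < x \<bullet> f \<and> x \<bullet> f < t2 \<and> r \<le> \<epsilon> * (x \<bullet> b) \<and> \<epsilon> * (x \<bullet> b) \<le> r + \<delta>)" for r x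
    using that P0[of x] dS0[of r x] by (auto simp: k_def)
  have knn: "k r x \<ge> 0" for r x
    using Pb(1)[of x] smooth_step_deriv_nonneg ord(3) by (simp add: k_def dS_def)
  have kc: "continuous_on UNIV (k r)" for r
  proof -
    have "partial_deriv 1 smooth_step = deriv smooth_step"
      using partial_deriv_real[OF smooth_step_DERIV] by blast
    then have "continuous_on UNIV (deriv smooth_step)"
      using smooth_on_continuous[OF smooth_on_partial_deriv[of UNIV smooth_step 1]] smooth_smooth_step
      by (simp add: smooth_iff_smooth_on)
    then have "continuous_on UNIV (dS r)"
      unfolding dS_def by (rule continuous_on_compose2) (use ord(3) in \<open>auto intro!: continuous_intros\<close>)
    then show ?thesis
      unfolding k_def
      using ord(3) continuous_on_divide[OF continuous_on_mult[OF smooth_on_continuous[OF smP]] continuous_on_const, of _ \<delta>]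
      by simp
  qed
  have kK: "k q x = 0" "k h x = 0" if "x \<notin> K" for x
    using that k0[of x q] k0[of x h] ord(2) by (auto simp: K_def)
  have ki: "integrable lebesgue (k q)" "integrable lebesgue (k h)"
    by (rule compact_support_integrable[OF kc Kc]; simp add: kK)+
  \<comment> \<open>The kernels at the two heights are translates of each other, hence have equal
    mass, so the two averages of \<open>u\<close> are taken with the same total weight.\<close>
  have trans: "(\<integral>x. k h x \<partial>lebesgue) = (\<integral>x. k q x \<partial>lebesgue)"
  proof -
    have "(\<integral>x. k h x \<partial>lebesgue) = (\<integral>x. k h (x + (\<epsilon> * (h - q)) *\<^sub>R b) \<partial>lebesgue)"
      by (rule integral_translate[symmetric]) (rule borel_measurable_continuous_onI[OF kc])
    also have "(\<lambda>x. k h (x + (\<epsilon> * (h - q)) *\<^sub>R b)) = k q"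
    proof
      fix x
      have ee: "\<epsilon> * \<epsilon> = 1" using \<epsilon> by auto
      have "\<epsilon> * ((x + (\<epsilon> * (h - q)) *\<^sub>R b) \<bullet> b) = \<epsilon> * (x \<bullet> b) + (\<epsilon> * \<epsilon>) * (h - q)"
        by (simp add: inner_add_left bf algebra_simps)
      then have "dS h (x + (\<epsilon> * (h - q)) *\<^sub>R b) = dS q x"
        unfolding dS_def arg ee by simp
      moreover have "P (x + (\<epsilon> * (h - q)) *\<^sub>R b) = P x" by (simp add: P_def inner_add_left bf)
      ultimately show "k h (x + (\<epsilon> * (h - q)) *\<^sub>R b) = k q x" by (simp add: k_def)
    qed
    finally show ?thesis .
  qed
  \<comment> \<open>On the middle third, at heights between q + \<alpha> \<delta> and q + \<beta>
    \<delta>, the kernel is at least b0 / \<delta>; the thickness \<delta> of the layer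
    cancels.\<close>
  have klow: "b0 * (\<beta> - \<alpha>) / 3 * (t2 - t1) \<le> (\<integral>x. k q x \<partial>lebesgue)"
  proof -
    let ?l1 = "t1 + (t2 - t1) / 3" and ?u1 = "t2 - (t2 - t1) / 3" and ?l2 = "q + \<alpha> * \<delta>" and ?u2 = "q + \<beta> * \<delta>"
    let ?Q = "{x. ?l1 \<le> x \<bullet> f \<and> x \<bullet> f \<le> ?u1 \<and> ?l2 \<le> \<epsilon> * (x \<bullet> b) \<and> \<epsilon> * (x \<bullet> b) \<le> ?u2}"
    have le: "?l1 \<le> ?u1" "?l2 \<le> ?u2" using ord st by (auto simp: field_simps)
    note Q = measure_real2_box[OF B \<epsilon> le]
    have Qi: "integrable lebesgue (indicator ?Q :: real^2 \<Rightarrow> real)"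
      using Q(1) unfolding fmeasurable_def by (intro integrable_real_indicator) auto
    have "b0 * (\<beta> - \<alpha>) / 3 * (t2 - t1) = b0 / \<delta> * ((?u1 - ?l1) * (?u2 - ?l2))"
      using ord(3) by (simp add: field_simps)
    also have "\<dots> = (\<integral>x. b0 / \<delta> * indicator ?Q x \<partial>lebesgue)"
      using Q(2) by simp
    also have "\<dots> \<le> (\<integral>x. k q x \<partial>lebesgue)"
    proof (rule integral_mono[OF _ ki(1)])
      show "integrable lebesgue (\<lambda>x. b0 / \<delta> * indicator ?Q x)" using Qi by (rule integrable_mult_right)
      fix x
      show "b0 / \<delta> * indicator ?Q x \<le> k q x"
      proof (cases "x \<in> ?Q")
        case True
        have "(\<epsilon> * (x \<bullet> b) - q) / \<delta> \<in> {\<alpha>..\<beta>}" using True ord(3) by (auto simp: field_simps)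
        then have "b0 \<le> dS q x" unfolding dS_def arg by (rule st(5))
        moreover have "P x = 1" using True by (intro P1) auto
        ultimately show ?thesis using True ord(3) by (simp add: k_def divide_right_mono)
      next
        case False
        then have "indicator ?Q x = (0::real)" by (rule indicator_simps(2))
        then show ?thesis using knn[of q x] by simp
      qed
    qed
    finally show ?thesis .
  qed
  have cu: "continuous_on V u" and V: "open V" and li: "locally_integrable V g" using wg by (auto simp: wgrad_def)
  have kcu: "continuous_on UNIV (\<lambda>x. u x * k r x)" if "r = q \<or> r = h" for r
    using that kK by (intro continuous_on_extend_zero[OF V compact_imp_closed[OF Kc] KV] continuous_intros cu
        continuous_on_subset[OF kc]) auto
  have kui: "integrable lebesgue (\<lambda>x. s * u x * k r x)" if "r = q \<or> r = h" for r
  proof -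
    have "integrable lebesgue (\<lambda>x. u x * k r x)"
      using that kK by (intro compact_support_integrable[OF kcu[OF that] Kc]) auto
    then show ?thesis using integrable_mult_right[of s lebesgue "\<lambda>x. u x * k r x"] by (simp add: mult.assoc)
  qed
  have L: "N * (\<integral>x. k q x \<partial>lebesgue) \<le> (\<integral>x. s * u x * k q x \<partial>lebesgue)"
  proof -
    have "(\<integral>x. N * k q x \<partial>lebesgue) \<le> (\<integral>x. s * u x * k q x \<partial>lebesgue)"
    proof (rule integral_mono)
      show "N * k q x \<le> s * u x * k q x" for x
      proof (cases "k q x = 0")
        case False
        then have "t1 < x \<bullet> f \<and> x \<bullet> f < t2 \<and> q \<le> \<epsilon> * (x \<bullet> b) \<and> \<epsilon> * (x \<bullet> b) \<le> q + \<delta>"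
          using k0 by blast
        then show ?thesis using low[of x] knn[of q x] by (intro mult_right_mono) auto
      qed simp
    qed (use ki kui in auto)
    then show ?thesis by simp
  qed
  have R: "(\<integral>x. s * u x * k h x \<partial>lebesgue) \<le> M * (\<integral>x. k h x \<partial>lebesgue)"
  proof -
    have "(\<integral>x. s * u x * k h x \<partial>lebesgue) \<le> (\<integral>x. M * k h x \<partial>lebesgue)"
    proof (rule integral_mono)
      show "s * u x * k h x \<le> M * k h x" for x
      proof (cases "k h x = 0")
        case False
        then have "t1 < x \<bullet> f \<and> x \<bullet> f < t2 \<and> h \<le> \<epsilon> * (x \<bullet> b) \<and> \<epsilon> * (x \<bullet> b) \<le> h + \<delta>"
          using k0 by blast
        then show ?thesis using high[of x] knn[of h x] by (intro mult_right_mono) auto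
      qed simp
    qed (use ki kui in auto)
    then show ?thesis by simp
  qed
  have id: "(\<integral>x. u x * partial_deriv b \<phi> x \<partial>lebesgue) = - (\<integral>x. (g x \<bullet> b) * \<phi> x \<partial>lebesgue)"
    using wg test B(1) by (auto simp: wgrad_def)
  have "(\<integral>x. u x * partial_deriv b \<phi> x \<partial>lebesgue) = (\<integral>x. \<epsilon> * s * (s * u x * k q x - s * u x * k h x) \<partial>lebesgue)"
    using s by (intro Bochner_Integration.integral_cong refl) (auto simp: d\<phi> algebra_simps)
  also have "\<dots> = \<epsilon> * s * ((\<integral>x. s * u x * k q x \<partial>lebesgue) - (\<integral>x. s * u x * k h x \<partial>lebesgue))"
    using kui by (simp only: integral_mult_right_zero) (simp add: Bochner_Integration.integral_diff)
  finally have "\<bar>\<integral>x. (g x \<bullet> b) * \<phi> x \<partial>lebesgue\<bar> = \<bar>(\<integral>x. s * u x * k q x \<partial>lebesgue) - (\<integral>x. s * u x * k h x \<partial>lebesgue)\<bar>"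
    using id \<epsilon> s by (auto simp: abs_mult)
  then have 1: "(N - M) * (\<integral>x. k q x \<partial>lebesgue) \<le> \<bar>\<integral>x. (g x \<bullet> b) * \<phi> x \<partial>lebesgue\<bar>"
    using L R trans by (simp add: left_diff_distrib)
  let ?Z = "{x \<in> V. t1 \<le> x \<bullet> f \<and> x \<bullet> f < t2}"
  have Zm: "?Z \<in> sets lebesgue"
  proof -
    have "?Z = V \<inter> ({x. t1 \<le> x \<bullet> f} \<inter> {x. x \<bullet> f < t2})" by auto
    moreover have "closed {x. t1 \<le> x \<bullet> f}" "open {x. x \<bullet> f < t2}"
      by (auto intro!: closed_Collect_le open_Collect_less continuous_intros)
    ultimately show ?thesis using V by auto
  qed
  have gZ: "integrable lebesgue (\<lambda>x. indicator ?Z x * norm (g x))"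
  proof -
    have "integrable lebesgue (\<lambda>x. (indicator V x *\<^sub>R norm (g x)) * indicator ?Z x)"
      by (rule integrable_mult_bounded[OF gint borel_measurable_indicator[OF Zm], where B=1]) (simp add: indicator_def)
    moreover have "(indicator V x *\<^sub>R norm (g x)) * indicator ?Z x = indicator ?Z x * norm (g x)" for x
      by (simp add: indicator_def)
    ultimately show ?thesis by (simp only:)
  qed
  have "\<bar>\<integral>x. (g x \<bullet> b) * \<phi> x \<partial>lebesgue\<bar> \<le> (\<integral>x. \<bar>(g x \<bullet> b) * \<phi> x\<bar> \<partial>lebesgue)"
    by (rule integral_abs_bound)
  also have "\<dots> \<le> (\<integral>x. indicator ?Z x * norm (g x) \<partial>lebesgue)"
  proof (rule integral_mono[OF _ gZ])
    show "integrable lebesgue (\<lambda>x. \<bar>(g x \<bullet> b) * \<phi> x\<bar>)"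
      by (rule integrable_abs[OF integrable_locally_integrable_times_test[OF li test]])
    fix x
    show "\<bar>(g x \<bullet> b) * \<phi> x\<bar> \<le> indicator ?Z x * norm (g x)"
    proof (cases "\<phi> x = 0")
      case False
      then have "x \<in> K" using \<phi>0 by blast
      moreover have "t1 < x \<bullet> f" "x \<bullet> f < t2" using False P0[of x] by (auto simp: \<phi>_def)
      ultimately have xZ: "x \<in> ?Z" using KV by auto
      have "\<bar>St q x - St h x\<bar> \<le> 1"
        using smooth_step_nonneg smooth_step_le_1 unfolding St_def by (smt (verit))
      then have "\<bar>\<phi> x\<bar> \<le> 1 * 1" unfolding \<phi>_def abs_mult using Pb[of x] by (intro mult_mono) auto
      then have "\<bar>g x \<bullet> b\<bar> * \<bar>\<phi> x\<bar> \<le> norm (g x) * 1"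
        using Basis_le_norm[OF B(1), of "g x"] by (intro mult_mono) auto
      then show ?thesis using xZ by (simp add: abs_mult)
    qed simp
  qed
  finally have "(N - M) * (\<integral>x. k q x \<partial>lebesgue) \<le> (\<integral>x. indicator ?Z x * norm (g x) \<partial>lebesgue)"
    using 1 by linarith
  moreover have "(N - M) * (b0 * (\<beta> - \<alpha>) / 3 * (t2 - t1)) \<le> (N - M) * (\<integral>x. k q x \<partial>lebesgue)"
    using klow NM by (intro mult_left_mono) auto
  ultimately show ?thesis by (simp add: mult_ac)
qed

text \<open>A substitute for absolute continuity on almost every line. If each line x . f = t
  carried a point below height h with |u| > N, then near each t a narrow strip would contribute at
  least c (N - M) times its width to \<integral> |g|, by comparison with the layer above, where |u|
  \<le> M. Bisection adds the strips up, and for large N the sum exceeds the total integral.\<close>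

lemma bounded_on_line:
  fixes u :: "real^2 \<Rightarrow> real" and b f :: "real^2"
  assumes wg: "wgrad V u g" and B: "b \<in> Basis" "f \<in> Basis" "b \<noteq> f" and \<epsilon>: "\<epsilon> = 1 \<or> \<epsilon> = - 1"
    and gint: "integrable lebesgue (\<lambda>x. indicator V x *\<^sub>R norm (g x))"
    and ord: "t1 < t2" "h < h'"
    and up: "\<And>x \<tau>. x \<in> V \<Longrightarrow> t1 \<le> x \<bullet> f \<Longrightarrow> x \<bullet> f \<le> t2 \<Longrightarrow> 0 \<le> \<tau> \<Longrightarrow> \<epsilon> * (x \<bullet> b) + \<tau> \<le> h' \<Longrightarrow> x + (\<epsilon> * \<tau>) *\<^sub>R b \<in> V"
    and top: "\<And>x. t1 \<le> x \<bullet> f \<Longrightarrow> x \<bullet> f \<le> t2 \<Longrightarrow> h \<le> \<epsilon> * (x \<bullet> b) \<Longrightarrow> \<epsilon> * (x \<bullet> b) \<le> h' \<Longrightarrow> \<bar>u x\<bar> \<le> M"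
  obtains t N where "t1 \<le> t" "t \<le> t2" "\<And>x. x \<in> V \<Longrightarrow> x \<bullet> f = t \<Longrightarrow> \<epsilon> * (x \<bullet> b) \<le> h \<Longrightarrow> \<bar>u x\<bar> \<le> N"
proof -
  obtain b0 \<alpha> \<beta> where st: "b0 > 0" "0 \<le> \<alpha>" "\<alpha> < \<beta>" "\<beta> \<le> 1" "\<And>y. y \<in> {\<alpha>..\<beta>} \<Longrightarrow> b0 \<le> deriv smooth_step y"
    using smooth_step_steep by blast
  define c where "c = b0 * (\<beta> - \<alpha>) / 3"
  have c: "c > 0" using st by (simp add: c_def)
  let ?I = "\<lambda>s1 s2. \<integral>x. indicator {x \<in> V. s1 \<le> x \<bullet> f \<and> x \<bullet> f < s2} x * norm (g x) \<partial>lebesgue"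
  define G where "G = ?I t1 t2"
  \<comment> \<open>Large enough that c (N - M) (t2 - t1) exceeds the integral \<open>G\<close> of
    |g| over the whole strip.\<close>
  define N where "N = \<bar>M\<bar> + \<bar>G\<bar> / (c * (t2 - t1)) + 1"
  have NM: "M \<le> N" "\<bar>M\<bar> < N"
  proof -
    have "\<bar>G\<bar> / (c * (t2 - t1)) \<ge> 0" using ord(1) c by simp
    then show "M \<le> N" "\<bar>M\<bar> < N" unfolding N_def by linarith+
  qed
  have cu: "continuous_on V u" and V: "open V" using wg by (auto simp: wgrad_def)
  have bf: "b \<bullet> f = 0" "f \<bullet> b = 0" "b \<bullet> b = 1" "f \<bullet> f = 1" using B by (auto simp: inner_Basis)
  have ee: "\<epsilon> * \<epsilon> = 1" "\<bar>\<epsilon>\<bar> = 1" using \<epsilon> by auto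
  have int: "integrable lebesgue (\<lambda>x. indicator {x \<in> V. s1 \<le> x \<bullet> f \<and> x \<bullet> f < s2} x * norm (g x))" for s1 s2
  proof -
    let ?Z = "{x \<in> V. s1 \<le> x \<bullet> f \<and> x \<bullet> f < s2}"
    have "?Z = V \<inter> ({x. s1 \<le> x \<bullet> f} \<inter> {x. x \<bullet> f < s2})" by auto
    moreover have "closed {x. s1 \<le> x \<bullet> f}" "open {x. x \<bullet> f < s2}"
      by (auto intro!: closed_Collect_le open_Collect_less continuous_intros)
    ultimately have Zm: "?Z \<in> sets lebesgue" using V by auto
    have "integrable lebesgue (\<lambda>x. (indicator V x *\<^sub>R norm (g x)) * indicator ?Z x)"
      by (rule integrable_mult_bounded[OF gint borel_measurable_indicator[OF Zm], where B=1]) (simp add: indicator_def)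
    moreover have "(indicator V x *\<^sub>R norm (g x)) * indicator ?Z x = indicator ?Z x * norm (g x)" for x
      by (simp add: indicator_def)
    ultimately show ?thesis by (simp only:)
  qed
  have "\<exists>t\<in>{t1..t2}. \<forall>x\<in>V. x \<bullet> f = t \<longrightarrow> \<epsilon> * (x \<bullet> b) \<le> h \<longrightarrow> \<bar>u x\<bar> \<le> N"
  proof (rule ccontr)
    assume neg: "\<not> ?thesis"
    \<comment> \<open>The strips are half-open so that their integrals add up over adjacent
      intervals; \<open>Bolzano\<close> then propagates the estimate from short intervals to
      [t1, t2].\<close>
    define Q where "Q s1 s2 \<longleftrightarrow> (t1 \<le> s1 \<and> s1 \<le> s2 \<and> s2 \<le> t2 \<longrightarrow> c * (N - M) * (s2 - s1) \<le> ?I s1 s2)" for s1 s2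
    have "Q t1 t2"
    proof (rule Bolzano)
      show "t1 \<le> t2" using ord by simp
    next
      fix s1 s2 s3 assume Q: "Q s1 s2" "Q s2 s3" and le: "s1 \<le> s2" "s2 \<le> s3"
      show "Q s1 s3"
        unfolding Q_def
      proof
        assume r: "t1 \<le> s1 \<and> s1 \<le> s3 \<and> s3 \<le> t2"
        have "c * (N - M) * (s2 - s1) \<le> ?I s1 s2" "c * (N - M) * (s3 - s2) \<le> ?I s2 s3"
          using Q r le by (auto simp: Q_def)
        moreover have "?I s1 s3 = ?I s1 s2 + ?I s2 s3"
        proof -
          have "indicator {x \<in> V. s1 \<le> x \<bullet> f \<and> x \<bullet> f < s3} x * norm (g x)
            = indicator {x \<in> V. s1 \<le> x \<bullet> f \<and> x \<bullet> f < s2} x * norm (g x)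
              + indicator {x \<in> V. s2 \<le> x \<bullet> f \<and> x \<bullet> f < s3} x * norm (g x)" for x
            using le by (auto simp: indicator_def)
          then show ?thesis using int by simp
        qed
        ultimately show "c * (N - M) * (s3 - s1) \<le> ?I s1 s3" by (simp add: algebra_simps)
      qed
    next
      fix t assume t: "t1 \<le> t" "t \<le> t2"
      then obtain x where x: "x \<in> V" "x \<bullet> f = t" "\<epsilon> * (x \<bullet> b) \<le> h" "\<bar>u x\<bar> > N"
        using neg by (meson atLeastAtMost_iff not_le)
      define s where "s = sgn (u x)"
      have s: "s = 1 \<or> s = - 1" "s * u x > N"
        using x(4) NM by (auto simp: s_def sgn_if abs_if split: if_splits)
      have "open (V \<inter> (\<lambda>y. s * u y) -` {N<..})"
        by (intro continuous_open_preimage continuous_intros cu V)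
      then obtain r where r: "r > 0" "ball x r \<subseteq> V \<inter> (\<lambda>y. s * u y) -` {N<..}"
        using x s openE[of "V \<inter> (\<lambda>y. s * u y) -` {N<..}" x] by auto
      \<comment> \<open>r / 2 keeps the lower layer inside the ball where \<open>s * u\<close>
        exceeds \<open>N\<close>, and h' - h keeps the upper layer inside the region where
        \<open>M\<close> is a bound.\<close>
      define \<delta> where "\<delta> = min (r / 2) (h' - h)"
      have \<delta>: "\<delta> > 0" "\<delta> \<le> r / 2" "h + \<delta> \<le> h'" using r(1) ord(2) unfolding \<delta>_def min_def by (auto split: if_splits)
      define q where "q = \<epsilon> * (x \<bullet> b)"
      have near: "y \<in> ball x r" if "\<bar>y \<bullet> f - t\<bar> < r / 2" "\<bar>\<epsilon> * (y \<bullet> b) - q\<bar> \<le> r / 2" for y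
      proof -
        have "y - x = ((y - x) \<bullet> f) *\<^sub>R f + ((y - x) \<bullet> b) *\<^sub>R b" by (rule real2_decompose[OF B])
        then have "norm (y - x) \<le> \<bar>(y - x) \<bullet> f\<bar> * norm f + \<bar>(y - x) \<bullet> b\<bar> * norm b"
          by (metis norm_scaleR norm_triangle_ineq)
        also have "\<dots> = \<bar>y \<bullet> f - t\<bar> + \<bar>\<epsilon> * (y \<bullet> b) - q\<bar>"
          using B x(2) ee by (simp add: inner_diff_left q_def right_diff_distrib[symmetric] abs_mult)
        also have "\<dots> < r" using that by linarith
        finally show ?thesis by (simp add: dist_norm norm_minus_commute)
      qed
      show "\<exists>d>0. \<forall>s1 s2. s1 \<le> t \<and> t \<le> s2 \<and> s2 - s1 < d \<longrightarrow> Q s1 s2"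
      proof (intro exI[of _ "r / 2"] conjI allI impI)
        fix s1 s2 assume ss: "s1 \<le> t \<and> t \<le> s2 \<and> s2 - s1 < r / 2"
        show "Q s1 s2"
          unfolding Q_def
        proof
          assume rg: "t1 \<le> s1 \<and> s1 \<le> s2 \<and> s2 \<le> t2"
          show "c * (N - M) * (s2 - s1) \<le> ?I s1 s2"
          proof (cases "s1 = s2")
            case True
            have "{x \<in> V. s1 \<le> x \<bullet> f \<and> x \<bullet> f < s2} = {}" using True by auto
            then show ?thesis using True by simp
          next
            case False
            show ?thesis unfolding c_def
            proof (rule average_difference_bound[OF wg B \<epsilon> gint st _ _ \<delta>(1) s(1), where q=q and h=h])
              show "s1 < s2" using False rg by simp
              show "q \<le> h" using x(3) by (simp add: q_def)
              show "M \<le> N" by (rule NM)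
              fix y assume y: "s1 \<le> y \<bullet> f" "y \<bullet> f \<le> s2"
              have yf: "\<bar>y \<bullet> f - t\<bar> < r / 2"
              proof -
                have "y \<bullet> f - t < r / 2" "- (y \<bullet> f - t) < r / 2" using y ss by linarith+
                then show ?thesis by (rule abs_less_iff[THEN iffD2, OF conjI])
              qed
              show "y \<in> V" if "q \<le> \<epsilon> * (y \<bullet> b)" "\<epsilon> * (y \<bullet> b) \<le> h + \<delta>"
              proof -
                \<comment> \<open>The point is moved down to height q, where it lies in the ball,
                  and brought back by \<open>up\<close>, the stability of \<open>V\<close> under
                  this motion.\<close>
                define \<tau> where "\<tau> = \<epsilon> * (y \<bullet> b) - q"
                define y' where "y' = y - (\<epsilon> * \<tau>) *\<^sub>R b"
                have yq: "\<epsilon> * (y' \<bullet> b) = q"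
                proof -
                  have "\<epsilon> * (y' \<bullet> b) = \<epsilon> * (y \<bullet> b) - (\<epsilon> * \<epsilon>) * \<tau>"
                    by (simp add: y'_def inner_diff_left bf algebra_simps)
                  then show ?thesis by (simp add: ee \<tau>_def)
                qed
                have yf': "y' \<bullet> f = y \<bullet> f" by (simp add: y'_def inner_diff_left bf)
                have "y' \<in> ball x r" using r(1) yf yf' yq by (intro near) auto
                then have "y' \<in> V" using r(2) by blast
                then have "y' + (\<epsilon> * \<tau>) *\<^sub>R b \<in> V"
                  using y rg yf' yq that \<delta>(3) by (intro up) (auto simp: \<tau>_def)
                then show ?thesis by (simp add: y'_def)
              qed
              show "N \<le> s * u y" if "q \<le> \<epsilon> * (y \<bullet> b)" "\<epsilon> * (y \<bullet> b) \<le> q + \<delta>"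
              proof -
                have "y \<in> ball x r" using yf that \<delta>(2) by (intro near) auto
                then show ?thesis using r(2) by force
              qed
              show "s * u y \<le> M" if "h \<le> \<epsilon> * (y \<bullet> b)" "\<epsilon> * (y \<bullet> b) \<le> h + \<delta>"
                using top[of y] y rg that \<delta>(3) s(1) by auto
            qed
          qed
        qed
      qed (use r in simp)
    qed
    then have "c * (N - M) * (t2 - t1) \<le> G" using ord by (simp add: Q_def G_def)
    moreover have "G < c * (N - M) * (t2 - t1)"
    proof -
      have ct: "c * (t2 - t1) > 0" using c ord by simp
      have "\<bar>G\<bar> / (c * (t2 - t1)) < N - M" by (simp add: N_def)
      then have "\<bar>G\<bar> < (N - M) * (c * (t2 - t1))" using ct by (simp add: pos_divide_less_eq)
      then show ?thesis by (simp add: mult_ac)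
    qed
    ultimately show False by simp
  qed
  then obtain t where "t1 \<le> t" "t \<le> t2" "\<forall>x\<in>V. x \<bullet> f = t \<longrightarrow> \<epsilon> * (x \<bullet> b) \<le> h \<longrightarrow> \<bar>u x\<bar> \<le> N"
    by auto
  then show ?thesis by (intro that[of t N]) auto
qed

section \<open>Geometry of a smooth boundary point\<close>

lemma frechet_derivative_eq_grad:
  fixes f :: "'a::euclidean_space \<Rightarrow> real"
  assumes "f differentiable (at x)"
  shows "frechet_derivative f (at x) h = grad f x \<bullet> h"
proof -
  have l: "linear (frechet_derivative f (at x))" by (rule linear_frechet_derivative[OF assms])
  have "frechet_derivative f (at x) h = frechet_derivative f (at x) (\<Sum>i\<in>Basis. (h \<bullet> i) *\<^sub>R i)"
    by (simp only: euclidean_representation)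
  also have "\<dots> = (\<Sum>i\<in>Basis. (h \<bullet> i) * frechet_derivative f (at x) i)"
    by (simp add: linear_sum[OF l] linear_scale[OF l])
  also have "\<dots> = grad f x \<bullet> h"
    unfolding grad_def inner_sum_left inner_scaleR_left partial_deriv_def
    by (simp add: inner_commute mult.commute)
  finally show ?thesis .
qed

lemma has_derivative_grad:
  fixes f :: "'a::euclidean_space \<Rightarrow> real"
  assumes "f differentiable (at x)"
  shows "(f has_derivative (\<lambda>h. grad f x \<bullet> h)) (at x)"
proof -
  have "frechet_derivative f (at x) = (\<lambda>h. grad f x \<bullet> h)"
    using frechet_derivative_eq_grad[OF assms] by blast
  then show ?thesis using assms by (simp add: frechet_derivative_works)
qed

lemma DERIV_along_line:
  fixes f :: "'a::euclidean_space \<Rightarrow> real"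
  assumes "smooth f"
  shows "((\<lambda>t. f (x + t *\<^sub>R v)) has_real_derivative grad f (x + t *\<^sub>R v) \<bullet> v) (at t)"
proof -
  have "((\<lambda>t. x + t *\<^sub>R v) has_derivative (\<lambda>t. t *\<^sub>R v)) (at t)"
    by (auto intro!: derivative_eq_intros)
  from has_derivative_compose[OF this has_derivative_grad[OF smooth_differentiable[OF assms]]]
  show ?thesis by (simp add: has_field_derivative_def mult_commute_abs)
qed

lemma grad_lipschitz:
  fixes f :: "'a::euclidean_space \<Rightarrow> real"
  assumes "smooth f"
  obtains L where "L > 0" "\<And>x y. x \<in> cball 0 1 \<Longrightarrow> y \<in> cball 0 1 \<Longrightarrow> norm (grad f x - grad f y) \<le> L * norm (x - y)"
proof -
  have "\<exists>L\<ge>0. \<forall>x\<in>cball 0 1. \<forall>y\<in>cball 0 1. \<bar>partial_deriv i f x - partial_deriv i f y\<bar> \<le> L * norm (x - y)"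
    if i: "i \<in> Basis" for i
  proof -
    let ?p = "partial_deriv i f"
    have sp: "smooth_on UNIV ?p" using assms i by (simp add: smooth_iff_smooth_on smooth_on_partial_deriv)
    have "continuous_on (cball 0 1) (grad ?p)"
      using continuous_on_grad[OF sp] by (rule continuous_on_subset) simp
    then have "bounded (grad ?p ` cball 0 1)"
      by (intro compact_imp_bounded compact_continuous_image) auto
    then obtain B where "\<forall>x\<in>cball 0 1. norm (grad ?p x) \<le> B" unfolding bounded_iff by blast
    then have B: "norm (grad ?p x) \<le> B" if "x \<in> cball 0 1" for x using that by blast
    have "norm (?p x - ?p y) \<le> B * norm (x - y)" if "x \<in> cball 0 1" "y \<in> cball 0 1" for x y
    proof (rule differentiable_bound[OF convex_cball _ _ that])
      fix z :: 'a assume z: "z \<in> cball 0 1"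
      show "(?p has_derivative (\<lambda>h. grad ?p z \<bullet> h)) (at z within cball 0 1)"
        using has_derivative_grad[OF smooth_on_differentiable[OF open_UNIV sp UNIV_I]] by (rule has_derivative_at_withinI)
      show "onorm (\<lambda>h. grad ?p z \<bullet> h) \<le> B"
      proof (rule onorm_le)
        fix h
        have "norm (grad ?p z \<bullet> h) \<le> norm (grad ?p z) * norm h"
          using Cauchy_Schwarz_ineq2 by simp
        also have "\<dots> \<le> B * norm h" using B[OF z] by (rule mult_right_mono) simp
        finally show "norm (grad ?p z \<bullet> h) \<le> B * norm h" .
      qed
    qed
    moreover have "0 \<le> B" by (rule order_trans[OF norm_ge_zero B[of 0]]) simp
    ultimately show ?thesis by auto
  qed
  then obtain L where L: "\<And>i. i \<in> Basis \<Longrightarrow> L i \<ge> 0"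
    "\<And>i x y. i \<in> Basis \<Longrightarrow> x \<in> cball 0 1 \<Longrightarrow> y \<in> cball 0 1 \<Longrightarrow> \<bar>partial_deriv i f x - partial_deriv i f y\<bar> \<le> L i * norm (x - y)"
    by metis
  show ?thesis
  proof (rule that[of "(\<Sum>i\<in>Basis. L i) + 1"])
    show "(\<Sum>i\<in>Basis. L i) + 1 > 0" using L(1) by (intro add_nonneg_pos sum_nonneg) auto
    fix x y :: 'a assume xy: "x \<in> cball 0 1" "y \<in> cball 0 1"
    have "norm (grad f x - grad f y) \<le> (\<Sum>i\<in>Basis. \<bar>(grad f x - grad f y) \<bullet> i\<bar>)" by (rule norm_le_l1)
    also have "\<dots> \<le> (\<Sum>i\<in>Basis. L i * norm (x - y))"
      using L(2) xy by (intro sum_mono) (simp add: inner_diff_left grad_inner)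
    also have "\<dots> \<le> ((\<Sum>i\<in>Basis. L i) + 1) * norm (x - y)"
      by (simp add: sum_distrib_right distrib_right)
    finally show "norm (grad f x - grad f y) \<le> ((\<Sum>i\<in>Basis. L i) + 1) * norm (x - y)" .
  qed
qed

text \<open>The mean value form f x - f 0 = \<nabla>f(\<tau> x) . x together with a Lipschitz bound
  for the gradient on the unit ball. For a boundary function \<sigma> with \<sigma> 0 = 0 the two
  estimates bound x . \<nabla>\<sigma>(x) and \<nabla>\<sigma>(0) . x from below by - K |x|^2
  wherever \<sigma> > 0.\<close>

lemma taylor_at_origin:
  fixes f :: "'a::euclidean_space \<Rightarrow> real"
  assumes "smooth f"
  obtains K where "K > 0"
    "\<And>x. x \<in> cball 0 1 \<Longrightarrow> \<bar>x \<bullet> grad f x - (f x - f 0)\<bar> \<le> K * (norm x)\<^sup>2"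
    "\<And>x. x \<in> cball 0 1 \<Longrightarrow> \<bar>(f x - f 0) - grad f 0 \<bullet> x\<bar> \<le> K * (norm x)\<^sup>2"
proof -
  obtain L where L: "L > 0" "\<And>x y. x \<in> cball 0 1 \<Longrightarrow> y \<in> cball 0 1 \<Longrightarrow> norm (grad f x - grad f y) \<le> L * norm (x - y)"
    using grad_lipschitz[OF assms] by blast
  have mid: "\<exists>\<tau>. 0 < \<tau> \<and> \<tau> < 1 \<and> f x - f 0 = grad f (\<tau> *\<^sub>R x) \<bullet> x" for x
    using MVT2[of 0 1 "\<lambda>t. f (0 + t *\<^sub>R x)" "\<lambda>t. grad f (0 + t *\<^sub>R x) \<bullet> x"] DERIV_along_line[OF assms, of 0 x] by auto
  have est: "\<bar>(grad f y - grad f z) \<bullet> x\<bar> \<le> L * (norm x)\<^sup>2"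
    if "y \<in> cball 0 1" "z \<in> cball 0 1" "norm (y - z) \<le> norm x" for x y z
  proof -
    have "\<bar>(grad f y - grad f z) \<bullet> x\<bar> \<le> norm (grad f y - grad f z) * norm x" by (rule Cauchy_Schwarz_ineq2)
    also have "\<dots> \<le> (L * norm x) * norm x"
      using order_trans[OF L(2)[OF that(1,2)] mult_left_mono[OF that(3), of L]] L(1)
      by (intro mult_right_mono) auto
    finally show ?thesis by (simp add: power2_eq_square)
  qed
  show ?thesis
  proof (rule that[OF L(1)])
    fix x :: 'a assume x: "x \<in> cball 0 1"
    obtain \<tau> where t: "0 < \<tau>" "\<tau> < 1" "f x - f 0 = grad f (\<tau> *\<^sub>R x) \<bullet> x" using mid by blast
    have "\<tau> * norm x \<le> 1 * norm x" using t by (intro mult_right_mono) auto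
    then have tx: "norm (\<tau> *\<^sub>R x) \<le> norm x" using t by simp
    then have tb: "\<tau> *\<^sub>R x \<in> cball 0 1" using x by (simp add: dist_norm)
    have "x - \<tau> *\<^sub>R x = (1 - \<tau>) *\<^sub>R x" by (simp add: scaleR_diff_left)
    then have "norm (x - \<tau> *\<^sub>R x) = (1 - \<tau>) * norm x" using t by simp
    also have "\<dots> \<le> 1 * norm x" using t by (intro mult_right_mono) auto
    finally have d: "norm (x - \<tau> *\<^sub>R x) \<le> norm x" by simp
    show "\<bar>x \<bullet> grad f x - (f x - f 0)\<bar> \<le> L * (norm x)\<^sup>2"
      using est[OF x tb d] by (simp add: t(3) inner_diff_left inner_commute[of x])
    show "\<bar>(f x - f 0) - grad f 0 \<bullet> x\<bar> \<le> L * (norm x)\<^sup>2"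
      using est[OF tb, of 0 x] tx by (simp add: t(3) inner_diff_left)
  qed
qed

text \<open>\<sigma> is the height above the graph in the local orthogonal coordinates. It replaces
  \<open>T\<close> and \<gamma> from here on, so that all later work takes place in the original
  coordinates.\<close>

lemma boundary_defining_function:
  fixes \<Omega> :: "(real^2) set"
  assumes sb: "smooth_boundary \<Omega>" and op: "open \<Omega>" and fr: "0 \<in> frontier \<Omega>"
  obtains r \<sigma> where "r > 0" "smooth \<sigma>" "\<sigma> 0 = 0" "grad \<sigma> 0 \<noteq> 0" "\<And>x. x \<in> ball 0 r \<Longrightarrow> x \<in> \<Omega> \<longleftrightarrow> \<sigma> x > 0"
proof -
  obtain r and T :: "real^2 \<Rightarrow> real^2" and \<gamma> :: "real \<Rightarrow> real" where r: "r > 0" and T: "orthogonal_transformation T" and \<gamma>: "smooth \<gamma>"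
    and eq: "\<Omega> \<inter> ball 0 r = {x \<in> ball 0 r. T x $ 2 > \<gamma> (T x $ 1)}"
    using sb fr unfolding smooth_boundary_def by blast
  define \<sigma> where "\<sigma> x = T x $ 2 - \<gamma> (T x $ 1)" for x
  have lT: "linear T" using T by (simp add: orthogonal_transformation_def)
  have bl: "bounded_linear (\<lambda>x. T x $ i)" for i
    using bounded_linear_compose[OF bounded_linear_vec_nth linear_conv_bounded_linear[THEN iffD1, OF lT]] .
  have sm: "smooth \<sigma>"
    unfolding smooth_iff_smooth_on \<sigma>_def
    by (intro smooth_on_diff smooth_on_bounded_linear bl smooth_on_compose_UNIV[OF open_UNIV \<gamma>] open_UNIV)
  have iff: "x \<in> \<Omega> \<longleftrightarrow> \<sigma> x > 0" if "x \<in> ball 0 r" for x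
  proof -
    have "x \<in> \<Omega> \<inter> ball 0 r \<longleftrightarrow> x \<in> {x \<in> ball 0 r. T x $ 2 > \<gamma> (T x $ 1)}" by (simp only: eq)
    then show ?thesis using that by (simp add: \<sigma>_def)
  qed
  have cs: "continuous_on UNIV \<sigma>" using sm by (intro smooth_on_continuous) (simp add: smooth_iff_smooth_on)
  have "0 \<notin> \<Omega>" using fr op by (simp add: frontier_def interior_open)
  then have "\<sigma> 0 \<le> 0" using iff[of 0] r by simp
  \<comment> \<open>A negative value would persist near the origin, and a neighbourhood of the
    origin would miss the domain.\<close>
  moreover have "\<not> \<sigma> 0 < 0"
  proof
    assume neg: "\<sigma> 0 < 0"
    have "open (\<sigma> -` {..<0} \<inter> ball 0 r)" using cs by (intro open_Int open_vimage) auto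
    moreover have "0 \<in> closure \<Omega>" using fr by (simp add: frontier_def)
    ultimately have "\<Omega> \<inter> (\<sigma> -` {..<0} \<inter> ball 0 r) \<noteq> {}"
      using neg r open_Int_closure_eq_empty[of "\<sigma> -` {..<0} \<inter> ball 0 r" \<Omega>] by auto
    then show False using iff by force
  qed
  ultimately have s0: "\<sigma> 0 = 0" by simp
  have "surj T" using T by (rule orthogonal_transformation_surj)
  \<comment> \<open>Along the preimage of the second axis \<sigma> is t - \<gamma> 0, so its
    derivative is 1 and the gradient cannot vanish.\<close>
  then obtain v where v: "T v = axis 2 1" by (metis surjD)
  have "((\<lambda>t. \<sigma> (0 + t *\<^sub>R v)) has_real_derivative grad \<sigma> (0 + 0 *\<^sub>R v) \<bullet> v) (at 0)"
    by (rule DERIV_along_line[OF sm])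
  moreover have "(\<lambda>t. \<sigma> (0 + t *\<^sub>R v)) = (\<lambda>t. t - \<gamma> 0)"
    by (rule ext) (simp add: \<sigma>_def linear_scale[OF lT] v axis_def)
  moreover have "((\<lambda>t. t - \<gamma> 0) has_real_derivative 1) (at 0)" by (auto intro!: derivative_eq_intros)
  ultimately have "grad \<sigma> 0 \<bullet> v = 1" using DERIV_unique by fastforce
  then have "grad \<sigma> 0 \<noteq> 0" by auto
  then show ?thesis using that[OF r sm s0 _ iff] by blast
qed

lemma frontier_real2_box:
  fixes b f :: "real^2"
  shows "open {x. t1 < x \<bullet> f \<and> x \<bullet> f < t2 \<and> l < \<epsilon> * (x \<bullet> b) \<and> \<epsilon> * (x \<bullet> b) < h}" (is "open ?U")
    "closure {x. t1 < x \<bullet> f \<and> x \<bullet> f < t2 \<and> l < \<epsilon> * (x \<bullet> b) \<and> \<epsilon> * (x \<bullet> b) < h} \<subseteq> {x. t1 \<le> x \<bullet> f \<and> x \<bullet> f \<le> t2 \<and> l \<le> \<epsilon> * (x \<bullet> b) \<and> \<epsilon> * (x \<bullet> b) \<le> h}"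
proof -
  show "open ?U" by (intro open_Collect_conj open_Collect_less continuous_intros)
  show "closure ?U \<subseteq> {x. t1 \<le> x \<bullet> f \<and> x \<bullet> f \<le> t2 \<and> l \<le> \<epsilon> * (x \<bullet> b) \<and> \<epsilon> * (x \<bullet> b) \<le> h}"
    by (intro closure_minimal closed_Collect_conj closed_Collect_le continuous_intros) auto
qed

text \<open>Since the gradient of \<sigma> at the origin is nonzero, some coordinate axis
  \<open>b\<close> is transversal to the boundary, and the rectangle may be axis-parallel. Heights
  are measured by \<epsilon> x . b, with the sign \<epsilon> chosen so that \<sigma> increases with
  height.\<close>

lemma good_neighborhood_boundary:
  fixes \<Omega> :: "(real^2) set" and u :: "real^2 \<Rightarrow> real"
  assumes \<Omega>: "open \<Omega>" "0 \<notin> \<Omega>" and cu: "continuous_on \<Omega> u"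
    and wg: "\<And>V. open V \<Longrightarrow> V \<subseteq> \<Omega> \<Longrightarrow> wgrad V u g"
    and gint: "integrable lebesgue (\<lambda>x. indicator \<Omega> x *\<^sub>R norm (g x))"
    and r: "r > 0" "\<And>x. x \<in> ball 0 r \<Longrightarrow> x \<in> \<Omega> \<longleftrightarrow> \<sigma> x > 0"
    and \<sigma>: "smooth \<sigma>" "\<sigma> 0 = 0" "grad \<sigma> 0 \<noteq> 0" and R: "R > 0"
  obtains U N where "open U" "0 \<in> U" "closure U \<subseteq> ball 0 R" "\<And>x. x \<in> \<Omega> \<Longrightarrow> x \<in> frontier U \<Longrightarrow> \<bar>u x\<bar> \<le> N"
proof -
  obtain b :: "real^2" where b: "b \<in> Basis" "grad \<sigma> 0 \<bullet> b \<noteq> 0"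
    using \<sigma>(3) by (metis euclidean_eqI inner_zero_left)
  obtain f :: "real^2" where f: "f \<in> Basis" "b \<noteq> f"
  proof -
    have "card (Basis :: (real^2) set) = 2" by simp
    then have "(Basis :: (real^2) set) \<noteq> {b}" by (metis card.empty card_insert_disjoint empty_iff finite.emptyI numeral_2_eq_2 n_not_Suc_n One_nat_def)
    then show ?thesis using that b(1) by blast
  qed
  note B = b(1) f
  have bf: "b \<bullet> f = 0" "f \<bullet> b = 0" "b \<bullet> b = 1" "f \<bullet> f = 1" using B by (auto simp: inner_Basis)
  have nb: "norm b = 1" "norm f = 1" using B by auto
  define \<epsilon> where "\<epsilon> = sgn (grad \<sigma> 0 \<bullet> b)"
  have \<epsilon>: "\<epsilon> = 1 \<or> \<epsilon> = - 1" using b(2) by (auto simp: \<epsilon>_def sgn_if)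
  then have ee: "\<epsilon> * \<epsilon> = 1" "\<bar>\<epsilon>\<bar> = 1" by auto
  \<comment> \<open>Half the derivative of \<sigma> at the origin in the direction \<epsilon> b;
    near the origin \<sigma> grows at least at this rate.\<close>
  define \<mu> where "\<mu> = \<epsilon> * (grad \<sigma> 0 \<bullet> b) / 2"
  have \<mu>: "\<mu> > 0" using b(2) by (auto simp: \<mu>_def \<epsilon>_def sgn_if)
  have cg: "continuous_on UNIV (grad \<sigma>)" using \<sigma>(1) by (intro continuous_on_grad) (simp add: smooth_iff_smooth_on)
  define F where "F = \<bar>grad \<sigma> 0 \<bullet> f\<bar> + 1"
  have "open {x. \<mu> < \<epsilon> * (grad \<sigma> x \<bullet> b) \<and> \<bar>grad \<sigma> x \<bullet> f\<bar> < F}"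
    by (intro open_Collect_conj open_Collect_less continuous_intros cg)
  moreover have "0 \<in> {x. \<mu> < \<epsilon> * (grad \<sigma> x \<bullet> b) \<and> \<bar>grad \<sigma> x \<bullet> f\<bar> < F}" using \<mu> by (auto simp: \<mu>_def F_def)
  ultimately obtain r1 where r1: "r1 > 0" "ball 0 r1 \<subseteq> {x. \<mu> < \<epsilon> * (grad \<sigma> x \<bullet> b) \<and> \<bar>grad \<sigma> x \<bullet> f\<bar> < F}"
    by (meson openE)
  define \<rho> where "\<rho> = min r (min r1 R)"
  have \<rho>: "\<rho> > 0" "\<rho> \<le> r" "\<rho> \<le> r1" "\<rho> \<le> R" using r r1 R by (auto simp: \<rho>_def)
  have F: "F > 0" by (simp add: F_def)
  \<comment> \<open>1/8 leaves room in the ball of radius \<rho> for the larger box of half-width 2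
    s and half-height 3 h.\<close>
  define h where "h = \<rho> / 8"
  \<comment> \<open>\<open>F\<close> bounds the sideways derivative of \<sigma>, so F s < \<mu> h
    says that a sideways move by at most s cannot undo the change of \<sigma> over the height h.
    Hence \<sigma> > 0 at the top and \<sigma> < 0 at the bottom.\<close>
  define s where "s = min h (\<mu> * h / (2 * F))"
  have h: "h > 0" using \<rho> by (simp add: h_def)
  have s: "s > 0" "s \<le> h" "F * s < \<mu> * h"
  proof -
    show "s > 0" "s \<le> h" using h \<mu> F by (auto simp: s_def)
    have "F * s \<le> F * (\<mu> * h / (2 * F))" using F by (intro mult_left_mono) (auto simp: s_def)
    also have "\<dots> = \<mu> * h / 2" using F by simp
    also have "\<dots> < \<mu> * h" using \<mu> h by simp
    finally show "F * s < \<mu> * h" .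
  qed
  have inb: "x \<in> ball 0 \<rho>" if "\<bar>x \<bullet> f\<bar> \<le> 2 * s" "\<bar>\<epsilon> * (x \<bullet> b)\<bar> \<le> 3 * h" for x
  proof -
    have "x = (x \<bullet> f) *\<^sub>R f + (x \<bullet> b) *\<^sub>R b" by (rule real2_decompose[OF B])
    then have "norm x \<le> \<bar>x \<bullet> f\<bar> * norm f + \<bar>x \<bullet> b\<bar> * norm b"
      by (metis norm_scaleR norm_triangle_ineq)
    then have "norm x \<le> 2 * s + 3 * h" using that ee by (simp add: nb abs_mult)
    also have "\<dots> < \<rho>" using s h by (simp add: h_def)
    finally show ?thesis by simp
  qed
  have mono: "\<sigma> x + \<mu> * \<tau> \<le> \<sigma> (x + (\<epsilon> * \<tau>) *\<^sub>R b)" if \<tau>: "0 \<le> \<tau>" and bx: "x \<in> ball 0 \<rho>" "x + (\<epsilon> * \<tau>) *\<^sub>R b \<in> ball 0 \<rho>" for x \<tau>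
  proof (cases "\<tau> = 0")
    case False
    then have tp: "\<tau> > 0" using \<tau> by simp
    obtain t where t: "0 < t" "t < \<tau>" "\<sigma> (x + \<tau> *\<^sub>R (\<epsilon> *\<^sub>R b)) - \<sigma> (x + 0 *\<^sub>R (\<epsilon> *\<^sub>R b)) = (\<tau> - 0) * (grad \<sigma> (x + t *\<^sub>R (\<epsilon> *\<^sub>R b)) \<bullet> (\<epsilon> *\<^sub>R b))"
      using MVT2[OF tp DERIV_along_line[OF \<sigma>(1)]] by blast
    have "x + t *\<^sub>R (\<epsilon> *\<^sub>R b) = (1 - t / \<tau>) *\<^sub>R x + (t / \<tau>) *\<^sub>R (x + (\<epsilon> * \<tau>) *\<^sub>R b)"
      using tp by (simp add: algebra_simps)
    also have "\<dots> \<in> ball 0 \<rho>"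
      using t tp by (intro convexD[OF convex_ball bx]) auto
    finally have "\<mu> < \<epsilon> * (grad \<sigma> (x + t *\<^sub>R (\<epsilon> *\<^sub>R b)) \<bullet> b)" using r1(2) \<rho>(3) by force
    then have "\<tau> * \<mu> \<le> \<tau> * (\<epsilon> * (grad \<sigma> (x + t *\<^sub>R (\<epsilon> *\<^sub>R b)) \<bullet> b))" using tp by (intro mult_left_mono) auto
    then show ?thesis using t(3) by (simp add: mult_ac)
  qed simp
  have side: "\<bar>\<sigma> ((x \<bullet> f) *\<^sub>R f)\<bar> \<le> F * s" if "\<bar>x \<bullet> f\<bar> \<le> s" for x
  proof (cases "x \<bullet> f = 0")
    case True
    then show ?thesis using \<sigma>(2) F s by simp
  next
    case False
    have fr: "(t * (x \<bullet> f)) *\<^sub>R f \<in> ball 0 r1" if "0 \<le> t" "t \<le> 1" for t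
    proof -
      have "\<bar>t\<bar> * \<bar>x \<bullet> f\<bar> \<le> 1 * \<bar>x \<bullet> f\<bar>" using that by (intro mult_right_mono) auto
      then have "\<bar>t * (x \<bullet> f)\<bar> \<le> s" using \<open>\<bar>x \<bullet> f\<bar> \<le> s\<close> by (simp add: abs_mult)
      also have "s < r1" using s h \<rho> by (simp add: h_def)
      finally show ?thesis by (simp add: nb)
    qed
    obtain t where t: "0 < t" "t < 1" "\<sigma> (0 + 1 *\<^sub>R ((x \<bullet> f) *\<^sub>R f)) - \<sigma> (0 + 0 *\<^sub>R ((x \<bullet> f) *\<^sub>R f)) = (1 - 0) * (grad \<sigma> (0 + t *\<^sub>R ((x \<bullet> f) *\<^sub>R f)) \<bullet> ((x \<bullet> f) *\<^sub>R f))"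
      using MVT2[OF zero_less_one DERIV_along_line[OF \<sigma>(1)]] by blast
    have "(t * (x \<bullet> f)) *\<^sub>R f \<in> ball 0 r1" using t by (intro fr) auto
    then have "\<bar>grad \<sigma> ((t * (x \<bullet> f)) *\<^sub>R f) \<bullet> f\<bar> \<le> F" using subsetD[OF r1(2)] by fastforce
    then have "\<bar>x \<bullet> f\<bar> * \<bar>grad \<sigma> ((t * (x \<bullet> f)) *\<^sub>R f) \<bullet> f\<bar> \<le> s * F" using that s by (intro mult_mono) auto
    then show ?thesis using t(3) \<sigma>(2) by (simp add: abs_mult mult.commute)
  qed
  have dec: "(x \<bullet> f) *\<^sub>R f + (\<epsilon> * (\<epsilon> * (x \<bullet> b))) *\<^sub>R b = x" for x
    using real2_decompose[OF B, of x] ee by (simp add: mult.assoc[symmetric])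
  have sidein: "(x \<bullet> f) *\<^sub>R f \<in> ball 0 \<rho>" if "\<bar>x \<bullet> f\<bar> \<le> s" for x
    using that s h by (intro inb) (auto simp: bf)
  have topin: "x \<in> \<Omega>" if "\<bar>x \<bullet> f\<bar> \<le> s" "h \<le> \<epsilon> * (x \<bullet> b)" "\<epsilon> * (x \<bullet> b) \<le> 2 * h" for x
  proof -
    have xb: "x \<in> ball 0 \<rho>" using that s h by (intro inb) auto
    have "\<sigma> ((x \<bullet> f) *\<^sub>R f) + \<mu> * (\<epsilon> * (x \<bullet> b)) \<le> \<sigma> ((x \<bullet> f) *\<^sub>R f + (\<epsilon> * (\<epsilon> * (x \<bullet> b))) *\<^sub>R b)"
      using that h xb sidein[OF that(1)] dec[of x] by (intro mono) auto
    moreover have "\<mu> * h \<le> \<mu> * (\<epsilon> * (x \<bullet> b))" using that \<mu> by (intro mult_left_mono) auto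
    ultimately have "\<sigma> x > 0" using side[OF that(1)] s(3) unfolding dec[of x] by linarith
    then show ?thesis using r(2) xb \<rho>(2) by auto
  qed
  have botout: "x \<notin> \<Omega>" if "\<bar>x \<bullet> f\<bar> \<le> s" "\<epsilon> * (x \<bullet> b) = - h" for x
  proof -
    have xb: "x \<in> ball 0 \<rho>" using that s h by (intro inb) auto
    have e: "x + (\<epsilon> * h) *\<^sub>R b = (x \<bullet> f) *\<^sub>R f"
      using dec[of x] that(2) by (metis add.right_neutral add_diff_cancel_right' diff_minus_eq_add mult_minus_right scaleR_minus_left uminus_add_conv_diff diff_add_cancel)
    have "\<sigma> x + \<mu> * h \<le> \<sigma> (x + (\<epsilon> * h) *\<^sub>R b)"
      by (rule mono) (use h xb sidein[OF that(1)] e in auto)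
    then have "\<sigma> x < 0" using side[OF that(1)] s(3) unfolding e by linarith
    then show ?thesis using r(2) xb \<rho>(2) by force
  qed
  \<comment> \<open>Larger than the final rectangle, so that it contains the layer between the
    heights h and 2 h used by \<open>bounded_on_line\<close>.\<close>
  define Box where "Box = {x. - (2 * s) < x \<bullet> f \<and> x \<bullet> f < 2 * s \<and> - (3 * h) < \<epsilon> * (x \<bullet> b) \<and> \<epsilon> * (x \<bullet> b) < 3 * h}"
  define V where "V = \<Omega> \<inter> Box"
  have Bo: "open Box" unfolding Box_def by (rule frontier_real2_box(1))
  have V: "open V" "V \<subseteq> \<Omega>" using \<Omega>(1) Bo by (auto simp: V_def)
  have wV: "wgrad V u g" by (rule wg[OF V])
  have gV: "integrable lebesgue (\<lambda>x. indicator V x *\<^sub>R norm (g x))"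
  proof -
    have Vm: "V \<in> sets lebesgue" using V(1) by auto
    have "integrable lebesgue (\<lambda>x. (indicator \<Omega> x *\<^sub>R norm (g x)) * indicator V x)"
      by (rule integrable_mult_bounded[OF gint borel_measurable_indicator[OF Vm], where B=1]) (simp add: indicator_def)
    moreover have "(indicator \<Omega> x *\<^sub>R norm (g x)) * indicator V x = indicator V x *\<^sub>R norm (g x)" for x
      using V(2) by (auto simp: indicator_def)
    ultimately show ?thesis by (simp only:)
  qed
  define Top where "Top = {x. - s \<le> x \<bullet> f \<and> x \<bullet> f \<le> s \<and> h \<le> \<epsilon> * (x \<bullet> b) \<and> \<epsilon> * (x \<bullet> b) \<le> 2 * h}"
  have "compact Top"
  proof -
    have "closed Top" unfolding Top_def by (intro closed_Collect_conj closed_Collect_le continuous_intros)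
    moreover have "Top \<subseteq> ball 0 \<rho>" using s h by (auto simp: Top_def intro!: inb)
    ultimately show ?thesis using bounded_ball bounded_subset compact_eq_bounded_closed by blast
  qed
  moreover have "Top \<subseteq> \<Omega>" using topin by (auto simp: Top_def)
  ultimately have "bounded (u ` Top)"
    by (intro compact_imp_bounded compact_continuous_image continuous_on_subset[OF cu])
  then obtain M where M: "\<And>x. x \<in> Top \<Longrightarrow> \<bar>u x\<bar> \<le> M" unfolding bounded_iff by auto
  have line: "\<exists>t N. t1 \<le> t \<and> t \<le> t2 \<and> (\<forall>x\<in>V. x \<bullet> f = t \<longrightarrow> \<epsilon> * (x \<bullet> b) \<le> h \<longrightarrow> \<bar>u x\<bar> \<le> N)"
    if tt: "t1 < t2" "- s \<le> t1" "t2 \<le> s" for t1 t2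
  proof -
    obtain t N where "t1 \<le> t" "t \<le> t2" "\<And>x. x \<in> V \<Longrightarrow> x \<bullet> f = t \<Longrightarrow> \<epsilon> * (x \<bullet> b) \<le> h \<Longrightarrow> \<bar>u x\<bar> \<le> N"
    proof (rule bounded_on_line[OF wV B \<epsilon> gV tt(1), of h "2 * h" M])
      show "h < 2 * h" using h by simp
      fix x assume xf: "t1 \<le> x \<bullet> f" "x \<bullet> f \<le> t2"
      show "\<bar>u x\<bar> \<le> M" if "h \<le> \<epsilon> * (x \<bullet> b)" "\<epsilon> * (x \<bullet> b) \<le> 2 * h"
        using xf tt that by (intro M) (auto simp: Top_def)
      show "x + (\<epsilon> * \<tau>) *\<^sub>R b \<in> V" if xV: "x \<in> V" and \<tau>: "0 \<le> \<tau>" "\<epsilon> * (x \<bullet> b) + \<tau> \<le> 2 * h" for \<tau>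
      proof -
        let ?y = "x + (\<epsilon> * \<tau>) *\<^sub>R b"
        have yf: "?y \<bullet> f = x \<bullet> f" by (simp add: inner_add_left bf)
        have "\<epsilon> * (?y \<bullet> b) = \<epsilon> * (x \<bullet> b) + (\<epsilon> * \<epsilon>) * \<tau>" by (simp add: inner_add_left bf algebra_simps)
        then have yb: "\<epsilon> * (?y \<bullet> b) = \<epsilon> * (x \<bullet> b) + \<tau>" using ee by simp
        have xB: "x \<in> Box" "x \<in> \<Omega>" using xV by (auto simp: V_def)
        have yB: "?y \<in> Box" using xB(1) \<tau> h unfolding Box_def mem_Collect_eq yf yb by auto
        have inr: "z \<in> ball 0 \<rho>" if "z \<in> Box" for z using that by (intro inb) (auto simp: Box_def)
        have "\<sigma> x + \<mu> * \<tau> \<le> \<sigma> ?y" by (rule mono[OF \<tau>(1) inr[OF xB(1)] inr[OF yB]])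
        moreover have "\<sigma> x > 0" using r(2)[of x] xB(2) inr[OF xB(1)] \<rho>(2) by auto
        moreover have "0 \<le> \<mu> * \<tau>" using \<mu> \<tau> by simp
        ultimately have "?y \<in> \<Omega>" using r(2)[of ?y] inr[OF yB] \<rho>(2) by auto
        then show ?thesis using yB by (simp add: V_def)
      qed
    qed (use that in blast)
    then show ?thesis by blast
  qed
  \<comment> \<open>The intervals for the two lines lie on opposite sides of 0, so the rectangle
    between the lines contains the origin.\<close>
  obtain tp Np where tp: "s / 2 \<le> tp" "tp \<le> s" "\<And>x. x \<in> V \<Longrightarrow> x \<bullet> f = tp \<Longrightarrow> \<epsilon> * (x \<bullet> b) \<le> h \<Longrightarrow> \<bar>u x\<bar> \<le> Np"
    using line[of "s / 2" s] s(1) by auto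
  obtain tm Nm where tm: "- s \<le> tm" "tm \<le> - (s / 2)" "\<And>x. x \<in> V \<Longrightarrow> x \<bullet> f = tm \<Longrightarrow> \<epsilon> * (x \<bullet> b) \<le> h \<Longrightarrow> \<bar>u x\<bar> \<le> Nm"
    using line[of "- s" "- (s / 2)"] s(1) by auto
  define U where "U = {x. tm < x \<bullet> f \<and> x \<bullet> f < tp \<and> - h < \<epsilon> * (x \<bullet> b) \<and> \<epsilon> * (x \<bullet> b) < h}"
  have U: "open U" "closure U \<subseteq> {x. tm \<le> x \<bullet> f \<and> x \<bullet> f \<le> tp \<and> - h \<le> \<epsilon> * (x \<bullet> b) \<and> \<epsilon> * (x \<bullet> b) \<le> h}"
    unfolding U_def by (rule frontier_real2_box)+
  show ?thesis
  proof (rule that[OF U(1)])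
    show "0 \<in> U" using tp tm s h by (auto simp: U_def)
    have "x \<in> ball 0 \<rho>" if "x \<in> closure U" for x
      using U(2) that tp(2) tm(1) s h by (intro inb) force+
    then show "closure U \<subseteq> ball 0 R" using \<rho>(4) by fastforce
    fix x assume x: "x \<in> \<Omega>" "x \<in> frontier U"
    then have xc: "tm \<le> x \<bullet> f" "x \<bullet> f \<le> tp" "- h \<le> \<epsilon> * (x \<bullet> b)" "\<epsilon> * (x \<bullet> b) \<le> h" and xn: "x \<notin> U"
      using U by (auto simp: frontier_def interior_open)
    have xs: "\<bar>x \<bullet> f\<bar> \<le> s" using xc tp tm by auto
    have xV: "x \<in> V" using x xc xs s h by (auto simp: V_def Box_def)
    have "\<epsilon> * (x \<bullet> b) \<noteq> - h" using botout[OF xs] x(1) by blast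
    then consider "x \<bullet> f = tm" | "x \<bullet> f = tp" | "\<epsilon> * (x \<bullet> b) = h"
      using xc xn unfolding U_def by fastforce
    then show "\<bar>u x\<bar> \<le> max M (max Np Nm)"
    proof cases
      case 1
      then show ?thesis using tm(3)[OF xV 1 xc(4)] by simp
    next
      case 2
      then show ?thesis using tp(3)[OF xV 2 xc(4)] by simp
    next
      case 3
      then have "x \<in> Top" using xs h by (auto simp: Top_def)
      then show ?thesis using M[of x] by simp
    qed
  qed
qed

section \<open>The barrier\<close>

text \<open>Off the origin this is \<open>ln (a / norm x)\<close>, written with
  \<open>x \<bullet> x\<close> to stay clear of the derivative of the norm.\<close>

definition log_dist :: "real \<Rightarrow> real^2 \<Rightarrow> real" where
  "log_dist a x = ln a - ln (x \<bullet> x) / 2"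

definition barrier :: "real \<Rightarrow> real \<Rightarrow> real \<Rightarrow> real^2 \<Rightarrow> real \<Rightarrow> real^2 \<Rightarrow> real" where
  "barrier a \<alpha> C b c x = C * log_dist a x powr \<alpha> - b \<bullet> x - c * (x \<bullet> x)"

lemma log_dist_eq: "a > 0 \<Longrightarrow> x \<noteq> 0 \<Longrightarrow> log_dist a x = ln (a / norm x)"
  by (simp add: log_dist_def norm_eq_sqrt_inner ln_div ln_sqrt)

lemma log_dist_has_derivative:
  assumes "x \<noteq> 0"
  shows "(log_dist a has_derivative (\<lambda>h. - (x \<bullet> h) / (x \<bullet> x))) (at x)"
proof -
  have "((\<lambda>x. x \<bullet> x) has_derivative (\<lambda>h. 2 * (x \<bullet> h))) (at x)"
    by (auto intro!: derivative_eq_intros simp: inner_commute)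
  moreover have "(ln has_real_derivative inverse (x \<bullet> x)) (at (x \<bullet> x))"
    by (rule DERIV_ln) (use assms in simp)
  ultimately have "((\<lambda>x. ln (x \<bullet> x)) has_derivative (\<lambda>h. 2 * (x \<bullet> h) * inverse (x \<bullet> x))) (at x)"
    by (rule DERIV_compose_FDERIV[where f=ln, rotated])
  from has_derivative_diff[OF has_derivative_const[of "ln a"] has_derivative_mult_right[OF this, of "1/2"]]
  have D: "((\<lambda>x. ln a - 1/2 * ln (x \<bullet> x)) has_derivative (\<lambda>h. 0 - 1/2 * (2 * (x \<bullet> h) * inverse (x \<bullet> x)))) (at x)" .
  have "(\<lambda>h. 0 - 1/2 * (2 * (x \<bullet> h) * inverse (x \<bullet> x))) = (\<lambda>h. - (x \<bullet> h) / (x \<bullet> x))"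
    by (rule ext) (simp add: inverse_eq_divide)
  moreover have "(\<lambda>x. ln a - 1/2 * ln (x \<bullet> x)) = log_dist a"
    by (rule ext) (simp add: log_dist_def)
  ultimately show ?thesis using D by (simp only:)
qed

lemma log_dist_powr_has_derivative:
  assumes "x \<noteq> 0" "log_dist a x > 0"
  shows "((\<lambda>x. log_dist a x powr p) has_derivative
    (\<lambda>h. - (p * log_dist a x powr (p - 1) * (x \<bullet> h) / (x \<bullet> x)))) (at x)"
  using DERIV_compose_FDERIV[OF has_real_derivative_powr[OF assms(2), of p] log_dist_has_derivative[OF assms(1)]]
  by (simp add: mult_ac)

lemma smooth_on_inner_self: "smooth_on S (\<lambda>x::'a::euclidean_space. x \<bullet> x)"
  using smooth_imp_smooth_on[OF smooth_norm_square[of 0]] by (simp add: power2_norm_eq_inner)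

lemma smooth_on_barrier:
  assumes "open W" "0 \<notin> W" "\<And>x. x \<in> W \<Longrightarrow> log_dist a x > 0"
  shows "smooth_on W (barrier a \<alpha> C b c)"
proof -
  have ln: "smooth_on W (\<lambda>x. ln (x \<bullet> x))"
    by (rule smooth_on_compose[OF assms(1) _ _ smooth_on_ln smooth_on_inner_self])
      (use assms(2) in \<open>auto simp: image_subset_iff\<close>)
  have "smooth_on W (\<lambda>x. ln a + - (1/2) * ln (x \<bullet> x))"
    by (intro smooth_on_add smooth_on_mult smooth_on_const ln assms(1))
  then have ld: "smooth_on W (log_dist a)"
    by (rule smooth_on_cong[rotated 2]) (auto simp: log_dist_def assms(1))
  have pw: "smooth_on W (\<lambda>x. log_dist a x powr \<alpha>)"
    by (rule smooth_on_compose[OF assms(1) _ _ smooth_on_powr ld]) (use assms(3) in auto)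
  show ?thesis
    unfolding barrier_def[abs_def]
    by (intro pw smooth_on_diff smooth_on_mult smooth_on_const smooth_on_inner_self smooth_on_bounded_linear
        bounded_linear_inner_right assms(1))
qed

lemma partial_deriv_barrier:
  assumes "x \<noteq> 0" "log_dist a x > 0"
  shows "partial_deriv i (barrier a \<alpha> C b c) x
    = - (C * \<alpha>) * (log_dist a x powr (\<alpha> - 1) * ((x \<bullet> i) * inverse (x \<bullet> x))) - b \<bullet> i - 2 * c * (x \<bullet> i)"
proof -
  have "(barrier a \<alpha> C b c has_derivative
      (\<lambda>h. C * - (\<alpha> * log_dist a x powr (\<alpha> - 1) * (x \<bullet> h) / (x \<bullet> x)) - b \<bullet> h - c * (x \<bullet> h + h \<bullet> x))) (at x)"
    unfolding barrier_def[abs_def]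
    by (intro has_derivative_diff has_derivative_mult_right log_dist_powr_has_derivative assms
        has_derivative_inner_right has_derivative_inner has_derivative_ident)
  then show ?thesis by (subst partial_deriv_eqI) (auto simp: inner_commute divide_inverse algebra_simps)
qed

lemma grad_barrier:
  assumes "x \<noteq> 0" "log_dist a x > 0"
  shows "grad (barrier a \<alpha> C b c) x = - ((C * \<alpha> * log_dist a x powr (\<alpha> - 1) / (x \<bullet> x) + 2 * c) *\<^sub>R x + b)"
proof (rule euclidean_eqI)
  fix i :: "real^2" assume "i \<in> Basis"
  then show "grad (barrier a \<alpha> C b c) x \<bullet> i = - ((C * \<alpha> * log_dist a x powr (\<alpha> - 1) / (x \<bullet> x) + 2 * c) *\<^sub>R x + b) \<bullet> i"
    by (simp add: grad_inner partial_deriv_barrier[OF assms] inner_add_left inner_diff_left divide_inverse algebra_simps)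
qed

text \<open>ln |x| is harmonic in the plane, so only the second derivative of the power survives,
  multiplied by the squared length 1 / |x|^2 of the gradient of \<open>log_dist\<close>. The linear
  term has Laplacian 0 and |x|^2 has Laplacian 4.\<close>

lemma laplacian_barrier:
  assumes "x \<noteq> 0" "log_dist a x > 0"
  shows "laplacian (barrier a \<alpha> C b c) x
    = - (C * (\<alpha> * (1 - \<alpha>)) * log_dist a x powr (\<alpha> - 2) / (x \<bullet> x)) - 4 * c"
proof -
  \<comment> \<open>The formula for the first derivatives must hold on an open set before it can be
    differentiated again.\<close>
  define W where "W = {x :: real^2. x \<noteq> 0 \<and> 0 < log_dist a x}"
  have W: "open W" "x \<in> W"
  proof -
    have "continuous_on (- {0}) (log_dist a)"
      using log_dist_has_derivative has_derivative_continuous by (intro continuous_at_imp_continuous_on) blast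
    then have "open (- {0} \<inter> log_dist a -` {0<..})"
      by (intro continuous_open_preimage) auto
    moreover have "- {0} \<inter> log_dist a -` {0<..} = W" by (auto simp: W_def)
    ultimately show "open W" by simp
  qed (use assms in \<open>simp add: W_def\<close>)
  let ?q = "x \<bullet> x" and ?t = "log_dist a x"
  have q: "?q > 0" using assms by simp
  have pp: "partial_deriv i (partial_deriv i (barrier a \<alpha> C b c)) x
    = - (C * \<alpha>) * (?t powr (\<alpha> - 1) * inverse ?q
        - (\<alpha> - 1) * ?t powr (\<alpha> - 2) * inverse ?q * inverse ?q * (x \<bullet> i)\<^sup>2
        - 2 * ?t powr (\<alpha> - 1) * inverse ?q * inverse ?q * (x \<bullet> i)\<^sup>2) - 2 * c" if i: "i \<in> Basis" for i
  proof -
    have xi: "((\<lambda>x. x \<bullet> i) has_derivative (\<lambda>h. h \<bullet> i)) (at x)"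
      by (rule has_derivative_inner_left[OF has_derivative_ident])
    have iq: "((\<lambda>x. inverse (x \<bullet> x)) has_derivative (\<lambda>h. - (inverse ?q * (x \<bullet> h + h \<bullet> x) * inverse ?q))) (at x)"
      by (rule Deriv.has_derivative_inverse[OF _ has_derivative_inner[OF has_derivative_ident has_derivative_ident]])
        (use assms(1) in simp)
    have "partial_deriv i (partial_deriv i (barrier a \<alpha> C b c)) x
      = partial_deriv i (\<lambda>x. - (C * \<alpha>) * (log_dist a x powr (\<alpha> - 1) * ((x \<bullet> i) * inverse (x \<bullet> x))) - b \<bullet> i - 2 * c * (x \<bullet> i)) x"
      by (rule partial_deriv_cong[OF W]) (simp add: partial_deriv_barrier W_def)
    also have "\<dots> = - (C * \<alpha>) * (?t powr (\<alpha> - 1) * ((x \<bullet> i) * - (inverse ?q * (x \<bullet> i + i \<bullet> x) * inverse ?q) + (i \<bullet> i) * inverse ?q)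
        + - ((\<alpha> - 1) * ?t powr (\<alpha> - 1 - 1) * (x \<bullet> i) / ?q) * ((x \<bullet> i) * inverse ?q)) - 0 - 2 * c * (i \<bullet> i)"
      by (rule partial_deriv_eqI[OF has_derivative_diff[OF has_derivative_diff[OF has_derivative_mult_right[OF
                has_derivative_mult[OF log_dist_powr_has_derivative[OF assms] has_derivative_mult[OF xi iq]]]
              has_derivative_const] has_derivative_mult_right[OF xi]]])
    also have "\<alpha> - 1 - 1 = \<alpha> - 2" by simp
    finally show ?thesis using i by (simp add: inner_commute power2_eq_square divide_inverse algebra_simps)
  qed
  have sq: "(\<Sum>i\<in>Basis. (x \<bullet> i)\<^sup>2) = ?q"
    by (subst euclidean_inner[of x x]) (simp add: power2_eq_square)
  have "laplacian (barrier a \<alpha> C b c) x = (\<Sum>i\<in>Basis. (- (C * \<alpha>) * (?t powr (\<alpha> - 1) * inverse ?q) - 2 * c)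
      + C * \<alpha> * ((\<alpha> - 1) * ?t powr (\<alpha> - 2) * inverse ?q * inverse ?q + 2 * ?t powr (\<alpha> - 1) * inverse ?q * inverse ?q) * (x \<bullet> i)\<^sup>2)"
    unfolding laplacian_def by (intro sum.cong refl) (simp add: pp algebra_simps)
  also have "\<dots> = 2 * (- (C * \<alpha>) * (?t powr (\<alpha> - 1) * inverse ?q) - 2 * c)
      + C * \<alpha> * ((\<alpha> - 1) * ?t powr (\<alpha> - 2) * inverse ?q * inverse ?q + 2 * ?t powr (\<alpha> - 1) * inverse ?q * inverse ?q) * ?q"
    unfolding sum.distrib sum_distrib_left[symmetric] sq by simp
  also have "\<dots> = - (C * (\<alpha> * (1 - \<alpha>)) * ?t powr (\<alpha> - 2) / ?q) - 4 * c"
    using q by (simp add: field_simps)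
  finally show ?thesis .
qed

text \<open>The common part of the interior and the boundary case. On the domain the correction b .
  x + c |x|^2 stays between 0 and 1/2 while the logarithm is at least 1, so \<Psi> lies between C /
  2 and C times the power of the logarithm. The cutoffs \<omega> take care of the boundary;
  \<open>normal\<close> is their sign condition against - \<nabla>\<Psi> / C.\<close>

lemma barrier_estimate:
  fixes \<Omega> U :: "(real^2) set" and \<omega> :: "nat \<Rightarrow> real^2 \<Rightarrow> real"
  assumes \<Omega>: "open \<Omega>" "bounded \<Omega>" "\<Omega> \<subseteq> cball 0 1" and a: "a > 1"
    and ev: "0 < second_eigenvalue \<Omega> a" and ef: "second_eigenfunction \<Omega> a u"
    and cont: "continuous_on (\<Omega> - {0}) u"
    and \<alpha>: "0 < \<alpha>" "\<alpha> < 1/2" "\<alpha> * (1 - \<alpha>) = second_eigenvalue \<Omega> a"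
    and R: "0 < R" "R \<le> 1" "1 \<le> ln (a / R)"
    and bc: "c > 0" "\<And>x. x \<in> \<Omega> \<inter> ball 0 R \<Longrightarrow> 0 \<le> b \<bullet> x + c * (x \<bullet> x)"
      "\<And>x. x \<in> ball 0 R \<Longrightarrow> b \<bullet> x + c * (x \<bullet> x) \<le> 1/2"
    and U: "open U" "0 \<in> U" "closure U \<subseteq> ball 0 R"
    and N: "\<And>x. x \<in> \<Omega> - {0} \<Longrightarrow> x \<in> frontier U \<Longrightarrow> \<bar>u x\<bar> \<le> N"
    and \<omega>: "\<And>n. smooth (\<omega> n)" "\<And>n x. 0 \<le> \<omega> n x" "\<And>n x. \<omega> n x \<le> 1"
      "\<And>x. x \<in> \<Omega> \<inter> U \<Longrightarrow> (\<lambda>n. \<omega> n x) \<longlonglongrightarrow> 1"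
    and F: "\<And>n. closed (F n)" "\<And>n. F n \<inter> ball 0 R \<subseteq> \<Omega>" "\<And>n x. x \<notin> F n \<Longrightarrow> \<omega> n x = 0"
    and normal: "\<And>n x. x \<in> \<Omega> \<inter> ball 0 R - {0} \<Longrightarrow>
      0 \<le> grad (\<omega> n) x \<bullet> ((\<alpha> * log_dist a x powr (\<alpha> - 1) / (x \<bullet> x) + 2 * c) *\<^sub>R x + b)"
  obtains C where "C > 0" "\<And>x. x \<in> \<Omega> \<inter> U - {0} \<Longrightarrow> \<bar>u x\<bar> \<le> C * ln (a / norm x) powr \<alpha>"
proof -
  \<comment> \<open>Makes the lower bound C / 2 of \<Psi> exceed \<open>N\<close>, for the strict
    inequality on the frontier of \<open>U\<close>.\<close>
  define C where "C = 2 * \<bar>N\<bar> + 2"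
  have C: "C > 0" by (simp add: C_def)
  define W where "W = ball 0 R - {0 :: real^2}"
  have W: "open W" "0 \<notin> W" by (auto simp: W_def)
  have t1: "1 \<le> log_dist a x" if "x \<in> W" for x
  proof -
    have x: "x \<noteq> 0" "0 < norm x" "norm x < R" using that by (auto simp: W_def)
    have "ln (a / R) \<le> ln (a / norm x)" using x a R(1) by (intro ln_mono divide_left_mono) auto
    moreover have "log_dist a x = ln (a / norm x)" using a x by (intro log_dist_eq) auto
    ultimately show ?thesis using R(3) by linarith
  qed
  have t0: "0 < log_dist a x" if "x \<in> W" for x using t1[OF that] by linarith
  define \<Psi> where "\<Psi> = barrier a \<alpha> C (C *\<^sub>R b) (C * c)"
  have \<Psi>s: "smooth_on W \<Psi>" unfolding \<Psi>_def by (rule smooth_on_barrier[OF W t0])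
  have \<Psi>eq: "\<Psi> x = C * (log_dist a x powr \<alpha> - (b \<bullet> x + c * (x \<bullet> x)))" for x
    by (simp add: \<Psi>_def barrier_def algebra_simps)
  have p1: "1 \<le> log_dist a x powr \<alpha>" if "x \<in> W" for x
    using t1[OF that] \<alpha>(1) by (intro ge_one_powr_ge_zero) auto
  have \<Psi>low: "C / 2 \<le> \<Psi> x" if "x \<in> W" for x
  proof -
    have "1/2 \<le> log_dist a x powr \<alpha> - (b \<bullet> x + c * (x \<bullet> x))"
      using p1[OF that] bc(3)[of x] that by (auto simp: W_def)
    then show ?thesis using C mult_left_mono[of "1/2" "log_dist a x powr \<alpha> - (b \<bullet> x + c * (x \<bullet> x))" C]
      by (simp add: \<Psi>eq)
  qed
  define U0 where "U0 = U - {0}"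
  have U0: "open U0" "0 \<notin> U0" using U by (auto simp: U0_def)
  have clU: "closure U0 \<subseteq> closure U" by (rule closure_mono) (auto simp: U0_def)
  have U0W: "U0 \<subseteq> W" using U closure_subset[of U] by (auto simp: U0_def W_def)
  \<comment> \<open>Deleting the origin adds nothing but the origin to the frontier.\<close>
  have frU: "x \<in> frontier U" if "x \<in> frontier U0" "x \<noteq> 0" for x
    using that clU U U0 by (auto simp: frontier_def interior_open U0_def)
  have gradsq: "grad \<Psi> x = - (C *\<^sub>R ((\<alpha> * log_dist a x powr (\<alpha> - 1) / (x \<bullet> x) + 2 * c) *\<^sub>R x + b))" if "x \<in> W" for x
    using that grad_barrier[OF _ t0[OF that], of \<alpha> C "C *\<^sub>R b" "C * c"]
    by (simp add: \<Psi>_def W_def scaleR_add_right distrib_left mult_ac)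
  \<comment> \<open>The excess 4 C c comes from the Laplacian of C c |x|^2. The correction only
    lowers \<Psi>, so on the left \<Psi> may be replaced by C times the power of the logarithm, for
    which equality holds by \<alpha> (1 - \<alpha>) = \<lambda>.\<close>
  have lam: "second_eigenvalue \<Omega> a * log_weight a x * \<Psi> x + 4 * (C * c) \<le> - laplacian \<Psi> x" if "x \<in> \<Omega> \<inter> U0" for x
  proof -
    have xW: "x \<in> W" and xb: "x \<in> \<Omega> \<inter> ball 0 R" using that U0W by (auto simp: W_def)
    have x0: "x \<noteq> 0" using xW by (simp add: W_def)
    let ?t = "log_dist a x"
    have w: "log_weight a x = 1 / ((x \<bullet> x) * ?t\<^sup>2)"
      using log_dist_eq[of a x] a x0 by (simp add: log_weight_def power2_norm_eq_inner)
    have "second_eigenvalue \<Omega> a * log_weight a x * \<Psi> x \<le> second_eigenvalue \<Omega> a * log_weight a x * (C * ?t powr \<alpha>)"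
      using bc(2)[OF xb] C ev log_weight_nonneg[of a x] by (intro mult_left_mono) (auto simp: \<Psi>eq)
    also have "\<dots> = C * (\<alpha> * (1 - \<alpha>)) * ?t powr (\<alpha> - 2) / (x \<bullet> x)"
      using t0[OF xW] by (simp add: w \<alpha>(3) powr_diff powr_numeral mult_ac)
    finally show ?thesis
      using laplacian_barrier[OF x0 t0[OF xW], of \<alpha> C "C *\<^sub>R b" "C * c"] by (simp add: \<Psi>_def)
  qed
  \<comment> \<open>Gives the cutoffs compact support in the ball; being 1 near the closure of
    \<open>U\<close>, it contributes nothing to their gradient there.\<close>
  obtain \<zeta> Q where \<zeta>: "\<zeta> \<in> test_functions (ball 0 R)" "\<And>x. 0 \<le> \<zeta> x" "\<And>x. \<zeta> x \<le> 1"
    "open Q" "closure U \<subseteq> Q" "\<And>x. x \<in> Q \<Longrightarrow> \<zeta> x = (1::real)"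
  proof -
    have "compact (closure U)"
      using U(3) bounded_subset[OF bounded_ball] by (simp add: compact_eq_bounded_closed)
    then show ?thesis using cutoff_exists[OF open_ball _ U(3)] that by metis
  qed
  \<comment> \<open>One factor for each obstruction: \<omega> for the boundary of the domain,
    \<open>origin_cutoff\<close> for the origin, \<zeta> for the frontier of the ball.\<close>
  define \<kappa> where "\<kappa> n x = (\<omega> n x * origin_cutoff n x) * \<zeta> x" for n x
  have sm: "smooth_on UNIV (\<lambda>x. \<omega> n x * origin_cutoff n x)" for n
    by (intro smooth_on_mult open_UNIV smooth_imp_smooth_on \<omega>(1) smooth_origin_cutoff)
  have \<kappa>t: "\<kappa> n \<in> test_functions (\<Omega> \<inter> W)" for n
  proof -
    define K where "K = closure {x. \<zeta> x \<noteq> 0} \<inter> F n \<inter> {x. 1 \<le> real n * (norm x)\<^sup>2}"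
    show ?thesis
    proof (rule test_functionsI[of _ K])
      show "smooth (\<kappa> n)"
        unfolding smooth_iff_smooth_on \<kappa>_def
        by (intro smooth_on_mult[OF open_UNIV sm] smooth_imp_smooth_on test_functionsD(1)[OF \<zeta>(1)])
      have "closed {x :: real^2. 1 \<le> real n * (norm x)\<^sup>2}" by (intro closed_Collect_le continuous_intros)
      then show "compact K"
        unfolding K_def by (intro compact_Int_closed test_functionsD(2)[OF \<zeta>(1)] F(1))
      show "K \<subseteq> \<Omega> \<inter> W" using test_functionsD(3)[OF \<zeta>(1)] F(2)[of n] by (auto simp: K_def W_def)
      show "\<kappa> n x = 0" if "x \<notin> K" for x
      proof -
        have "\<zeta> x = 0 \<or> x \<notin> F n \<or> \<not> 1 \<le> real n * (norm x)\<^sup>2"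
          using that closure_subset[of "{x. \<zeta> x \<noteq> 0}"] unfolding K_def by blast
        then show ?thesis using F(3)[of x n] origin_cutoff_0[of n x] by (auto simp: \<kappa>_def)
      qed
    qed
  qed
  have \<kappa>grad: "grad (\<kappa> n) x \<bullet> grad \<Psi> x \<le> 0" if "x \<in> \<Omega> \<inter> U0" for n x
  proof -
    have xW: "x \<in> W" and xb: "x \<in> \<Omega> \<inter> ball 0 R - {0}" using that U0W by (auto simp: W_def)
    have xQ: "x \<in> Q" using that \<zeta>(5) closure_subset[of U] by (auto simp: U0_def)
    let ?v = "(\<alpha> * log_dist a x powr (\<alpha> - 1) / (x \<bullet> x) + 2 * c) *\<^sub>R x + b"
    have pd: "partial_deriv i (\<kappa> n) x = \<omega> n x * partial_deriv i (origin_cutoff n) x + partial_deriv i (\<omega> n) x * origin_cutoff n x" for i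
    proof -
      have "partial_deriv i (\<kappa> n) x = partial_deriv i (\<lambda>x. \<omega> n x * origin_cutoff n x) x"
        by (rule partial_deriv_cong[OF \<zeta>(4) xQ]) (simp add: \<kappa>_def \<zeta>(6))
      also have "\<dots> = \<omega> n x * partial_deriv i (origin_cutoff n) x + partial_deriv i (\<omega> n) x * origin_cutoff n x"
        by (rule partial_deriv_mult) (intro smooth_differentiable \<omega>(1) smooth_origin_cutoff)+
      finally show ?thesis .
    qed
    define D where "D = deriv smooth_step (real n * (norm x)\<^sup>2 - 1) * (2 * real n)"
    have D: "D \<ge> 0" by (simp add: D_def smooth_step_deriv_nonneg)
    have oc: "grad (origin_cutoff n) x = D *\<^sub>R x"
      by (rule euclidean_eqI) (simp add: grad_inner origin_cutoff_deriv D_def)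
    have "grad (\<kappa> n) x = \<omega> n x *\<^sub>R grad (origin_cutoff n) x + origin_cutoff n x *\<^sub>R grad (\<omega> n) x"
      by (rule euclidean_eqI) (simp add: grad_inner pd inner_add_left)
    then have gk: "grad (\<kappa> n) x \<bullet> ?v = \<omega> n x * D * (x \<bullet> ?v) + origin_cutoff n x * (grad (\<omega> n) x \<bullet> ?v)"
      by (simp add: oc inner_add_left)
    \<comment> \<open>The gradient of \<open>origin_cutoff\<close> is a nonnegative multiple of x,
      so this is its sign condition. Of the 2 c |x|^2, one half is spent on compensating a negative
      b . x.\<close>
    have "0 \<le> x \<bullet> ?v"
    proof -
      have "x \<bullet> ?v = \<alpha> * log_dist a x powr (\<alpha> - 1) / (x \<bullet> x) * (x \<bullet> x) + c * (x \<bullet> x) + (b \<bullet> x + c * (x \<bullet> x))"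
        by (simp add: inner_add_right inner_commute algebra_simps)
      moreover have "0 \<le> \<alpha> * log_dist a x powr (\<alpha> - 1) / (x \<bullet> x) * (x \<bullet> x)" "0 \<le> c * (x \<bullet> x)" using \<alpha>(1) bc(1) by simp_all
      ultimately show ?thesis using bc(2)[of x] xb by simp
    qed
    then have "0 \<le> grad (\<kappa> n) x \<bullet> ?v"
      unfolding gk using normal[OF xb, of n] D \<omega>(2) origin_cutoff_bounds[of n x] by (intro add_nonneg_nonneg mult_nonneg_nonneg) auto
    then show ?thesis using C unfolding gradsq[OF xW] by (simp del: scaleR_add_right)
  qed
  \<comment> \<open>With t = \<open>log_dist a x\<close>, the gradient is bounded by C (t powr
    (\<alpha> - 1) / |x| + B). Its square is integrable because the exponent 2 - 2 \<alpha> exceeds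
    1, that is, because \<alpha> < 1/2.\<close>
  have grad2: "integrable (lebesgue_on \<Omega>) (\<lambda>x. indicator (\<Omega> \<inter> U0) x * (norm (grad \<Psi> x))\<^sup>2)"
  proof -
    have \<Omega>m: "\<Omega> \<in> sets lebesgue" using \<Omega> by auto
    let ?k = "\<lambda>x. log_dist a x powr (- (2 - 2 * \<alpha>)) / (norm x)\<^sup>2"
    have k: "integrable lebesgue (\<lambda>x::real^2. indicator (cball 0 1) x * (ln (a / norm x) powr (- (2 - 2 * \<alpha>)) / (norm x)\<^sup>2))"
      by (rule log_weight_powr_integrable[OF a]) (use \<alpha> in simp)
    have one: "integrable lebesgue (\<lambda>x::real^2. indicator (cball 0 1) x :: real)"
      using lmeasurable_cball[of "0 :: real^2" 1] unfolding fmeasurable_def by (intro integrable_real_indicator) auto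
    define B where "B = 2 * c + norm b"
    have "integrable lebesgue (\<lambda>x. indicator (\<Omega> \<inter> U0) x *\<^sub>R (norm (grad \<Psi> x))\<^sup>2)"
    proof (rule Bochner_Integration.integrable_bound)
      show "integrable lebesgue (\<lambda>x::real^2. 2 * C\<^sup>2 * (indicator (cball 0 1) x * (ln (a / norm x) powr (- (2 - 2 * \<alpha>)) / (norm x)\<^sup>2))
         + 2 * C\<^sup>2 * B\<^sup>2 * indicator (cball 0 1) x)"
        by (intro Bochner_Integration.integrable_add integrable_mult_right k one)
      have "continuous_on (\<Omega> \<inter> U0) (\<lambda>x. (norm (grad \<Psi> x))\<^sup>2)"
        using U0W by (intro continuous_intros continuous_on_subset[OF continuous_on_grad[OF \<Psi>s]]) auto
      then show "(\<lambda>x. indicator (\<Omega> \<inter> U0) x *\<^sub>R (norm (grad \<Psi> x))\<^sup>2) \<in> borel_measurable lebesgue"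
        by (rule indicator_continuous_measurable[where \<Omega>=UNIV, unfolded lebesgue_on_UNIV_eq, OF open_Int[OF \<Omega>(1) U0(1)]])
      show "AE x in lebesgue. norm (indicator (\<Omega> \<inter> U0) x *\<^sub>R (norm (grad \<Psi> x))\<^sup>2)
         \<le> norm (2 * C\<^sup>2 * (indicator (cball 0 1) x * (ln (a / norm x) powr (- (2 - 2 * \<alpha>)) / (norm x)\<^sup>2))
         + 2 * C\<^sup>2 * B\<^sup>2 * indicator (cball 0 1) x)"
      proof (intro AE_I2)
        fix x :: "real^2"
        show "norm (indicator (\<Omega> \<inter> U0) x *\<^sub>R (norm (grad \<Psi> x))\<^sup>2)
         \<le> norm (2 * C\<^sup>2 * (indicator (cball 0 1) x * (ln (a / norm x) powr (- (2 - 2 * \<alpha>)) / (norm x)\<^sup>2))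
         + 2 * C\<^sup>2 * B\<^sup>2 * indicator (cball 0 1) x)"
        proof (cases "x \<in> \<Omega> \<inter> U0")
          case True
          then have xW: "x \<in> W" using U0W by blast
          have x0: "x \<noteq> 0" "norm x \<le> 1" using xW R(2) by (auto simp: W_def)
          define A where "A = log_dist a x powr (\<alpha> - 1) / norm x"
          have A: "A \<ge> 0" by (simp add: A_def)
          have "norm ((\<alpha> * log_dist a x powr (\<alpha> - 1) / (x \<bullet> x) + 2 * c) *\<^sub>R x + b)
            \<le> norm ((\<alpha> * log_dist a x powr (\<alpha> - 1) / (x \<bullet> x) + 2 * c) *\<^sub>R x) + norm b" by (rule norm_triangle_ineq)
          also have "norm ((\<alpha> * log_dist a x powr (\<alpha> - 1) / (x \<bullet> x) + 2 * c) *\<^sub>R x) = \<alpha> * A + 2 * c * norm x"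
            using \<alpha>(1) bc(1) x0(1) by (simp add: A_def dot_square_norm power2_eq_square distrib_right)
          also have "\<dots> + norm b \<le> A + B"
          proof -
            have "\<alpha> * A \<le> 1 * A" using \<alpha> A by (intro mult_right_mono) auto
            moreover have "2 * c * norm x \<le> 2 * c * 1" using x0 bc(1) by (intro mult_left_mono) auto
            ultimately show ?thesis by (simp add: B_def)
          qed
          finally have "norm (grad \<Psi> x) \<le> C * (A + B)"
            using C unfolding gradsq[OF xW] norm_minus_cancel norm_scaleR by (simp add: mult_left_mono)
          then have "(norm (grad \<Psi> x))\<^sup>2 \<le> (C * (A + B))\<^sup>2" by (intro power_mono) auto
          also have "\<dots> = C\<^sup>2 * (A + B)\<^sup>2" by (simp add: power_mult_distrib)
          also have "\<dots> \<le> C\<^sup>2 * (2 * A\<^sup>2 + 2 * B\<^sup>2)"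
          proof (rule mult_left_mono)
            show "(A + B)\<^sup>2 \<le> 2 * A\<^sup>2 + 2 * B\<^sup>2"
              using zero_le_power2[of "A - B"] by (simp add: power2_sum power2_diff)
          qed simp
          also have "A\<^sup>2 = ln (a / norm x) powr (- (2 - 2 * \<alpha>)) / (norm x)\<^sup>2"
          proof -
            have "(log_dist a x powr (\<alpha> - 1))\<^sup>2 = log_dist a x powr (- (2 - 2 * \<alpha>))"
              by (simp add: power2_eq_square powr_add[symmetric])
            then show ?thesis using log_dist_eq[of a x] a x0 by (simp add: A_def power_divide)
          qed
          finally have "(norm (grad \<Psi> x))\<^sup>2 \<le> 2 * C\<^sup>2 * (ln (a / norm x) powr (- (2 - 2 * \<alpha>)) / (norm x)\<^sup>2) + 2 * C\<^sup>2 * B\<^sup>2"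
            by (simp add: algebra_simps)
          also have "\<dots> \<le> \<bar>2 * C\<^sup>2 * (ln (a / norm x) powr (- (2 - 2 * \<alpha>)) / (norm x)\<^sup>2) + 2 * C\<^sup>2 * B\<^sup>2\<bar>" by (rule abs_ge_self)
          finally show ?thesis using True x0 by simp
        qed simp
      qed
    qed
    then have "integrable lebesgue (\<lambda>x. indicator \<Omega> x *\<^sub>R (indicator (\<Omega> \<inter> U0) x * (norm (grad \<Psi> x))\<^sup>2))"
      by (rule Bochner_Integration.integrable_cong[THEN iffD1, rotated 2]) (auto simp: indicator_def)
    then show ?thesis using \<Omega>m by (subst integrable_restrict_space) simp_all
  qed
  have main: "\<bar>u x\<bar> \<le> \<Psi> x" if "x \<in> \<Omega> \<inter> U0" for x
  proof (rule comparison_principle[OF \<Omega> a ev ef cont U0 W _ \<Psi>s _ _ grad2 \<kappa>t _ _ _ \<kappa>grad _ lam that])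
    show "(\<Omega> - {0}) \<inter> closure U0 \<subseteq> W" using clU U(3) by (auto simp: W_def)
    show "0 < \<Psi> x" if "x \<in> W" for x using \<Psi>low[OF that] C by simp
    show "\<bar>u x\<bar> < \<Psi> x" if "x \<in> \<Omega> - {0}" "x \<in> frontier U0" for x
    proof -
      have "x \<in> frontier U" using frU that by blast
      then have "\<bar>u x\<bar> \<le> N" using N that by blast
      moreover have "x \<in> W"
        using that clU U(3) by (auto simp: W_def frontier_def)
      ultimately show ?thesis using \<Psi>low[of x] by (simp add: C_def)
    qed
    show "0 \<le> \<kappa> n x" for n x unfolding \<kappa>_def using \<omega>(2) origin_cutoff_bounds(1) \<zeta>(2) by (intro mult_nonneg_nonneg)
    show "\<kappa> n x \<le> 1" for n x unfolding \<kappa>_def using \<omega>(2,3) origin_cutoff_bounds \<zeta>(2,3) by (intro mult_le_one mult_nonneg_nonneg)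
    show "(\<lambda>n. \<kappa> n x) \<longlonglongrightarrow> 1" if "x \<in> \<Omega> \<inter> U0" for x
    proof -
      have "\<zeta> x = 1" "x \<noteq> 0" "x \<in> \<Omega> \<inter> U" using that \<zeta>(5,6) closure_subset[of U] by (auto simp: U0_def)
      then show ?thesis
        using tendsto_mult[OF \<omega>(4)[of x] origin_cutoff_tendsto[of x]] by (simp add: \<kappa>_def)
    qed
    show "0 < 4 * (C * c)" using C bc(1) by simp
  qed
  show ?thesis
  proof (rule that[OF C])
    fix x assume x: "x \<in> \<Omega> \<inter> U - {0}"
    then have xU: "x \<in> \<Omega> \<inter> U0" by (simp add: U0_def)
    then have xb: "x \<in> \<Omega> \<inter> ball 0 R" using U0W by (auto simp: W_def)
    have "\<bar>u x\<bar> \<le> \<Psi> x" by (rule main[OF xU])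
    also have "\<dots> \<le> C * log_dist a x powr \<alpha>" using bc(2)[OF xb] C by (simp add: \<Psi>eq)
    also have "log_dist a x = ln (a / norm x)" using x a by (intro log_dist_eq) auto
    finally show "\<bar>u x\<bar> \<le> C * ln (a / norm x) powr \<alpha>" .
  qed
qed

section \<open>The bound for the eigenfunction near an interior or boundary origin\<close>

lemma small_radius:
  assumes "(a::real) > 1" "\<eta> > 0"
  obtains R where "0 < R" "R \<le> 1" "R \<le> \<eta>" "1 \<le> ln (a / R)"
proof
  let ?R = "min 1 (min \<eta> (a / exp 1))"
  show "0 < ?R" using assms by simp
  moreover have "?R \<le> a / exp 1" by simp
  ultimately have "exp 1 \<le> a / ?R" by (metis exp_gt_zero mult.commute pos_le_divide_eq)
  then show "1 \<le> ln (a / ?R)" using ln_mono[of "exp 1" "a / ?R"] by (simp add: less_le_trans[OF exp_gt_zero])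
qed auto

text \<open>\<alpha> is the smaller root of \<alpha> (1 - \<alpha>) = \<lambda>, and \<lambda> in
  (0, 1/4) puts it in (0, 1/2). The two positions of the origin differ in the data fed to
  \<open>barrier_estimate\<close>.\<close>

lemma eigenfunction_bound:
  fixes \<Omega> :: "(real^2) set"
  assumes "smooth_bounded_domain \<Omega>" and "0 \<in> closure \<Omega>" and "(SUP x\<in>\<Omega>. norm x) = 1" and a: "a > 1"
    and ev: "0 < second_eigenvalue \<Omega> a" and ev4: "second_eigenvalue \<Omega> a < 1/4"
    and ef: "second_eigenfunction \<Omega> a u" and cont: "continuous_on (\<Omega> - {0}) u"
  defines "\<alpha> \<equiv> 1/2 - sqrt (1 - 4 * second_eigenvalue \<Omega> a) / 2"
  obtains \<delta> C where "\<delta> > 0" "C > 0" "0 \<in> \<Omega> \<Longrightarrow> ball 0 \<delta> \<subseteq> \<Omega>"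
    "\<And>x. x \<in> ball 0 \<delta> \<inter> \<Omega> - {0} \<Longrightarrow> \<bar>u x\<bar> \<le> C * ln (a / norm x) powr \<alpha>"
proof -
  have \<Omega>: "open \<Omega>" "bounded \<Omega>" and sb: "smooth_boundary \<Omega>"
    using assms(1) by (auto simp: smooth_bounded_domain_def)
  have ball1: "\<Omega> \<subseteq> cball 0 1"
  proof
    fix x assume "x \<in> \<Omega>"
    moreover have "bdd_above (norm ` \<Omega>)" using \<Omega>(2) by (simp add: bounded_imp_bdd_above bounded_norm_comp)
    ultimately have "norm x \<le> (SUP x\<in>\<Omega>. norm x)" by (intro cSUP_upper)
    then show "x \<in> cball 0 1" using assms(3) by simp
  qed
  let ?l = "second_eigenvalue \<Omega> a"
  have sq: "0 < sqrt (1 - 4 * ?l)" "sqrt (1 - 4 * ?l) < 1" "(sqrt (1 - 4 * ?l))\<^sup>2 = 1 - 4 * ?l"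
    using ev ev4 by auto
  have \<alpha>: "0 < \<alpha>" "\<alpha> < 1/2" "\<alpha> * (1 - \<alpha>) = ?l"
  proof -
    have "\<alpha> * (1 - \<alpha>) = (1 - (sqrt (1 - 4 * ?l))\<^sup>2) / 4" by (simp add: \<alpha>_def field_simps power2_eq_square)
    then show "\<alpha> * (1 - \<alpha>) = ?l" unfolding sq(3) by simp
  qed (use sq in \<open>auto simp: \<alpha>_def\<close>)
  note est = barrier_estimate[OF \<Omega> ball1 a ev ef cont \<alpha>]
  show ?thesis
  proof (cases "0 \<in> \<Omega>")
    case True
    obtain r where r: "r > 0" "ball 0 r \<subseteq> \<Omega>" using openE[OF \<Omega>(1) True] by blast
    obtain R where R: "0 < R" "R \<le> 1" "R \<le> r" "1 \<le> ln (a / R)" using small_radius[OF a r(1)] .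
    let ?U = "ball 0 (R / 2) :: (real^2) set"
    have RO: "ball 0 R \<subseteq> \<Omega>" using r(2) R(3) by (meson order_trans subset_ball)
    have "compact (sphere 0 (R / 2) :: (real^2) set)" by simp
    moreover have "sphere 0 (R / 2) \<subseteq> \<Omega> - {0}" using RO R(1) by (force simp: sphere_def)
    ultimately have "bounded (u ` sphere 0 (R / 2))"
      by (intro compact_imp_bounded compact_continuous_image continuous_on_subset[OF cont])
    then obtain N where N: "\<forall>x\<in>sphere 0 (R / 2). \<bar>u x\<bar> \<le> N" unfolding bounded_iff by auto
    obtain C where C: "C > 0" "\<And>x. x \<in> \<Omega> \<inter> ?U - {0} \<Longrightarrow> \<bar>u x\<bar> \<le> C * ln (a / norm x) powr \<alpha>"
    \<comment> \<open>Interior case: b = 0 and c = 1/2; the cutoff is constantly 1, as the ball lies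
      in the domain, and \<open>N\<close> bounds \<open>u\<close> on a circle by
      compactness.\<close>
    proof (rule est[OF R(1,2,4), of "1/2" 0 ?U N "\<lambda>_ _. 1" "\<lambda>_. UNIV"])
      fix x :: "real^2"
      show "0 \<bullet> x + 1 / 2 * (x \<bullet> x) \<le> 1 / 2" if "x \<in> ball 0 R"
      proof -
        have "(norm x)\<^sup>2 \<le> 1" using that R(2) by (intro power_le_one) auto
        then show ?thesis by (simp add: power2_norm_eq_inner)
      qed
      show "closure ?U \<subseteq> ball 0 R" using R(1) by (auto simp: closure_ball)
      show "\<bar>u x\<bar> \<le> N" if "x \<in> frontier ?U" using that N R(1) by (simp add: frontier_ball)
      show "0 \<le> grad (\<lambda>_. 1) x \<bullet> v" for v
        using partial_deriv_eqI[of "\<lambda>_. 1" "\<lambda>_. 0" x] by (simp add: grad_def)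
      show "smooth (\<lambda>_ :: real^2. 1 :: real)" by (simp add: smooth_iff_smooth_on smooth_on_const)
    qed (use R RO in auto)
    show ?thesis
    proof (rule that[of "R / 2" C])
      show "ball 0 (R / 2) \<subseteq> \<Omega>" using RO R(1) subset_ball[of "R / 2" R 0] by (auto intro: order_trans)
    qed (use R C in auto)
  next
    case False
    have fr: "0 \<in> frontier \<Omega>" using assms(2) False \<Omega>(1) by (simp add: frontier_def interior_open)
    obtain r \<sigma> where \<sigma>: "r > 0" "smooth \<sigma>" "\<sigma> 0 = 0" "grad \<sigma> 0 \<noteq> 0" "\<And>x. x \<in> ball 0 r \<Longrightarrow> x \<in> \<Omega> \<longleftrightarrow> \<sigma> x > 0"
      using boundary_defining_function[OF sb \<Omega>(1) fr] by blast
    obtain K where K: "K > 0"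
      "\<And>x. x \<in> cball 0 1 \<Longrightarrow> \<bar>x \<bullet> grad \<sigma> x - (\<sigma> x - \<sigma> 0)\<bar> \<le> K * (norm x)\<^sup>2"
      "\<And>x. x \<in> cball 0 1 \<Longrightarrow> \<bar>(\<sigma> x - \<sigma> 0) - grad \<sigma> 0 \<bullet> x\<bar> \<le> K * (norm x)\<^sup>2"
      using taylor_at_origin[OF \<sigma>(2)] by blast
    define n0 where "n0 = grad \<sigma> 0"
    \<comment> \<open>Near the origin n0 . \<nabla>\<sigma> > |n0|^2 / 2, so this \<open>M\<close>
      yields b . \<nabla>\<sigma> \<ge> 2 K, enough to outweigh the radial part of the gradient of
      the barrier. The choice c = M K makes b . x + c |x|^2 nonnegative in the domain, where n0 . x
      \<ge> - K |x|^2.\<close>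
    define M where "M = 4 * K / (norm n0)\<^sup>2"
    define b where "b = M *\<^sub>R n0"
    define c where "c = M * K"
    have n0: "norm n0 > 0" using \<sigma>(4) by (simp add: n0_def)
    have M: "M > 0" using K(1) n0 by (simp add: M_def)
    have c: "c > 0" using M K(1) by (simp add: c_def)
    have "open {x. (norm n0)\<^sup>2 / 2 < n0 \<bullet> grad \<sigma> x}"
      using \<sigma>(2) by (intro open_Collect_less continuous_intros continuous_on_grad) (simp add: smooth_iff_smooth_on)
    moreover have "0 \<in> {x. (norm n0)\<^sup>2 / 2 < n0 \<bullet> grad \<sigma> x}"
      using n0 by (simp add: n0_def[symmetric] power2_norm_eq_inner[symmetric])
    ultimately obtain r1 where r1: "r1 > 0" "ball 0 r1 \<subseteq> {x. (norm n0)\<^sup>2 / 2 < n0 \<bullet> grad \<sigma> x}"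
      by (meson openE)
    have den: "2 * (norm b + c) + 2 * c > 0" using c by (intro add_nonneg_pos mult_nonneg_nonneg) auto
    \<comment> \<open>The last bound gives R (|b| + c) \<le> 1/2, for the upper bound of the
      correction, and 2 c R \<le> 1, for the normal derivative.\<close>
    define \<eta> where "\<eta> = min r (min r1 (1 / (2 * (norm b + c) + 2 * c)))"
    have \<eta>: "\<eta> > 0" using \<sigma>(1) r1(1) den unfolding \<eta>_def by (simp only: min_less_iff_conj zero_less_divide_1_iff)
    obtain R where R: "0 < R" "R \<le> 1" "R \<le> \<eta>" "1 \<le> ln (a / R)" using small_radius[OF a \<eta>] .
    have "R \<le> 1 / (2 * (norm b + c) + 2 * c)" using R(3) by (simp add: \<eta>_def)
    then have "R * (2 * (norm b + c) + 2 * c) \<le> 1" using den by (simp add: pos_le_divide_eq)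
    moreover have "0 \<le> R * (norm b + c)" "0 \<le> R * c" using R(1) c by simp_all
    ultimately have Rb: "R * (norm b + c) \<le> 1/2" "2 * (c * R) \<le> 1"
      by (simp_all add: distrib_left) (simp_all add: mult.commute[of R])
    have in1: "x \<in> cball 0 1" "x \<in> ball 0 r" "x \<in> ball 0 r1" if "x \<in> ball 0 R" for x
      using that R(2,3) by (auto simp: \<eta>_def)
    have sq_le: "x \<bullet> x \<le> R" "norm x \<le> R" if "x \<in> ball 0 R" for x
    proof -
      show "norm x \<le> R" using that by simp
      have "norm x * norm x \<le> R * 1" using that R(1,2) by (intro mult_mono) auto
      then show "x \<bullet> x \<le> R" by (simp add: dot_square_norm power2_eq_square)
    qed
    have EL: "L2_on \<Omega> (weak_gradient \<Omega> u)" "is_weak_gradient \<Omega> u (weak_gradient \<Omega> u)"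
      using euler_lagrange(2,3)[OF \<Omega> ball1 a ev ef] .
    have cu: "continuous_on \<Omega> u" using cont False by simp
    have wg: "wgrad V u (weak_gradient \<Omega> u)" if "open V" "V \<subseteq> \<Omega>" for V
      by (rule wgrad_of_weak_gradient[OF EL \<Omega>(1) that continuous_on_subset[OF cu that(2)]])
    have gint: "integrable lebesgue (\<lambda>x. indicator \<Omega> x *\<^sub>R norm (weak_gradient \<Omega> u x))"
    proof -
      have \<Omega>m: "\<Omega> \<in> sets lebesgue" using \<Omega>(1) by auto
      have one: "L2_on \<Omega> (\<lambda>_. 1 :: real)" by (rule L2_on_const[OF \<Omega>])
      have "integrable (lebesgue_on \<Omega>) (\<lambda>x. norm (weak_gradient \<Omega> u x) \<bullet> (1 :: real))"
        by (rule integrable_product_of_squares) (use EL(1) one in \<open>auto simp: L2_on_def\<close>)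
      then show ?thesis using \<Omega>m by (simp add: integrable_restrict_space)
    qed
    obtain U N where U: "open U" "0 \<in> U" "closure U \<subseteq> ball 0 R"
      and N: "\<And>x. x \<in> \<Omega> \<Longrightarrow> x \<in> frontier U \<Longrightarrow> \<bar>u x\<bar> \<le> N"
      using good_neighborhood_boundary[OF \<Omega>(1) False cu wg gint \<sigma>(1,5,2,3,4) R(1)] by blast
    \<comment> \<open>Vanishes where n \<sigma> \<le> 1, and its gradient is a nonnegative multiple
      of \<nabla>\<sigma>, so its sign condition becomes one on \<nabla>\<sigma>.\<close>
    let ?\<omega> = "\<lambda>n x. smooth_step (real n * \<sigma> x - 1)"
    have dn: "(\<lambda>x. real n * \<sigma> x - 1) differentiable (at x)" for n x
      by (intro derivative_intros smooth_differentiable[OF \<sigma>(2)])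
    have pd: "partial_deriv i (?\<omega> n) x = deriv smooth_step (real n * \<sigma> x - 1) * (real n * partial_deriv i \<sigma> x)" for i n x
    proof -
      have "partial_deriv i (\<lambda>x. real n * \<sigma> x + - 1) x = real n * partial_deriv i \<sigma> x"
        using partial_deriv_add[of "\<lambda>x. real n * \<sigma> x" x "\<lambda>_. - 1" i] partial_deriv_mult[of "\<lambda>_. real n" x \<sigma> i]
          smooth_differentiable[OF \<sigma>(2)] partial_deriv_eqI[of "\<lambda>_. - 1" "\<lambda>_. 0" x i]
          partial_deriv_eqI[of "\<lambda>_. real n" "\<lambda>_. 0" x i] by simp
      then show ?thesis using partial_deriv_compose[OF dn smooth_step_DERIV, of i n x] by simp
    qed
    have go: "grad (?\<omega> n) x = (deriv smooth_step (real n * \<sigma> x - 1) * real n) *\<^sub>R grad \<sigma> x" for n x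
      by (rule euclidean_eqI) (simp add: grad_inner pd)
    have \<sigma>c: "continuous_on UNIV \<sigma>" by (rule smooth_on_continuous[OF smooth_imp_smooth_on[OF \<sigma>(2)]])
    obtain C where C: "C > 0" "\<And>x. x \<in> \<Omega> \<inter> U - {0} \<Longrightarrow> \<bar>u x\<bar> \<le> C * ln (a / norm x) powr \<alpha>"
    proof (rule est[OF R(1,2,4) c _ _ U, of b N ?\<omega> "\<lambda>n. {x. 1 \<le> real n * \<sigma> x}"])
      fix n and x :: "real^2"
      show "0 \<le> b \<bullet> x + c * (x \<bullet> x)" if "x \<in> \<Omega> \<inter> ball 0 R"
      proof -
        have "\<sigma> x > 0" using \<sigma>(5) in1(2)[of x] that by blast
        moreover have "\<sigma> x - K * (norm x)\<^sup>2 \<le> n0 \<bullet> x"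
          using K(3)[OF in1(1)[of x]] that \<sigma>(3) unfolding n0_def by (simp add: abs_le_iff)
        ultimately have "0 \<le> n0 \<bullet> x + K * (norm x)\<^sup>2" by linarith
        then have "0 \<le> M * (n0 \<bullet> x + K * (norm x)\<^sup>2)" using M by simp
        then show ?thesis by (simp add: b_def c_def power2_norm_eq_inner algebra_simps)
      qed
      show "b \<bullet> x + c * (x \<bullet> x) \<le> 1 / 2" if "x \<in> ball 0 R"
      proof -
        have "b \<bullet> x \<le> norm b * norm x" by (rule norm_cauchy_schwarz)
        also have "\<dots> \<le> norm b * R" using sq_le(2)[OF that] by (intro mult_left_mono) auto
        finally have "b \<bullet> x + c * (x \<bullet> x) \<le> norm b * R + c * R"
          using sq_le(1)[OF that] c by (intro add_mono mult_left_mono) auto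
        also have "\<dots> \<le> 1/2" using Rb(1) by (simp add: algebra_simps)
        finally show ?thesis .
      qed
      show "\<bar>u x\<bar> \<le> N" if "x \<in> \<Omega> - {0}" "x \<in> frontier U" using N that by blast
      show "smooth (?\<omega> n)"
        unfolding smooth_iff_smooth_on
        by (intro smooth_on_compose_UNIV[OF open_UNIV smooth_smooth_step] smooth_on_diff smooth_on_mult
            smooth_on_const smooth_imp_smooth_on \<sigma>(2) open_UNIV)
      show "(\<lambda>n. ?\<omega> n x) \<longlonglongrightarrow> 1" if "x \<in> \<Omega> \<inter> U"
      proof -
        have "x \<in> ball 0 R" using that U(3) closure_subset[of U] by blast
        then have s: "\<sigma> x > 0" using \<sigma>(5) in1(2)[of x] that by blast
        obtain m where m: "2 / \<sigma> x \<le> real m" using real_arch_simple by blast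
        have "?\<omega> n x = 1" if "n \<ge> m" for n
        proof -
          have "2 / \<sigma> x \<le> real n" using m that by linarith
          then have "2 \<le> real n * \<sigma> x" using s by (simp add: pos_divide_le_eq)
          then show ?thesis by (simp add: smooth_step_1)
        qed
        then show ?thesis by (intro tendsto_eventually eventually_sequentiallyI)
      qed
      show "closed {x. 1 \<le> real n * \<sigma> x}"
        using \<sigma>c by (intro closed_Collect_le continuous_intros)
      show "{x. 1 \<le> real n * \<sigma> x} \<inter> ball 0 R \<subseteq> \<Omega>"
      proof
        fix y assume y: "y \<in> {x. 1 \<le> real n * \<sigma> x} \<inter> ball 0 R"
        then have "0 < real n * \<sigma> y" by auto
        then have "\<sigma> y > 0" by (simp add: zero_less_mult_iff)
        then show "y \<in> \<Omega>" using \<sigma>(5) in1(2)[of y] y by blast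
      qed
      show "?\<omega> n x = 0" if "x \<notin> {x. 1 \<le> real n * \<sigma> x}"
        using that by (intro smooth_step_0) auto
      \<comment> \<open>The normal derivative is estimated at all points of the domain near the
        origin, not only on the boundary. From s |x|^2 \<le> 2 and x . \<nabla>\<sigma> \<ge> - K
        |x|^2 the radial part s x contributes at least - 2 K, which b . \<nabla>\<sigma> \<ge> 2 K
        absorbs.\<close>
      show "0 \<le> grad (?\<omega> n) x \<bullet> ((\<alpha> * log_dist a x powr (\<alpha> - 1) / (x \<bullet> x) + 2 * c) *\<^sub>R x + b)"
        if x: "x \<in> \<Omega> \<inter> ball 0 R - {0}"
      proof -
        have xR: "x \<in> ball 0 R" and x0: "x \<noteq> 0" "norm x > 0" using x by auto
        have sx: "\<sigma> x > 0" using \<sigma>(5) in1(2)[of x] x by blast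
        define q where "q = x \<bullet> x"
        have q: "q > 0" using x0 by (simp add: q_def)
        have "ln (a / R) \<le> ln (a / norm x)"
          using x0 xR a R(1) by (intro ln_mono divide_left_mono) auto
        moreover have "log_dist a x = ln (a / norm x)" using a x0 by (intro log_dist_eq) auto
        ultimately have t: "1 \<le> log_dist a x" using R(4) by linarith
        define A where "A = log_dist a x powr (\<alpha> - 1)"
        have "A \<le> log_dist a x powr 0" unfolding A_def using t \<alpha> by (intro powr_mono) auto
        then have A: "0 \<le> A" "A \<le> 1" using t by (auto simp: A_def)
        define s where "s = \<alpha> * A / q + 2 * c"
        have s: "s \<ge> 0" using \<alpha> A q c by (simp add: s_def)
        have "- (K * q) \<le> x \<bullet> grad \<sigma> x"
          using K(2)[OF in1(1)[OF xR]] \<sigma>(3) sx by (simp add: q_def power2_norm_eq_inner abs_le_iff)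
        then have "s * (- (K * q)) \<le> s * (x \<bullet> grad \<sigma> x)" using s by (intro mult_left_mono)
        moreover have "s * q \<le> 2"
        proof -
          have "s * q = \<alpha> * A + 2 * (c * q)" using q by (simp add: s_def distrib_right)
          moreover have "\<alpha> * A \<le> 1 * 1" using \<alpha> A by (intro mult_mono) auto
          moreover have "c * q \<le> c * R" using sq_le(1)[OF xR] c by (intro mult_left_mono) (auto simp: q_def)
          ultimately show ?thesis using Rb(2) by linarith
        qed
        then have "K * (s * q) \<le> K * 2" using K(1) by (intro mult_left_mono) auto
        moreover have "2 * K \<le> b \<bullet> grad \<sigma> x"
        proof -
          have "(norm n0)\<^sup>2 / 2 < n0 \<bullet> grad \<sigma> x" using subsetD[OF r1(2) in1(3)[OF xR]] by simp
          then have "M * ((norm n0)\<^sup>2 / 2) \<le> M * (n0 \<bullet> grad \<sigma> x)" using M by (intro mult_left_mono) auto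
          moreover have "M * ((norm n0)\<^sup>2 / 2) = 2 * K" using n0 by (simp add: M_def)
          ultimately show ?thesis by (simp add: b_def)
        qed
        ultimately have "0 \<le> s * (x \<bullet> grad \<sigma> x) + b \<bullet> grad \<sigma> x" by (simp add: mult_ac)
        then have "0 \<le> grad \<sigma> x \<bullet> (s *\<^sub>R x + b)" by (simp add: inner_add_right inner_commute)
        then show ?thesis
          unfolding go A_def[symmetric] q_def[symmetric] s_def[symmetric] inner_scaleR_left
          by (intro mult_nonneg_nonneg smooth_step_deriv_nonneg) auto
      qed
    qed (auto simp: smooth_step_nonneg smooth_step_le_1)
    obtain \<delta> where \<delta>: "\<delta> > 0" "ball 0 \<delta> \<subseteq> U" using openE[OF U(1,2)] by blast
    show ?thesis
      by (rule that[OF \<delta>(1) C(1)]) (use False C(2) \<delta>(2) in auto)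
  qed
qed

theorem theorem3:
  fixes \<Omega> :: "(real^2) set" and a :: real and u :: "real^2 \<Rightarrow> real"
  assumes "smooth_bounded_domain \<Omega>"
    and "0 \<in> closure \<Omega>"
    and "(SUP x\<in>\<Omega>. norm x) = 1"
    and "a > 1"
    and "0 < second_eigenvalue \<Omega> a" and "second_eigenvalue \<Omega> a < 1/4"
    and "second_eigenfunction \<Omega> a u"
    and "continuous_on (\<Omega> - {0}) u"
  shows "\<exists>\<delta>>0. \<exists>C>0.
    (0 \<in> \<Omega> \<longrightarrow> ball 0 \<delta> \<subseteq> \<Omega> \<and>
       (\<forall>x\<in>ball 0 \<delta> - {0}.
          \<bar>u x\<bar> \<le> C * ln (a / norm x) powr (1/2 - sqrt (1 - 4 * second_eigenvalue \<Omega> a) / 2))) \<and>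
    (0 \<in> frontier \<Omega> \<longrightarrow>
       (\<forall>x\<in>ball 0 \<delta> \<inter> \<Omega>.
          \<bar>u x\<bar> \<le> C * ln (a / norm x) powr (1/2 - sqrt (1 - 4 * second_eigenvalue \<Omega> a) / 2)))"
proof -
  obtain \<delta> C where d: "\<delta> > 0" "C > 0" "0 \<in> \<Omega> \<Longrightarrow> ball 0 \<delta> \<subseteq> \<Omega>"
    "\<And>x. x \<in> ball 0 \<delta> \<inter> \<Omega> - {0} \<Longrightarrow>
      \<bar>u x\<bar> \<le> C * ln (a / norm x) powr (1/2 - sqrt (1 - 4 * second_eigenvalue \<Omega> a) / 2)"
    using eigenfunction_bound[OF assms] by blast
  have "0 \<notin> \<Omega>" if "0 \<in> frontier \<Omega>"
    using that assms(1) by (simp add: smooth_bounded_domain_def frontier_def interior_open)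
  then show ?thesis using d by (intro exI[of _ \<delta>] exI[of _ C] conjI impI ballI) auto
qed

end
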